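(* Every weak solution $(\mathbf{u},p)$ of the quasi-static poroelasticity problem (in the sense defined in the context) satisfies the following energy law: $$E(t)+\frac{1}{\mu_f}\int_0^t\bigl(K(\nabla p-\rho_f\mathbf{g}),\nabla p\bigr)\,ds-\int_0^t(\phi,p)\,ds-\int_0^t\langle\phi_1,p\rangle\,ds=E(0)\qquad\text{for all }t\in[0,T],$$ where $$E(t):=\frac12\Bigl[\mu\|\varepsilon(\mathbf{u}(t))\|_{L^2(\Omega)}^2+\lambda\|\operatorname{div}\mathbf{u}(t)\|_{L^2(\Omega)}^2+c_0\|p(t)\|_{L^2(\Omega)}^2-2(\mathbf{f},\mathbf{u}(t))-2\langle\mathbf{f}_1,\mathbf{u}(t)\rangle\Bigr].$$ Moreover, $$\|(c_0p+\alpha\operatorname{div}\mathbf{u})_t\|_{L^2(0,T;H^{-1}(\Omega))}\le\frac{K}{\mu_f}\|\nabla p-\rho_f\mathbf{g}\|_{L^2(\Omega_T)}+\|\phi\|_{L^2(\Omega_T)}+\|\phi_1\|_{L^2(\partial\Omega_T)}<\infty.$$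
   Context: Setting. $\Omega\subset\mathbb{R}^d$ ($d=1,2,3$) is a bounded polygonal domain such that $\Delta:H^1_0(\Omega)\cap H^2(\Omega)\to L^2(\Omega)$ is an isomorphism; $T>0$, $\Omega_T=\Omega\times(0,T)$, $\partial\Omega_T=\partial\Omega\times(0,T)$. $(\cdot,\cdot)$ and $\langle\cdot,\cdot\rangle$ are the $L^2(\Omega)$ and $L^2(\partial\Omega)$ inner products (for scalar, vector or tensor functions); bold spaces are $d$-vector-valued. $H^{-1}(\Omega)$ is the dual of $H^1_0(\Omega)$, and $(\cdot,\cdot)_{\rm dual}$ is the duality pairing of $(H^1(\Omega))'$ with $H^1(\Omega)$. $\varepsilon(\mathbf{u})=\frac12(\nabla\mathbf{u}+\nabla\mathbf{u}^T)$. $\mathbf{RM}=\{\mathbf{a}+\mathbf{b}\times x:\ \mathbf{a},\mathbf{b}\in\mathbb{R}^d\}$ is the space of infinitesimal rigid motions (the kernel of $\varepsilon$), and $\mathbf{H}^1_\perp(\Omega)=\{\mathbf{v}\in\mathbf{H}^1(\Omega):(\mathbf{v},\mathbf{r})=0\ \forall\mathbf{r}\in\mathbf{RM}\}$. Parameters. Lamé constants $\lambda,\mu>0$; Biot–Willis constant $\alpha>0$; constrained specific storage coefficient $c_0\ge0$; solvent viscosity $\mu_f>0$; (symmetric positive definite) permeability tensor $K$, written as a positive scalar when it appears as a factor of a norm; $\rho_f\not\equiv0$ and $\mathbf{g}$ are the given density and gravity. Data. $\mathbf{f}\in\mathbf{L}^2(\Omega)$, $\mathbf{f}_1\in\mathbf{L}^2(\partial\Omega)$,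 $\phi\in L^2(\Omega)$, $\phi_1\in L^2(\partial\Omega)$, all independent of $t$, $\mathbf{u}_0\in\mathbf{H}^1(\Omega)$, $p_0\in L^2(\Omega)$, with $(\mathbf{f},\mathbf{v})+\langle\mathbf{f}_1,\mathbf{v}\rangle=0$ for all $\mathbf{v}\in\mathbf{RM}$. Weak solution. A pair $(\mathbf{u},p)$ with $\mathbf{u}\in L^\infty(0,T;\mathbf{H}^1_\perp(\Omega))$, $p\in L^2(0,T;H^1(\Omega))$, $(c_0p+\alpha\operatorname{div}\mathbf{u})_t\in L^2(0,T;H^{-1}(\Omega))$, $c_0^{1/2}p\in L^\infty(0,T;L^2(\Omega))$ is a weak solution if for almost every $t\in[0,T]$ $$\mu(\varepsilon(\mathbf{u}),\varepsilon(\mathbf{v}))+\lambda(\operatorname{div}\mathbf{u},\operatorname{div}\mathbf{v})-\alpha(p,\operatorname{div}\mathbf{v})=(\mathbf{f},\mathbf{v})+\langle\mathbf{f}_1,\mathbf{v}\rangle\quad\forall\mathbf{v}\in\mathbf{H}^1(\Omega),$$ $$\bigl((c_0p+\alpha\operatorname{div}\mathbf{u})_t,\varphi\bigr)_{\rm dual}+\frac1{\mu_f}\bigl(K(\nabla p-\rho_f\mathbf{g}),\nabla\varphi\bigr)=(\phi,\varphi)+\langle\phi_1,\varphi\rangle\quad\forall\varphi\in H^1(\Omega),$$ and $\mathbf{u}(0)=\mathbf{u}_0$, $p(0)=p_0$. (The second identity includes that the time derivative acts on $H^1(\Omega)$.) *)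

theory Defs
  imports "HOL-Analysis.Analysis"
begin

section \<open>Domains\<close>

text \<open>A polygonal (polyhedral) domain: its closure is a finite union of polytopes and it has no slits,
  i.e. it lies on one side of the faces of its boundary.\<close>

definition polygonal_domain :: "(real^'d) set \<Rightarrow> bool" where
  "polygonal_domain \<Omega> \<longleftrightarrow>
     open \<Omega> \<and> connected \<Omega> \<and> \<Omega> \<noteq> {} \<and> bounded \<Omega> \<and> interior (closure \<Omega>) = \<Omega> \<and>
     (\<exists>P. finite P \<and> (\<forall>S\<in>P. polytope S) \<and> closure \<Omega> = \<Union>P)"


section \<open>Test functions\<close>

primrec C_k :: "nat \<Rightarrow> ('a::euclidean_space \<Rightarrow> real) \<Rightarrow> bool" where
  "C_k 0 f \<longleftrightarrow> continuous_on UNIV f"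
| "C_k (Suc k) f \<longleftrightarrow> (\<forall>x. f differentiable (at x)) \<and>
     (\<forall>b\<in>Basis. C_k k (\<lambda>x. frechet_derivative f (at x) b))"

text \<open>\<open>test_fun S\<close> is \<open>C\<^sub>c\<^sup>\<infinity>(S)\<close>, its members being extended by zero to the whole space.\<close>

definition test_fun :: "'a::euclidean_space set \<Rightarrow> ('a \<Rightarrow> real) set" where
  "test_fun S = {\<psi>. (\<forall>k. C_k k \<psi>) \<and> compact (closure {x. \<psi> x \<noteq> 0}) \<and> closure {x. \<psi> x \<noteq> 0} \<subseteq> S}"


section \<open>The spaces L2\<close>

text \<open>Elements of function spaces are represented by functions; equality in the space is equality
  almost everywhere. The codomain may be the scalars, the vectors \<open>real^'d\<close> or the tensors
  \<open>real^'d^'d\<close>, the inner product of which is the Frobenius one.\<close>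

definition L2 :: "'a measure \<Rightarrow> ('a \<Rightarrow> 'b::euclidean_space) set" where
  "L2 M = {f. f \<in> borel_measurable M \<and> integrable M (\<lambda>x. (norm (f x))\<^sup>2)}"

definition L2_inner :: "'a measure \<Rightarrow> ('a \<Rightarrow> 'b::euclidean_space) \<Rightarrow> ('a \<Rightarrow> 'b) \<Rightarrow> real" where
  "L2_inner M f h = (\<integral>x. f x \<bullet> h x \<partial>M)"

definition L2_norm :: "'a measure \<Rightarrow> ('a \<Rightarrow> 'b::euclidean_space) \<Rightarrow> real" where
  "L2_norm M f = sqrt (L2_inner M f f)"


section \<open>Sobolev spaces\<close>

definition is_weak_gradient :: "(real^'d) set \<Rightarrow> (real^'d \<Rightarrow> real) \<Rightarrow> (real^'d \<Rightarrow> real^'d) \<Rightarrow> bool" where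
  "is_weak_gradient \<Omega> v w \<longleftrightarrow>
     (\<forall>\<psi>\<in>test_fun \<Omega>. \<forall>i.
        (\<integral>x. v x * frechet_derivative \<psi> (at x) (axis i 1) \<partial>lebesgue_on \<Omega>)
          = - (\<integral>x. w x $ i * \<psi> x \<partial>lebesgue_on \<Omega>))"

definition H1 :: "(real^'d) set \<Rightarrow> (real^'d \<Rightarrow> real) set" where
  "H1 \<Omega> = {v \<in> L2 (lebesgue_on \<Omega>). \<exists>w\<in>L2 (lebesgue_on \<Omega>). is_weak_gradient \<Omega> v w}"

text \<open>The weak gradient, which is determined almost everywhere on \<open>\<Omega>\<close> for \<open>v \<in> H1 \<Omega>\<close>.\<close>

definition grad :: "(real^'d) set \<Rightarrow> (real^'d \<Rightarrow> real) \<Rightarrow> real^'d \<Rightarrow> real^'d" where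
  "grad \<Omega> v = (SOME w. w \<in> L2 (lebesgue_on \<Omega>) \<and> is_weak_gradient \<Omega> v w)"

definition H1_norm :: "(real^'d) set \<Rightarrow> (real^'d \<Rightarrow> real) \<Rightarrow> real" where
  "H1_norm \<Omega> v = sqrt ((L2_norm (lebesgue_on \<Omega>) v)\<^sup>2 + (L2_norm (lebesgue_on \<Omega>) (grad \<Omega> v))\<^sup>2)"

definition H10 :: "(real^'d) set \<Rightarrow> (real^'d \<Rightarrow> real) set" where
  "H10 \<Omega> = {v \<in> H1 \<Omega>. \<forall>e>0. \<exists>\<psi>\<in>test_fun \<Omega>. H1_norm \<Omega> (\<lambda>x. v x - \<psi> x) < e}"

text \<open>Vector fields. Row \<open>i\<close> of \<open>jac \<Omega> u x\<close> is the weak gradient of the \<open>i\<close>-th component.\<close>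

definition H1v :: "(real^'d) set \<Rightarrow> (real^'d \<Rightarrow> real^'d) set" where
  "H1v \<Omega> = {u. \<forall>i. (\<lambda>x. u x $ i) \<in> H1 \<Omega>}"

definition jac :: "(real^'d) set \<Rightarrow> (real^'d \<Rightarrow> real^'d) \<Rightarrow> real^'d \<Rightarrow> real^'d^'d" where
  "jac \<Omega> u x = (\<chi> i. grad \<Omega> (\<lambda>y. u y $ i) x)"

definition H1v_norm :: "(real^'d) set \<Rightarrow> (real^'d \<Rightarrow> real^'d) \<Rightarrow> real" where
  "H1v_norm \<Omega> u = sqrt ((L2_norm (lebesgue_on \<Omega>) u)\<^sup>2 + (L2_norm (lebesgue_on \<Omega>) (jac \<Omega> u))\<^sup>2)"

definition strain :: "(real^'d) set \<Rightarrow> (real^'d \<Rightarrow> real^'d) \<Rightarrow> real^'d \<Rightarrow> real^'d^'d" where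
  "strain \<Omega> u x = (1/2) *\<^sub>R (jac \<Omega> u x + transpose (jac \<Omega> u x))"

definition dvg :: "(real^'d) set \<Rightarrow> (real^'d \<Rightarrow> real^'d) \<Rightarrow> real^'d \<Rightarrow> real" where
  "dvg \<Omega> u x = trace (jac \<Omega> u x)"

definition H2 :: "(real^'d) set \<Rightarrow> (real^'d \<Rightarrow> real) set" where
  "H2 \<Omega> = {v \<in> H1 \<Omega>. grad \<Omega> v \<in> H1v \<Omega>}"

definition H2_norm :: "(real^'d) set \<Rightarrow> (real^'d \<Rightarrow> real) \<Rightarrow> real" where
  "H2_norm \<Omega> v = sqrt ((H1_norm \<Omega> v)\<^sup>2 + (L2_norm (lebesgue_on \<Omega>) (jac \<Omega> (grad \<Omega> v)))\<^sup>2)"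

definition laplacian :: "(real^'d) set \<Rightarrow> (real^'d \<Rightarrow> real) \<Rightarrow> real^'d \<Rightarrow> real" where
  "laplacian \<Omega> v = dvg \<Omega> (grad \<Omega> v)"

text \<open>Injectivity of the Laplacian follows from the lower bound on its norm.\<close>

definition laplacian_isomorphism :: "(real^'d) set \<Rightarrow> bool" where
  "laplacian_isomorphism \<Omega> \<longleftrightarrow>
     (\<forall>F\<in>L2 (lebesgue_on \<Omega>). \<exists>v\<in>H10 \<Omega> \<inter> H2 \<Omega>. AE x in lebesgue_on \<Omega>. laplacian \<Omega> v x = F x) \<and>
     (\<exists>C. \<forall>v\<in>H10 \<Omega> \<inter> H2 \<Omega>.
        L2_norm (lebesgue_on \<Omega>) (laplacian \<Omega> v) \<le> C * H2_norm \<Omega> v \<and>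
        H2_norm \<Omega> v \<le> C * L2_norm (lebesgue_on \<Omega>) (laplacian \<Omega> v))"


section \<open>Boundary integrals and traces\<close>

text \<open>The \<open>n\<close>-dimensional Hausdorff measure on the Borel sets, normalised so as to be the
  \<open>n\<close>-dimensional volume on \<open>n\<close>-planes and the counting measure for \<open>n = 0\<close>. The set function
  \<open>hausdorff_outer n\<close> is a metric outer measure, so that it is a measure on the Borel sets.\<close>

definition hausdorff_gauge :: "nat \<Rightarrow> 'a::euclidean_space set \<Rightarrow> ennreal" where
  "hausdorff_gauge n C =
     (if C = {} then 0 else ennreal (unit_ball_vol (real n) * (diameter C / 2) ^ n))"

definition hausdorff_pre :: "nat \<Rightarrow> real \<Rightarrow> 'a::euclidean_space set \<Rightarrow> ennreal" where
  "hausdorff_pre n \<delta> A =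
     (INF C\<in>{C :: nat \<Rightarrow> 'a set. A \<subseteq> (\<Union>i. C i) \<and> (\<forall>i. bounded (C i) \<and> diameter (C i) \<le> \<delta>)}.
        \<Sum>i. hausdorff_gauge n (C i))"

definition hausdorff_outer :: "nat \<Rightarrow> 'a::euclidean_space set \<Rightarrow> ennreal" where
  "hausdorff_outer n A = (SUP \<delta>\<in>{0<..}. hausdorff_pre n \<delta> A)"

definition hausdorff_measure :: "nat \<Rightarrow> 'a::euclidean_space measure" where
  "hausdorff_measure n = measure_of UNIV (sets borel) (hausdorff_outer n)"

definition surface_measure :: "(real^'d) set \<Rightarrow> (real^'d) measure" where
  "surface_measure \<Omega> = restrict_space (hausdorff_measure (CARD('d) - 1)) (frontier \<Omega>)"

text \<open>The trace on the boundary of a Sobolev function, as the pointwise limit of its means over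
  \<open>\<Omega> \<inter> ball x r\<close>. For a function in \<open>H1\<close> of a polyhedral domain the limit exists at almost every
  boundary point (with respect to the surface measure) and is the value there of the usual trace;
  for a function that is continuous up to the boundary it is the restriction.\<close>

definition boundary_trace ::
    "(real^'d) set \<Rightarrow> (real^'d \<Rightarrow> 'b::euclidean_space) \<Rightarrow> real^'d \<Rightarrow> 'b" where
  "boundary_trace \<Omega> v x =
     Lim (at_right 0) (\<lambda>r. (1 / measure lebesgue (\<Omega> \<inter> ball x r)) *\<^sub>R
                            (\<integral>y. v y \<partial>lebesgue_on (\<Omega> \<inter> ball x r)))"

lemma boundary_trace_eq_restriction:
  fixes v :: "real^'d \<Rightarrow> 'b::euclidean_space"
  assumes \<Omega>: "open \<Omega>" "bounded \<Omega>" and v: "continuous_on (closure \<Omega>) v" and x: "x \<in> frontier \<Omega>"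
  shows "boundary_trace \<Omega> v x = v x"
proof -
  let ?A = "\<lambda>r. (1 / measure lebesgue (\<Omega> \<inter> ball x r)) *\<^sub>R (\<integral>y. v y \<partial>lebesgue_on (\<Omega> \<inter> ball x r))"
  have xc: "x \<in> closure \<Omega>" using x by (simp add: frontier_def)
  have "compact (closure \<Omega>)" using \<Omega> by simp
  then have "compact (v ` closure \<Omega>)" using v compact_continuous_image by blast
  then obtain M where M: "\<And>y. y \<in> closure \<Omega> \<Longrightarrow> norm (v y) \<le> M"
    using compact_imp_bounded bounded_iff by (metis image_eqI)
  have avg: "dist (?A r) (v x) \<le> e"
    if r: "r > 0" and e: "\<And>y. y \<in> \<Omega> \<Longrightarrow> dist y x < r \<Longrightarrow> dist (v y) (v x) \<le> e" for r e
  proof -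
    let ?S = "\<Omega> \<inter> ball x r" and ?L = "lebesgue_on (\<Omega> \<inter> ball x r)"
    have S: "open ?S" "bounded ?S" using \<Omega> by auto
    have ne: "?S \<noteq> {}" using xc r
      by (metis Int_commute \<Omega>(1) centre_in_ball disjoint_iff open_Int_closure_eq_empty open_ball)
    have lm: "?S \<in> lmeasurable" using S
      by (simp add: lmeasurable_open)
    then have fin: "finite_measure ?L"
      by (simp add: finite_measure_lebesgue_on)
    have pos: "measure lebesgue ?S > 0"
      using ne S lm open_not_negligible negligible_iff_measure by (metis zero_less_measure_iff)
    have vm: "v \<in> borel_measurable ?L"
      using S by (intro continuous_imp_measurable_on_sets_lebesgue continuous_on_subset[OF v])
        (auto simp: closure_def)
    have int: "integrable ?L v"
      by (rule finite_measure.integrable_const_bound[OF fin, of _ M])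
         (use M closure_subset[of \<Omega>] vm in \<open>auto intro!: AE_I2 M\<close>)
    have ic: "integrable ?L (\<lambda>y. v x)" using fin by (simp add: finite_measure.integrable_const)
    have meas: "measure ?L (space ?L) = measure lebesgue ?S"
      using lm by (simp add: measure_restrict_space)
    have "?A r - v x = (1 / measure lebesgue ?S) *\<^sub>R (\<integral>y. v y - v x \<partial>?L)"
      using pos int ic meas by (simp add: scaleR_diff_right)
    also have "norm \<dots> = (1 / measure lebesgue ?S) * norm (\<integral>y. v y - v x \<partial>?L)"
      using pos by simp
    also have "norm (\<integral>y. v y - v x \<partial>?L) \<le> (\<integral>y. norm (v y - v x) \<partial>?L)"
      by (rule integral_norm_bound)
    also have "(\<integral>y. norm (v y - v x) \<partial>?L) \<le> (\<integral>y. e \<partial>?L)"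
      using int ic fin e by (intro integral_mono) (auto simp: finite_measure.integrable_const dist_norm norm_minus_commute)
    also have "(\<integral>y. e \<partial>?L) = measure lebesgue ?S * e" using meas by simp
    finally show ?thesis using pos by (simp add: dist_norm field_simps)
  qed
  have "(?A \<longlongrightarrow> v x) (at_right 0)"
  proof (rule tendstoI)
    fix e :: real assume e: "e > 0"
    obtain d where d: "d > 0" "\<And>y. y \<in> closure \<Omega> \<Longrightarrow> dist y x < d \<Longrightarrow> dist (v y) (v x) < e / 2"
      using v xc e unfolding continuous_on_iff by (meson half_gt_zero)
    have "dist (?A r) (v x) < e" if "0 < r" "r < d" for r
      using avg[of r "e / 2"] d that e closure_subset[of \<Omega>] by (smt (verit, best) field_sum_of_halves subsetD)
    then show "\<forall>\<^sub>F r in at_right 0. dist (?A r) (v x) < e"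
      using d(1) eventually_at_right_field by (metis (mono_tags, lifting))
  qed
  then show ?thesis unfolding boundary_trace_def by (intro tendsto_Lim) auto
qed

definition boundary_inner ::
    "(real^'d) set \<Rightarrow> (real^'d \<Rightarrow> 'b::euclidean_space) \<Rightarrow> (real^'d \<Rightarrow> 'b) \<Rightarrow> real" where
  "boundary_inner \<Omega> h v = L2_inner (surface_measure \<Omega>) h (boundary_trace \<Omega> v)"


section \<open>Rigid motions\<close>

text \<open>For \<open>d = 3\<close> the skew-symmetric matrices are the maps \<open>x \<mapsto> b \<times> x\<close>; for \<open>d = 2\<close> they are the
  multiples of the rotation by a right angle, and for \<open>d = 1\<close> only zero remains.\<close>

definition RM :: "(real^'d \<Rightarrow> real^'d) set" where
  "RM = {r. \<exists>a B. transpose B = - B \<and> r = (\<lambda>x. a + B *v x)}"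

lemma RM_3: "(RM :: (real^3 \<Rightarrow> real^3) set) = {r. \<exists>a b. r = (\<lambda>x. a + cross3 b x)}"
proof -
  have 1: "\<exists>b. \<forall>x. B *v x = cross3 b x" if "transpose B = - B" for B :: "real^3^3"
  proof -
    have e: "B $ j $ i = - B $ i $ j" for i j
    proof -
      have "transpose B $ i $ j = (- B) $ i $ j" using that by simp
      then show ?thesis by (simp add: transpose_def)
    qed
    have d: "B $ i $ i = 0" for i using e[of i i] by simp
    show ?thesis
      apply (rule exI[of _ "vector [B$3$2, B$1$3, B$2$1]"])
      using e[of 1 2] e[of 2 3] e[of 3 1] d[of 1] d[of 2] d[of 3]
      by (simp add: cross3_def vec_eq_iff forall_3 matrix_vector_mult_def sum_3 algebra_simps)
  qed
  have 2: "\<exists>B. transpose B = - B \<and> (\<forall>x. B *v x = cross3 b x)" for b :: "real^3"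
  proof -
    have lin: "linear (cross3 b)"
      by (rule linearI) (simp_all add: cross3_simps forall_3)
    have *: "matrix (cross3 b) *v x = cross3 b x" for x using lin by (simp add: matrix_works)
    have "transpose (matrix (cross3 b)) = - matrix (cross3 b)"
      by (simp add: transpose_def matrix_def vec_eq_iff forall_3 cross3_simps axis_def)
    with * show ?thesis by blast
  qed
  show ?thesis unfolding RM_def
    by safe (metis 1, metis 2)
qed

definition H1_perp :: "(real^'d) set \<Rightarrow> (real^'d \<Rightarrow> real^'d) set" where
  "H1_perp \<Omega> = {v \<in> H1v \<Omega>. \<forall>r\<in>RM. L2_inner (lebesgue_on \<Omega>) v r = 0}"


section \<open>Dual spaces\<close>

text \<open>Functionals act on representatives; boundedness makes them respect equality in the space.
  \<open>X\<close> is a linear space of functions and \<open>N\<close> its norm.\<close>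

definition dual_space :: "('a \<Rightarrow> real) set \<Rightarrow> (('a \<Rightarrow> real) \<Rightarrow> real) \<Rightarrow> (('a \<Rightarrow> real) \<Rightarrow> real) set" where
  "dual_space X N = {G.
     (\<forall>v\<in>X. \<forall>w\<in>X. G (\<lambda>x. v x + w x) = G v + G w) \<and>
     (\<forall>a. \<forall>v\<in>X. G (\<lambda>x. a * v x) = a * G v) \<and>
     (\<exists>C. \<forall>v\<in>X. \<bar>G v\<bar> \<le> C * N v)}"

definition dual_norm ::
    "('a \<Rightarrow> real) set \<Rightarrow> (('a \<Rightarrow> real) \<Rightarrow> real) \<Rightarrow> (('a \<Rightarrow> real) \<Rightarrow> real) \<Rightarrow> real" where
  "dual_norm X N G = (SUP v\<in>{v\<in>X. N v \<le> 1}. \<bar>G v\<bar>)"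

abbreviation Hm1 :: "(real^'d) set \<Rightarrow> ((real^'d \<Rightarrow> real) \<Rightarrow> real) set" where
  "Hm1 \<Omega> \<equiv> dual_space (H10 \<Omega>) (H1_norm \<Omega>)"

abbreviation Hm1_norm :: "(real^'d) set \<Rightarrow> ((real^'d \<Rightarrow> real) \<Rightarrow> real) \<Rightarrow> real" where
  "Hm1_norm \<Omega> \<equiv> dual_norm (H10 \<Omega>) (H1_norm \<Omega>)"


section \<open>Bochner spaces on a time interval\<close>

definition strongly_measurable ::
    "real \<Rightarrow> 'v::minus set \<Rightarrow> ('v \<Rightarrow> real) \<Rightarrow> (real \<Rightarrow> 'v) \<Rightarrow> bool" where
  "strongly_measurable T X N F \<longleftrightarrow>
     (\<exists>s :: nat \<Rightarrow> real \<Rightarrow> 'v.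
        (\<forall>n. simple_function (lebesgue_on {0..T}) (s n) \<and> s n ` {0..T} \<subseteq> X) \<and>
        (AE t in lebesgue_on {0..T}. F t \<in> X \<and> (\<lambda>n. N (s n t - F t)) \<longlonglongrightarrow> 0))"

definition Bochner_L2 ::
    "real \<Rightarrow> 'v::minus set \<Rightarrow> ('v \<Rightarrow> real) \<Rightarrow> (real \<Rightarrow> 'v) set" where
  "Bochner_L2 T X N = {F. strongly_measurable T X N F \<and>
     integrable (lebesgue_on {0..T}) (\<lambda>t. (N (F t))\<^sup>2)}"

definition Bochner_Linf ::
    "real \<Rightarrow> 'v::minus set \<Rightarrow> ('v \<Rightarrow> real) \<Rightarrow> (real \<Rightarrow> 'v) set" where
  "Bochner_Linf T X N = {F. strongly_measurable T X N F \<and>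
     (\<exists>C. AE t in lebesgue_on {0..T}. N (F t) \<le> C)}"

definition esqrt :: "ennreal \<Rightarrow> ennreal" where
  "esqrt x = (if x = top then top else ennreal (sqrt (enn2real x)))"

text \<open>Norms with values in the extended reals, \<open>\<infinity>\<close> meaning that the function is not in the space:
  that of \<open>L2(0,T;X)\<close>, and that of \<open>L2\<close> of the space-time cylinder, which is written as an iterated
  integral (Tonelli).\<close>

definition Bochner_L2_enorm :: "real \<Rightarrow> ('v \<Rightarrow> real) \<Rightarrow> (real \<Rightarrow> 'v) \<Rightarrow> ennreal" where
  "Bochner_L2_enorm T N F = esqrt (\<integral>\<^sup>+t. ennreal ((N (F t))\<^sup>2) \<partial>lebesgue_on {0..T})"

definition cylinder_L2_enorm ::
    "real \<Rightarrow> 'a measure \<Rightarrow> (real \<Rightarrow> 'a \<Rightarrow> 'b::euclidean_space) \<Rightarrow> ennreal" where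
  "cylinder_L2_enorm T M F =
     esqrt (\<integral>\<^sup>+t. (\<integral>\<^sup>+x. ennreal ((norm (F t x))\<^sup>2) \<partial>M) \<partial>lebesgue_on {0..T})"

text \<open>\<open>G\<close> is the distributional time derivative of \<open>F\<close>, with values in the dual of \<open>H1 \<Omega>\<close>, where
  \<open>F t \<in> L2\<close> acts on \<open>H1 \<Omega>\<close> by the inner product of \<open>L2\<close>.\<close>

definition is_time_derivative ::
    "(real^'d) set \<Rightarrow> real \<Rightarrow> (real \<Rightarrow> real^'d \<Rightarrow> real) \<Rightarrow> (real \<Rightarrow> (real^'d \<Rightarrow> real) \<Rightarrow> real) \<Rightarrow> bool" where
  "is_time_derivative \<Omega> T F G \<longleftrightarrow>
     (AE t in lebesgue_on {0..T}. G t \<in> dual_space (H1 \<Omega>) (H1_norm \<Omega>)) \<and>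
     (\<forall>\<phi>\<in>H1 \<Omega>.
        integrable (lebesgue_on {0..T}) (\<lambda>t. G t \<phi>) \<and>
        (\<forall>\<psi>\<in>test_fun {0<..<T}.
           (\<integral>t. L2_inner (lebesgue_on \<Omega>) (F t) \<phi> * deriv \<psi> t \<partial>lebesgue_on {0..T})
             = - (\<integral>t. G t \<phi> * \<psi> t \<partial>lebesgue_on {0..T})))"

text \<open>The initial value of a function of time that is only determined for almost every \<open>t\<close>: the
  limit as \<open>t\<close> tends to \<open>0\<close> outside a null set, in the weak topology of \<open>L2\<close>.\<close>

definition has_initial_value ::
    "(real^'d) set \<Rightarrow> real \<Rightarrow> (real \<Rightarrow> real^'d \<Rightarrow> 'b::euclidean_space) \<Rightarrow> (real^'d \<Rightarrow> 'b) \<Rightarrow> bool" where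
  "has_initial_value \<Omega> T F F0 \<longleftrightarrow>
     (\<exists>Z\<in>null_sets lebesgue. \<forall>w\<in>L2 (lebesgue_on \<Omega>).
        ((\<lambda>t. L2_inner (lebesgue_on \<Omega>) (F t) w) \<longlongrightarrow> L2_inner (lebesgue_on \<Omega>) F0 w)
          (at 0 within ({0..T} - Z)))"

definition L2_continuous ::
    "(real^'d) set \<Rightarrow> real \<Rightarrow> (real \<Rightarrow> real^'d \<Rightarrow> 'b::euclidean_space) \<Rightarrow> bool" where
  "L2_continuous \<Omega> T F \<longleftrightarrow>
     (\<forall>t\<in>{0..T}. F t \<in> L2 (lebesgue_on \<Omega>) \<and>
        ((\<lambda>s. L2_norm (lebesgue_on \<Omega>) (\<lambda>x. F s x - F t x)) \<longlongrightarrow> 0) (at t within {0..T}))"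


section \<open>The poroelasticity problem\<close>

text \<open>\<open>etat\<close> is the time derivative of \<open>c0 p + \<alpha> div u\<close>. The initial condition for the pressure is
  imposed on \<open>c0\<^sup>1\<^sup>/\<^sup>2 p\<close>: for \<open>c0 > 0\<close> it says that \<open>p\<close> has the initial value \<open>p0\<close>, whereas for
  \<open>c0 = 0\<close> the pressure, being merely in \<open>L2(0,T;H1)\<close>, has no initial value and \<open>p0\<close> can only be
  its value in a representative.\<close>

definition weak_solution ::
    "(real^'d) set \<Rightarrow> real \<Rightarrow> real \<Rightarrow> real \<Rightarrow> real \<Rightarrow> real \<Rightarrow> real \<Rightarrow> real^'d^'d \<Rightarrow>
     (real^'d \<Rightarrow> real) \<Rightarrow> real^'d \<Rightarrow>
     (real^'d \<Rightarrow> real^'d) \<Rightarrow> (real^'d \<Rightarrow> real^'d) \<Rightarrow> (real^'d \<Rightarrow> real) \<Rightarrow> (real^'d \<Rightarrow> real) \<Rightarrow>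
     (real^'d \<Rightarrow> real^'d) \<Rightarrow> (real^'d \<Rightarrow> real) \<Rightarrow>
     (real \<Rightarrow> real^'d \<Rightarrow> real^'d) \<Rightarrow> (real \<Rightarrow> real^'d \<Rightarrow> real) \<Rightarrow>
     (real \<Rightarrow> (real^'d \<Rightarrow> real) \<Rightarrow> real) \<Rightarrow> bool" where
  "weak_solution \<Omega> T lam \<mu> \<alpha> c0 \<mu>f K \<rho>f g f f1 \<phi> \<phi>1 u0 p0 u p etat \<longleftrightarrow>
     u \<in> Bochner_Linf T (H1_perp \<Omega>) (H1v_norm \<Omega>) \<and>
     p \<in> Bochner_L2 T (H1 \<Omega>) (H1_norm \<Omega>) \<and>
     (\<lambda>t x. sqrt c0 * p t x) \<in> Bochner_Linf T (L2 (lebesgue_on \<Omega>)) (L2_norm (lebesgue_on \<Omega>)) \<and>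
     etat \<in> Bochner_L2 T (Hm1 \<Omega>) (Hm1_norm \<Omega>) \<and>
     is_time_derivative \<Omega> T (\<lambda>t x. c0 * p t x + \<alpha> * dvg \<Omega> (u t) x) etat \<and>
     (AE t in lebesgue_on {0..T}. \<forall>v\<in>H1v \<Omega>.
        \<mu> * L2_inner (lebesgue_on \<Omega>) (strain \<Omega> (u t)) (strain \<Omega> v)
        + lam * L2_inner (lebesgue_on \<Omega>) (dvg \<Omega> (u t)) (dvg \<Omega> v)
        - \<alpha> * L2_inner (lebesgue_on \<Omega>) (p t) (dvg \<Omega> v)
        = L2_inner (lebesgue_on \<Omega>) f v + boundary_inner \<Omega> f1 v) \<and>
     (AE t in lebesgue_on {0..T}. \<forall>q\<in>H1 \<Omega>.
        etat t q
        + 1 / \<mu>f * L2_inner (lebesgue_on \<Omega>)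
                     (\<lambda>x. K *v (grad \<Omega> (p t) x - \<rho>f x *\<^sub>R g)) (grad \<Omega> q)
        = L2_inner (lebesgue_on \<Omega>) \<phi> q + boundary_inner \<Omega> \<phi>1 q) \<and>
     has_initial_value \<Omega> T u u0 \<and>
     has_initial_value \<Omega> T (\<lambda>t x. sqrt c0 * p t x) (\<lambda>x. sqrt c0 * p0 x)"

text \<open>The functions \<open>u\<close> and \<open>p\<close> being determined for almost every \<open>t\<close> only, their values at a given
  time are those of a version that is continuous in time, in the sense of the norms that
  occur in the energy (so that the energy does not depend on the version).\<close>

definition continuous_version ::
    "(real^'d) set \<Rightarrow> real \<Rightarrow> real \<Rightarrow> (real^'d \<Rightarrow> real^'d) \<Rightarrow> (real^'d \<Rightarrow> real) \<Rightarrow>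
     (real \<Rightarrow> real^'d \<Rightarrow> real^'d) \<Rightarrow> (real \<Rightarrow> real^'d \<Rightarrow> real) \<Rightarrow>
     (real \<Rightarrow> real^'d \<Rightarrow> real^'d) \<Rightarrow> (real \<Rightarrow> real^'d \<Rightarrow> real) \<Rightarrow> bool" where
  "continuous_version \<Omega> T c0 u0 p0 u p U P \<longleftrightarrow>
     (AE t in lebesgue_on {0..T}. AE x in lebesgue_on \<Omega>. U t x = u t x \<and> P t x = p t x) \<and>
     (\<forall>t\<in>{0..T}. U t \<in> H1_perp \<Omega> \<and> P t \<in> L2 (lebesgue_on \<Omega>)) \<and>
     L2_continuous \<Omega> T (\<lambda>t. strain \<Omega> (U t)) \<and>
     L2_continuous \<Omega> T (\<lambda>t. dvg \<Omega> (U t)) \<and>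
     L2_continuous \<Omega> T (\<lambda>t x. sqrt c0 * P t x) \<and>
     (AE x in lebesgue_on \<Omega>. U 0 x = u0 x \<and> P 0 x = p0 x)"

definition energy ::
    "(real^'d) set \<Rightarrow> real \<Rightarrow> real \<Rightarrow> real \<Rightarrow> (real^'d \<Rightarrow> real^'d) \<Rightarrow> (real^'d \<Rightarrow> real^'d) \<Rightarrow>
     (real^'d \<Rightarrow> real^'d) \<Rightarrow> (real^'d \<Rightarrow> real) \<Rightarrow> real" where
  "energy \<Omega> lam \<mu> c0 f f1 v q =
     1 / 2 * (\<mu> * (L2_norm (lebesgue_on \<Omega>) (strain \<Omega> v))\<^sup>2
              + lam * (L2_norm (lebesgue_on \<Omega>) (dvg \<Omega> v))\<^sup>2
              + c0 * (L2_norm (lebesgue_on \<Omega>) q)\<^sup>2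
              - 2 * L2_inner (lebesgue_on \<Omega>) f v
              - 2 * boundary_inner \<Omega> f1 v)"

end

theory Submission
  imports Defs
begin

text \<open>Write \<open>\<eta> = c\<^sub>0 p + \<alpha> div u\<close>. For almost all \<open>s\<close> and \<open>t\<close> the elasticity equations at these times,
  tested with \<open>u(t) \<plusminus> u(s)\<close>, give
  \<open>2 (E(t) - E(s)) = (\<eta>(t) - \<eta>(s), p(t) + p(s))\<close> and
  \<open>D(s, t) = (\<eta>(t) - \<eta>(s), p(t) - p(s))\<close>, where \<open>D\<close> is the squared energy norm of the
  difference of the solution at the two times. As \<open>\<eta>\<close> has the derivative \<open>\<eta>\<^sub>t\<close> in the dual of \<open>H\<^sup>1\<close>, the
  increments of \<open>E\<close> over a fine partition are trapezoidal sums, and for a partition into suitable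
  points (Chebyshev) these converge to the integral of \<open>\<langle>\<eta>\<^sub>t, p\<rangle>\<close>, although \<open>p\<close> itself has no time
  derivative. Comparing both ends of an interval with one good point in it yields
  \<open>D(s, t) \<le> C (W(t) - W(s))\<close> with \<open>W\<close> the primitive of an integrable function. Hence the solution has
  a continuous version; its value at an exceptional time is a strong limit of averages of nearby
  values of \<open>u\<close>, so that neither Korn's inequality nor trace theorems enter.\<close>

section \<open>Square-integrable functions\<close>

text \<open>Formally one tests the elasticity equation with the time derivative of \<open>u\<close>,
  which need not exist. As the loads are constant in time, the equations at two times can be
  combined so that differences in time take its place. The usual product rule for a function with
  values in H1 and derivative in the dual does not apply: H1 contains p(t), whereas the derivative
  is that of \<eta>. Its substitute is that the elasticity equation makes the dependence of \<eta>
  on \<open>p\<close> symmetric, up to the load. The trapezoidal form is essential, since one-sided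
  sums keep the sum of the D(s, t) as an error: D(s, t) = 2 (E(t) - E(s)) - 2 (\<eta>(t) -
  \<eta>(s), p(s)) = - 2 (E(t) - E(s)) + 2 (\<eta>(t) - \<eta>(s), p(t)). These two forms also give
  the modulus of continuity. Each involves \<open>p\<close> at one end of the interval only, so that
  this end can be a point at which the H1 norm of \<open>p\<close> is controlled by its quadratic
  mean, while at the other end it may be arbitrarily large.\<close>

lemma L2D:
  assumes "f \<in> L2 M"
  shows "f \<in> borel_measurable M" "integrable M (\<lambda>x. (norm (f x))\<^sup>2)"
  using assms by (auto simp: L2_def)

lemma L2_dominated:
  assumes "f \<in> borel_measurable M" "integrable M w" "\<And>x. x \<in> space M \<Longrightarrow> (norm (f x))\<^sup>2 \<le> w x"
  shows "f \<in> L2 M"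
  unfolding L2_def mem_Collect_eq
proof
  show "integrable M (\<lambda>x. (norm (f x))\<^sup>2)"
    using assms by (intro Bochner_Integration.integrable_bound[OF assms(2)] AE_I2) (auto intro: order_trans[OF _ abs_ge_self])
qed (rule assms)

lemma L2_inner_integrable:
  assumes "f \<in> L2 M" "h \<in> L2 M"
  shows "integrable M (\<lambda>x. f x \<bullet> h x)"
proof (rule Bochner_Integration.integrable_bound)
  show "integrable M (\<lambda>x. (norm (f x))\<^sup>2 + (norm (h x))\<^sup>2)" "(\<lambda>x. f x \<bullet> h x) \<in> borel_measurable M"
    using assms by (auto simp: L2_def)
  have "norm (f x \<bullet> h x) \<le> norm ((norm (f x))\<^sup>2 + (norm (h x))\<^sup>2)" for x
  proof -
    have "norm (f x \<bullet> h x) \<le> norm (f x) * norm (h x)" using Cauchy_Schwarz_ineq2 by auto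
    also have "\<dots> \<le> (norm (f x))\<^sup>2 + (norm (h x))\<^sup>2"
      using sum_squares_bound[of "norm (f x)" "norm (h x)"]
        mult_nonneg_nonneg[OF norm_ge_zero[of "f x"] norm_ge_zero[of "h x"]] by linarith
    finally show ?thesis by simp
  qed
  then show "AE x in M. norm (f x \<bullet> h x) \<le> norm ((norm (f x))\<^sup>2 + (norm (h x))\<^sup>2)" by simp
qed

lemma L2_add:
  assumes "f \<in> L2 M" "h \<in> L2 M"
  shows "(\<lambda>x. f x + h x) \<in> L2 M"
proof (rule L2_dominated)
  show "integrable M (\<lambda>x. 2 * ((norm (f x))\<^sup>2 + (norm (h x))\<^sup>2))" "(\<lambda>x. f x + h x) \<in> borel_measurable M"
    using assms by (auto simp: L2_def)
  show "(norm (f x + h x))\<^sup>2 \<le> 2 * ((norm (f x))\<^sup>2 + (norm (h x))\<^sup>2)" for x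
  proof -
    have "(norm (f x + h x))\<^sup>2 \<le> (norm (f x) + norm (h x))\<^sup>2"
      by (intro power_mono norm_triangle_ineq) auto
    then show ?thesis using sum_squares_bound[of "norm (f x)" "norm (h x)"]
      by (simp add: power2_sum)
  qed
qed

lemma L2_scaleR: "f \<in> L2 M \<Longrightarrow> (\<lambda>x. c *\<^sub>R f x) \<in> L2 M"
  by (auto simp: L2_def power_mult_distrib)

lemma L2_mult: "f \<in> L2 M \<Longrightarrow> (\<lambda>x. c * f x) \<in> L2 M" for f :: "'a \<Rightarrow> real"
  using L2_scaleR[of f M c] by simp

lemma L2_diff:
  assumes "f \<in> L2 M" "h \<in> L2 M"
  shows "(\<lambda>x. f x - h x) \<in> L2 M"
  using L2_add[OF assms(1) L2_scaleR[OF assms(2), of "-1"]] by simp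

lemma L2_zero: "(\<lambda>x. 0) \<in> L2 M"
  by (simp add: L2_def)

lemma L2_linear_image:
  assumes A: "linear A" and f: "f \<in> L2 M"
  shows "(\<lambda>x. A (f x)) \<in> L2 M"
proof (rule L2_dominated)
  have bl: "bounded_linear A" using A linear_conv_bounded_linear by blast
  show "(\<lambda>x. A (f x)) \<in> borel_measurable M"
    using L2D(1)[OF f] linear_continuous_on[OF bl] by (metis borel_measurable_continuous_on)
  show "integrable M (\<lambda>x. (onorm A)\<^sup>2 * (norm (f x))\<^sup>2)" using f by (simp add: L2_def)
  show "(norm (A (f x)))\<^sup>2 \<le> (onorm A)\<^sup>2 * (norm (f x))\<^sup>2" for x
    using onorm[OF bl, of "f x"] by (metis norm_ge_zero power_mono power_mult_distrib)
qed

lemma L2_measurable_finite: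
  assumes "finite_measure M" "f \<in> borel_measurable M" "\<And>x. x \<in> space M \<Longrightarrow> norm (f x) \<le> C"
  shows "f \<in> L2 M"
proof (rule L2_dominated)
  show "integrable M (\<lambda>x. C\<^sup>2)" using assms(1) by (simp add: finite_measure.integrable_const)
  show "(norm (f x))\<^sup>2 \<le> C\<^sup>2" if "x \<in> space M" for x using assms(3)[OF that] by (intro power_mono) auto
qed (rule assms)

lemma L2_imp_integrable:
  assumes "finite_measure M" "f \<in> L2 M"
  shows "integrable M f"
proof (rule Bochner_Integration.integrable_bound)
  show "integrable M (\<lambda>x. 1 + (norm (f x))\<^sup>2)"
    using assms by (auto simp: L2_def finite_measure.integrable_const)
  have "norm (f x) \<le> norm (1 + (norm (f x))\<^sup>2)" for x
  proof -
    have "2 * norm (f x) \<le> 1 + (norm (f x))\<^sup>2" using sum_squares_bound[of 1 "norm (f x)"] by simp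
    moreover have "norm (f x) \<ge> 0" by simp
    ultimately have "norm (f x) \<le> 1 + (norm (f x))\<^sup>2" by linarith
    then show ?thesis by simp
  qed
  then show "AE x in M. norm (f x) \<le> norm (1 + (norm (f x))\<^sup>2)" by simp
qed (use assms in \<open>auto simp: L2_def\<close>)

lemma L2_inner_commute: "L2_inner M f h = L2_inner M h f"
  by (simp add: L2_inner_def inner_commute)

lemma L2_inner_add_left:
  assumes "f \<in> L2 M" "h \<in> L2 M" "k \<in> L2 M"
  shows "L2_inner M (\<lambda>x. f x + h x) k = L2_inner M f k + L2_inner M h k"
  unfolding L2_inner_def inner_add_left
  by (intro Bochner_Integration.integral_add L2_inner_integrable assms)

lemma L2_inner_diff_left:
  assumes "f \<in> L2 M" "h \<in> L2 M" "k \<in> L2 M"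
  shows "L2_inner M (\<lambda>x. f x - h x) k = L2_inner M f k - L2_inner M h k"
  unfolding L2_inner_def inner_diff_left
  by (intro Bochner_Integration.integral_diff L2_inner_integrable assms)

lemma L2_inner_scaleR_left: "L2_inner M (\<lambda>x. c *\<^sub>R f x) k = c * L2_inner M f k"
  unfolding L2_inner_def by simp

lemma L2_inner_mult_left: "L2_inner M (\<lambda>x. c * f x) k = c * L2_inner M f k" for f :: "'a \<Rightarrow> real"
  using L2_inner_scaleR_left[of M c f k] by simp

lemma L2_inner_add_right:
  assumes "f \<in> L2 M" "h \<in> L2 M" "k \<in> L2 M"
  shows "L2_inner M k (\<lambda>x. f x + h x) = L2_inner M k f + L2_inner M k h"
  using L2_inner_add_left[OF assms] by (simp add: L2_inner_commute)

lemma L2_inner_diff_right: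
  assumes "f \<in> L2 M" "h \<in> L2 M" "k \<in> L2 M"
  shows "L2_inner M k (\<lambda>x. f x - h x) = L2_inner M k f - L2_inner M k h"
  using L2_inner_diff_left[OF assms] by (simp add: L2_inner_commute)

lemma L2_inner_scaleR_right: "L2_inner M k (\<lambda>x. c *\<^sub>R f x) = c * L2_inner M k f"
  unfolding L2_inner_def by simp

lemma L2_inner_cong_AE:
  assumes "f \<in> borel_measurable M" "f' \<in> borel_measurable M" "h \<in> borel_measurable M" "h' \<in> borel_measurable M"
    and "AE x in M. f x = f' x" "AE x in M. h x = h' x"
  shows "L2_inner M f h = L2_inner M f' h'"
  unfolding L2_inner_def using assms by (intro integral_cong_AE) auto

lemma L2_inner_self_nonneg: "L2_inner M f f \<ge> 0"
  unfolding L2_inner_def by (simp add: integral_nonneg_AE)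

lemma L2_norm_nonneg: "L2_norm M f \<ge> 0"
  unfolding L2_norm_def by (simp add: L2_inner_self_nonneg)

lemma L2_norm_sq: "(L2_norm M f)\<^sup>2 = L2_inner M f f"
  by (simp add: L2_norm_def L2_inner_self_nonneg)

lemma L2_norm_sq_integral: "(L2_norm M f)\<^sup>2 = (\<integral>x. (norm (f x))\<^sup>2 \<partial>M)"
  by (simp add: L2_norm_sq L2_inner_def power2_norm_eq_inner)

lemma L2_norm_cong_AE:
  assumes "f \<in> borel_measurable M" "h \<in> borel_measurable M" "AE x in M. f x = h x"
  shows "L2_norm M f = L2_norm M h"
  unfolding L2_norm_def using L2_inner_cong_AE[OF assms(1,2,1,2) assms(3,3)] by simp

lemma L2_norm_scaleR: "L2_norm M (\<lambda>x. c *\<^sub>R f x) = \<bar>c\<bar> * L2_norm M f"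
proof -
  have "L2_inner M (\<lambda>x. c *\<^sub>R f x) (\<lambda>x. c *\<^sub>R f x) = c\<^sup>2 * L2_inner M f f"
    by (simp add: L2_inner_scaleR_left L2_inner_scaleR_right power2_eq_square)
  then show ?thesis by (simp add: L2_norm_def real_sqrt_mult)
qed

lemma L2_norm_minus_commute: "L2_norm M (\<lambda>x. f x - h x) = L2_norm M (\<lambda>x. h x - f x)"
  using L2_norm_scaleR[of M "-1" "\<lambda>x. f x - h x"] by simp

lemma L2_norm_zero [simp]: "L2_norm M (\<lambda>x. 0) = 0"
  by (simp add: L2_norm_def L2_inner_def)

lemma L2_norm_diff_sq:
  assumes "f \<in> L2 M" "h \<in> L2 M"
  shows "(L2_norm M (\<lambda>x. f x - h x))\<^sup>2 = L2_inner M f f - 2 * L2_inner M f h + L2_inner M h h"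
  using assms
  by (simp add: L2_norm_sq L2_inner_diff_left L2_inner_diff_right L2_diff L2_inner_commute[of M h f])

lemma L2_norm_add_sq:
  assumes "f \<in> L2 M" "h \<in> L2 M"
  shows "(L2_norm M (\<lambda>x. f x + h x))\<^sup>2 = L2_inner M f f + 2 * L2_inner M f h + L2_inner M h h"
  using assms
  by (simp add: L2_norm_sq L2_inner_add_left L2_inner_add_right L2_add L2_inner_commute[of M h f])

text \<open>The squared norm of \<open>f - t h\<close> is a nonnegative quadratic polynomial in
  \<open>t\<close>; its value at the minimum \<open>t = c / b\<close> is the inequality.\<close>

lemma L2_Cauchy_Schwarz:
  assumes f: "f \<in> L2 M" and h: "h \<in> L2 M"
  shows "\<bar>L2_inner M f h\<bar> \<le> L2_norm M f * L2_norm M h"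
proof -
  let ?a = "L2_inner M f f" and ?b = "L2_inner M h h" and ?c = "L2_inner M f h"
  have q: "0 \<le> ?a - 2 * t * ?c + t\<^sup>2 * ?b" for t
  proof -
    have "0 \<le> (L2_norm M (\<lambda>x. f x - t *\<^sub>R h x))\<^sup>2" by simp
    then show ?thesis unfolding L2_norm_diff_sq[OF f L2_scaleR[OF h]]
      by (simp add: L2_inner_scaleR_left L2_inner_scaleR_right power2_eq_square)
  qed
  have "?c\<^sup>2 \<le> ?a * ?b"
  proof (cases "?b = 0")
    case True
    have "?c = 0"
    proof (rule ccontr)
      assume "?c \<noteq> 0"
      \<comment> \<open>With \<open>b = 0\<close> the polynomial is \<open>a - 2 t c\<close>, and
        this \<open>t\<close> gives it the value -1.\<close>
      then show False using q[of "(?a + 1) / (2 * ?c)"] True by (simp add: field_simps)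
    qed
    then show ?thesis using True by simp
  next
    case False
    then have "?b > 0" using L2_inner_self_nonneg[of M h] by linarith
    then show ?thesis using q[of "?c / ?b"] by (simp add: power2_eq_square field_simps)
  qed
  then have "sqrt (?c\<^sup>2) \<le> sqrt (?a * ?b)" using real_sqrt_le_mono by blast
  then show ?thesis by (simp add: L2_norm_def real_sqrt_mult)
qed

lemma L2_norm_triangle:
  assumes "f \<in> L2 M" "h \<in> L2 M"
  shows "L2_norm M (\<lambda>x. f x + h x) \<le> L2_norm M f + L2_norm M h"
proof (rule power2_le_imp_le)
  show "(L2_norm M (\<lambda>x. f x + h x))\<^sup>2 \<le> (L2_norm M f + L2_norm M h)\<^sup>2"
    unfolding L2_norm_add_sq[OF assms] unfolding power2_sum L2_norm_sq
    using L2_Cauchy_Schwarz[OF assms] by linarith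
qed (simp add: L2_norm_nonneg)

lemma L2_norm_triangle_diff:
  assumes "f \<in> L2 M" "h \<in> L2 M" "k \<in> L2 M"
  shows "L2_norm M (\<lambda>x. f x - k x) \<le> L2_norm M (\<lambda>x. f x - h x) + L2_norm M (\<lambda>x. h x - k x)"
  using L2_norm_triangle[OF L2_diff[OF assms(1,2)] L2_diff[OF assms(2,3)]] by simp

lemma L2_norm_reverse_triangle:
  assumes "f \<in> L2 M" "h \<in> L2 M"
  shows "\<bar>L2_norm M f - L2_norm M h\<bar> \<le> L2_norm M (\<lambda>x. f x - h x)"
  using L2_norm_triangle_diff[OF assms(1,2) L2_zero] L2_norm_triangle_diff[OF assms(2,1) L2_zero]
  by (simp add: L2_norm_minus_commute[of M h f] abs_le_iff)

lemma L2_norm_linear_image: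
  assumes A: "linear A" and f: "f \<in> L2 M"
  shows "L2_norm M (\<lambda>x. A (f x)) \<le> onorm A * L2_norm M f"
proof (rule power2_le_imp_le)
  have bl: "bounded_linear A" using A linear_conv_bounded_linear by blast
  have "(L2_norm M (\<lambda>x. A (f x)))\<^sup>2 \<le> (\<integral>x. (onorm A)\<^sup>2 * (norm (f x))\<^sup>2 \<partial>M)"
    unfolding L2_norm_sq_integral
  proof (rule integral_mono)
    show "(norm (A (f x)))\<^sup>2 \<le> (onorm A)\<^sup>2 * (norm (f x))\<^sup>2" for x
      using onorm[OF bl, of "f x"] by (metis norm_ge_zero power_mono power_mult_distrib)
  qed (use f L2_linear_image[OF A f] in \<open>auto simp: L2_def\<close>)
  then show "(L2_norm M (\<lambda>x. A (f x)))\<^sup>2 \<le> (onorm A * L2_norm M f)\<^sup>2"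
    by (simp add: power_mult_distrib L2_norm_sq_integral)
  show "0 \<le> onorm A * L2_norm M f" using onorm_pos_le[OF bl] L2_norm_nonneg[of M f] by simp
qed

lemma L2_norm_linear_image_diff:
  assumes "linear A" "f \<in> L2 M" "h \<in> L2 M"
  shows "L2_norm M (\<lambda>x. A (f x) - A (h x)) \<le> onorm A * L2_norm M (\<lambda>x. f x - h x)"
  using L2_norm_linear_image[OF assms(1) L2_diff[OF assms(2,3)]] by (simp add: linear_diff[OF assms(1)])

lemma L2_norm_eq_0_AE:
  assumes "f \<in> L2 M" "L2_norm M f = 0"
  shows "AE x in M. f x = 0"
proof -
  have "(\<integral>x. (norm (f x))\<^sup>2 \<partial>M) = 0" using L2_norm_sq_integral[of M f] assms by simp
  then show ?thesis using integral_nonneg_eq_0_iff_AE[OF L2D(2)[OF assms(1)]] by simp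
qed

lemma L2_inner_tendsto:
  assumes "\<And>n. f n \<in> L2 M" "h \<in> L2 M" "w \<in> L2 M" "(\<lambda>n. L2_norm M (\<lambda>x. f n x - h x)) \<longlonglongrightarrow> 0"
  shows "(\<lambda>n. L2_inner M (f n) w) \<longlonglongrightarrow> L2_inner M h w"
proof -
  have "(\<lambda>n. L2_norm M (\<lambda>x. f n x - h x) * L2_norm M w) \<longlonglongrightarrow> 0"
    using tendsto_mult[OF assms(4) tendsto_const] by simp
  then have "(\<lambda>n. L2_inner M (f n) w - L2_inner M h w) \<longlonglongrightarrow> 0"
    by (rule Lim_null_comparison[OF always_eventually, rotated])
       (use L2_Cauchy_Schwarz[OF L2_diff[OF assms(1,2)] assms(3)] in \<open>simp add: L2_inner_diff_left[OF assms(1,2,3)]\<close>)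
  then show ?thesis by (simp add: LIM_zero_iff)
qed

lemma nn_integral_L2_norm:
  assumes "f \<in> L2 M"
  shows "(\<integral>\<^sup>+x. ennreal ((norm (f x))\<^sup>2) \<partial>M) = ennreal ((L2_norm M f)\<^sup>2)"
  unfolding L2_norm_sq_integral by (rule nn_integral_eq_integral) (use L2D(2)[OF assms] in auto)

section \<open>Test functions\<close>

text \<open>Smoothness can thus be shown with an explicit derivative \<open>D\<close>, while
  \<open>C_k\<close> itself speaks of \<open>frechet_derivative\<close>, which is a choice.\<close>

lemma C_k_SucI:
  assumes "\<And>x. (f has_derivative D x) (at x)" "\<And>b. b \<in> Basis \<Longrightarrow> C_k k (\<lambda>x. D x b)"
  shows "C_k (Suc k) f"
proof -
  have "frechet_derivative f (at x) = D x" for x using frechet_derivative_at[OF assms(1)] by simp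
  then show ?thesis using assms by (auto simp: differentiable_def)
qed

lemma C_k_Suc_D: "C_k (Suc k) f \<Longrightarrow> C_k k f"
proof (induction k arbitrary: f)
  case 0
  then have "f differentiable_on UNIV" by (simp add: differentiable_on_def)
  then show ?case by (simp add: differentiable_imp_continuous_on)
qed auto

lemma C_k_has_derivative:
  assumes "C_k (Suc k) f"
  shows "(f has_derivative frechet_derivative f (at x)) (at x)"
  using assms by (simp add: frechet_derivative_works[symmetric])

lemma C_k_const: "C_k k (\<lambda>x. c)"
  by (induction k arbitrary: c) (auto simp: frechet_derivative_const)

lemma C_k_add: "C_k k f \<Longrightarrow> C_k k g \<Longrightarrow> C_k k (\<lambda>x. f x + g x)"
proof (induction k arbitrary: f g)
  case (Suc k)
  show ?case
    by (rule C_k_SucI[OF has_derivative_add[OF C_k_has_derivative[OF Suc.prems(1)] C_k_has_derivative[OF Suc.prems(2)]]])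
       (use Suc in auto)
qed (auto intro: continuous_on_add)

lemma C_k_mult: "C_k k f \<Longrightarrow> C_k k g \<Longrightarrow> C_k k (\<lambda>x. f x * g x)"
proof (induction k arbitrary: f g)
  case (Suc k)
  show ?case
    by (rule C_k_SucI[OF has_derivative_mult[OF C_k_has_derivative[OF Suc.prems(1)] C_k_has_derivative[OF Suc.prems(2)]]])
       (use Suc C_k_Suc_D[OF Suc.prems(1)] C_k_Suc_D[OF Suc.prems(2)] in \<open>auto intro!: C_k_add Suc.IH\<close>)
qed (auto intro: continuous_on_mult)

lemma C_k_cmult: "C_k k f \<Longrightarrow> C_k k (\<lambda>x. c * f x)"
  by (intro C_k_mult C_k_const)

lemma C_k_prod: "finite I \<Longrightarrow> (\<And>i. i \<in> I \<Longrightarrow> C_k k (f i)) \<Longrightarrow> C_k k (\<lambda>x. \<Prod>i\<in>I. f i x)"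
  by (induction I rule: finite_induct) (auto intro: C_k_const C_k_mult)

text \<open>The partial derivatives are constants times the derivative of \<open>g\<close> composed
  with the same affine map, so the induction is over all \<open>g\<close> at once.\<close>

lemma C_k_affine:
  fixes v :: "'a::euclidean_space" and g :: "real \<Rightarrow> real"
  shows "C_k k g \<Longrightarrow> C_k k (\<lambda>x. g (x \<bullet> v + t))"
proof (induction k arbitrary: g)
  case 0
  then show ?case by (auto intro!: continuous_on_compose2[of UNIV g] continuous_intros)
next
  case (Suc k)
  let ?g' = "\<lambda>y. frechet_derivative g (at y) 1"
  have lin: "frechet_derivative g (at y) h = h * ?g' y" for y h
    using linear_cmul[OF has_derivative_linear[OF C_k_has_derivative[OF Suc.prems]], of y h 1] by simp
  have "((\<lambda>x. g (x \<bullet> v + t)) has_derivative (\<lambda>h. (h \<bullet> v) * ?g' (x \<bullet> v + t))) (at x)" for x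
    unfolding lin[symmetric]
    by (rule has_derivative_compose[of "\<lambda>x. x \<bullet> v + t" "\<lambda>h. h \<bullet> v" x UNIV g, OF _ C_k_has_derivative[OF Suc.prems]])
       (auto intro!: derivative_eq_intros)
  then show ?case
    by (rule C_k_SucI) (use Suc in \<open>auto intro!: C_k_cmult\<close>)
qed

text \<open>As \<open>c\<close> decreases to \<open>0\<close>, \<open>exp_cut 0 c\<close> increases to the indicator of the positive half-line.
  The exponent \<open>n\<close> makes the family closed under differentiation.\<close>

definition exp_cut :: "nat \<Rightarrow> real \<Rightarrow> real \<Rightarrow> real" where
  "exp_cut n c x = (if x > 0 then (1 / x) ^ n * exp (- c / x) else 0)"

text \<open>In the variable y = 1 / x this is the decay of y^n exp(- c y) at infinity; on the
  negative side the function vanishes.\<close>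

lemma exp_cut_tendsto_0:
  assumes "c > 0"
  shows "(exp_cut n c \<longlongrightarrow> 0) (at 0)"
proof -
  have "((\<lambda>y. (c * y) ^ n / exp (c * y)) \<longlongrightarrow> 0) at_top"
    by (rule filterlim_compose[OF tendsto_power_div_exp_0])
       (use assms filterlim_tendsto_pos_mult_at_top[OF tendsto_const assms filterlim_ident] in simp)
  then have "((\<lambda>y. (1 / c ^ n) * ((c * y) ^ n / exp (c * y))) \<longlongrightarrow> (1 / c ^ n) * 0) at_top"
    by (intro tendsto_mult tendsto_const)
  then have "((\<lambda>y. y ^ n * exp (- (c * y))) \<longlongrightarrow> 0) at_top"
    using assms by (simp add: power_mult_distrib exp_minus divide_inverse mult.assoc[symmetric])
  then have "((\<lambda>x. inverse x ^ n * exp (- (c * inverse x))) \<longlongrightarrow> 0) (at_right 0)"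
    by (rule filterlim_compose[OF _ filterlim_inverse_at_top_right])
  moreover have "\<forall>\<^sub>F x in at_right 0. inverse x ^ n * exp (- (c * inverse x)) = exp_cut n c x"
    by (simp add: eventually_at_filter exp_cut_def divide_inverse)
  ultimately have r: "(exp_cut n c \<longlongrightarrow> 0) (at_right 0)"
    by (rule Lim_transform_eventually)
  have "\<forall>\<^sub>F x in at_left 0. 0 = exp_cut n c x"
    by (auto simp: eventually_at_filter exp_cut_def)
  with tendsto_const have "(exp_cut n c \<longlongrightarrow> 0) (at_left 0)" by (rule Lim_transform_eventually)
  with r show ?thesis by (simp add: filterlim_split_at)
qed

lemma exp_cut_deriv:
  assumes "c > 0"
  shows "(exp_cut n c has_real_derivative (c * exp_cut (n + 2) c x + - real n * exp_cut (n + 1) c x)) (at x)"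
proof (cases x "0::real" rule: linorder_cases)
  case less
  have "((\<lambda>_. 0) has_real_derivative 0) (at x)" by simp
  then have "(exp_cut n c has_real_derivative 0) (at x)"
    by (rule has_field_derivative_transform_within_open[where S="{..<0}"]) (use less in \<open>auto simp: exp_cut_def\<close>)
  then show ?thesis using less by (simp add: exp_cut_def)
next
  case equal
  \<comment> \<open>The difference quotient at 0 is \<open>exp_cut (n + 1) c h\<close> for
    \<open>h\<close> of either sign, and this tends to 0.\<close>
  have "((\<lambda>h. (exp_cut n c (0 + h) - exp_cut n c 0) / h) \<longlongrightarrow> 0) (at 0)"
  proof (rule Lim_transform_eventually[OF exp_cut_tendsto_0[OF assms, of "n + 1"]])
    show "\<forall>\<^sub>F h in at 0. exp_cut (n + 1) c h = (exp_cut n c (0 + h) - exp_cut n c 0) / h"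
      by (auto simp: exp_cut_def eventually_at_filter)
  qed
  then show ?thesis using equal by (simp add: DERIV_def exp_cut_def)
next
  case greater
  have "((\<lambda>x. (1 / x) ^ n) has_real_derivative (- real n * (1 / x) ^ (n + 1))) (at x)"
  proof (cases n)
    case (Suc m)
    have "((\<lambda>x. 1 / x) has_real_derivative - (1 / x)\<^sup>2) (at x)"
      using greater by (auto intro!: derivative_eq_intros simp: power2_eq_square)
    from DERIV_power[OF this, of "Suc m"] show ?thesis
      by (simp add: Suc power2_eq_square algebra_simps minus_divide_left del: power_one_over minus_divide_left[symmetric] flip: diff_divide_distrib)
  qed simp
  moreover have "((\<lambda>x. exp (- c / x)) has_real_derivative (exp (- c / x) * (c * (1 / x)\<^sup>2))) (at x)"
    using greater by (auto intro!: derivative_eq_intros simp: power2_eq_square)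
  ultimately have "((\<lambda>x. (1 / x) ^ n * exp (- c / x)) has_real_derivative
      (- real n * (1 / x) ^ (n + 1) * exp (- c / x) + exp (- c / x) * (c * (1 / x)\<^sup>2) * (1 / x) ^ n)) (at x)"
    by (rule DERIV_mult)
  moreover have "- real n * (1 / x) ^ (n + 1) * exp (- c / x) + exp (- c / x) * (c * (1 / x)\<^sup>2) * (1 / x) ^ n
      = c * exp_cut (n + 2) c x + - real n * exp_cut (n + 1) c x"
    using greater by (simp add: exp_cut_def power2_eq_square mult_ac)
  ultimately have "((\<lambda>x. (1 / x) ^ n * exp (- c / x)) has_real_derivative
      (c * exp_cut (n + 2) c x + - real n * exp_cut (n + 1) c x)) (at x)"
    by simp
  then show ?thesis
    by (rule has_field_derivative_transform_within_open[where S="{0<..}"]) (use greater in \<open>auto simp: exp_cut_def\<close>)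
qed

lemma C_k_exp_cut:
  assumes "c > 0"
  shows "C_k k (exp_cut n c)"
proof (induction k arbitrary: n)
  case 0
  show ?case
    by (simp add: continuous_on_eq_continuous_at, rule allI, rule DERIV_isCont[OF exp_cut_deriv[OF assms]])
next
  case (Suc k)
  show ?case
  proof (rule C_k_SucI[OF exp_cut_deriv[OF assms, THEN has_field_derivative_imp_has_derivative]])
    show "C_k k (\<lambda>x. (c * exp_cut (n + 2) c x + - real n * exp_cut (n + 1) c x) * b)" for b
      by (intro C_k_mult C_k_add C_k_const Suc.IH)
  qed
qed

text \<open>The two factors for a direction \<open>i\<close> are positive where a . i < x . i and
  where x . i < b . i, so the product is positive exactly on the open box. With \<open>c\<close>
  fixed it is a bump; as \<open>c\<close> tends to 0 it tends to the indicator of the box, which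
  serves in place of convolution with a mollifier.\<close>

definition box_bump :: "'a::euclidean_space \<Rightarrow> 'a \<Rightarrow> real \<Rightarrow> 'a \<Rightarrow> real" where
  "box_bump a b c x = (\<Prod>i\<in>Basis. exp_cut 0 c (x \<bullet> i + - (a \<bullet> i)) * exp_cut 0 c (x \<bullet> (- i) + b \<bullet> i))"

lemma C_k_box_bump: "c > 0 \<Longrightarrow> C_k k (box_bump a b c)"
  unfolding box_bump_def by (intro C_k_prod C_k_mult C_k_affine C_k_exp_cut) auto

lemma exp_cut_bounds: "c > 0 \<Longrightarrow> 0 \<le> exp_cut 0 c x" "c > 0 \<Longrightarrow> exp_cut 0 c x \<le> 1"
  by (auto simp: exp_cut_def)

lemma box_bump_bounds:
  assumes "c > 0"
  shows "0 \<le> box_bump a b c x" "box_bump a b c x \<le> 1"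
  unfolding box_bump_def using exp_cut_bounds[OF assms]
  by (auto intro!: prod_nonneg prod_le_1 mult_le_one)

lemma box_bump_outside: "x \<notin> box a b \<Longrightarrow> box_bump a b c x = 0"
  unfolding box_bump_def by (auto simp: mem_box exp_cut_def intro!: prod_zero)

lemma box_bump_pos: "x \<in> box a b \<Longrightarrow> box_bump a b c x > 0"
  unfolding box_bump_def by (auto simp: mem_box exp_cut_def intro!: prod_pos)

lemma box_bump_tendsto:
  "(\<lambda>n. box_bump a b (1 / real (Suc n)) x) \<longlonglongrightarrow> indicator (box a b) x"
proof (cases "x \<in> box a b")
  case True
  have *: "(\<lambda>n. exp_cut 0 (1 / real (Suc n)) y) \<longlonglongrightarrow> 1" if "y > 0" for y
  proof -
    have "(\<lambda>n. exp (- (1 / real (Suc n)) / y)) \<longlonglongrightarrow> exp (- 0 / y)"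
      by (intro tendsto_intros LIMSEQ_Suc[OF lim_const_over_n]) (use that in auto)
    then show ?thesis using that by (simp add: exp_cut_def)
  qed
  have "(\<lambda>n. box_bump a b (1 / real (Suc n)) x) \<longlonglongrightarrow> (\<Prod>i\<in>(Basis::'a set). 1 * 1)"
    unfolding box_bump_def using True by (intro tendsto_prod tendsto_mult *) (auto simp: mem_box)
  then show ?thesis using True by simp
qed (simp add: box_bump_outside)

lemma test_funI:
  assumes "\<And>k. C_k k \<psi>" "\<And>x. x \<notin> cbox a b \<Longrightarrow> \<psi> x = 0" "cbox a b \<subseteq> S"
  shows "\<psi> \<in> test_fun S"
proof -
  have "closure {x. \<psi> x \<noteq> 0} \<subseteq> cbox a b" using assms(2) by (intro closure_minimal) auto
  then have "compact (closure {x. \<psi> x \<noteq> 0})" "closure {x. \<psi> x \<noteq> 0} \<subseteq> S"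
    using assms(3) bounded_subset[OF bounded_cbox, of "{x. \<psi> x \<noteq> 0}" a b] closure_subset[of "{x. \<psi> x \<noteq> 0}"]
    by (auto simp: compact_closure)
  then show ?thesis using assms(1) by (simp add: test_fun_def)
qed

lemma box_bump_test_fun:
  assumes "c > 0" "cbox a b \<subseteq> S"
  shows "box_bump a b c \<in> test_fun S"
  using assms box_subset_cbox[of a b] by (intro test_funI[of _ a b]) (auto simp: C_k_box_bump intro!: box_bump_outside)

lemma test_fun_C_k: "\<psi> \<in> test_fun S \<Longrightarrow> C_k k \<psi>"
  by (simp add: test_fun_def)

lemma test_fun_has_derivative: "\<psi> \<in> test_fun S \<Longrightarrow> (\<psi> has_derivative frechet_derivative \<psi> (at x)) (at x)"
  using C_k_has_derivative[of 0] test_fun_C_k by blast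

lemma test_fun_continuous: "\<psi> \<in> test_fun S \<Longrightarrow> continuous_on A \<psi>"
  using test_fun_C_k[of \<psi> S 0] continuous_on_subset by auto

lemma test_fun_partial_continuous:
  "\<psi> \<in> test_fun S \<Longrightarrow> b \<in> Basis \<Longrightarrow> continuous_on A (\<lambda>x. frechet_derivative \<psi> (at x) b)"
  using test_fun_C_k[of \<psi> S 1] continuous_on_subset[of UNIV _ A] by auto

lemma test_fun_outside: "\<psi> \<in> test_fun S \<Longrightarrow> x \<notin> S \<Longrightarrow> \<psi> x = 0"
  using closure_subset[of "{x. \<psi> x \<noteq> 0}"] by (auto simp: test_fun_def)

lemma test_fun_support:
  assumes "\<psi> \<in> test_fun S"
  shows "\<exists>K. compact K \<and> K \<subseteq> S \<and> (\<forall>x. x \<notin> K \<longrightarrow> \<psi> x = 0 \<and> (\<forall>h. frechet_derivative \<psi> (at x) h = 0))"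
proof (intro exI conjI allI impI)
  let ?K = "closure {x. \<psi> x \<noteq> 0}"
  show "compact ?K" "?K \<subseteq> S" using assms by (auto simp: test_fun_def)
  show z: "\<psi> x = 0" if "x \<notin> ?K" for x using that closure_subset[of "{x. \<psi> x \<noteq> 0}"] by auto
  show "frechet_derivative \<psi> (at x) h = 0" if "x \<notin> ?K" for x h
  proof -
    have "(\<psi> has_derivative (\<lambda>h. 0)) (at x)"
    proof (rule has_derivative_transform_within_open[where s="- ?K"])
      show "((\<lambda>x. 0) has_derivative (\<lambda>h. 0)) (at x)" by simp
      show "open (- ?K)" by (intro open_Compl closed_closure)
      show "x \<in> - ?K" using that by simp
      show "0 = \<psi> y" if "y \<in> - ?K" for y using z[of y] that by simp
    qed
    then have "(\<lambda>h. 0) = frechet_derivative \<psi> (at x)" by (rule frechet_derivative_at)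
    then show ?thesis by metis
  qed
qed

lemma continuous_zero_outside_compact_bounded:
  fixes f :: "'a::topological_space \<Rightarrow> real"
  assumes "compact K" "continuous_on K f" "\<And>x. x \<notin> K \<Longrightarrow> f x = 0"
  obtains B where "B > 0" "\<And>x. \<bar>f x\<bar> \<le> B"
proof -
  have "bounded (f ` K)" using assms compact_continuous_image compact_imp_bounded by blast
  then obtain B where "\<And>x. x \<in> K \<Longrightarrow> \<bar>f x\<bar> \<le> B" by (auto simp: bounded_iff)
  then have "\<bar>f x\<bar> \<le> \<bar>B\<bar> + 1" for x
    using assms(3)[of x] by (cases "x \<in> K") fastforce+
  then show ?thesis using that[of "\<bar>B\<bar> + 1"] by auto
qed

lemma test_fun_bounded:
  assumes "\<psi> \<in> test_fun S"
  obtains B where "B > 0" "\<And>x. \<bar>\<psi> x\<bar> \<le> B"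
proof -
  obtain K where K: "compact K" "\<And>x. x \<notin> K \<Longrightarrow> \<psi> x = 0"
    using test_fun_support[OF assms] by metis
  show ?thesis
    by (rule continuous_zero_outside_compact_bounded[OF K(1) test_fun_continuous[OF assms] K(2)]) (assumption | rule that)+
qed

lemma test_fun_partial_bounded:
  assumes "\<psi> \<in> test_fun S" "b \<in> Basis"
  obtains B where "B > 0" "\<And>x. \<bar>frechet_derivative \<psi> (at x) b\<bar> \<le> B"
proof -
  obtain K where K: "compact K" "\<And>x. x \<notin> K \<Longrightarrow> frechet_derivative \<psi> (at x) b = 0"
    using test_fun_support[OF assms(1)] by metis
  show ?thesis
    by (rule continuous_zero_outside_compact_bounded[OF K(1) test_fun_partial_continuous[OF assms] K(2)]) (assumption | rule that)+
qed

section \<open>The fundamental lemma of the calculus of variations\<close>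

lemma continuous_on_measurable_lebesgue_on:
  fixes f :: "'a::euclidean_space \<Rightarrow> 'b::euclidean_space"
  assumes "continuous_on UNIV f"
  shows "f \<in> borel_measurable (lebesgue_on S)"
proof -
  have "f \<in> borel_measurable borel" using assms by (rule borel_measurable_continuous_onI)
  then have "f \<in> borel_measurable lebesgue" by (simp add: measurable_completion)
  then show ?thesis by (rule measurable_restrict_space1)
qed

lemma AE_lebesgue_on_iff:
  assumes "S \<in> sets lebesgue"
  shows "(AE x in lebesgue_on S. P x) \<longleftrightarrow> (AE x in lebesgue. x \<in> S \<longrightarrow> P x)"
  using assms by (simp add: AE_restrict_space_iff)

text \<open>By dominated convergence of box bumps the integral of \<open>w\<close> vanishes over
  every open box whose closed box lies in \<open>S\<close>. Boxes form an intersection-stable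
  generator of the Borel sets, so \<open>w\<close> integrates to zero over all Borel subsets of such
  a box and vanishes there almost everywhere; countably many closed boxes make up
  \<open>S\<close>.\<close>

theorem fundamental_lemma_of_calculus_of_variations:
  fixes w :: "'a::euclidean_space \<Rightarrow> real"
  assumes S: "open S" and w: "integrable (lebesgue_on S) w"
    and 0: "\<And>\<psi>. \<psi> \<in> test_fun S \<Longrightarrow> (\<integral>x. w x * \<psi> x \<partial>lebesgue_on S) = 0"
  shows "AE x in lebesgue_on S. w x = 0"
proof -
  have Sm: "S \<in> sets lebesgue" "S \<inter> space lebesgue \<in> sets lebesgue" using S by auto
  define v where "v = (\<lambda>x. indicator S x * w x)"
  have vi: "integrable lebesgue v" using w Sm by (simp add: v_def integrable_restrict_space)
  \<comment> \<open>The argument on generators takes place in the Borel sets, hence a Borel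
    representative \<open>v'\<close> of \<open>w\<close> extended by zero.\<close>
  then obtain v' where v': "v' \<in> borel_measurable lborel" "AE x in lborel. v x = v' x"
    using completion_ex_borel_measurable_real by blast
  have v'i: "integrable lborel v'"
  proof -
    have "v' \<in> borel_measurable lebesgue" using v'(1) by (rule measurable_completion)
    then have "integrable lebesgue v'"
      by (rule integrable_cong_AE_imp[OF vi _ AE_completion[OF v'(2)]])
    then show ?thesis using integrable_completion[OF v'(1)] by simp
  qed
  have vv': "(\<integral>x. v x * h x \<partial>lebesgue) = (\<integral>x. v' x * h x \<partial>lborel)" if "h \<in> borel_measurable borel" for h
  proof -
    have "(\<integral>x. v x * h x \<partial>lebesgue) = (\<integral>x. v' x * h x \<partial>lebesgue)"
    proof (rule integral_cong_AE)
      have "h \<in> borel_measurable lebesgue" "v' \<in> borel_measurable lebesgue"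
        using that v'(1) by (auto intro: measurable_completion)
      then show "(\<lambda>x. v x * h x) \<in> borel_measurable lebesgue" "(\<lambda>x. v' x * h x) \<in> borel_measurable lebesgue"
        using borel_measurable_integrable[OF vi] by (auto intro: borel_measurable_times)
    qed (use AE_completion[OF v'(2)] in auto)
    then show ?thesis using integral_completion[of "\<lambda>x. v' x * h x" lborel] v'(1) that by simp
  qed
  have box0: "(\<integral>x. v' x * indicator (box a b) x \<partial>lborel) = 0" if "cbox a b \<subseteq> S" for a b
  proof -
    have bm: "box_bump a b (1 / real (Suc n)) \<in> borel_measurable borel" for n
      using C_k_box_bump[of "1 / real (Suc n)" 0 a b] by (simp add: borel_measurable_continuous_onI)
    have "(\<integral>x. v' x * box_bump a b (1 / real (Suc n)) x \<partial>lborel) = 0" for n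
    proof -
      have "(\<integral>x. v x * box_bump a b (1 / real (Suc n)) x \<partial>lebesgue)
          = (\<integral>x. w x * box_bump a b (1 / real (Suc n)) x \<partial>lebesgue_on S)"
        using Sm by (simp add: v_def integral_restrict_space mult.assoc)
      then show ?thesis using 0[OF box_bump_test_fun[OF _ that, of "1 / real (Suc n)"]] vv'[OF bm, of n] by simp
    qed
    moreover have "(\<lambda>n. \<integral>x. v' x * box_bump a b (1 / real (Suc n)) x \<partial>lborel) \<longlonglongrightarrow> (\<integral>x. v' x * indicator (box a b) x \<partial>lborel)"
    proof (rule integral_dominated_convergence[where w="\<lambda>x. \<bar>v' x\<bar>"])
      show "AE x in lborel. (\<lambda>n. v' x * box_bump a b (1 / real (Suc n)) x) \<longlonglongrightarrow> v' x * indicator (box a b) x"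
        by (intro AE_I2 tendsto_mult tendsto_const box_bump_tendsto)
      show "AE x in lborel. norm (v' x * box_bump a b (1 / real (Suc n)) x) \<le> \<bar>v' x\<bar>" for n
        using box_bump_bounds[of "1 / real (Suc n)" a b] by (intro AE_I2) (auto simp: abs_mult intro!: mult_left_le)
    qed (use v'(1) v'i bm in \<open>auto intro!: borel_measurable_times\<close>)
    ultimately show ?thesis using LIMSEQ_unique by (metis (no_types, lifting) LIMSEQ_const_iff ext)
  qed
  have cbox0: "AE x in lebesgue. x \<in> cbox a b \<longrightarrow> v' x = 0" if ab: "cbox a b \<subseteq> S" for a b
  proof -
    let ?f = "\<lambda>x. v' x * indicator (box a b) x"
    have fi: "integrable lborel ?f"
      using integrable_mult_indicator[OF _ v'i, of "box a b"] by (simp add: mult.commute)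
    have "(\<integral>x\<in>A. ?f x \<partial>lborel) = 0" if "A \<in> sets lborel" for A
    proof -
      have A: "A \<in> sigma_sets UNIV (range (\<lambda>(a, b). box a b))"
        using that borel_eq_box by (metis sets_lborel sets_measure_of top_greatest Pow_UNIV)
      have G: "Int_stable (range (\<lambda>(a::'a, b). box a b))"
        by (auto simp: Int_stable_def box_Int_box)
      have "range (\<lambda>(a::'a, b). box a b) \<subseteq> Pow UNIV" by simp
      from G this A show ?thesis
      proof (induction rule: sigma_sets_induct_disjoint)
        case (basic B)
        then obtain c d where "B = box c d" by auto
        then obtain a' b' where e: "B \<inter> box a b = box a' b'" by (simp add: box_Int_box)
        \<comment> \<open>If the intersection is empty, \<open>cbox a' b'\<close> need not lie in
          \<open>S\<close>, so that \<open>box0\<close> cannot be used; but then the integrand is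
          zero.\<close>
        have "(\<integral>x. v' x * indicator (box a' b') x \<partial>lborel) = 0"
        proof (cases "box a' b' = {}")
          case False
          then have "cbox a' b' \<subseteq> cbox a b"
            by (metis closure_box closure_mono e inf_le2 box_subset_cbox closure_minimal closed_cbox subset_trans)
          then show ?thesis using box0 ab by blast
        qed simp
        moreover have "(\<integral>x\<in>B. ?f x \<partial>lborel) = (\<integral>x. v' x * indicator (box a' b') x \<partial>lborel)"
          unfolding set_lebesgue_integral_def e[symmetric]
          by (rule Bochner_Integration.integral_cong) (auto simp: indicator_def)
        ultimately show ?case by simp
      next
        case empty
        show ?case by (simp add: set_lebesgue_integral_def)
      next
        case (compl A)
        have A: "A \<in> sets lborel" using compl(1) borel_eq_box by (metis sets_lborel sets_measure_of top_greatest Pow_UNIV)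
        have si: "set_integrable lborel B ?f" if "B \<in> sets lborel" for B
          unfolding set_integrable_def by (rule integrable_mult_indicator[OF that fi])
        have "(\<integral>x\<in>A \<union> (UNIV - A). ?f x \<partial>lborel) = (\<integral>x\<in>A. ?f x \<partial>lborel) + (\<integral>x\<in>UNIV - A. ?f x \<partial>lborel)"
          using A by (intro set_integral_Un si) auto
        \<comment> \<open>The integral over the whole space is that over \<open>box a b\<close>,
          because \<open>?f\<close> vanishes outside.\<close>
        moreover have "(\<integral>x\<in>A \<union> (UNIV - A). ?f x \<partial>lborel) = 0"
          using box0[OF ab] by (simp add: set_lebesgue_integral_def)
        ultimately show ?case using compl(2) by simp
      next
        case (union A)
        have A: "A i \<in> sets lborel" for i
          using union(2) borel_eq_box by (metis sets_lborel sets_measure_of top_greatest Pow_UNIV range_subsetD)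
        have "(\<integral>x\<in>(\<Union>i. A i). ?f x \<partial>lborel) = (\<Sum>i. (\<integral>x\<in>A i. ?f x \<partial>lborel))"
        proof (rule lebesgue_integral_countable_add)
          show "set_integrable lborel (\<Union>i. A i) ?f"
            unfolding set_integrable_def using A by (intro integrable_mult_indicator fi) auto
        qed (use A union(1) in \<open>auto simp: disjoint_family_on_def\<close>)
        then show ?case using union(3) by simp
      qed
    qed
    then have "AE x in lborel. ?f x = 0"
      by (rule sigma_finite_measure.density_zero[OF sigma_finite_lborel fi])
    then have "AE x in lebesgue. ?f x = 0" by (rule AE_completion)
    moreover have "AE x in lebesgue. x \<notin> cbox a b - box a b"
      using negligible_frontier_interval[of a b] by (intro AE_not_in) (simp add: negligible_iff_null_sets)
    ultimately show ?thesis by eventually_elim (auto simp: indicator_def split: if_splits)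
  qed
  obtain \<D> where \<D>: "countable \<D>" "\<D> \<subseteq> Pow S" "\<And>X. X \<in> \<D> \<Longrightarrow> \<exists>a b. X = cbox a b" "\<Union>\<D> = S"
    using open_countable_Union_open_cbox[OF S] by metis
  have "AE x in lebesgue. \<forall>X\<in>\<D>. x \<in> X \<longrightarrow> v' x = 0"
    unfolding AE_ball_countable[OF \<D>(1)] using \<D>(2,3) cbox0 by blast
  with AE_completion[OF v'(2)] have "AE x in lebesgue. x \<in> S \<longrightarrow> w x = 0"
  proof eventually_elim
    case (elim x)
    then show ?case using \<D>(4) by (cases "x \<in> S") (auto simp: v_def)
  qed
  then show ?thesis by (simp add: AE_lebesgue_on_iff Sm(1))
qed

section \<open>Completeness of L2\<close>

lemma L2_norm_norm: "L2_norm M (\<lambda>x. norm (f x)) = L2_norm M f"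
  by (simp add: L2_norm_def L2_inner_def power2_norm_eq_inner[symmetric] power2_eq_square)

lemma L2_norm_L2: "f \<in> L2 M \<Longrightarrow> (\<lambda>x. norm (f x)) \<in> L2 M"
  by (auto simp: L2_def)

text \<open>The theorem of Riesz and Fischer. The increments of a rapidly converging subsequence are
  summable in L1, since the measure is finite, hence the subsequence converges almost everywhere;
  Fatou's lemma bounds the distance of the whole sequence to the limit.\<close>

lemma L2_complete:
  fixes y :: "nat \<Rightarrow> 'a \<Rightarrow> 'b::euclidean_space"
  assumes fin: "finite_measure M" and y: "\<And>n. y n \<in> L2 M"
    and cau: "\<And>e. e > 0 \<Longrightarrow> \<exists>N. \<forall>m\<ge>N. \<forall>n\<ge>N. L2_norm M (\<lambda>x. y m x - y n x) < e"
  obtains f where "f \<in> L2 M" "(\<lambda>n. L2_norm M (\<lambda>x. y n x - f x)) \<longlonglongrightarrow> 0"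
proof -
  have one: "(\<lambda>x. 1::real) \<in> L2 M" by (rule L2_measurable_finite[OF fin, where C=1]) auto
  have "\<forall>k. \<exists>N. \<forall>m\<ge>N. \<forall>n\<ge>N. L2_norm M (\<lambda>x. y m x - y n x) < (1/2) ^ k" by (intro allI cau) simp
  then obtain r0 where r0: "\<And>k m n. m \<ge> r0 k \<Longrightarrow> n \<ge> r0 k \<Longrightarrow> L2_norm M (\<lambda>x. y m x - y n x) < (1/2) ^ k"
    by metis
  \<comment> \<open>The maximum makes \<open>r l\<close> admissible for all thresholds
    \<open>r0 k\<close> with \<open>k \<le> l\<close>.\<close>
  define r where "r k = Max (r0 ` {..k})" for k
  have rr: "r0 k \<le> r l" if "k \<le> l" for k l unfolding r_def using that by (intro Max_ge) auto
  define z where "z k = y (r k)" for k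
  have zL: "z k \<in> L2 M" for k unfolding z_def by (rule y)
  have [measurable]: "z k \<in> borel_measurable M" for k using zL L2D(1) by blast
  have zy: "L2_norm M (\<lambda>x. z k x - y n x) \<le> (1/2) ^ j" if "k \<ge> j" "n \<ge> r0 j" for k n j
    using r0[OF rr[OF that(1)] that(2)] by (simp add: z_def)
  have zz: "L2_norm M (\<lambda>x. z (Suc k) x - z k x) \<le> (1/2) ^ k" for k
    using zy[of k "Suc k" "r k"] rr[of k k] by (simp add: z_def)
  define d where "d k x = norm (z (Suc k) x - z k x)" for k x
  have dL: "d k \<in> L2 M" for k unfolding d_def using L2_diff[OF zL zL] by (intro L2_norm_L2)
  have di: "integrable M (d k)" for k by (rule L2_imp_integrable[OF fin dL])
  have "(\<integral>x. d k x \<partial>M) \<le> (1/2) ^ k * L2_norm M (\<lambda>x. 1::real)" for k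
  proof -
    have "(\<integral>x. d k x \<partial>M) = L2_inner M (d k) (\<lambda>x. 1)" by (simp add: L2_inner_def)
    also have "\<dots> \<le> L2_norm M (d k) * L2_norm M (\<lambda>x. 1::real)" using L2_Cauchy_Schwarz[OF dL one] abs_le_D1 by blast
    also have "L2_norm M (d k) \<le> (1/2) ^ k" unfolding d_def L2_norm_norm by (rule zz)
    finally show ?thesis by (simp add: mult_right_mono L2_norm_nonneg)
  qed
  note dint = this
  have "(\<integral>\<^sup>+x. (\<Sum>k. ennreal (d k x)) \<partial>M) = (\<Sum>k. \<integral>\<^sup>+x. ennreal (d k x) \<partial>M)"
    by (rule nn_integral_suminf) (simp add: d_def)
  also have "\<dots> = (\<Sum>k. ennreal (\<integral>x. d k x \<partial>M))"
    by (intro suminf_cong nn_integral_eq_integral di) (simp add: d_def)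
  also have "\<dots> \<le> (\<Sum>k. ennreal ((1/2) ^ k * L2_norm M (\<lambda>x. 1::real)))"
    by (intro suminf_le ennreal_leI dint) auto
  also have "\<dots> = ennreal (\<Sum>k. (1/2) ^ k * L2_norm M (\<lambda>x. 1::real))"
    by (intro suminf_ennreal2 summable_mult2 summable_geometric) (auto simp: L2_norm_nonneg)
  finally have "(\<integral>\<^sup>+x. (\<Sum>k. ennreal (d k x)) \<partial>M) \<noteq> \<infinity>" by (auto simp: top_unique)
  then have "AE x in M. (\<Sum>k. ennreal (d k x)) \<noteq> \<infinity>"
    by (intro nn_integral_PInf_AE) (simp_all add: d_def)
  then have conv: "AE x in M. convergent (\<lambda>k. z k x)"
  proof eventually_elim
    case (elim x)
    have "summable (\<lambda>k. d k x)"
      by (rule summable_suminf_not_top) (use elim in \<open>auto simp: d_def\<close>)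
    then have "summable (\<lambda>k. z (Suc k) x - z k x)" unfolding d_def by (rule summable_norm_cancel)
    then obtain s where "(\<lambda>n. \<Sum>k<n. z (Suc k) x - z k x) \<longlonglongrightarrow> s" by (auto simp: summable_def sums_def)
    then have "(\<lambda>n. z n x - z 0 x) \<longlonglongrightarrow> s" by (simp only: sum_lessThan_telescope[of "\<lambda>k. z k x"])
    from tendsto_add[OF this tendsto_const[of "z 0 x"]] show ?case by (auto simp: convergent_def)
  qed
  define f where "f x = lim (\<lambda>k. z k x)" for x
  have fm[measurable]: "f \<in> borel_measurable M" unfolding f_def by (rule borel_measurable_lim_metric) simp
  have [measurable]: "y n \<in> borel_measurable M" for n using y L2D(1) by blast
  have est: "(\<lambda>x. y n x - f x) \<in> L2 M \<and> L2_norm M (\<lambda>x. y n x - f x) \<le> (1/2) ^ j" if n: "n \<ge> r0 j" for n j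
  proof -
    have "(\<integral>\<^sup>+x. ennreal ((norm (y n x - f x))\<^sup>2) \<partial>M) = (\<integral>\<^sup>+x. liminf (\<lambda>k. ennreal ((norm (z k x - y n x))\<^sup>2)) \<partial>M)"
      using conv
    proof (intro nn_integral_cong_AE, eventually_elim)
      case (elim x)
      then have "(\<lambda>k. z k x) \<longlonglongrightarrow> f x" by (simp add: f_def convergent_LIMSEQ_iff)
      then have "(\<lambda>k. ennreal ((norm (z k x - y n x))\<^sup>2)) \<longlonglongrightarrow> ennreal ((norm (f x - y n x))\<^sup>2)"
        by (intro tendsto_ennrealI tendsto_power tendsto_norm tendsto_diff tendsto_const)
      then have "liminf (\<lambda>k. ennreal ((norm (z k x - y n x))\<^sup>2)) = ennreal ((norm (f x - y n x))\<^sup>2)"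
        by (intro lim_imp_Liminf) auto
      then show ?case by (simp only: norm_minus_commute[of "y n x"])
    qed
    also have "\<dots> \<le> liminf (\<lambda>k. \<integral>\<^sup>+x. ennreal ((norm (z k x - y n x))\<^sup>2) \<partial>M)"
      by (rule nn_integral_liminf) simp
    also have "\<dots> \<le> ennreal (((1/2) ^ j)\<^sup>2)"
    proof (rule Liminf_le)
      show "\<forall>\<^sub>F k in sequentially. (\<integral>\<^sup>+x. ennreal ((norm (z k x - y n x))\<^sup>2) \<partial>M) \<le> ennreal (((1/2) ^ j)\<^sup>2)"
        using eventually_ge_at_top[of j]
      proof eventually_elim
        case (elim k)
        show ?case unfolding nn_integral_L2_norm[OF L2_diff[OF zL y]]
          using zy[OF elim n] by (intro ennreal_leI power_mono L2_norm_nonneg)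
      qed
    qed simp
    finally have b: "(\<integral>\<^sup>+x. ennreal ((norm (y n x - f x))\<^sup>2) \<partial>M) \<le> ennreal (((1/2) ^ j)\<^sup>2)" .
    have L: "(\<lambda>x. y n x - f x) \<in> L2 M"
      unfolding L2_def mem_Collect_eq
      by (intro conjI integrableI_bounded) (use b in \<open>auto simp: le_less_trans\<close>)
    have "(L2_norm M (\<lambda>x. y n x - f x))\<^sup>2 \<le> ((1/2) ^ j)\<^sup>2"
      using b unfolding nn_integral_L2_norm[OF L] by (simp add: ennreal_le_iff)
    then have "L2_norm M (\<lambda>x. y n x - f x) \<le> (1/2) ^ j"
      by (rule power2_le_imp_le) simp
    with L show ?thesis by simp
  qed
  have "f \<in> L2 M"
    using L2_diff[OF y conjunct1[OF est[of 0 "r0 0"]], of "r0 0"] by simp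
  moreover have "(\<lambda>n. L2_norm M (\<lambda>x. y n x - f x)) \<longlonglongrightarrow> 0"
  proof (rule LIMSEQ_I)
    fix e :: real assume "e > 0"
    then obtain j where "(1/2) ^ j < e" using real_arch_pow_inv[of e "1/2"] by auto
    then show "\<exists>no. \<forall>n\<ge>no. norm (L2_norm M (\<lambda>x. y n x - f x) - 0) < e"
      using est[of j] by (intro exI[of _ "r0 j"]) (force simp: abs_of_nonneg[OF L2_norm_nonneg])
  qed
  ultimately show ?thesis by (rule that)
qed

section \<open>Integration by parts for test functions\<close>

text \<open>Difference quotients in the direction \<open>b\<close> have integral zero because the
  Lebesgue measure is invariant under translations; they converge to the partial derivative under an
  integrable bound.\<close>

lemma integral_partial_derivative_eq_0:
  fixes \<psi> :: "'a::euclidean_space \<Rightarrow> real"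
  assumes D: "\<And>x. (\<psi> has_derivative D x) (at x)" and b: "b \<in> Basis"
    and cont: "continuous_on UNIV (\<lambda>x. D x b)"
    and K: "compact K" "\<And>x. x \<notin> K \<Longrightarrow> \<psi> x = 0" "\<And>x. x \<notin> K \<Longrightarrow> D x b = 0"
  shows "(\<integral>x. D x b \<partial>lborel) = 0"
proof -
  have nb: "norm b = 1" using b by simp
  have cont\<psi>: "continuous_on UNIV \<psi>"
    using D by (meson continuous_at_imp_continuous_on has_derivative_continuous)
  have [measurable]: "\<psi> \<in> borel_measurable borel" "(\<lambda>x. D x b) \<in> borel_measurable borel"
    using cont cont\<psi> by (auto intro: borel_measurable_continuous_onI)
  obtain B where B: "B > 0" "\<And>x. \<bar>D x b\<bar> \<le> B"
    by (rule continuous_zero_outside_compact_bounded[OF K(1) continuous_on_subset[OF cont] K(3)]) auto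
  obtain C where C: "C > 0" "\<And>x. \<bar>\<psi> x\<bar> \<le> C"
    by (rule continuous_zero_outside_compact_bounded[OF K(1) continuous_on_subset[OF cont\<psi>] K(2)]) auto
  obtain R where R: "\<And>x. x \<in> K \<Longrightarrow> norm x \<le> R" using compact_imp_bounded[OF K(1)] bounded_iff by metis
  define h where "h n = 1 / real (Suc n)" for n
  have h: "h n > 0" "h n \<le> 1" for n by (auto simp: h_def)
  define s where "s n x = (\<psi> (x + h n *\<^sub>R b) - \<psi> x) / h n" for n x
  have \<psi>i: "integrable lborel \<psi>"
  proof (rule Bochner_Integration.integrable_bound)
    show "integrable lborel (\<lambda>x. C * indicator (cball 0 R) x :: real)"
      by (intro integrable_mult_right integrable_real_indicator) (use emeasure_lborel_cball_finite in \<open>auto simp: less_top\<close>)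
    show "AE x in lborel. norm (\<psi> x) \<le> norm (C * indicator (cball 0 R) x)"
      using C K(2) R by (intro AE_I2) (auto simp: indicator_def abs_of_pos)
  qed simp
  have s0: "(\<integral>x. s n x \<partial>lborel) = 0" for n
  proof -
    have "integrable (distr lborel borel ((+) (h n *\<^sub>R b))) \<psi>" using \<psi>i by (simp add: lborel_distr_plus)
    then have i: "integrable lborel (\<lambda>x. \<psi> (h n *\<^sub>R b + x))" by (simp add: integrable_distr_eq)
    have "(\<integral>x. \<psi> (h n *\<^sub>R b + x) \<partial>lborel) = (\<integral>x. \<psi> x \<partial>distr lborel borel ((+) (h n *\<^sub>R b)))"
      by (simp add: integral_distr)
    also have "\<dots> = (\<integral>x. \<psi> x \<partial>lborel)" by (simp add: lborel_distr_plus)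
    finally show ?thesis using i \<psi>i by (simp add: s_def add.commute)
  qed
  \<comment> \<open>The shifts have length at most 1, so all quotients vanish outside the ball of
    radius \<open>R + 1\<close>; on it the mean value theorem bounds them by
    \<open>B\<close>.\<close>
  have "(\<lambda>n. \<integral>x. s n x \<partial>lborel) \<longlonglongrightarrow> (\<integral>x. D x b \<partial>lborel)"
  proof (rule integral_dominated_convergence[where w="\<lambda>x. B * indicator (cball 0 (R + 1)) x"])
    show "integrable lborel (\<lambda>x. B * indicator (cball 0 (R + 1)) x :: real)"
      by (intro integrable_mult_right integrable_real_indicator) (use emeasure_lborel_cball_finite in \<open>auto simp: less_top\<close>)
    show "AE x in lborel. (\<lambda>n. s n x) \<longlonglongrightarrow> D x b"
    proof (intro AE_I2)
      fix x
      have "((\<lambda>t. x + t *\<^sub>R b) has_derivative (\<lambda>t. t *\<^sub>R b)) (at 0)"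
        by (auto intro!: derivative_eq_intros)
      from has_derivative_compose[OF this, of \<psi> "D x"]
      have "((\<lambda>t. \<psi> (x + t *\<^sub>R b)) has_derivative (\<lambda>t. D x (t *\<^sub>R b))) (at 0)" using D by simp
      moreover have "D x (t *\<^sub>R b) = D x b * t" for t
        using linear_cmul[OF has_derivative_linear[OF D]] by simp
      ultimately have "((\<lambda>t. \<psi> (x + t *\<^sub>R b)) has_real_derivative D x b) (at 0)"
        by (simp add: has_field_derivative_def)
      then have "((\<lambda>t. (\<psi> (x + t *\<^sub>R b) - \<psi> x) / t) \<longlongrightarrow> D x b) (at 0)" by (simp add: DERIV_def)
      moreover have "filterlim h (at 0) sequentially"
        unfolding filterlim_at h_def using LIMSEQ_Suc[OF lim_1_over_n] by auto
      ultimately show "(\<lambda>n. s n x) \<longlonglongrightarrow> D x b" unfolding s_def by (rule filterlim_compose)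
    qed
    show "AE x in lborel. norm (s n x) \<le> B * indicator (cball 0 (R + 1)) x" for n
    proof (intro AE_I2)
      fix x
      have dt: "((\<lambda>t. \<psi> (x + t *\<^sub>R b)) has_real_derivative D (x + t *\<^sub>R b) b) (at t)" for t
      proof -
        have "((\<lambda>t. x + t *\<^sub>R b) has_derivative (\<lambda>t. t *\<^sub>R b)) (at t)"
          by (auto intro!: derivative_eq_intros)
        from has_derivative_compose[OF this D]
        have "((\<lambda>t. \<psi> (x + t *\<^sub>R b)) has_derivative (\<lambda>s. D (x + t *\<^sub>R b) (s *\<^sub>R b))) (at t)" .
        moreover have "D y (s *\<^sub>R b) = D y b * s" for s y
          using linear_cmul[OF has_derivative_linear[OF D]] by simp
        ultimately show ?thesis by (simp add: has_field_derivative_def)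
      qed
      obtain t where t: "0 < t" "t < h n" "\<psi> (x + h n *\<^sub>R b) - \<psi> (x + 0 *\<^sub>R b) = (h n - 0) * D (x + t *\<^sub>R b) b"
        using MVT2[OF h(1)[of n], of "\<lambda>t. \<psi> (x + t *\<^sub>R b)" "\<lambda>t. D (x + t *\<^sub>R b) b"] dt by blast
      then have st: "s n x = D (x + t *\<^sub>R b) b" using h(1)[of n] by (simp add: s_def)
      show "norm (s n x) \<le> B * indicator (cball 0 (R + 1)) x"
      proof (cases "x \<in> cball 0 (R + 1)")
        case False
        have "norm x \<le> norm (x + t *\<^sub>R b) + norm (t *\<^sub>R b)"
          using norm_triangle_ineq4[of "x + t *\<^sub>R b" "t *\<^sub>R b"] by simp
        then have "norm (x + t *\<^sub>R b) > R" using False t h(2)[of n] nb by (auto simp: norm_scaleR)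
        then have "x + t *\<^sub>R b \<notin> K" using R by force
        then show ?thesis using st K(3) False by simp
      qed (use B(2) st in simp)
    qed
  qed (simp_all add: s_def)
  then show ?thesis using s0 by (simp add: LIMSEQ_const_iff)
qed

text \<open>The derivative of the product has integral zero. This makes the test functions members
  of \<open>H1\<close>, on which the density argument for functions in \<open>H10\<close>
  relies.\<close>

lemma test_fun_integral_by_parts:
  fixes \<psi> \<eta> :: "'a::euclidean_space \<Rightarrow> real"
  assumes S: "open S" and \<psi>: "\<psi> \<in> test_fun S" and \<eta>: "\<eta> \<in> test_fun S" and b: "b \<in> Basis"
  shows "(\<integral>x. \<eta> x * frechet_derivative \<psi> (at x) b \<partial>lebesgue_on S)
       = - (\<integral>x. frechet_derivative \<eta> (at x) b * \<psi> x \<partial>lebesgue_on S)"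
proof -
  let ?d\<psi> = "\<lambda>x. frechet_derivative \<psi> (at x) b" and ?d\<eta> = "\<lambda>x. frechet_derivative \<eta> (at x) b"
  have Sm: "S \<inter> space lebesgue \<in> sets lebesgue" using S by auto
  obtain K where K: "compact K" "\<And>x. x \<notin> K \<Longrightarrow> \<psi> x = 0" "\<And>x. x \<notin> K \<Longrightarrow> ?d\<psi> x = 0"
    using test_fun_support[OF \<psi>] by metis
  have ci: "integrable lborel f" if f: "continuous_on UNIV f" "\<And>x. x \<notin> K \<Longrightarrow> f x = 0" for f :: "'a \<Rightarrow> real"
  proof -
    have "integrable lborel (\<lambda>x. indicator K x *\<^sub>R f x)"
      using borel_integrable_compact[OF K(1), of f] continuous_on_subset[OF f(1)] by simp
    moreover have "(\<lambda>x. indicator K x *\<^sub>R f x) = f" using f(2) by (auto simp: fun_eq_iff indicator_def)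
    ultimately show ?thesis by simp
  qed
  have e: "(\<integral>x. f x \<partial>lebesgue_on S) = (\<integral>x. f x \<partial>lborel)"
    if "continuous_on UNIV f" "\<And>x. x \<notin> S \<Longrightarrow> f x = 0" for f :: "'a \<Rightarrow> real"
  proof -
    have "(\<integral>x. f x \<partial>lebesgue_on S) = (\<integral>x. indicator S x *\<^sub>R f x \<partial>lebesgue)" by (rule integral_restrict_space[OF Sm])
    also have "(\<lambda>x. indicator S x *\<^sub>R f x) = f" using that(2) by (auto simp: fun_eq_iff indicator_def)
    also have "(\<integral>x. f x \<partial>lebesgue) = (\<integral>x. f x \<partial>lborel)"
      by (rule integral_completion) (use that(1) in \<open>simp add: borel_measurable_continuous_onI\<close>)
    finally show ?thesis .
  qed
  have c: "continuous_on UNIV (\<lambda>x. \<eta> x * ?d\<psi> x)" "continuous_on UNIV (\<lambda>x. ?d\<eta> x * \<psi> x)"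
    by (intro continuous_on_mult test_fun_continuous[OF \<psi>] test_fun_continuous[OF \<eta>]
        test_fun_partial_continuous[OF \<psi> b] test_fun_partial_continuous[OF \<eta> b])+
  have "(\<integral>x. \<eta> x * ?d\<psi> x + ?d\<eta> x * \<psi> x \<partial>lborel) = 0"
  proof (rule integral_partial_derivative_eq_0[where D="\<lambda>x h. \<eta> x * frechet_derivative \<psi> (at x) h + frechet_derivative \<eta> (at x) h * \<psi> x", OF _ b _ K(1)])
    show "((\<lambda>x. \<eta> x * \<psi> x) has_derivative (\<lambda>h. \<eta> x * frechet_derivative \<psi> (at x) h + frechet_derivative \<eta> (at x) h * \<psi> x)) (at x)" for x
      by (rule has_derivative_mult[OF test_fun_has_derivative[OF \<eta>] test_fun_has_derivative[OF \<psi>]])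
  qed (use K c in \<open>auto intro: continuous_on_add\<close>)
  then have "(\<integral>x. \<eta> x * ?d\<psi> x \<partial>lborel) = - (\<integral>x. ?d\<eta> x * \<psi> x \<partial>lborel)"
    using ci[OF c(1)] ci[OF c(2)] K by (simp add: eq_neg_iff_add_eq_0)
  then show ?thesis
    using e[OF c(1)] e[OF c(2)] test_fun_outside[OF \<psi>] test_fun_outside[OF \<eta>] by simp
qed

section \<open>Seminormed spaces of functions\<close>

text \<open>Elements are functions and not classes, so \<open>N\<close> is a seminorm that may
  vanish on functions other than zero. The instances are L2, \<open>H1\<close>, \<open>H1v\<close>
  and \<open>H1_perp\<close>; approximation in Bochner spaces, midpoints and the chain rule are
  developed on this common ground.\<close>

locale seminormed_functions =
  fixes X :: "('a \<Rightarrow> 'b::real_vector) set" and N :: "('a \<Rightarrow> 'b) \<Rightarrow> real"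
  assumes zero_mem: "(\<lambda>x. 0) \<in> X"
    and add_mem: "v \<in> X \<Longrightarrow> w \<in> X \<Longrightarrow> (\<lambda>x. v x + w x) \<in> X"
    and scale_mem: "v \<in> X \<Longrightarrow> (\<lambda>x. a *\<^sub>R v x) \<in> X"
    and triangle: "v \<in> X \<Longrightarrow> w \<in> X \<Longrightarrow> N (\<lambda>x. v x + w x) \<le> N v + N w"
    and homogeneous: "v \<in> X \<Longrightarrow> N (\<lambda>x. a *\<^sub>R v x) = \<bar>a\<bar> * N v"
begin

lemma zero: "N (\<lambda>x. 0) = 0"
  using homogeneous[OF zero_mem, of 0] by simp

lemma diff_mem: "v \<in> X \<Longrightarrow> w \<in> X \<Longrightarrow> (\<lambda>x. v x - w x) \<in> X"
  using add_mem[OF _ scale_mem[of w "-1"]] by simp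

lemma minus_commute: "v \<in> X \<Longrightarrow> w \<in> X \<Longrightarrow> N (\<lambda>x. v x - w x) = N (\<lambda>x. w x - v x)"
  using homogeneous[OF diff_mem[of v w], of "-1"] by simp

text \<open>The seminorm of \<open>v - v\<close> is 0 and at most twice that of
  \<open>v\<close>.\<close>

lemma nonneg: "v \<in> X \<Longrightarrow> N v \<ge> 0"
  using triangle[of v "\<lambda>x. (-1) *\<^sub>R v x"] homogeneous[of v "-1"] scale_mem[of v "-1"] zero by simp

lemma triangle_diff:
  "u \<in> X \<Longrightarrow> v \<in> X \<Longrightarrow> w \<in> X \<Longrightarrow> N (\<lambda>x. u x - w x) \<le> N (\<lambda>x. u x - v x) + N (\<lambda>x. v x - w x)"
  using triangle[OF diff_mem[of u v] diff_mem[of v w]] by simp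

lemma triangle_le_diff: "v \<in> X \<Longrightarrow> w \<in> X \<Longrightarrow> N (\<lambda>x. v x - w x) \<le> N v + N w"
  using triangle_diff[of v "\<lambda>x. 0" w] zero_mem minus_commute[of "\<lambda>x. 0" w] by simp

lemma reverse_triangle: "v \<in> X \<Longrightarrow> w \<in> X \<Longrightarrow> \<bar>N v - N w\<bar> \<le> N (\<lambda>x. v x - w x)"
  using triangle_diff[of v w "\<lambda>x. 0"] triangle_diff[of w v "\<lambda>x. 0"] zero_mem minus_commute[of v w]
  by (simp add: abs_le_iff)

lemma sum_mem:
  "finite I \<Longrightarrow> (\<And>i. i \<in> I \<Longrightarrow> v i \<in> X) \<Longrightarrow> (\<lambda>x. \<Sum>i\<in>I. c i *\<^sub>R v i x) \<in> X"
proof (induction I rule: finite_induct)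
  case (insert i I)
  then show ?case using add_mem[OF scale_mem[of "v i" "c i"], of "\<lambda>x. \<Sum>i\<in>I. c i *\<^sub>R v i x"] by simp
qed (simp add: zero_mem)

lemma norm_sum:
  "finite I \<Longrightarrow> (\<And>i. i \<in> I \<Longrightarrow> v i \<in> X) \<Longrightarrow> N (\<lambda>x. \<Sum>i\<in>I. c i *\<^sub>R v i x) \<le> (\<Sum>i\<in>I. \<bar>c i\<bar> * N (v i))"
proof (induction I rule: finite_induct)
  case (insert i I)
  have "N (\<lambda>x. c i *\<^sub>R v i x + (\<Sum>i\<in>I. c i *\<^sub>R v i x)) \<le> N (\<lambda>x. c i *\<^sub>R v i x) + N (\<lambda>x. \<Sum>i\<in>I. c i *\<^sub>R v i x)"
    using insert by (intro triangle scale_mem sum_mem) auto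
  then show ?case using insert homogeneous[of "v i" "c i"] by force
qed (simp add: zero)

lemma norm_tendsto:
  assumes "\<And>n. v n \<in> X" "w \<in> X" "(\<lambda>n. N (\<lambda>x. v n x - w x)) \<longlonglongrightarrow> 0"
  shows "(\<lambda>n. N (v n)) \<longlonglongrightarrow> N w"
proof -
  have "(\<lambda>n. N (v n) - N w) \<longlonglongrightarrow> 0"
    by (rule Lim_null_comparison[OF always_eventually assms(3)]) (use reverse_triangle assms in auto)
  then show ?thesis by (simp add: LIM_zero_iff)
qed

end

lemma seminormed_functions_L2: "seminormed_functions (L2 M) (L2_norm M)"
  by unfold_locales (auto intro: L2_zero L2_add L2_scaleR L2_norm_triangle L2_norm_scaleR)

section \<open>Sobolev spaces on a bounded open set\<close>

lemma axis_1_Basis: "axis i (1::real) \<in> Basis"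
  by (simp add: axis_in_Basis_iff)

locale bounded_open_set =
  fixes \<Omega> :: "(real^'d) set"
  assumes open_\<Omega>: "open \<Omega>" and bounded_\<Omega>: "bounded \<Omega>"
begin

abbreviation "M \<equiv> lebesgue_on \<Omega>"

lemma finite_M: "finite_measure M"
  using open_\<Omega> bounded_\<Omega> by (intro finite_measure_lebesgue_on) (simp add: lmeasurable_open)

lemma continuous_L2:
  fixes f :: "real^'d \<Rightarrow> 'b::euclidean_space"
  assumes "continuous_on UNIV f"
  shows "f \<in> L2 M"
proof -
  have "compact (f ` closure \<Omega>)"
    using bounded_\<Omega> by (intro compact_continuous_image continuous_on_subset[OF assms]) (auto simp: compact_closure)
  then obtain C where C: "\<And>x. x \<in> closure \<Omega> \<Longrightarrow> norm (f x) \<le> C" using compact_imp_bounded bounded_iff by (metis imageI)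
  show ?thesis
    by (rule L2_measurable_finite[OF finite_M continuous_on_measurable_lebesgue_on[OF assms], where C=C])
       (use C closure_subset in \<open>auto simp: space_restrict_space\<close>)
qed

lemma test_fun_L2: "\<psi> \<in> test_fun \<Omega> \<Longrightarrow> \<psi> \<in> L2 M"
  by (intro continuous_L2 test_fun_continuous)

lemma test_fun_partial_L2: "\<psi> \<in> test_fun \<Omega> \<Longrightarrow> (\<lambda>x. frechet_derivative \<psi> (at x) (axis i 1)) \<in> L2 M"
  by (intro continuous_L2 test_fun_partial_continuous axis_1_Basis)

lemma component_L2: "w \<in> L2 M \<Longrightarrow> (\<lambda>x. w x $ i) \<in> L2 M" for w :: "real^'d \<Rightarrow> real^'e"
  using L2_linear_image[of "\<lambda>x. x $ i"] by (simp add: bounded_linear.linear[OF bounded_linear_vec_nth])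

lemma is_weak_gradient_iff:
  "is_weak_gradient \<Omega> v w \<longleftrightarrow>
     (\<forall>\<psi>\<in>test_fun \<Omega>. \<forall>i. L2_inner M v (\<lambda>x. frechet_derivative \<psi> (at x) (axis i 1)) = - L2_inner M (\<lambda>x. w x $ i) \<psi>)"
  by (simp add: is_weak_gradient_def L2_inner_def)

text \<open>\<open>grad\<close> is a choice among weak gradients; uniqueness is what makes it
  additive and homogeneous, up to null sets.\<close>

lemma weak_gradient_unique:
  assumes w: "w \<in> L2 M" "is_weak_gradient \<Omega> v w" and w': "w' \<in> L2 M" "is_weak_gradient \<Omega> v w'"
  shows "AE x in M. w x = w' x"
proof -
  have "AE x in M. w x $ i - w' x $ i = 0" for i
  proof (rule fundamental_lemma_of_calculus_of_variations[OF open_\<Omega>])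
    have d: "(\<lambda>x. w x $ i - w' x $ i) \<in> L2 M" using w w' by (intro L2_diff component_L2)
    then show "integrable M (\<lambda>x. w x $ i - w' x $ i)" by (rule L2_imp_integrable[OF finite_M])
    fix \<psi> assume \<psi>: "\<psi> \<in> test_fun \<Omega>"
    have "L2_inner M (\<lambda>x. w x $ i - w' x $ i) \<psi> = L2_inner M (\<lambda>x. w x $ i) \<psi> - L2_inner M (\<lambda>x. w' x $ i) \<psi>"
      using w w' \<psi> by (intro L2_inner_diff_left component_L2 test_fun_L2)
    also have "\<dots> = 0" using w(2) w'(2) \<psi> unfolding is_weak_gradient_iff by simp
    finally show "(\<integral>x. (w x $ i - w' x $ i) * \<psi> x \<partial>M) = 0" by (simp add: L2_inner_def)
  qed
  then have "AE x in M. \<forall>i\<in>UNIV. w x $ i - w' x $ i = 0" by (subst AE_finite_all) auto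
  then show ?thesis by eventually_elim (auto simp: vec_eq_iff)
qed

lemma H1_L2: "v \<in> H1 \<Omega> \<Longrightarrow> v \<in> L2 M"
  by (simp add: H1_def)

lemma grad:
  assumes "v \<in> H1 \<Omega>"
  shows "grad \<Omega> v \<in> L2 M" "is_weak_gradient \<Omega> v (grad \<Omega> v)"
proof -
  have "\<exists>w. w \<in> L2 M \<and> is_weak_gradient \<Omega> v w" using assms by (auto simp: H1_def)
  then have "grad \<Omega> v \<in> L2 M \<and> is_weak_gradient \<Omega> v (grad \<Omega> v)" unfolding grad_def by (rule someI_ex)
  then show "grad \<Omega> v \<in> L2 M" "is_weak_gradient \<Omega> v (grad \<Omega> v)" by auto
qed

lemma H1I:
  assumes "v \<in> L2 M" "w \<in> L2 M" "is_weak_gradient \<Omega> v w"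
  shows "v \<in> H1 \<Omega>" "AE x in M. grad \<Omega> v x = w x"
proof -
  show "v \<in> H1 \<Omega>" using assms by (auto simp: H1_def)
  then show "AE x in M. grad \<Omega> v x = w x" using grad weak_gradient_unique assms by blast
qed

lemma is_weak_gradient_add:
  assumes "v \<in> L2 M" "v' \<in> L2 M" "w \<in> L2 M" "w' \<in> L2 M" "is_weak_gradient \<Omega> v w" "is_weak_gradient \<Omega> v' w'"
  shows "is_weak_gradient \<Omega> (\<lambda>x. v x + v' x) (\<lambda>x. w x + w' x)"
  using assms unfolding is_weak_gradient_iff
  by (simp add: L2_inner_add_left test_fun_partial_L2 test_fun_L2 component_L2)

lemma is_weak_gradient_scale:
  assumes "is_weak_gradient \<Omega> v w"
  shows "is_weak_gradient \<Omega> (\<lambda>x. a * v x) (\<lambda>x. a *\<^sub>R w x)"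
  using assms unfolding is_weak_gradient_iff by (simp add: L2_inner_mult_left)

lemma H1_add:
  assumes "v \<in> H1 \<Omega>" "v' \<in> H1 \<Omega>"
  shows "(\<lambda>x. v x + v' x) \<in> H1 \<Omega>" "AE x in M. grad \<Omega> (\<lambda>x. v x + v' x) x = grad \<Omega> v x + grad \<Omega> v' x"
  using H1I[OF L2_add[OF H1_L2[OF assms(1)] H1_L2[OF assms(2)]] L2_add[OF grad(1)[OF assms(1)] grad(1)[OF assms(2)]]
      is_weak_gradient_add[OF H1_L2[OF assms(1)] H1_L2[OF assms(2)] grad(1)[OF assms(1)] grad(1)[OF assms(2)]
        grad(2)[OF assms(1)] grad(2)[OF assms(2)]]] by auto

lemma H1_scale:
  assumes "v \<in> H1 \<Omega>"
  shows "(\<lambda>x. a * v x) \<in> H1 \<Omega>" "AE x in M. grad \<Omega> (\<lambda>x. a * v x) x = a *\<^sub>R grad \<Omega> v x"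
  using H1I[OF L2_mult[OF H1_L2[OF assms]] L2_scaleR[OF grad(1)[OF assms]] is_weak_gradient_scale[OF grad(2)[OF assms]]]
  by auto

lemma is_weak_gradient_cong_AE:
  assumes "v \<in> borel_measurable M" "v' \<in> borel_measurable M" "AE x in M. v x = v' x"
  shows "is_weak_gradient \<Omega> v = is_weak_gradient \<Omega> v'"
proof -
  have "L2_inner M v (\<lambda>x. frechet_derivative \<psi> (at x) (axis i 1)) = L2_inner M v' (\<lambda>x. frechet_derivative \<psi> (at x) (axis i 1))"
    if "\<psi> \<in> test_fun \<Omega>" for \<psi> i
    using assms L2D(1)[OF test_fun_partial_L2[OF that]] by (intro L2_inner_cong_AE) auto
  then show ?thesis by (auto simp: is_weak_gradient_iff fun_eq_iff)
qed

text \<open>Equality holds at every point, because \<open>SOME\<close> is applied to the same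
  predicate for both functions.\<close>

lemma grad_cong_AE:
  assumes "v \<in> borel_measurable M" "v' \<in> borel_measurable M" "AE x in M. v x = v' x"
  shows "grad \<Omega> v = grad \<Omega> v'"
  unfolding grad_def is_weak_gradient_cong_AE[OF assms] ..

lemma H1_cong_AE:
  assumes "v \<in> H1 \<Omega>" "v' \<in> L2 M" "AE x in M. v x = v' x"
  shows "v' \<in> H1 \<Omega>"
  using is_weak_gradient_cong_AE[OF L2D(1)[OF H1_L2[OF assms(1)]] L2D(1)[OF assms(2)] assms(3)] assms
  by (auto simp: H1_def)

text \<open>The identity that defines weak gradients involves a fixed test function, so both of its
  sides pass to the limit in L2. With the completeness of L2 this yields limits in
  \<open>H1\<close>.\<close>

lemma H1_closed:
  assumes v: "\<And>n. v n \<in> H1 \<Omega>" "v' \<in> L2 M" "w \<in> L2 M"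
    and lim: "(\<lambda>n. L2_norm M (\<lambda>x. v n x - v' x)) \<longlonglongrightarrow> 0" "(\<lambda>n. L2_norm M (\<lambda>x. grad \<Omega> (v n) x - w x)) \<longlonglongrightarrow> 0"
  shows "v' \<in> H1 \<Omega>" "AE x in M. grad \<Omega> v' x = w x"
proof -
  have "is_weak_gradient \<Omega> v' w"
    unfolding is_weak_gradient_iff
  proof (intro ballI allI)
    fix \<psi> i assume \<psi>: "\<psi> \<in> test_fun \<Omega>"
    let ?d = "\<lambda>x. frechet_derivative \<psi> (at x) (axis i 1)"
    have 1: "(\<lambda>n. L2_inner M (v n) ?d) \<longlonglongrightarrow> L2_inner M v' ?d"
      by (intro L2_inner_tendsto lim test_fun_partial_L2 \<psi> H1_L2 v)
    have li: "linear (\<lambda>x::real^'d. x $ i)" by (simp add: bounded_linear.linear[OF bounded_linear_vec_nth])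
    have "(\<lambda>n. onorm (\<lambda>x::real^'d. x $ i) * L2_norm M (\<lambda>x. grad \<Omega> (v n) x - w x)) \<longlonglongrightarrow> 0"
      using tendsto_mult[OF tendsto_const lim(2)] by simp
    then have "(\<lambda>n. L2_norm M (\<lambda>x. grad \<Omega> (v n) x $ i - w x $ i)) \<longlonglongrightarrow> 0"
      by (rule Lim_null_comparison[OF always_eventually, rotated])
         (use L2_norm_linear_image_diff[OF li grad(1)[OF v(1)] v(3)] in \<open>simp add: L2_norm_nonneg\<close>)
    then have "(\<lambda>n. L2_inner M (\<lambda>x. grad \<Omega> (v n) x $ i) \<psi>) \<longlonglongrightarrow> L2_inner M (\<lambda>x. w x $ i) \<psi>"
      using v by (intro L2_inner_tendsto component_L2 grad test_fun_L2 \<psi>)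
    moreover have "L2_inner M (v n) ?d = - L2_inner M (\<lambda>x. grad \<Omega> (v n) x $ i) \<psi>" for n
      using grad(2)[OF v(1)] \<psi> unfolding is_weak_gradient_iff by blast
    ultimately have "(\<lambda>n. L2_inner M (v n) ?d) \<longlonglongrightarrow> - L2_inner M (\<lambda>x. w x $ i) \<psi>"
      by (simp add: tendsto_minus)
    with 1 show "L2_inner M v' ?d = - L2_inner M (\<lambda>x. w x $ i) \<psi>" by (rule LIMSEQ_unique)
  qed
  then show "v' \<in> H1 \<Omega>" "AE x in M. grad \<Omega> v' x = w x" using H1I v by auto
qed

lemma grad_measurable: "v \<in> H1 \<Omega> \<Longrightarrow> grad \<Omega> v \<in> borel_measurable M"
  using grad(1) L2D(1) by blast

lemma L2_norm_grad_diff: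
  assumes "v \<in> H1 \<Omega>" "v' \<in> H1 \<Omega>"
  shows "L2_norm M (\<lambda>x. grad \<Omega> v x - grad \<Omega> v' x) = L2_norm M (grad \<Omega> (\<lambda>x. v x - v' x))"
proof (rule L2_norm_cong_AE)
  have e: "(\<lambda>x. v x - v' x) = (\<lambda>x. v x + (-1) * v' x)" by auto
  show "AE x in M. grad \<Omega> v x - grad \<Omega> v' x = grad \<Omega> (\<lambda>x. v x - v' x) x"
    unfolding e using H1_add(2)[OF assms(1) H1_scale(1)[OF assms(2), of "-1"]] H1_scale(2)[OF assms(2), of "-1"]
    by eventually_elim simp
  show "grad \<Omega> (\<lambda>x. v x - v' x) \<in> borel_measurable M"
    unfolding e by (intro grad_measurable H1_add H1_scale assms)
qed (use assms in \<open>auto intro: grad_measurable borel_measurable_diff\<close>)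

lemma seminormed_H1: "seminormed_functions (H1 \<Omega>) (H1_norm \<Omega>)"
proof
  have z: "(\<lambda>x. 0) = (\<lambda>x. 0 * v x)" for v :: "real^'d \<Rightarrow> real" by simp
  show "(\<lambda>x. 0) \<in> H1 \<Omega>"
    by (rule H1I(1)[OF L2_zero L2_zero]) (simp add: is_weak_gradient_def)
next
  fix v w :: "real^'d \<Rightarrow> real" and a :: real
  assume v: "v \<in> H1 \<Omega>"
  show "(\<lambda>x. a *\<^sub>R v x) \<in> H1 \<Omega>" using H1_scale(1)[OF v] by simp
  have "L2_norm M (grad \<Omega> (\<lambda>x. a * v x)) = L2_norm M (\<lambda>x. a *\<^sub>R grad \<Omega> v x)"
    using H1_scale[OF v] by (intro L2_norm_cong_AE grad_measurable) (auto intro!: borel_measurable_scaleR grad_measurable v)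
  then have "H1_norm \<Omega> (\<lambda>x. a *\<^sub>R v x) = sqrt (a\<^sup>2 * ((L2_norm M v)\<^sup>2 + (L2_norm M (grad \<Omega> v))\<^sup>2))"
    using L2_norm_scaleR[of M a v] by (simp add: H1_norm_def L2_norm_scaleR power_mult_distrib distrib_left)
  then show "H1_norm \<Omega> (\<lambda>x. a *\<^sub>R v x) = \<bar>a\<bar> * H1_norm \<Omega> v"
    by (simp add: H1_norm_def real_sqrt_mult)
  assume w: "w \<in> H1 \<Omega>"
  show "(\<lambda>x. v x + w x) \<in> H1 \<Omega>" by (rule H1_add(1)[OF v w])
  have "L2_norm M (grad \<Omega> (\<lambda>x. v x + w x)) = L2_norm M (\<lambda>x. grad \<Omega> v x + grad \<Omega> w x)"
    using H1_add[OF v w] by (intro L2_norm_cong_AE grad_measurable) (auto intro!: borel_measurable_add grad_measurable v w)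
  also have "\<dots> \<le> L2_norm M (grad \<Omega> v) + L2_norm M (grad \<Omega> w)" by (intro L2_norm_triangle grad v w)
  finally have "H1_norm \<Omega> (\<lambda>x. v x + w x)
      \<le> sqrt ((L2_norm M v + L2_norm M w)\<^sup>2 + (L2_norm M (grad \<Omega> v) + L2_norm M (grad \<Omega> w))\<^sup>2)"
    unfolding H1_norm_def
    by (intro real_sqrt_le_mono add_mono power_mono L2_norm_triangle H1_L2 v w L2_norm_nonneg)
  \<comment> \<open>The triangle inequality of the plane, for the pairs formed by the norm of a
    function and the norm of its gradient.\<close>
  also have "\<dots> \<le> H1_norm \<Omega> v + H1_norm \<Omega> w"
    unfolding H1_norm_def by (rule real_sqrt_sum_squares_triangle_ineq)
  finally show "H1_norm \<Omega> (\<lambda>x. v x + w x) \<le> H1_norm \<Omega> v + H1_norm \<Omega> w" .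
qed

sublocale H1: seminormed_functions "H1 \<Omega>" "H1_norm \<Omega>"
  by (rule seminormed_H1)

lemma L2_norm_le_H1_norm: "L2_norm M v \<le> H1_norm \<Omega> v"
  unfolding H1_norm_def by (rule real_le_rsqrt) simp

lemma L2_norm_grad_le_H1_norm: "L2_norm M (grad \<Omega> v) \<le> H1_norm \<Omega> v"
  unfolding H1_norm_def by (rule real_le_rsqrt) simp

lemma test_fun_H1:
  assumes "\<psi> \<in> test_fun \<Omega>"
  shows "\<psi> \<in> H1 \<Omega>"
proof (rule H1I(1)[OF test_fun_L2[OF assms]])
  let ?w = "\<lambda>x. (\<chi> i. frechet_derivative \<psi> (at x) (axis i 1)) :: real^'d"
  show "?w \<in> L2 M"
    by (intro continuous_L2 continuous_on_vec_lambda test_fun_partial_continuous[OF assms] axis_1_Basis)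
  show "is_weak_gradient \<Omega> \<psi> ?w"
    unfolding is_weak_gradient_def
    using test_fun_integral_by_parts[OF open_\<Omega> _ assms axis_1_Basis] by simp
qed

end

section \<open>Strong limits of midpoints of a bounded sequence\<close>

text \<open>Iterated midpoints of the tail from \<open>n\<close> on. They replace the convex combinations of Mazur's
  lemma, which gives strong limits of convex combinations of a bounded sequence.\<close>

inductive_set midpoints :: "(nat \<Rightarrow> 'a \<Rightarrow> 'b::real_vector) \<Rightarrow> nat \<Rightarrow> ('a \<Rightarrow> 'b) set"
  for s :: "nat \<Rightarrow> 'a \<Rightarrow> 'b" and n :: nat where
  base: "m \<ge> n \<Longrightarrow> s m \<in> midpoints s n"
| mid: "v \<in> midpoints s n \<Longrightarrow> w \<in> midpoints s n \<Longrightarrow> (\<lambda>x. (1/2) *\<^sub>R (v x + w x)) \<in> midpoints s n"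

lemma midpoints_antimono: "n \<le> m \<Longrightarrow> v \<in> midpoints s m \<Longrightarrow> v \<in> midpoints s n"
  by (rotate_tac, induction rule: midpoints.induct) (auto intro: midpoints.intros)

context seminormed_functions
begin

lemma midpoint_mem: "v \<in> X \<Longrightarrow> w \<in> X \<Longrightarrow> (\<lambda>x. (1/2) *\<^sub>R (v x + w x)) \<in> X"
  using scale_mem[OF add_mem] by blast

lemma midpoints_mem: "v \<in> midpoints s n \<Longrightarrow> (\<And>m. s m \<in> X) \<Longrightarrow> v \<in> X"
  by (induction rule: midpoints.induct) (auto intro: midpoint_mem)

text \<open>The infima \<open>d n\<close> of the squared norm over the midpoints of the tails
  increase and are bounded, hence converge. Nearly minimal elements \<open>y n\<close> then form a
  Cauchy sequence by the parallelogram law, as in the proof that a closed convex set of a Hilbert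
  space has an element of least norm.\<close>

lemma midpoints_Cauchy:
  assumes par: "\<And>v w. v \<in> X \<Longrightarrow> w \<in> X \<Longrightarrow> (N (\<lambda>x. v x + w x))\<^sup>2 + (N (\<lambda>x. v x - w x))\<^sup>2 = 2 * (N v)\<^sup>2 + 2 * (N w)\<^sup>2"
    and s: "\<And>n. s n \<in> X" "\<And>n. N (s n) \<le> C"
  obtains y where "\<And>n. y n \<in> midpoints s n"
    "\<And>e. e > 0 \<Longrightarrow> \<exists>k. \<forall>m\<ge>k. \<forall>n\<ge>k. N (\<lambda>x. y m x - y n x) < e"
proof -
  define d where "d n = Inf ((\<lambda>v. (N v)\<^sup>2) ` midpoints s n)" for n
  have bb: "bdd_below ((\<lambda>v. (N v)\<^sup>2) ` midpoints s n)" for n by (rule bdd_belowI[where m=0]) auto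
  have ne: "(\<lambda>v. (N v)\<^sup>2) ` midpoints s n \<noteq> {}" for n using midpoints.base[of n n s] by auto
  have dle: "d n \<le> (N v)\<^sup>2" if "v \<in> midpoints s n" for v n
    unfolding d_def using that by (intro cInf_lower bb) auto
  have mono: "d n \<le> d m" if "n \<le> m" for n m
    unfolding d_def using that by (intro cInf_superset_mono ne bb image_mono) (auto intro: midpoints_antimono)
  have "d n \<le> C\<^sup>2" for n
    using dle[OF midpoints.base[of n n s]] power_mono[OF s(2)[of n] nonneg[OF s(1)], of 2] by simp
  then have "norm (d n) \<le> \<bar>d 0\<bar> + C\<^sup>2" for n
    using mono[of 0 n] by (simp add: abs_if) (smt (verit) zero_le_power2)
  then have "Bseq d" by (rule BseqI')
  then have "convergent d" using mono by (intro Bseq_mono_convergent) auto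
  then have cau: "Cauchy d" by (rule convergent_Cauchy)
  define \<delta> where "\<delta> n = 1 / real (Suc n)" for n
  have "\<exists>v\<in>midpoints s n. (N v)\<^sup>2 < d n + \<delta> n" for n
    using cInf_lessD[OF ne, of n "d n + \<delta> n"] by (auto simp: d_def \<delta>_def)
  then obtain y where y: "\<And>n. y n \<in> midpoints s n" "\<And>n. (N (y n))\<^sup>2 < d n + \<delta> n" by metis
  have yX: "y n \<in> X" for n using midpoints_mem[OF y(1) s(1)] .
  have est: "(N (\<lambda>x. y m x - y n x))\<^sup>2 \<le> 2 * (d m - d n) + 2 * \<delta> n + 2 * \<delta> m" if "n \<le> m" for n m
  proof -
    \<comment> \<open>For \<open>n \<le> m\<close> this midpoint still belongs to the tail from
      \<open>n\<close>, so its squared norm, a quarter of that of the sum, is at least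
      \<open>d n\<close>.\<close>
    have "(\<lambda>x. (1/2) *\<^sub>R (y m x + y n x)) \<in> midpoints s n"
      using y(1) midpoints_antimono[OF that] by (intro midpoints.mid) auto
    from dle[OF this] have "4 * d n \<le> (N (\<lambda>x. y m x + y n x))\<^sup>2"
      using homogeneous[OF add_mem[OF yX[of m] yX[of n]], of "1/2"] by (simp add: power_mult_distrib power2_eq_square)
    then show ?thesis using par[OF yX yX, of m n] y(2)[of m] y(2)[of n] by simp
  qed
  have "\<exists>k. \<forall>m\<ge>k. \<forall>n\<ge>k. N (\<lambda>x. y m x - y n x) < e" if e: "e > 0" for e
  proof -
    \<comment> \<open>The bound \<open>est\<close> contains three quantities with the factor 2; each
      being less than an eighth of \<open>e^2\<close>, the sum stays below
      \<open>e^2\<close>.\<close>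
    obtain k1 where k1: "\<And>m n. m \<ge> k1 \<Longrightarrow> n \<ge> k1 \<Longrightarrow> \<bar>d m - d n\<bar> < e\<^sup>2 / 8"
      using CauchyD[OF cau, of "e\<^sup>2 / 8"] e by auto
    obtain k2 where k2: "1 / real (Suc k2) < e\<^sup>2 / 8"
      using reals_Archimedean[of "e\<^sup>2 / 8"] e by (auto simp: inverse_eq_divide)
    have small: "\<delta> n < e\<^sup>2 / 8" if "n \<ge> k2" for n
      using k2 that unfolding \<delta>_def
      by (smt (verit, best) frac_le of_nat_0_less_iff of_nat_le_iff Suc_le_mono zero_less_Suc)
    have "N (\<lambda>x. y m x - y n x) < e" if "m \<ge> max k1 k2" "n \<ge> max k1 k2" "n \<le> m" for m n
    proof -
      have "(N (\<lambda>x. y m x - y n x))\<^sup>2 < e\<^sup>2"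
      proof -
        have "d m - d n < e\<^sup>2 / 8" using k1[of m n] that abs_ge_self[of "d m - d n"] by (simp del: abs_ge_self)
        moreover have "\<delta> n < e\<^sup>2 / 8" "\<delta> m < e\<^sup>2 / 8" using small that by auto
        ultimately show ?thesis using est[OF that(3)] zero_less_power[OF e, of 2] by argo
      qed
      then show ?thesis using e by (simp add: power2_less_imp_less)
    qed
    then have "N (\<lambda>x. y m x - y n x) < e" if "m \<ge> max k1 k2" "n \<ge> max k1 k2" for m n
      using that minus_commute[OF yX yX, of m n] by (metis nle_le)
    then show ?thesis by blast
  qed
  with y(1) show ?thesis by (rule that)
qed

end

section \<open>Vector-valued Sobolev functions\<close>

lemma L2_sum: "finite I \<Longrightarrow> (\<And>i. i \<in> I \<Longrightarrow> f i \<in> L2 M) \<Longrightarrow> (\<lambda>x. \<Sum>i\<in>I. f i x) \<in> L2 M"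
  by (induction I rule: finite_induct) (auto simp: L2_zero intro!: L2_add)

lemma linear_component: "linear (\<lambda>x::'b::euclidean_space^'n. x $ i)"
  by (rule linearI) auto

lemma linear_axis: "linear (axis i :: 'b::euclidean_space \<Rightarrow> 'b^'n)"
  by (rule linearI) (auto simp: axis_def vec_eq_iff)

lemma L2_vec:
  fixes f :: "'a \<Rightarrow> 'b::euclidean_space^'n"
  shows "f \<in> L2 M \<longleftrightarrow> (\<forall>i. (\<lambda>x. f x $ i) \<in> L2 M)"
proof
  assume "f \<in> L2 M"
  then show "\<forall>i. (\<lambda>x. f x $ i) \<in> L2 M" using L2_linear_image[OF linear_component] by blast
next
  assume "\<forall>i. (\<lambda>x. f x $ i) \<in> L2 M"
  then have "(\<lambda>x. \<Sum>i\<in>UNIV. axis i (f x $ i)) \<in> L2 M" by (intro L2_sum L2_linear_image[OF linear_axis]) auto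
  moreover have "(\<lambda>x. \<Sum>i\<in>UNIV. axis i (f x $ i)) = f"
    by (auto simp: vec_eq_iff axis_def fun_eq_iff sum.delta' if_distrib[where f="\<lambda>v. v $ _"] cong: if_cong)
  ultimately show "f \<in> L2 M" by simp
qed

text \<open>The strain is this linear map applied pointwise to the Jacobian, as the divergence is
  \<open>trace\<close> applied to it. Both are thus instances of statements about a linear map
  \<open>A\<close>.\<close>

definition strain_map :: "real^'d^'d \<Rightarrow> real^'d^'d" where
  "strain_map J = (1/2) *\<^sub>R (J + transpose J)"

lemma linear_strain_map: "linear strain_map"
  by (rule linearI) (simp_all add: strain_map_def transpose_def vec_eq_iff algebra_simps)

lemma linear_trace: "linear (trace :: real^'d^'d \<Rightarrow> real)"
  by (rule linearI) (auto simp: trace_def sum.distrib sum_distrib_left)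

lemma strain_eq: "strain \<Omega> u = (\<lambda>x. strain_map (jac \<Omega> u x))"
  by (rule ext) (simp only: strain_def strain_map_def)

lemma dvg_eq: "dvg \<Omega> u = (\<lambda>x. trace (jac \<Omega> u x))"
  by (rule ext) (simp only: dvg_def)

context bounded_open_set
begin

lemma H1v_L2: "u \<in> H1v \<Omega> \<Longrightarrow> u \<in> L2 M"
  by (subst L2_vec) (simp add: H1v_def H1_L2)

lemma jac_L2: "u \<in> H1v \<Omega> \<Longrightarrow> jac \<Omega> u \<in> L2 M"
  by (subst L2_vec) (simp add: jac_def H1v_def grad(1))

lemma strain_L2: "u \<in> H1v \<Omega> \<Longrightarrow> strain \<Omega> u \<in> L2 M"
  unfolding strain_eq by (rule L2_linear_image[OF linear_strain_map jac_L2])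

lemma dvg_L2: "u \<in> H1v \<Omega> \<Longrightarrow> dvg \<Omega> u \<in> L2 M"
  unfolding dvg_eq by (rule L2_linear_image[OF linear_trace jac_L2])

lemma AE_vecI:
  fixes f h :: "_ \<Rightarrow> 'b^'n"
  assumes "\<And>i. AE x in M. f x $ i = h x $ i"
  shows "AE x in M. f x = h x"
proof -
  have "AE x in M. \<forall>i\<in>UNIV. f x $ i = h x $ i" using assms by (subst AE_finite_all) auto
  then show ?thesis by eventually_elim (simp add: vec_eq_iff)
qed

lemma H1v_add:
  assumes "u \<in> H1v \<Omega>" "u' \<in> H1v \<Omega>"
  shows "(\<lambda>x. u x + u' x) \<in> H1v \<Omega>" "AE x in M. jac \<Omega> (\<lambda>x. u x + u' x) x = jac \<Omega> u x + jac \<Omega> u' x"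
proof -
  have c: "(\<lambda>x. u x $ i) \<in> H1 \<Omega>" "(\<lambda>x. u' x $ i) \<in> H1 \<Omega>" for i using assms by (auto simp: H1v_def)
  show "(\<lambda>x. u x + u' x) \<in> H1v \<Omega>" using H1_add(1)[OF c] by (simp add: H1v_def)
  show "AE x in M. jac \<Omega> (\<lambda>x. u x + u' x) x = jac \<Omega> u x + jac \<Omega> u' x"
    by (rule AE_vecI) (use H1_add(2)[OF c] in \<open>simp add: jac_def\<close>)
qed

lemma H1v_scale:
  assumes "u \<in> H1v \<Omega>"
  shows "(\<lambda>x. a *\<^sub>R u x) \<in> H1v \<Omega>" "AE x in M. jac \<Omega> (\<lambda>x. a *\<^sub>R u x) x = a *\<^sub>R jac \<Omega> u x"
proof -
  have c: "(\<lambda>x. u x $ i) \<in> H1 \<Omega>" for i using assms by (auto simp: H1v_def)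
  show "(\<lambda>x. a *\<^sub>R u x) \<in> H1v \<Omega>" using H1_scale(1)[OF c] by (simp add: H1v_def)
  show "AE x in M. jac \<Omega> (\<lambda>x. a *\<^sub>R u x) x = a *\<^sub>R jac \<Omega> u x"
    by (rule AE_vecI) (use H1_scale(2)[OF c] in \<open>simp add: jac_def\<close>)
qed

lemma jac_cong_AE:
  assumes "u \<in> L2 M" "u' \<in> L2 M" "AE x in M. u x = u' x"
  shows "jac \<Omega> u = jac \<Omega> u'"
proof -
  have "grad \<Omega> (\<lambda>y. u y $ i) = grad \<Omega> (\<lambda>y. u' y $ i)" for i
    using assms by (intro grad_cong_AE L2D(1)[OF component_L2]) auto
  then show ?thesis by (simp add: jac_def fun_eq_iff)
qed

lemma L2_norm_jac_diff:
  assumes "u \<in> H1v \<Omega>" "u' \<in> H1v \<Omega>"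
  shows "(\<lambda>x. u x - u' x) \<in> H1v \<Omega>"
    "L2_norm M (jac \<Omega> (\<lambda>x. u x - u' x)) = L2_norm M (\<lambda>x. jac \<Omega> u x - jac \<Omega> u' x)"
proof -
  have e: "(\<lambda>x. u x - u' x) = (\<lambda>x. u x + (-1) *\<^sub>R u' x)" by auto
  show m: "(\<lambda>x. u x - u' x) \<in> H1v \<Omega>" unfolding e by (intro H1v_add H1v_scale assms)
  show "L2_norm M (jac \<Omega> (\<lambda>x. u x - u' x)) = L2_norm M (\<lambda>x. jac \<Omega> u x - jac \<Omega> u' x)"
  proof (rule L2_norm_cong_AE)
    show "AE x in M. jac \<Omega> (\<lambda>x. u x - u' x) x = jac \<Omega> u x - jac \<Omega> u' x"
      unfolding e using H1v_add(2)[OF assms(1) H1v_scale(1)[OF assms(2), of "-1"]] H1v_scale(2)[OF assms(2), of "-1"]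
      by eventually_elim simp
  qed (use L2D(1)[OF jac_L2] m assms in \<open>auto intro: borel_measurable_diff\<close>)
qed

lemma L2_norm_jac_add:
  assumes "u \<in> H1v \<Omega>" "u' \<in> H1v \<Omega>"
  shows "L2_norm M (jac \<Omega> (\<lambda>x. u x + u' x)) = L2_norm M (\<lambda>x. jac \<Omega> u x + jac \<Omega> u' x)"
  by (rule L2_norm_cong_AE[OF _ _ H1v_add(2)[OF assms]])
     (use L2D(1)[OF jac_L2] H1v_add(1)[OF assms] assms in \<open>auto intro: borel_measurable_add\<close>)

sublocale H1v: seminormed_functions "H1v \<Omega>" "H1v_norm \<Omega>"
proof
  show "(\<lambda>x. 0) \<in> H1v \<Omega>" using H1.zero_mem by (simp add: H1v_def)
next
  fix v w :: "real^'d \<Rightarrow> real^'d" and a :: real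
  assume v: "v \<in> H1v \<Omega>"
  show "(\<lambda>x. a *\<^sub>R v x) \<in> H1v \<Omega>" using H1v_scale(1)[OF v] .
  have "L2_norm M (jac \<Omega> (\<lambda>x. a *\<^sub>R v x)) = L2_norm M (\<lambda>x. a *\<^sub>R jac \<Omega> v x)"
    by (rule L2_norm_cong_AE[OF _ _ H1v_scale(2)[OF v]])
       (use L2D(1)[OF jac_L2] H1v_scale(1)[OF v] v in \<open>auto intro: borel_measurable_scaleR\<close>)
  then have "H1v_norm \<Omega> (\<lambda>x. a *\<^sub>R v x) = sqrt (a\<^sup>2 * ((L2_norm M v)\<^sup>2 + (L2_norm M (jac \<Omega> v))\<^sup>2))"
    by (simp add: H1v_norm_def L2_norm_scaleR power_mult_distrib distrib_left)
  then show "H1v_norm \<Omega> (\<lambda>x. a *\<^sub>R v x) = \<bar>a\<bar> * H1v_norm \<Omega> v"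
    by (simp add: H1v_norm_def real_sqrt_mult)
  assume w: "w \<in> H1v \<Omega>"
  show "(\<lambda>x. v x + w x) \<in> H1v \<Omega>" by (rule H1v_add(1)[OF v w])
  have "L2_norm M (jac \<Omega> (\<lambda>x. v x + w x)) \<le> L2_norm M (jac \<Omega> v) + L2_norm M (jac \<Omega> w)"
    unfolding L2_norm_jac_add[OF v w] by (intro L2_norm_triangle jac_L2 v w)
  then have "H1v_norm \<Omega> (\<lambda>x. v x + w x)
      \<le> sqrt ((L2_norm M v + L2_norm M w)\<^sup>2 + (L2_norm M (jac \<Omega> v) + L2_norm M (jac \<Omega> w))\<^sup>2)"
    unfolding H1v_norm_def
    by (intro real_sqrt_le_mono add_mono power_mono L2_norm_triangle H1v_L2 v w L2_norm_nonneg)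
  also have "\<dots> \<le> H1v_norm \<Omega> v + H1v_norm \<Omega> w"
    unfolding H1v_norm_def by (rule real_sqrt_sum_squares_triangle_ineq)
  finally show "H1v_norm \<Omega> (\<lambda>x. v x + w x) \<le> H1v_norm \<Omega> v + H1v_norm \<Omega> w" .
qed

lemma H1v_norm_sq: "(H1v_norm \<Omega> u)\<^sup>2 = (L2_norm M u)\<^sup>2 + (L2_norm M (jac \<Omega> u))\<^sup>2"
  by (simp add: H1v_norm_def)

lemma H1v_parallelogram:
  assumes "u \<in> H1v \<Omega>" "u' \<in> H1v \<Omega>"
  shows "(H1v_norm \<Omega> (\<lambda>x. u x + u' x))\<^sup>2 + (H1v_norm \<Omega> (\<lambda>x. u x - u' x))\<^sup>2
       = 2 * (H1v_norm \<Omega> u)\<^sup>2 + 2 * (H1v_norm \<Omega> u')\<^sup>2"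
  unfolding H1v_norm_sq L2_norm_jac_add[OF assms] L2_norm_jac_diff[OF assms]
    L2_norm_add_sq[OF H1v_L2[OF assms(1)] H1v_L2[OF assms(2)]] L2_norm_diff_sq[OF H1v_L2[OF assms(1)] H1v_L2[OF assms(2)]]
    L2_norm_add_sq[OF jac_L2[OF assms(1)] jac_L2[OF assms(2)]] L2_norm_diff_sq[OF jac_L2[OF assms(1)] jac_L2[OF assms(2)]]
  by (simp add: L2_norm_sq)

lemma L2_norm_le_H1v_norm: "L2_norm M u \<le> H1v_norm \<Omega> u"
  unfolding H1v_norm_def by (rule real_le_rsqrt) simp

lemma L2_norm_jac_le_H1v_norm: "L2_norm M (jac \<Omega> u) \<le> H1v_norm \<Omega> u"
  unfolding H1v_norm_def by (rule real_le_rsqrt) simp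

lemma L2_norm_linear_jac_diff:
  assumes "linear A" "u \<in> H1v \<Omega>" "u' \<in> H1v \<Omega>"
  shows "L2_norm M (\<lambda>x. A (jac \<Omega> u x) - A (jac \<Omega> u' x)) \<le> onorm A * H1v_norm \<Omega> (\<lambda>x. u x - u' x)"
proof -
  have "L2_norm M (\<lambda>x. A (jac \<Omega> u x) - A (jac \<Omega> u' x)) \<le> onorm A * L2_norm M (jac \<Omega> (\<lambda>x. u x - u' x))"
    using L2_norm_linear_image_diff[OF assms(1) jac_L2[OF assms(2)] jac_L2[OF assms(3)]]
    by (simp add: L2_norm_jac_diff[OF assms(2,3)])
  also have "\<dots> \<le> onorm A * H1v_norm \<Omega> (\<lambda>x. u x - u' x)"
    using assms(1) by (intro mult_left_mono L2_norm_jac_le_H1v_norm onorm_pos_le) (simp add: linear_conv_bounded_linear)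
  finally show ?thesis .
qed

lemma RM_L2: "r \<in> RM \<Longrightarrow> r \<in> L2 M"
  by (auto simp: RM_def intro!: continuous_L2 continuous_intros matrix_vector_mult_linear_continuous_on)

lemma H1_perp_H1v: "u \<in> H1_perp \<Omega> \<Longrightarrow> u \<in> H1v \<Omega>"
  by (simp add: H1_perp_def)

sublocale H1_perp: seminormed_functions "H1_perp \<Omega>" "H1v_norm \<Omega>"
proof
  show "(\<lambda>x. 0) \<in> H1_perp \<Omega>" using H1v.zero_mem by (simp add: H1_perp_def L2_inner_def)
qed (auto simp: H1_perp_def H1v.add_mem H1v.scale_mem H1v.triangle H1v.homogeneous L2_inner_add_left H1v_L2 RM_L2 L2_inner_scaleR_left)

lemma H1v_closed:
  assumes u: "\<And>n. u n \<in> H1v \<Omega>" "v \<in> L2 M" "J \<in> L2 M"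
    and lim: "(\<lambda>n. L2_norm M (\<lambda>x. u n x - v x)) \<longlonglongrightarrow> 0" "(\<lambda>n. L2_norm M (\<lambda>x. jac \<Omega> (u n) x - J x)) \<longlonglongrightarrow> 0"
  shows "v \<in> H1v \<Omega>" "AE x in M. jac \<Omega> v x = J x"
proof -
  have comp: "(\<lambda>n. L2_norm M (\<lambda>x. f n x $ i - h x $ i)) \<longlonglongrightarrow> 0"
    if "\<And>n. f n \<in> L2 M" "h \<in> L2 M" "(\<lambda>n. L2_norm M (\<lambda>x. f n x - h x)) \<longlonglongrightarrow> 0"
    for f :: "nat \<Rightarrow> real^'d \<Rightarrow> 'b::euclidean_space^'d" and h i
  proof (rule Lim_null_comparison[OF always_eventually])
    show "(\<lambda>n. onorm (\<lambda>y::'b^'d. y $ i) * L2_norm M (\<lambda>x. f n x - h x)) \<longlonglongrightarrow> 0"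
      using tendsto_mult[OF tendsto_const that(3)] by simp
  qed (use L2_norm_linear_image_diff[OF linear_component that(1,2)] in \<open>simp add: L2_norm_nonneg\<close>)
  have c: "(\<lambda>x. v x $ i) \<in> H1 \<Omega>" "AE x in M. grad \<Omega> (\<lambda>x. v x $ i) x = J x $ i" for i
  proof -
    have 1: "(\<lambda>x. u n x $ i) \<in> H1 \<Omega>" for n using u(1) by (simp add: H1v_def)
    have 2: "(\<lambda>x. v x $ i) \<in> L2 M" "(\<lambda>x. J x $ i) \<in> L2 M" using u(2,3) by (simp_all add: L2_vec)
    have 3: "(\<lambda>n. L2_norm M (\<lambda>x. grad \<Omega> (\<lambda>x. u n x $ i) x - J x $ i)) \<longlonglongrightarrow> 0"
      using comp[OF jac_L2[OF u(1)] u(3) lim(2), of i] by (simp add: jac_def)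
    note * = H1_closed[OF 1 2 comp[OF H1v_L2[OF u(1)] u(2) lim(1), of i] 3]
    show "(\<lambda>x. v x $ i) \<in> H1 \<Omega>" "AE x in M. grad \<Omega> (\<lambda>x. v x $ i) x = J x $ i" by (rule *)+
  qed
  show "v \<in> H1v \<Omega>" using c(1) by (simp add: H1v_def)
  show "AE x in M. jac \<Omega> v x = J x" by (rule AE_vecI) (use c(2) in \<open>simp add: jac_def\<close>)
qed

text \<open>Completeness of L2 gives limits of the midpoints and of their Jacobians separately;
  closedness of the weak gradient joins them, and orthogonality to rigid motions passes to the
  limit.\<close>

lemma H1_perp_bounded_midpoints:
  assumes s: "\<And>n. s n \<in> H1_perp \<Omega>" "\<And>n. H1v_norm \<Omega> (s n) \<le> C"
  obtains y v where "v \<in> H1_perp \<Omega>" "\<And>n. y n \<in> midpoints s n" "\<And>n. y n \<in> H1_perp \<Omega>"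
    "(\<lambda>n. H1v_norm \<Omega> (\<lambda>x. y n x - v x)) \<longlonglongrightarrow> 0"
proof -
  obtain y where y: "\<And>n. y n \<in> midpoints s n"
    "\<And>e. e > 0 \<Longrightarrow> \<exists>k. \<forall>m\<ge>k. \<forall>n\<ge>k. H1v_norm \<Omega> (\<lambda>x. y m x - y n x) < e"
  proof (rule H1_perp.midpoints_Cauchy[where s=s and C=C, OF H1v_parallelogram[OF H1_perp_H1v H1_perp_H1v] s])
    fix y
    assume "\<And>n. y n \<in> midpoints s n" "\<And>e. e > 0 \<Longrightarrow> \<exists>k. \<forall>m\<ge>k. \<forall>n\<ge>k. H1v_norm \<Omega> (\<lambda>x. y m x - y n x) < e"
    then show thesis by (rule that)
  qed
  have yp: "y n \<in> H1_perp \<Omega>" for n using H1_perp.midpoints_mem[OF y(1) s(1)] .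
  then have yv: "y n \<in> H1v \<Omega>" for n using H1_perp_H1v by blast
  obtain v where v: "v \<in> L2 M" "(\<lambda>n. L2_norm M (\<lambda>x. y n x - v x)) \<longlonglongrightarrow> 0"
  proof (rule L2_complete[OF finite_M H1v_L2[OF yv]])
    show "\<exists>k. \<forall>m\<ge>k. \<forall>n\<ge>k. L2_norm M (\<lambda>x. y m x - y n x) < e" if "e > 0" for e
      using y(2)[OF that] L2_norm_le_H1v_norm le_less_trans by blast
  qed
  obtain J where J: "J \<in> L2 M" "(\<lambda>n. L2_norm M (\<lambda>x. jac \<Omega> (y n) x - J x)) \<longlonglongrightarrow> 0"
  proof (rule L2_complete[OF finite_M jac_L2[OF yv]])
    show "\<exists>k. \<forall>m\<ge>k. \<forall>n\<ge>k. L2_norm M (\<lambda>x. jac \<Omega> (y m) x - jac \<Omega> (y n) x) < e" if "e > 0" for e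
      using y(2)[OF that] L2_norm_jac_le_H1v_norm[of "\<lambda>x. y _ x - y _ x"] le_less_trans
      unfolding L2_norm_jac_diff(2)[OF yv yv] by blast
  qed
  note vc = H1v_closed[OF yv v(1) J(1) v(2) J(2)]
  have "L2_inner M v r = 0" if "r \<in> RM" for r
  proof -
    have "(\<lambda>n. L2_inner M (y n) r) \<longlonglongrightarrow> L2_inner M v r"
      by (intro L2_inner_tendsto H1v_L2 yv v RM_L2 that)
    moreover have "L2_inner M (y n) r = 0" for n using yp that by (simp add: H1_perp_def)
    ultimately show ?thesis by (simp add: LIMSEQ_const_iff)
  qed
  then have vp: "v \<in> H1_perp \<Omega>" using vc(1) by (simp add: H1_perp_def)
  have "(\<lambda>n. sqrt ((L2_norm M (\<lambda>x. y n x - v x))\<^sup>2 + (L2_norm M (\<lambda>x. jac \<Omega> (y n) x - J x))\<^sup>2)) \<longlonglongrightarrow> sqrt (0\<^sup>2 + 0\<^sup>2)"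
    by (intro tendsto_real_sqrt tendsto_add tendsto_power v J)
  moreover have "L2_norm M (\<lambda>x. jac \<Omega> (y n) x - J x) = L2_norm M (jac \<Omega> (\<lambda>x. y n x - v x))" for n
    unfolding L2_norm_jac_diff(2)[OF yv vc(1)]
    by (rule L2_norm_cong_AE) (use vc(2) L2D(1)[OF jac_L2[OF yv]] L2D(1)[OF jac_L2[OF vc(1)]] L2D(1)[OF J(1)] in auto)
  ultimately have "(\<lambda>n. H1v_norm \<Omega> (\<lambda>x. y n x - v x)) \<longlonglongrightarrow> 0" by (simp add: H1v_norm_def)
  with vp y(1) yp show ?thesis using that by blast
qed

end

section \<open>Integrals over time intervals\<close>

lemma integrable_lebesgue_on_subset:
  fixes f :: "'a::euclidean_space \<Rightarrow> real"
  assumes "integrable (lebesgue_on A) f" "B \<subseteq> A" "A \<in> sets lebesgue" "B \<in> sets lebesgue"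
  shows "integrable (lebesgue_on B) f"
proof -
  have "A \<inter> space lebesgue \<in> sets lebesgue" using assms(3) by simp
  from iffD1[OF integrable_restrict_space[OF this] assms(1)]
  have "integrable lebesgue (\<lambda>x. indicator A x *\<^sub>R f x)" .
  then have "integrable lebesgue (\<lambda>x. indicator B x *\<^sub>R (indicator A x *\<^sub>R f x))"
    by (rule integrable_mult_indicator[OF assms(4)])
  also have "(\<lambda>x. indicator B x *\<^sub>R (indicator A x *\<^sub>R f x)) = (\<lambda>x. indicator B x *\<^sub>R f x)"
    using assms(2) by (auto simp: indicator_def fun_eq_iff)
  finally have "integrable lebesgue (\<lambda>x. indicator B x *\<^sub>R f x)" .
  then show ?thesis using assms(4) by (intro iffD2[OF integrable_restrict_space]) auto
qed

lemma integrable_subinterval: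
  fixes f :: "real \<Rightarrow> real"
  assumes "integrable (lebesgue_on {0..T}) f" "0 \<le> s" "t \<le> T"
  shows "integrable (lebesgue_on {s..t}) f"
  using assms by (intro integrable_lebesgue_on_subset[OF assms(1)]) auto

lemma continuous_on_integrable:
  fixes f :: "real \<Rightarrow> real"
  assumes "continuous_on {a..b} f"
  shows "integrable (lebesgue_on {a..b}) f"
  using absolutely_integrable_continuous_real[OF assms] integrable_restrict_space[of "{a..b}" lebesgue f]
  by (simp add: set_integrable_def del: real_scaleR_def)

text \<open>For \<open>s > t\<close> this is 0 and not the negative of the reversed integral; hence
  additivity is stated for ordered end points.\<close>

definition integral_from_to :: "real \<Rightarrow> real \<Rightarrow> (real \<Rightarrow> real) \<Rightarrow> real" where
  "integral_from_to s t f = (\<integral>x. f x \<partial>lebesgue_on {s..t})"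

lemma integral_from_to_eq:
  assumes "integrable (lebesgue_on {0..T}) f" "0 \<le> s" "t \<le> T"
  shows "integral_from_to s t f = integral {s..t} f"
  unfolding integral_from_to_def
  by (rule lebesgue_integral_eq_integral[OF integrable_subinterval[OF assms]]) auto

lemma integral_from_to_indicator:
  assumes "0 \<le> s" "t \<le> T"
  shows "integral_from_to s t f = (\<integral>x. indicator {s..t} x * f x \<partial>lebesgue_on {0..T})"
proof -
  have "integral_from_to s t f = (\<integral>x. (if x \<in> {s..t} then f x else 0) \<partial>lebesgue_on {0..T})"
    unfolding integral_from_to_def using assms by (intro integral_restrict[symmetric]) auto
  also have "(\<lambda>x. if x \<in> {s..t} then f x else 0) = (\<lambda>x. indicator {s..t} x * f x)"
    by (auto simp: fun_eq_iff indicator_def)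
  finally show ?thesis .
qed

lemma integral_from_to_combine:
  assumes "integrable (lebesgue_on {0..T}) f" "0 \<le> r" "r \<le> s" "s \<le> t" "t \<le> T"
  shows "integral_from_to r t f = integral_from_to r s f + integral_from_to s t f"
proof -
  have 1: "integral_from_to r t f = integral {r..t} f" "integral_from_to r s f = integral {r..s} f"
    "integral_from_to s t f = integral {s..t} f"
    using assms by (auto intro: integral_from_to_eq[OF assms(1)])
  have "f integrable_on {r..t}"
    using integrable_on_lebesgue_on[OF integrable_subinterval[OF assms(1,2,5)]] by simp
  then show ?thesis unfolding 1 using assms Henstock_Kurzweil_Integration.integral_combine by metis
qed

lemma integral_from_to_same: "integral_from_to t t f = 0"
  unfolding integral_from_to_def
  by (rule integral_eq_zero_null_sets) (auto intro!: AE_iff_null_sets simp: null_sets_restrict_space)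

lemma integral_from_to_continuous:
  assumes "integrable (lebesgue_on {0..T}) f"
  shows "continuous_on {0..T} (\<lambda>t. integral_from_to 0 t f)"
proof -
  have "continuous_on {0..T} (\<lambda>t. integral {0..t} f)"
    using integrable_on_lebesgue_on[OF assms] by (intro indefinite_integral_continuous_1) auto
  then show ?thesis
    by (rule continuous_on_cong[THEN iffD1, rotated 2]) (auto intro: integral_from_to_eq[OF assms, symmetric])
qed

lemma integral_from_to_diff:
  assumes "integrable (lebesgue_on {0..T}) f" "0 \<le> s" "s \<le> t" "t \<le> T"
  shows "integral_from_to s t f = integral_from_to 0 t f - integral_from_to 0 s f"
  using integral_from_to_combine[OF assms(1) order_refl assms(2-4)] by simp

lemma integral_from_to_mono:
  assumes "integrable (lebesgue_on {0..T}) f" "integrable (lebesgue_on {0..T}) h" "0 \<le> s" "t \<le> T"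
    and "AE x in lebesgue_on {0..T}. f x \<le> h x"
  shows "integral_from_to s t f \<le> integral_from_to s t h"
proof -
  have "AE x in lebesgue_on {s..t}. f x \<le> h x"
    using assms(3-5) by (auto simp: AE_restrict_space_iff elim: AE_mp)
  then show ?thesis unfolding integral_from_to_def
    using integrable_subinterval[OF assms(1,3,4)] integrable_subinterval[OF assms(2,3,4)] by (rule integral_mono_AE[rotated 2])
qed

lemma integral_from_to_abs_le:
  assumes "integrable (lebesgue_on {0..T}) f" "integrable (lebesgue_on {0..T}) h" "0 \<le> s" "t \<le> T"
    and "AE x in lebesgue_on {0..T}. \<bar>f x\<bar> \<le> h x"
  shows "\<bar>integral_from_to s t f\<bar> \<le> integral_from_to s t h"
proof -
  have "\<bar>integral_from_to s t f\<bar> \<le> integral_from_to s t (\<lambda>x. \<bar>f x\<bar>)"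
    unfolding integral_from_to_def by (rule integral_abs_bound)
  also have "\<dots> \<le> integral_from_to s t h"
    using assms by (intro integral_from_to_mono) auto
  finally show ?thesis .
qed

text \<open>The Lebesgue measure is complete, so that a function of time determined only up to null
  sets, as are those built from a weak solution, is measurable along with any
  representative.\<close>

lemma AE_measurable_lebesgue_on:
  fixes f :: "real \<Rightarrow> real"
  assumes "S \<in> sets lebesgue" "f \<in> borel_measurable (lebesgue_on S)" "AE x in lebesgue_on S. f x = h x"
  shows "h \<in> borel_measurable (lebesgue_on S)"
proof -
  have "(\<lambda>x. indicator S x *\<^sub>R f x) \<in> borel_measurable lebesgue"
    using assms(1,2) borel_measurable_restrict_space_iff[of S lebesgue f] by simp
  moreover have "AE x in lebesgue. indicator S x *\<^sub>R f x = indicator S x *\<^sub>R h x"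
    using assms(3) unfolding AE_lebesgue_on_iff[OF assms(1)] by eventually_elim (auto simp: indicator_def)
  ultimately have "(\<lambda>x. indicator S x *\<^sub>R h x) \<in> borel_measurable lebesgue" by (rule borel_measurable_AE)
  then show ?thesis using assms(1) borel_measurable_restrict_space_iff[of S lebesgue h] by simp
qed

lemma AE_limit_measurable_lebesgue_on:
  fixes f :: "nat \<Rightarrow> real \<Rightarrow> real"
  assumes "S \<in> sets lebesgue" "\<And>n. f n \<in> borel_measurable (lebesgue_on S)"
    and "AE x in lebesgue_on S. (\<lambda>n. f n x) \<longlonglongrightarrow> h x"
  shows "h \<in> borel_measurable (lebesgue_on S)"
proof (rule AE_measurable_lebesgue_on[OF assms(1)])
  show "(\<lambda>x. lim (\<lambda>n. f n x)) \<in> borel_measurable (lebesgue_on S)"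
    by (rule borel_measurable_lim_metric[OF assms(2)])
  show "AE x in lebesgue_on S. lim (\<lambda>n. f n x) = h x"
    using assms(3) by eventually_elim (rule limI)
qed

section \<open>The lemma of du Bois-Reymond\<close>

lemma deriv_test_fun:
  fixes \<psi> :: "real \<Rightarrow> real"
  assumes "\<psi> \<in> test_fun S"
  shows "(\<psi> has_real_derivative deriv \<psi> t) (at t)" "continuous_on A (deriv \<psi>)"
proof -
  have d: "(\<psi> has_derivative frechet_derivative \<psi> (at t)) (at t)" for t by (rule test_fun_has_derivative[OF assms])
  have "frechet_derivative \<psi> (at t) = (*) (frechet_derivative \<psi> (at t) 1)" for t
  proof
    fix h show "frechet_derivative \<psi> (at t) h = frechet_derivative \<psi> (at t) 1 * h"
      using linear_cmul[OF has_derivative_linear[OF d], of t h 1] by simp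
  qed
  then have f: "(\<psi> has_real_derivative frechet_derivative \<psi> (at t) 1) (at t)" for t
    using d[of t] by (simp add: has_field_derivative_def)
  have e: "deriv \<psi> = (\<lambda>t. frechet_derivative \<psi> (at t) 1)" using DERIV_imp_deriv[OF f] by auto
  show "(\<psi> has_real_derivative deriv \<psi> t) (at t)" unfolding e by (rule f)
  show "continuous_on A (deriv \<psi>)" unfolding e by (rule test_fun_partial_continuous[OF assms]) simp
qed

lemma test_fun_real_support:
  fixes \<psi> :: "real \<Rightarrow> real"
  assumes "\<psi> \<in> test_fun {0<..<T}" "T > 0"
  shows "\<exists>a b. 0 < a \<and> a < b \<and> b < T \<and> (\<forall>t. t \<notin> {a..b} \<longrightarrow> \<psi> t = 0)"
proof -
  obtain K where K: "compact K" "K \<subseteq> {0<..<T}" "\<And>x. x \<notin> K \<Longrightarrow> \<psi> x = 0" using test_fun_support[OF assms(1)] by metis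
  show ?thesis
  proof (cases "K = {}")
    case True
    then show ?thesis using K(3) assms(2) by (intro exI[of _ "T/3"] exI[of _ "T/2"]) simp
  next
    case False
    obtain a where a: "a \<in> K" "\<And>x. x \<in> K \<Longrightarrow> a \<le> x" using compact_attains_inf[OF K(1) False] by blast
    obtain b where b: "b \<in> K" "\<And>x. x \<in> K \<Longrightarrow> x \<le> b" using compact_attains_sup[OF K(1) False] by blast
    show ?thesis
    proof (intro exI conjI allI impI)
      have "0 < a" "b < T" "a \<le> b" using a b K(2) by auto
      \<comment> \<open>\<open>b\<close> would not do as the right end, since \<open>a = b\<close>
        when \<open>K\<close> is a single point.\<close>
      then show "0 < a" "a < (b + T) / 2" "(b + T) / 2 < T" by auto
      show "\<psi> t = 0" if "t \<notin> {a..(b + T) / 2}" for t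
      proof (rule K(3))
        show "t \<notin> K" using that a(2)[of t] b(2)[of t] \<open>b < T\<close> by auto
      qed
    qed
  qed
qed

text \<open>The primitive that vanishes at 0 is constant on either side of the support of \<theta>:
  on the left it is 0, on the right it equals the total integral, which is 0 by assumption.\<close>

lemma test_fun_primitive:
  fixes \<theta> :: "real \<Rightarrow> real"
  assumes T: "T > 0" and \<theta>: "\<theta> \<in> test_fun {0<..<T}" and 0: "(\<integral>t. \<theta> t \<partial>lebesgue_on {0..T}) = 0"
  obtains \<psi> where "\<psi> \<in> test_fun {0<..<T}" "deriv \<psi> = \<theta>"
proof -
  obtain a b where ab: "0 < a" "a < b" "b < T" "\<And>t. t \<notin> {a..b} \<Longrightarrow> \<theta> t = 0"
    using test_fun_real_support[OF \<theta> T] by metis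
  \<comment> \<open>The oriented integral, so that \<psi> is a primitive on the whole line, also to
    the left of 0.\<close>
  define \<psi> where "\<psi> = (\<lambda>u::real. LBINT y=ereal 0..ereal u. \<theta> y)"
  have d: "(\<psi> has_real_derivative \<theta> x) (at x)" for x
  proof -
    have "(\<psi> has_vector_derivative \<theta> x) (at x within {- \<bar>x\<bar> - 1..\<bar>x\<bar> + 1})"
      unfolding \<psi>_def by (rule interval_integral_FTC2) (use test_fun_continuous[OF \<theta>] in auto)
    moreover have "x \<in> interior {- \<bar>x\<bar> - 1..\<bar>x\<bar> + 1}" by auto
    ultimately show ?thesis
      by (simp only: at_within_interior has_real_derivative_iff_has_vector_derivative)
  qed
  have \<psi>0: "\<psi> 0 = 0" by (simp add: \<psi>_def)
  have c: "\<psi> s = \<psi> t" if "s < t" "\<And>x. s < x \<Longrightarrow> x < t \<Longrightarrow> \<theta> x = 0" for s t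
  proof (rule DERIV_isconst_end[OF that(1), symmetric])
    show "continuous_on {s..t} \<psi>" using DERIV_isCont[OF d] by (intro continuous_at_imp_continuous_on) auto
    show "(\<psi> has_real_derivative 0) (at x)" if "s < x" "x < t" for x
      using d[of x] \<open>\<And>x. s < x \<Longrightarrow> x < t \<Longrightarrow> \<theta> x = 0\<close>[OF that] by simp
  qed
  have l: "\<psi> t = 0" if "t < a" for t
    using c[of t 0] c[of 0 t] \<psi>0 ab that by (cases t "0::real" rule: linorder_cases) auto
  have \<psi>T: "\<psi> T = 0"
  proof -
    have "(\<theta> has_integral (\<psi> T - \<psi> 0)) {0..T}"
      using T d by (intro fundamental_theorem_of_calculus)
        (auto simp: has_real_derivative_iff_has_vector_derivative[symmetric] intro: has_field_derivative_at_within)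
    moreover have "integrable (lebesgue_on {0..T}) \<theta>"
      by (intro continuous_on_integrable test_fun_continuous[OF \<theta>])
    then have "(\<integral>t. \<theta> t \<partial>lebesgue_on {0..T}) = integral {0..T} \<theta>" by (rule lebesgue_integral_eq_integral) auto
    ultimately show ?thesis using 0 \<psi>0 by (simp add: integral_unique)
  qed
  have r: "\<psi> t = 0" if "t > b" for t
    using c[of t T] c[of T t] \<psi>T ab that by (cases t T rule: linorder_cases) auto
  have "\<psi> \<in> test_fun {0<..<T}"
  proof (rule test_funI)
    show "C_k k \<psi>" for k
    proof (cases k)
      case 0
      then show ?thesis using d DERIV_isCont by (auto intro!: continuous_at_imp_continuous_on)
    next
      case (Suc j)
      show ?thesis unfolding Suc
        by (rule C_k_SucI[OF d[THEN has_field_derivative_imp_has_derivative]])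
           (auto intro!: C_k_mult C_k_const test_fun_C_k[OF \<theta>])
    qed
    show "\<psi> x = 0" if "x \<notin> cbox a b" for x using l[of x] r[of x] that by auto
    show "cbox a b \<subseteq> {0<..<T}" using ab by auto
  qed
  moreover have "deriv \<psi> = \<theta>" using DERIV_imp_deriv[OF d] by auto
  ultimately show ?thesis by (rule that)
qed

text \<open>Fubini's theorem on the triangle \<open>s \<le> t\<close>: integrating the derivative of
  \<psi> from \<open>s\<close> to \<open>T\<close> gives \<open>- \<psi> s\<close>, since \<psi>
  vanishes at \<open>T\<close>.\<close>

lemma primitive_by_parts:
  fixes z \<psi> :: "real \<Rightarrow> real"
  assumes T: "T > 0" and z: "integrable (lebesgue_on {0..T}) z" and \<psi>: "\<psi> \<in> test_fun {0<..<T}"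
  shows "(\<integral>t. integral_from_to 0 t z * deriv \<psi> t \<partial>lebesgue_on {0..T}) = - (\<integral>t. z t * \<psi> t \<partial>lebesgue_on {0..T})"
proof -
  let ?L = "lebesgue_on {0..T}"
  have fin: "finite_measure ?L" by (intro finite_measure_lebesgue_on) auto
  interpret L: finite_measure ?L by (rule fin)
  interpret LL: pair_sigma_finite ?L ?L ..
  have zm[measurable]: "z \<in> borel_measurable ?L" using z by auto
  have dm[measurable]: "deriv \<psi> \<in> borel_measurable ?L"
    using deriv_test_fun(2)[OF \<psi>] by (rule continuous_on_measurable_lebesgue_on)
  have [measurable]: "(\<lambda>x. x) \<in> ?L \<rightarrow>\<^sub>M borel" by (rule continuous_on_measurable_lebesgue_on) (rule continuous_on_id)
  obtain B where B: "\<And>t. \<bar>deriv \<psi> t\<bar> \<le> B"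
  proof -
    obtain B where "\<And>t. \<bar>frechet_derivative \<psi> (at t) 1\<bar> \<le> B" using test_fun_partial_bounded[OF \<psi>, of 1] by auto
    moreover have "frechet_derivative \<psi> (at t) 1 = deriv \<psi> t" for t
      using frechet_derivative_at[OF has_field_derivative_imp_has_derivative[OF deriv_test_fun(1)[OF \<psi>, of t]], symmetric] by simp
    ultimately show ?thesis using that by auto
  qed
  define h where "h = (\<lambda>(t, s). deriv \<psi> t * (z s * (if s \<le> t then 1 else 0)))"
  have hm[measurable]: "h \<in> borel_measurable (?L \<Otimes>\<^sub>M ?L)" unfolding h_def by measurable
  have sl: "integrable ?L (\<lambda>s. h (t, s))" for t
  proof (rule Bochner_Integration.integrable_bound)
    show "integrable ?L (\<lambda>s. B * \<bar>z s\<bar>)" using z by simp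
    show "AE s in ?L. norm (h (t, s)) \<le> norm (B * \<bar>z s\<bar>)"
      using B[of t] by (intro AE_I2) (auto simp: h_def abs_mult intro!: mult_right_mono)
  qed (unfold h_def, simp)
  have hi: "integrable (?L \<Otimes>\<^sub>M ?L) h"
  proof (rule LL.Fubini_integrable[OF hm])
    show "integrable ?L (\<lambda>t. \<integral>s. norm (h (t, s)) \<partial>?L)"
    proof (rule L.integrable_const_bound[where B="B * (\<integral>s. \<bar>z s\<bar> \<partial>?L)"])
      have "(\<integral>s. norm (h (t, s)) \<partial>?L) \<le> (\<integral>s. B * \<bar>z s\<bar> \<partial>?L)" for t
      proof (rule integral_mono[OF integrable_norm[OF sl]])
        show "norm (h (t, s)) \<le> B * \<bar>z s\<bar>" for s
          using B[of t] order_trans[OF abs_ge_zero B[of t]] by (auto simp: h_def abs_mult intro!: mult_right_mono)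
      qed (use z in simp)
      then show "AE t in ?L. norm (\<integral>s. norm (h (t, s)) \<partial>?L) \<le> B * (\<integral>s. \<bar>z s\<bar> \<partial>?L)"
        by (intro AE_I2) (simp add: integral_nonneg_AE)
    qed simp
    show "AE t in ?L. integrable ?L (\<lambda>s. h (t, s))" using sl by simp
  qed
  have 1: "(\<integral>s. h (t, s) \<partial>?L) = integral_from_to 0 t z * deriv \<psi> t" if "t \<in> {0..T}" for t
  proof -
    have "(\<integral>s. h (t, s) \<partial>?L) = (\<integral>s. deriv \<psi> t * (indicator {0..t} s * z s) \<partial>?L)"
      by (rule Bochner_Integration.integral_cong) (auto simp: h_def indicator_def space_restrict_space)
    then show ?thesis using integral_from_to_indicator[of 0 t T z] that by simp
  qed
  have 2: "(\<integral>t. h (t, s) \<partial>?L) = - (z s * \<psi> s)" if s: "s \<in> {0..T}" for s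
  proof -
    have "(\<integral>t. h (t, s) \<partial>?L) = (\<integral>t. z s * (indicator {s..T} t * deriv \<psi> t) \<partial>?L)"
      by (rule Bochner_Integration.integral_cong) (auto simp: h_def indicator_def space_restrict_space)
    also have "\<dots> = z s * integral_from_to s T (deriv \<psi>)" using s by (subst integral_from_to_indicator[of s T T]) auto
    also have "integral_from_to s T (deriv \<psi>) = integral {s..T} (deriv \<psi>)"
      using s by (intro integral_from_to_eq[where T=T] continuous_on_integrable deriv_test_fun(2)[OF \<psi>]) auto
    also have "\<dots> = \<psi> T - \<psi> s"
    proof (rule integral_unique, rule fundamental_theorem_of_calculus)
      show "(\<psi> has_vector_derivative deriv \<psi> x) (at x within {s..T})" for x
        using deriv_test_fun(1)[OF \<psi>, of x]
        by (simp add: has_real_derivative_iff_has_vector_derivative has_vector_derivative_at_within)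
    qed (use s in auto)
    also have "\<psi> T = 0" by (rule test_fun_outside[OF \<psi>]) simp
    finally show ?thesis by simp
  qed
  have "(\<integral>t. integral_from_to 0 t z * deriv \<psi> t \<partial>?L) = (\<integral>t. \<integral>s. h (t, s) \<partial>?L \<partial>?L)"
    by (rule Bochner_Integration.integral_cong) (use 1 in \<open>auto simp: space_restrict_space\<close>)
  also have "\<dots> = (\<integral>s. \<integral>t. h (t, s) \<partial>?L \<partial>?L)"
    using LL.Fubini_integral[of "\<lambda>t s. h (t, s)"] hi by simp
  also have "\<dots> = (\<integral>s. - (z s * \<psi> s) \<partial>?L)"
    by (rule Bochner_Integration.integral_cong) (use 2 in \<open>auto simp: space_restrict_space\<close>)
  finally show ?thesis by simp
qed

text \<open>Subtracting the primitive of \<open>z\<close> leaves \<open>Y\<close>, which is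
  orthogonal to the derivatives of test functions, that is, to the test functions of integral zero.
  Every test function becomes one of these after subtraction of a multiple of a fixed bump, so
  \<open>Y\<close> minus a constant is orthogonal to all of them.\<close>

lemma du_Bois_Reymond:
  fixes y z :: "real \<Rightarrow> real"
  assumes T: "T > 0" and y: "integrable (lebesgue_on {0..T}) y" and z: "integrable (lebesgue_on {0..T}) z"
    and w: "\<And>\<psi>. \<psi> \<in> test_fun {0<..<T} \<Longrightarrow>
      (\<integral>t. y t * deriv \<psi> t \<partial>lebesgue_on {0..T}) = - (\<integral>t. z t * \<psi> t \<partial>lebesgue_on {0..T})"
  obtains c where "AE t in lebesgue_on {0..T}. y t = c + integral_from_to 0 t z"
proof -
  let ?L = "lebesgue_on {0..T}" and ?I = "{0<..<T}"
  have fin: "finite_measure ?L" by (intro finite_measure_lebesgue_on) auto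
  interpret L: finite_measure ?L by (rule fin)
  define Y where "Y t = y t - integral_from_to 0 t z" for t
  have Zc: "continuous_on {0..T} (\<lambda>t. integral_from_to 0 t z)" by (rule integral_from_to_continuous[OF z])
  then have Zi: "integrable ?L (\<lambda>t. integral_from_to 0 t z)"
    by (rule continuous_on_integrable)
  then have Yi: "integrable ?L Y" unfolding Y_def using y by simp
  have bi: "integrable ?L (\<lambda>t. f t * \<omega> t)" if "integrable ?L f" "continuous_on UNIV \<omega>" "\<And>t. \<bar>\<omega> t\<bar> \<le> B" for f \<omega> :: "real \<Rightarrow> real" and B
  proof (rule Bochner_Integration.integrable_bound)
    show "integrable ?L (\<lambda>t. B * \<bar>f t\<bar>)" using that by simp
    show "(\<lambda>t. f t * \<omega> t) \<in> borel_measurable ?L"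
      using that continuous_on_measurable_lebesgue_on[of \<omega>] by (intro borel_measurable_times) auto
    show "AE t in ?L. norm (f t * \<omega> t) \<le> norm (B * \<bar>f t\<bar>)"
    proof (intro AE_I2)
      fix t have "\<bar>\<omega> t\<bar> \<le> \<bar>B\<bar>" using that(3)[of t] by linarith
      then show "norm (f t * \<omega> t) \<le> norm (B * \<bar>f t\<bar>)"
        using mult_left_mono[of "\<bar>\<omega> t\<bar>" "\<bar>B\<bar>" "\<bar>f t\<bar>"] by (simp add: abs_mult mult.commute)
    qed
  qed
  have bt: "integrable ?L (\<lambda>t. f t * \<omega> t)" if f: "integrable ?L f" and \<omega>: "\<omega> \<in> test_fun ?I" for f \<omega>
    using test_fun_bounded[OF \<omega>] bi[OF f test_fun_continuous[OF \<omega>]] by metis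
  have t1: "integrable ?L \<omega>" if "\<omega> \<in> test_fun ?I" for \<omega>
    using bt[OF _ that, of "\<lambda>t. 1"] L.integrable_const by simp
  have Y0: "(\<integral>t. Y t * \<theta> t \<partial>?L) = 0" if \<theta>: "\<theta> \<in> test_fun ?I" "(\<integral>t. \<theta> t \<partial>?L) = 0" for \<theta>
  proof -
    obtain \<psi> where \<psi>: "\<psi> \<in> test_fun ?I" "deriv \<psi> = \<theta>" by (rule test_fun_primitive[OF T \<theta>])
    have "(\<integral>t. Y t * \<theta> t \<partial>?L) = (\<integral>t. y t * \<theta> t \<partial>?L) - (\<integral>t. integral_from_to 0 t z * \<theta> t \<partial>?L)"
      unfolding Y_def left_diff_distrib by (intro Bochner_Integration.integral_diff bt y Zi \<theta>)
    then show ?thesis using w[OF \<psi>(1)] primitive_by_parts[OF T z \<psi>(1)] unfolding \<psi>(2) by simp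
  qed
  define \<theta>0 where "\<theta>0 = box_bump (T/4) (3*T/4) 1"
  have \<theta>0: "\<theta>0 \<in> test_fun ?I" unfolding \<theta>0_def using T by (intro box_bump_test_fun) auto
  define a0 where "a0 = (\<integral>t. \<theta>0 t \<partial>?L)"
  \<comment> \<open>The bump is positive on an open interval, which is not a null set.\<close>
  have a0: "a0 \<noteq> 0"
  proof
    assume "a0 = 0"
    then have "AE t in ?L. \<theta>0 t = 0"
      unfolding a0_def using integral_nonneg_eq_0_iff_AE[OF t1[OF \<theta>0]] box_bump_bounds(1)[of 1] by (auto simp: \<theta>0_def)
    then have "AE t in ?L. t \<notin> {T/4<..<3*T/4}"
      by eventually_elim (use box_bump_pos[of _ "T/4" "3*T/4" 1] in \<open>force simp: \<theta>0_def\<close>)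
    then have "AE t in lebesgue. t \<in> {0..T} \<longrightarrow> t \<notin> {T/4<..<3*T/4}"
      by (subst (asm) AE_lebesgue_on_iff) auto
    then have "AE t in lebesgue. t \<notin> {T/4<..<3*T/4}"
      by eventually_elim (use T in auto)
    then have "{t. \<not> t \<notin> {T/4<..<3*T/4}} \<in> null_sets lebesgue"
      unfolding completion.AE_iff_null_sets by simp
    then have "negligible {T/4<..<3*T/4}" unfolding negligible_iff_null_sets by (simp only: not_not Collect_mem_eq)
    then show False using open_not_negligible[of "{T/4<..<3*T/4}"] T by simp
  qed
  define c where "c = (\<integral>t. Y t * \<theta>0 t \<partial>?L) / a0"
  have main: "(\<integral>t. (Y t - c) * \<omega> t \<partial>?L) = 0" if \<omega>: "\<omega> \<in> test_fun ?I" for \<omega>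
  proof -
    \<comment> \<open>The multiple of the bump that has the same integral as \<omega>.\<close>
    let ?k = "(\<integral>t. \<omega> t \<partial>?L) / a0"
    obtain a b where ab: "0 < a" "a < b" "b < T" "\<And>t. t \<notin> {a..b} \<Longrightarrow> \<omega> t = 0" using test_fun_real_support[OF \<omega> T] by metis
    obtain a' b' where ab': "0 < a'" "a' < b'" "b' < T" "\<And>t. t \<notin> {a'..b'} \<Longrightarrow> \<theta>0 t = 0" using test_fun_real_support[OF \<theta>0 T] by metis
    have "(\<lambda>t. \<omega> t + (- ?k) * \<theta>0 t) \<in> test_fun ?I"
    proof (rule test_funI[of _ "min a a'" "max b b'"])
      show "C_k k (\<lambda>t. \<omega> t + (- ?k) * \<theta>0 t)" for k
        by (intro C_k_add C_k_cmult test_fun_C_k[OF \<omega>] test_fun_C_k[OF \<theta>0])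
      show "\<omega> t + (- ?k) * \<theta>0 t = 0" if "t \<notin> cbox (min a a') (max b b')" for t
      proof -
        have "t \<notin> {a..b}" "t \<notin> {a'..b'}" using that by auto
        then show ?thesis using ab(4) ab'(4) by simp
      qed
    qed (use ab ab' in auto)
    moreover have "(\<integral>t. \<omega> t + (- ?k) * \<theta>0 t \<partial>?L) = 0"
      using t1[OF \<omega>] t1[OF \<theta>0] a0 by (simp add: a0_def[symmetric])
    ultimately have "(\<integral>t. Y t * (\<omega> t + (- ?k) * \<theta>0 t) \<partial>?L) = 0" by (rule Y0)
    also have "(\<lambda>t. Y t * (\<omega> t + (- ?k) * \<theta>0 t)) = (\<lambda>t. Y t * \<omega> t - ?k * (Y t * \<theta>0 t))" by (auto simp: algebra_simps)
    also have "(\<integral>t. Y t * \<omega> t - ?k * (Y t * \<theta>0 t) \<partial>?L) = (\<integral>t. Y t * \<omega> t \<partial>?L) - c * (\<integral>t. \<omega> t \<partial>?L)"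
      using bt[OF Yi \<omega>] bt[OF Yi \<theta>0] by (simp add: c_def)
    finally show ?thesis using bt[OF Yi \<omega>] t1[OF \<omega>] by (simp add: left_diff_distrib)
  qed
  have "AE t in lebesgue_on ?I. Y t - c = 0"
  proof (rule fundamental_lemma_of_calculus_of_variations)
    show "integrable (lebesgue_on ?I) (\<lambda>t. Y t - c)"
      by (rule integrable_lebesgue_on_subset[of "{0..T}"]) (use Yi L.integrable_const in auto)
    fix \<psi> assume \<psi>: "\<psi> \<in> test_fun ?I"
    have "(\<integral>t. (Y t - c) * \<psi> t \<partial>lebesgue_on ?I) = (\<integral>t. (if t \<in> ?I then (Y t - c) * \<psi> t else 0) \<partial>?L)"
      by (rule integral_restrict[symmetric]) auto
    also have "(\<lambda>t. if t \<in> ?I then (Y t - c) * \<psi> t else 0) = (\<lambda>t. (Y t - c) * \<psi> t)"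
      using test_fun_outside[OF \<psi>] by auto
    finally show "(\<integral>t. (Y t - c) * \<psi> t \<partial>lebesgue_on ?I) = 0" using main[OF \<psi>] by simp
  qed auto
  then have "AE t in lebesgue. t \<in> ?I \<longrightarrow> Y t - c = 0" by (simp add: AE_lebesgue_on_iff)
  \<comment> \<open>The fundamental lemma concerns the open interval; the end points are a null
    set.\<close>
  moreover have "AE t in lebesgue. t \<notin> {0, T}"
    by (rule AE_not_in) (simp add: negligible_iff_null_sets[symmetric])
  ultimately have "AE t in lebesgue. t \<in> {0..T} \<longrightarrow> y t = c + integral_from_to 0 t z"
    by eventually_elim (auto simp: Y_def less_le)
  then show ?thesis using that by (simp add: AE_lebesgue_on_iff)
qed

section \<open>Strongly measurable functions\<close>

lemma simple_function_apply_measurable: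
  fixes \<Lambda> :: "'t \<Rightarrow> 'v \<Rightarrow> real"
  assumes s: "simple_function M s" and \<Lambda>: "\<And>q. q \<in> s ` space M \<Longrightarrow> (\<lambda>t. \<Lambda> t q) \<in> borel_measurable M"
  shows "(\<lambda>t. \<Lambda> t (s t)) \<in> borel_measurable M"
proof -
  have fin: "finite (s ` space M)" using s by (simp add: simple_function_def)
  have meas: "(\<lambda>t. \<Sum>q\<in>s ` space M. indicator (s -` {q} \<inter> space M) t * \<Lambda> t q) \<in> borel_measurable M"
    using s \<Lambda> by (intro borel_measurable_sum borel_measurable_times borel_measurable_indicator) (auto simp: simple_function_def)
  have "(\<Sum>q\<in>s ` space M. indicator (s -` {q} \<inter> space M) t * \<Lambda> t q) = \<Lambda> t (s t)" if "t \<in> space M" for t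
  proof -
    have "(\<Sum>q\<in>s ` space M. indicator (s -` {q} \<inter> space M) t * \<Lambda> t q) = (\<Sum>q\<in>s ` space M. if q = s t then \<Lambda> t q else 0)"
      using that by (intro sum.cong) (auto simp: indicator_def)
    then show ?thesis using fin that by simp
  qed
  from iffD1[OF measurable_cong[OF this] meas] show ?thesis by simp
qed

text \<open>A condition of Caratheodory type: \<Lambda> is measurable in time for each fixed vector
  and continuous in the vector for almost every time. It applies to functionals that change with
  time, such as \<open>etat t\<close>, and involves no sigma-algebra on the space of
  functions.\<close>

lemma strongly_measurable_apply:
  fixes \<Lambda> :: "real \<Rightarrow> ('a \<Rightarrow> 'b::ab_group_add) \<Rightarrow> real"
  assumes F: "strongly_measurable T X N F"
    and \<Lambda>: "\<And>q. q \<in> X \<Longrightarrow> (\<lambda>t. \<Lambda> t q) \<in> borel_measurable (lebesgue_on {0..T})"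
    and cont: "AE t in lebesgue_on {0..T}. \<forall>v\<in>X. \<forall>s. (\<forall>n. s n \<in> X) \<longrightarrow> (\<lambda>n. N (\<lambda>x. s n x - v x)) \<longlonglongrightarrow> 0 \<longrightarrow> (\<lambda>n. \<Lambda> t (s n)) \<longlonglongrightarrow> \<Lambda> t v"
  shows "(\<lambda>t. \<Lambda> t (F t)) \<in> borel_measurable (lebesgue_on {0..T})"
proof -
  obtain s where s0: "(\<forall>n. simple_function (lebesgue_on {0..T}) (s n) \<and> s n ` {0..T} \<subseteq> X) \<and>
      (AE t in lebesgue_on {0..T}. F t \<in> X \<and> (\<lambda>n. N (s n t - F t)) \<longlonglongrightarrow> 0)"
    using F[unfolded strongly_measurable_def] by (rule exE)
  note s = conjunct1[OF spec[OF conjunct1[OF s0]]] conjunct2[OF spec[OF conjunct1[OF s0]]] conjunct2[OF s0]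
  show ?thesis
  proof (rule AE_limit_measurable_lebesgue_on)
    show "(\<lambda>t. \<Lambda> t (s n t)) \<in> borel_measurable (lebesgue_on {0..T})" for n
    proof (rule simple_function_apply_measurable[OF s(1)])
      show "(\<lambda>t. \<Lambda> t q) \<in> borel_measurable (lebesgue_on {0..T})" if "q \<in> s n ` space (lebesgue_on {0..T})" for q
        by (rule \<Lambda>) (use s(2)[of n] that in \<open>auto simp: space_restrict_space\<close>)
    qed
    have "AE t in lebesgue_on {0..T}. t \<in> {0..T}" by (auto simp: AE_restrict_space_iff)
    with s(3) cont show "AE t in lebesgue_on {0..T}. (\<lambda>n. \<Lambda> t (s n t)) \<longlonglongrightarrow> \<Lambda> t (F t)"
    proof eventually_elim
      case (elim t)
      have "s n t \<in> X" for n using s(2) elim(3) by blast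
      then show ?case using elim by (simp add: fun_diff_def)
    qed
  qed simp
qed

section \<open>Approximation in Bochner spaces by finite combinations with continuous
  coefficients\<close>

lemma indicator_continuous_approx:
  fixes A :: "real set"
  assumes "A \<in> sets lebesgue" "e > 0"
  obtains g D where "continuous_on UNIV g" "D \<in> sets lebesgue" "emeasure lebesgue D < ennreal e"
    "\<And>t. \<bar>indicator A t - g t\<bar> \<le> (indicator D t :: real)"
proof -
  obtain C where C: "closed C" "C \<subseteq> A" "A - C \<in> lmeasurable" "emeasure lebesgue (A - C) < ennreal (e/2)"
    using sets_lebesgue_inner_closed[OF assms(1), of "e/2"] assms(2) by auto
  obtain U where U: "open U" "A \<subseteq> U" "U - A \<in> lmeasurable" "emeasure lebesgue (U - A) < ennreal (e/2)"
    using sets_lebesgue_outer_open[OF assms(1), of "e/2"] assms(2) by auto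
  \<comment> \<open>\<open>g\<close> and the indicator agree on \<open>C\<close> and off
    \<open>U\<close>; elsewhere they differ by at most 1, as \<open>g\<close> has values in
    [0, 1].\<close>
  obtain g :: "real \<Rightarrow> real" where g: "continuous_on UNIV g" "\<And>x. g x \<in> closed_segment 1 0" "\<And>x. x \<in> C \<Longrightarrow> g x = 1" "\<And>x. x \<in> - U \<Longrightarrow> g x = 0"
    by (rule Urysohn[of C "- U"]) (use C U in auto)
  let ?D = "(A - C) \<union> (U - A)"
  have g01: "0 \<le> g x" "g x \<le> 1" for x using g(2)[of x] by (auto simp: closed_segment_eq_real_ivl)
  show ?thesis
  proof (rule that[OF g(1)])
    show "?D \<in> sets lebesgue" using C U by auto
    have "emeasure lebesgue ?D \<le> emeasure lebesgue (A - C) + emeasure lebesgue (U - A)"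
      using C U by (intro emeasure_subadditive) auto
    also have "\<dots> < ennreal (e/2) + ennreal (e/2)" using C U by (intro add_strict_mono) auto
    also have "\<dots> = ennreal e" using assms(2) by (simp flip: ennreal_plus)
    finally show "emeasure lebesgue ?D < ennreal e" .
    show "\<bar>indicator A t - g t\<bar> \<le> (indicator ?D t :: real)" for t
    proof (cases "t \<in> ?D")
      case True
      then show ?thesis using g01[of t] by (simp add: indicator_def abs_le_iff)
    next
      case False
      then have "t \<in> C \<or> t \<in> - U" by auto
      then show ?thesis using g(3,4)[of t] False C U by (auto simp: indicator_def)
    qed
  qed
qed

context seminormed_functions
begin

lemma norm_measurable:
  assumes "strongly_measurable T X N F"
  shows "(\<lambda>t. N (F t)) \<in> borel_measurable (lebesgue_on {0..T})"
  by (rule strongly_measurable_apply[OF assms, where \<Lambda>="\<lambda>t. N"]) (auto intro: norm_tendsto)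

lemma strongly_measurable_AE_mem:
  "strongly_measurable T X N F \<Longrightarrow> AE t in lebesgue_on {0..T}. F t \<in> X"
  unfolding strongly_measurable_def by (auto elim: AE_mp)

text \<open>Strong measurability gives pointwise approximation without a common bound. Replacing the
  approximation by 0 where its error exceeds 1 keeps the error below \<open>1 + N (F t)\<close>,
  which permits dominated convergence.\<close>

lemma Bochner_L2_simple_approx:
  assumes F: "F \<in> Bochner_L2 T X N" and e: "e > 0"
  obtains s where "simple_function (lebesgue_on {0..T}) s" "s ` {0..T} \<subseteq> X"
    "integrable (lebesgue_on {0..T}) (\<lambda>t. (N (\<lambda>x. F t x - s t x))\<^sup>2)"
    "(\<integral>t. (N (\<lambda>x. F t x - s t x))\<^sup>2 \<partial>lebesgue_on {0..T}) < e"
proof -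
  let ?L = "lebesgue_on {0..T}"
  interpret L: finite_measure ?L by (intro finite_measure_lebesgue_on) auto
  have sm: "strongly_measurable T X N F" and F2: "integrable ?L (\<lambda>t. (N (F t))\<^sup>2)"
    using F by (auto simp: Bochner_L2_def)
  obtain s where s0: "(\<forall>n. simple_function ?L (s n) \<and> s n ` {0..T} \<subseteq> X) \<and>
      (AE t in ?L. F t \<in> X \<and> (\<lambda>n. N (s n t - F t)) \<longlonglongrightarrow> 0)"
    using sm[unfolded strongly_measurable_def] by (rule exE)
  note s = conjunct1[OF spec[OF conjunct1[OF s0]]] conjunct2[OF spec[OF conjunct1[OF s0]]] conjunct2[OF s0]
  have diffm: "(\<lambda>t. N (\<lambda>x. F t x - r t x)) \<in> borel_measurable ?L"
    if r: "simple_function ?L r" "r ` {0..T} \<subseteq> X" for r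
  proof (rule strongly_measurable_apply[OF sm, where \<Lambda>="\<lambda>t q. N (\<lambda>x. q x - r t x)"])
    show "(\<lambda>t. N (\<lambda>x. q x - r t x)) \<in> borel_measurable ?L" for q
      using borel_measurable_simple_function[OF simple_function_compose[OF r(1), of "\<lambda>y. N (\<lambda>x. q x - y x)"]]
      by (simp add: comp_def)
    have "AE t in ?L. t \<in> {0..T}" by (auto simp: AE_restrict_space_iff)
    then show "AE t in ?L. \<forall>v\<in>X. \<forall>s. (\<forall>n. s n \<in> X) \<longrightarrow> (\<lambda>n. N (\<lambda>x. s n x - v x)) \<longlonglongrightarrow> 0 \<longrightarrow>
        (\<lambda>n. N (\<lambda>x. s n x - r t x)) \<longlonglongrightarrow> N (\<lambda>x. v x - r t x)"
    proof (eventually_elim, intro ballI allI impI)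
      fix t v s assume t: "t \<in> {0..T}" "v \<in> X" "\<forall>n. s n \<in> X" "(\<lambda>n. N (\<lambda>x. s n x - v x)) \<longlonglongrightarrow> 0"
      have rt: "r t \<in> X" using r(2) t(1) by blast
      show "(\<lambda>n. N (\<lambda>x. s n x - r t x)) \<longlonglongrightarrow> N (\<lambda>x. v x - r t x)"
        by (rule norm_tendsto) (use t rt in \<open>auto intro: diff_mem\<close>)
    qed
  qed
  define r where "r n t = (if N (\<lambda>x. F t x - s n t x) \<le> 1 then s n t else (\<lambda>x. 0))" for n t
  have rs: "simple_function ?L (r n)" for n
  proof -
    have [measurable]: "(\<lambda>t. N (\<lambda>x. F t x - s n t x)) \<in> borel_measurable ?L" by (rule diffm[OF s(1,2)])
    show ?thesis unfolding r_def by (rule simple_function_If[OF s(1) simple_function_const]) measurable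
  qed
  have rX: "r n ` {0..T} \<subseteq> X" for n using s(2)[of n] by (auto simp: r_def zero_mem)
  have AEX: "AE t in ?L. F t \<in> X \<and> t \<in> {0..T}"
    using strongly_measurable_AE_mem[OF sm] by (auto simp: AE_restrict_space_iff elim: AE_mp)
  define w where "w t = 2 + 2 * (N (F t))\<^sup>2" for t
  have wi: "integrable ?L w" unfolding w_def using F2 by (intro Bochner_Integration.integrable_add) auto
  have dom: "AE t in ?L. norm ((N (\<lambda>x. F t x - r n t x))\<^sup>2) \<le> w t" for n
    using AEX
  proof eventually_elim
    case (elim t)
    have "r n t \<in> X" using rX elim by blast
    then have "0 \<le> N (\<lambda>x. F t x - r n t x)" using elim by (intro nonneg diff_mem) auto
    moreover have "N (\<lambda>x. F t x - r n t x) \<le> 1 + N (F t)" using elim nonneg[of "F t"] by (auto simp: r_def)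
    ultimately have "(N (\<lambda>x. F t x - r n t x))\<^sup>2 \<le> (1 + N (F t))\<^sup>2" by (intro power_mono)
    also have "\<dots> \<le> w t" unfolding w_def using sum_squares_bound[of 1 "N (F t)"] by (simp add: power2_sum)
    finally show ?case by simp
  qed
  have lim: "AE t in ?L. (\<lambda>n. (N (\<lambda>x. F t x - r n t x))\<^sup>2) \<longlonglongrightarrow> 0"
    using s(3) AEX
  proof eventually_elim
    case (elim t)
    have sX: "s n t \<in> X" for n using s(2) elim by blast
    have l: "(\<lambda>n. N (\<lambda>x. F t x - s n t x)) \<longlonglongrightarrow> 0"
      using elim sX minus_commute[of "F t"] by (simp add: fun_diff_def)
    then have "\<forall>\<^sub>F n in sequentially. N (\<lambda>x. F t x - s n t x) < 1" by (rule order_tendstoD) simp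
    then have "\<forall>\<^sub>F n in sequentially. N (\<lambda>x. F t x - s n t x) = N (\<lambda>x. F t x - r n t x)"
      by eventually_elim (simp add: r_def)
    with l have "(\<lambda>n. N (\<lambda>x. F t x - r n t x)) \<longlonglongrightarrow> 0" by (rule Lim_transform_eventually)
    from tendsto_power[OF this, of 2] show ?case by simp
  qed
  have meas: "(\<lambda>t. (N (\<lambda>x. F t x - r n t x))\<^sup>2) \<in> borel_measurable ?L" for n
    using diffm[OF rs rX] by simp
  have "(\<lambda>n. \<integral>t. (N (\<lambda>x. F t x - r n t x))\<^sup>2 \<partial>?L) \<longlonglongrightarrow> (\<integral>t. 0 \<partial>?L)"
    by (rule integral_dominated_convergence[OF _ meas wi lim dom]) simp
  then have "(\<lambda>n. \<integral>t. (N (\<lambda>x. F t x - r n t x))\<^sup>2 \<partial>?L) \<longlonglongrightarrow> 0" by simp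
  then have "\<forall>\<^sub>F n in sequentially. (\<integral>t. (N (\<lambda>x. F t x - r n t x))\<^sup>2 \<partial>?L) < e"
    using e by (rule order_tendstoD)
  then obtain n where n: "(\<integral>t. (N (\<lambda>x. F t x - r n t x))\<^sup>2 \<partial>?L) < e"
    by (auto simp: eventually_sequentially)
  moreover have "integrable ?L (\<lambda>t. (N (\<lambda>x. F t x - r n t x))\<^sup>2)"
    by (rule Bochner_Integration.integrable_bound[OF wi meas]) (use dom[of n] in \<open>eventually_elim; simp\<close>)
  ultimately show ?thesis using that[OF rs rX] by blast
qed

text \<open>The indicators of the level sets of a simple approximation are replaced by continuous
  functions. The error is expressed by a measurable majorant \<open>n\<close> that holds at every
  time with \<open>F t\<close> in \<open>X\<close>, so that it can be evaluated at chosen points of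
  time.\<close>

lemma Bochner_L2_continuous_approx:
  assumes F: "F \<in> Bochner_L2 T X N" and e: "e > 0"
  obtains Q :: "('a \<Rightarrow> 'b) set" and g :: "('a \<Rightarrow> 'b) \<Rightarrow> real \<Rightarrow> real" and n :: "real \<Rightarrow> real" where
    "finite Q" "Q \<subseteq> X" "\<And>q. q \<in> Q \<Longrightarrow> continuous_on UNIV (g q)" "integrable (lebesgue_on {0..T}) (\<lambda>t. (n t)\<^sup>2)"
    "n \<in> borel_measurable (lebesgue_on {0..T})"
    "(\<integral>t. (n t)\<^sup>2 \<partial>lebesgue_on {0..T}) < e" "\<And>t. t \<in> {0..T} \<Longrightarrow> F t \<in> X \<Longrightarrow> N (\<lambda>x. F t x - (\<Sum>q\<in>Q. g q t *\<^sub>R q x)) \<le> n t"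
proof -
  let ?L = "lebesgue_on {0..T}"
  interpret L: finite_measure ?L by (intro finite_measure_lebesgue_on) auto
  obtain s where s: "simple_function ?L s" "s ` {0..T} \<subseteq> X"
    "integrable ?L (\<lambda>t. (N (\<lambda>x. F t x - s t x))\<^sup>2)" "(\<integral>t. (N (\<lambda>x. F t x - s t x))\<^sup>2 \<partial>?L) < e / 4"
    using Bochner_L2_simple_approx[OF F, of "e/4"] e by auto
  define Q where "Q = s ` {0..T}"
  have Q: "finite Q" "Q \<subseteq> X" using s by (auto simp: Q_def simple_function_def space_restrict_space)
  define S where "S = (\<Sum>q\<in>Q. N q)"
  have S0: "S \<ge> 0" unfolding S_def using Q nonneg by (intro sum_nonneg) auto
  \<comment> \<open>The function \<open>k\<close> below is at most \<open>S\<close> and has integral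
    at most \<open>S * \<delta>\<close>, so its square contributes at most
    \<open>S^2 * \<delta>\<close>; the summand 1 allows for \<open>S = 0\<close>.\<close>
  define \<delta> where "\<delta> = e / (4 * (S\<^sup>2 + 1))"
  have S1: "S\<^sup>2 + 1 > 0" by (simp add: add_nonneg_pos)
  have \<delta>: "\<delta> > 0" "S\<^sup>2 * \<delta> \<le> e / 4" using e S1 by (auto simp: \<delta>_def field_simps)
  have A: "s -` {q} \<inter> {0..T} \<in> sets lebesgue" for q
  proof -
    have "s -` {q} \<inter> {0..T} \<in> sets ?L" using simple_functionD(2)[OF s(1), of "{q}"] by (simp add: space_restrict_space)
    then show ?thesis by (simp add: sets_restrict_space_iff)
  qed
  have "\<forall>q. \<exists>g D. continuous_on UNIV g \<and> D \<in> sets lebesgue \<and> emeasure lebesgue D < ennreal \<delta> \<and>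
      (\<forall>t. \<bar>indicator (s -` {q} \<inter> {0..T}) t - g t\<bar> \<le> (indicator D t :: real))"
    by (intro allI, rule indicator_continuous_approx[OF A \<delta>(1)]) blast
  then obtain g D where gD: "\<And>q. continuous_on UNIV (g q)" "\<And>q. D q \<in> sets lebesgue" "\<And>q. emeasure lebesgue (D q) < ennreal \<delta>"
      "\<And>q t. \<bar>indicator (s -` {q} \<inter> {0..T}) t - g q t\<bar> \<le> (indicator (D q) t :: real)" by metis
  define k where "k t = (\<Sum>q\<in>Q. indicator (D q) t * N q)" for t :: real
  define n where "n t = N (\<lambda>x. F t x - s t x) + k t" for t
  have im: "(\<lambda>t. indicator (D q) t :: real) \<in> borel_measurable ?L" for q
    using measurable_restrict_space1[OF borel_measurable_indicator[OF gD(2)]] by blast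
  have Di: "integrable ?L (\<lambda>t. indicator (D q) t :: real)" for q
    by (rule L.integrable_const_bound[where B=1]) (use im in auto)
  have Dint: "(\<integral>t. indicator (D q) t \<partial>?L) \<le> \<delta>" for q
  proof -
    have "ennreal (\<integral>t. indicator (D q) t \<partial>?L) = (\<integral>\<^sup>+t. ennreal (indicator (D q) t) \<partial>?L)"
      by (rule nn_integral_eq_integral[symmetric, OF Di]) simp
    also have "\<dots> = (\<integral>\<^sup>+t. ennreal (indicator (D q) t) * indicator {0..T} t \<partial>lebesgue)"
      by (rule nn_integral_restrict_space) simp
    also have "\<dots> \<le> (\<integral>\<^sup>+t. indicator (D q) t \<partial>lebesgue)" by (rule nn_integral_mono) (auto simp: indicator_def)
    also have "\<dots> = emeasure lebesgue (D q)" using gD(2) by simp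
    also have "\<dots> \<le> ennreal \<delta>" using gD(3) by (rule less_imp_le)
    finally show ?thesis using \<delta> by (simp add: ennreal_le_iff)
  qed
  have k0: "0 \<le> k t" for t unfolding k_def using Q nonneg by (intro sum_nonneg) auto
  have kS: "k t \<le> S" for t
    unfolding k_def S_def using Q nonneg by (intro sum_mono) (auto simp: indicator_def)
  have ki: "integrable ?L k" unfolding k_def using Di by simp
  have kint: "(\<integral>t. k t \<partial>?L) \<le> S * \<delta>"
  proof -
    have "(\<integral>t. k t \<partial>?L) = (\<Sum>q\<in>Q. (\<integral>t. indicator (D q) t \<partial>?L) * N q)" unfolding k_def using Di by simp
    also have "\<dots> \<le> (\<Sum>q\<in>Q. \<delta> * N q)" using Dint Q nonneg by (intro sum_mono mult_right_mono) auto
    finally show ?thesis by (simp add: S_def sum_distrib_left mult.commute)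
  qed
  have Fsm: "(\<lambda>t. N (\<lambda>x. F t x - s t x)) \<in> borel_measurable ?L"
  proof -
    have [measurable]: "(\<lambda>t. (N (\<lambda>x. F t x - s t x))\<^sup>2) \<in> borel_measurable ?L" using s(3) by simp
    have "(\<lambda>t. sqrt ((N (\<lambda>x. F t x - s t x))\<^sup>2)) \<in> borel_measurable ?L" by measurable
    moreover have "AE t in ?L. sqrt ((N (\<lambda>x. F t x - s t x))\<^sup>2) = N (\<lambda>x. F t x - s t x)"
    proof -
      have "AE t in ?L. F t \<in> X \<and> t \<in> {0..T}"
        using strongly_measurable_AE_mem F by (auto simp: AE_restrict_space_iff Bochner_L2_def elim: AE_mp)
      then show ?thesis
      proof eventually_elim
        case (elim t)
        then have "N (\<lambda>x. F t x - s t x) \<ge> 0" using s(2) by (intro nonneg diff_mem) auto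
        then show ?case by simp
      qed
    qed
    ultimately show ?thesis by (rule AE_measurable_lebesgue_on[rotated]) simp
  qed
  have nm: "n \<in> borel_measurable ?L" unfolding n_def using Fsm ki by simp
  have nb: "(n t)\<^sup>2 \<le> 2 * (N (\<lambda>x. F t x - s t x))\<^sup>2 + 2 * (S * k t)" for t
  proof -
    have "(k t)\<^sup>2 \<le> S * k t" using k0[of t] kS[of t] by (simp add: power2_eq_square mult_right_mono)
    moreover have "(n t)\<^sup>2 \<le> 2 * (N (\<lambda>x. F t x - s t x))\<^sup>2 + 2 * (k t)\<^sup>2"
      unfolding n_def using sum_squares_bound[of "N (\<lambda>x. F t x - s t x)" "k t"] by (simp add: power2_sum)
    ultimately show ?thesis by argo
  qed
  have bi: "integrable ?L (\<lambda>t. 2 * (N (\<lambda>x. F t x - s t x))\<^sup>2 + 2 * (S * k t))" using s(3) ki by simp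
  have ni: "integrable ?L (\<lambda>t. (n t)\<^sup>2)"
    by (rule Bochner_Integration.integrable_bound[OF bi]) (use nm nb in \<open>auto intro!: AE_I2 order_trans[OF nb abs_ge_self]\<close>)
  have "(\<integral>t. (n t)\<^sup>2 \<partial>?L) \<le> (\<integral>t. 2 * (N (\<lambda>x. F t x - s t x))\<^sup>2 + 2 * (S * k t) \<partial>?L)"
    by (rule integral_mono[OF ni bi nb])
  also have "\<dots> = 2 * (\<integral>t. (N (\<lambda>x. F t x - s t x))\<^sup>2 \<partial>?L) + 2 * (S * (\<integral>t. k t \<partial>?L))" using s(3) ki by simp
  also have "\<dots> < 2 * (e / 4) + 2 * (e / 4)"
  proof -
    have "S * (\<integral>t. k t \<partial>?L) \<le> S * (S * \<delta>)" using kint S0 by (intro mult_left_mono)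
    also have "\<dots> \<le> e / 4" using \<delta>(2) by (simp add: power2_eq_square)
    finally show ?thesis using s(4) by argo
  qed
  finally have nint: "(\<integral>t. (n t)\<^sup>2 \<partial>?L) < e" by simp
  have est: "N (\<lambda>x. F t x - (\<Sum>q\<in>Q. g q t *\<^sub>R q x)) \<le> n t" if t: "t \<in> {0..T}" and Ft: "F t \<in> X" for t
  proof -
    have st: "s t \<in> X" "s t \<in> Q" using s(2) t by (auto simp: Q_def)
    have PX: "(\<lambda>x. \<Sum>q\<in>Q. g q t *\<^sub>R q x) \<in> X" using Q by (intro sum_mem[where v="\<lambda>q. q"]) auto
    have se: "s t x = (\<Sum>q\<in>Q. (indicator (s -` {q} \<inter> {0..T}) t :: real) *\<^sub>R q x)" for x
    proof -
      have "(\<Sum>q\<in>Q. (indicator (s -` {q} \<inter> {0..T}) t :: real) *\<^sub>R q x) = (\<Sum>q\<in>Q. if q = s t then q x else 0)"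
        using t by (intro sum.cong) (auto simp: indicator_def)
      then show ?thesis using Q(1) st(2) by simp
    qed
    have "N (\<lambda>x. F t x - (\<Sum>q\<in>Q. g q t *\<^sub>R q x)) \<le> N (\<lambda>x. F t x - s t x) + N (\<lambda>x. s t x - (\<Sum>q\<in>Q. g q t *\<^sub>R q x))"
      by (rule triangle_diff[OF Ft st(1) PX])
    also have "(\<lambda>x. s t x - (\<Sum>q\<in>Q. g q t *\<^sub>R q x)) = (\<lambda>x. \<Sum>q\<in>Q. (indicator (s -` {q} \<inter> {0..T}) t - g q t) *\<^sub>R q x)"
      unfolding scaleR_diff_left sum_subtractf by (rule ext) (simp only: se)
    also have "N \<dots> \<le> (\<Sum>q\<in>Q. \<bar>indicator (s -` {q} \<inter> {0..T}) t - g q t\<bar> * N q)"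
      using Q by (intro norm_sum) auto
    also have "\<dots> \<le> k t"
      unfolding k_def
    proof (intro sum_mono mult_right_mono)
      show "\<bar>indicator (s -` {q} \<inter> {0..T}) t - g q t\<bar> \<le> (indicator (D q) t :: real)" for q by (rule gD(4))
      show "0 \<le> N q" if "q \<in> Q" for q using Q nonneg that by blast
    qed
    finally show ?thesis by (simp only: n_def)
  qed
  show ?thesis by (rule that[OF Q gD(1) ni nm nint est])
qed

end

section \<open>The chain rule for the energy\<close>

text \<open>Otherwise \<open>f\<close> would exceed its mean by at least \<open>k / (b - a)\<close>
  almost everywhere on the interval. In this form Chebyshev's argument supplies points of small
  error inside a set \<open>G\<close> of full measure.\<close>

lemma AE_interval_point:
  fixes f :: "real \<Rightarrow> real"
  assumes f: "integrable (lebesgue_on {0..T}) f" and ab: "0 \<le> a" "a < b" "b \<le> T"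
    and G: "AE t in lebesgue_on {0..T}. t \<in> G" and k: "k > 0"
  shows "\<exists>\<tau>\<in>G. a < \<tau> \<and> \<tau> < b \<and> f \<tau> * (b - a) \<le> integral_from_to a b f + k"
proof (rule ccontr)
  assume neg: "\<not> ?thesis"
  let ?c = "(integral_from_to a b f + k) / (b - a)"
  have "AE t in lebesgue. t \<in> {0..T} \<longrightarrow> t \<in> G" using G by (simp add: AE_lebesgue_on_iff)
  moreover have "AE t in lebesgue. t \<notin> {a, b}"
    by (rule AE_not_in) (simp add: negligible_iff_null_sets[symmetric])
  ultimately have "AE t in lebesgue. t \<in> {a..b} \<longrightarrow> ?c \<le> f t"
  proof eventually_elim
    case (elim t)
    show ?case
    proof
      assume t: "t \<in> {a..b}"
      with elim ab have "t \<in> G" "a < t" "t < b" by auto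
      with neg have "f t * (b - a) > integral_from_to a b f + k" by force
      then show "?c \<le> f t" using ab by (simp add: field_simps)
    qed
  qed
  then have "AE t in lebesgue_on {a..b}. ?c \<le> f t" by (simp add: AE_lebesgue_on_iff)
  moreover have "integrable (lebesgue_on {a..b}) (\<lambda>t. ?c)" by (intro continuous_on_integrable continuous_on_const)
  ultimately have "(\<integral>t. ?c \<partial>lebesgue_on {a..b}) \<le> integral_from_to a b f"
    unfolding integral_from_to_def using integrable_subinterval[OF f ab(1,3)] by (intro integral_mono_AE)
  moreover have "(\<integral>t. ?c \<partial>lebesgue_on {a..b}) = integral_from_to a b f + k"
    using ab by (simp add: measure_restrict_space)
  ultimately show False using k by simp
qed

text \<open>The increments of \<open>\<Phi>\<close> are controlled by \<open>n\<close> at the end points, which are then chosen as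
  points of small \<open>n\<close> in the cells of a fine uniform partition.\<close>

lemma increments_bound:
  fixes \<Phi> n w :: "real \<Rightarrow> real"
  assumes n: "integrable (lebesgue_on {0..T}) (\<lambda>t. (n t)\<^sup>2)" and w: "integrable (lebesgue_on {0..T}) w"
    and G: "AE t in lebesgue_on {0..T}. t \<in> G" and e: "e > 0" and \<eta>: "\<eta> > 0"
    and st: "s \<in> G" "t \<in> G" "0 \<le> s" "s < t" "t \<le> T"
    and pair: "\<And>a b. a \<in> G \<Longrightarrow> b \<in> G \<Longrightarrow> 0 \<le> a \<Longrightarrow> a < b \<Longrightarrow> b \<le> T \<Longrightarrow> b - a \<le> \<eta> \<Longrightarrow>
      \<bar>\<Phi> b - \<Phi> a\<bar> \<le> (b - a) * ((n a)\<^sup>2 + (n b)\<^sup>2) / e + integral_from_to a b w"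
  shows "\<bar>\<Phi> t - \<Phi> s\<bar> \<le> 4 * (integral_from_to s t (\<lambda>t. (n t)\<^sup>2) + e\<^sup>2) / e + integral_from_to s t w"
proof -
  let ?n2 = "\<lambda>t. (n t)\<^sup>2"
  define c where "c = (n s)\<^sup>2 + (n t)\<^sup>2"
  have c0: "c \<ge> 0" by (simp add: c_def)
  \<comment> \<open>The mesh is fine enough for two purposes: points of neighbouring cells are at
    most \<eta> apart, and the prescribed end points \<open>s\<close> and \<open>t\<close>, at which
    \<open>n\<close> need not be small, contribute little.\<close>
  obtain K where K: "real K > max (2 * (t - s) / \<eta>) (2 * c * (t - s) / e\<^sup>2)" "K > 0"
  proof -
    obtain K where K: "real K > max (2 * (t - s) / \<eta>) (2 * c * (t - s) / e\<^sup>2)" using reals_Archimedean2 by blast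
    moreover have "2 * (t - s) / \<eta> > 0" using st \<eta> by simp
    ultimately have "real K > 0" by linarith
    then show ?thesis using that[OF K] by simp
  qed
  define \<delta> where "\<delta> = (t - s) / real K"
  have \<delta>: "\<delta> > 0" "2 * \<delta> \<le> \<eta>" "2 * (\<delta> * c) \<le> e\<^sup>2"
    using K st e \<eta> by (auto simp: \<delta>_def field_simps)
  have tK: "s + real K * \<delta> = t" using K by (simp add: \<delta>_def)
  define a where "a i = s + real i * \<delta>" for i :: nat
  have a: "0 \<le> a i" "a i < a (Suc i)" "a (Suc i) = a i + \<delta>" for i using \<delta> st by (auto simp: a_def algebra_simps)
  have aT: "a (Suc i) \<le> t" if "i < K" for i
  proof -
    have "real (Suc i) * \<delta> \<le> real K * \<delta>" using that \<delta> by (intro mult_right_mono) auto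
    then show ?thesis using tK by (simp add: a_def)
  qed
  \<comment> \<open>The slacks of the \<open>K\<close> cells add up to
    \<open>e^2 / 2\<close>.\<close>
  define \<kappa> where "\<kappa> = e\<^sup>2 / (2 * real K)"
  have \<kappa>: "\<kappa> > 0" using e K by (simp add: \<kappa>_def)
  have "\<exists>\<tau>\<in>G. a i < \<tau> \<and> \<tau> < a (Suc i) \<and> (n \<tau>)\<^sup>2 * \<delta> \<le> integral_from_to (a i) (a (Suc i)) ?n2 + \<kappa>" if "i < K" for i
    using AE_interval_point[OF n a(1,2) _ G \<kappa>, of i] aT[OF that] st a(3)[of i] by simp
  then obtain \<tau> where \<tau>: "\<And>i. i < K \<Longrightarrow> \<tau> i \<in> G" "\<And>i. i < K \<Longrightarrow> a i < \<tau> i" "\<And>i. i < K \<Longrightarrow> \<tau> i < a (Suc i)"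
    "\<And>i. i < K \<Longrightarrow> (n (\<tau> i))\<^sup>2 * \<delta> \<le> integral_from_to (a i) (a (Suc i)) ?n2 + \<kappa>" by metis
  \<comment> \<open>The points \<open>s\<close> and \<open>t\<close> together with one point in each
    of the \<open>K\<close> cells, which makes \<open>K + 1\<close> intervals.\<close>
  define x where "x i = (case i of 0 \<Rightarrow> s | Suc j \<Rightarrow> if j < K then \<tau> j else t)" for i
  have x0: "x 0 = s" "x (Suc K) = t" by (auto simp: x_def)
  have xG: "x i \<in> G" for i using \<tau>(1) st by (auto simp: x_def split: nat.split)
  have x1: "x i < x (Suc i) \<and> x (Suc i) - x i \<le> 2 * \<delta> \<and> 0 \<le> x i \<and> x (Suc i) \<le> t" if "i < Suc K" for i
  proof (cases i)
    case 0
    then show ?thesis using \<tau>(2,3)[of 0] K a(3)[of 0] aT[of 0] st \<delta> by (simp add: x_def a_def)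
  next
    case (Suc j)
    then have j: "j < K" using that by simp
    show ?thesis
    proof (cases "Suc j < K")
      case True
      then show ?thesis
        using \<tau>(2,3)[of j] \<tau>(2,3)[of "Suc j"] a(3)[of j] a(3)[of "Suc j"] a(1)[of j] aT[of "Suc j"] j by (simp add: x_def Suc)
    next
      case False
      then have "K = Suc j" using j by simp
      then have "a (Suc j) = t" using tK by (simp add: a_def)
      then show ?thesis using \<tau>(2,3)[OF j] a(3)[of j] a(1)[of j] j \<delta> \<open>K = Suc j\<close> by (simp add: x_def Suc)
    qed
  qed
  have "\<bar>\<Phi> t - \<Phi> s\<bar> = \<bar>\<Sum>i<Suc K. \<Phi> (x (Suc i)) - \<Phi> (x i)\<bar>"
    using sum_lessThan_telescope[of "\<lambda>i. \<Phi> (x i)" "Suc K"] x0 by simp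
  also have "\<dots> \<le> (\<Sum>i<Suc K. \<bar>\<Phi> (x (Suc i)) - \<Phi> (x i)\<bar>)" by (rule sum_abs)
  also have "\<dots> \<le> (\<Sum>i<Suc K. (2 * \<delta> / e) * ((n (x i))\<^sup>2 + (n (x (Suc i)))\<^sup>2)
      + (integral_from_to 0 (x (Suc i)) w - integral_from_to 0 (x i) w))"
  proof (rule sum_mono)
    fix i assume "i \<in> {..<Suc K}"
    then have xi: "x i < x (Suc i)" "x (Suc i) - x i \<le> 2 * \<delta>" "0 \<le> x i" "x (Suc i) \<le> t" using x1 by auto
    have "\<bar>\<Phi> (x (Suc i)) - \<Phi> (x i)\<bar>
        \<le> (x (Suc i) - x i) * ((n (x i))\<^sup>2 + (n (x (Suc i)))\<^sup>2) / e + integral_from_to (x i) (x (Suc i)) w"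
      using xi \<delta> st by (intro pair xG) auto
    also have "(x (Suc i) - x i) * ((n (x i))\<^sup>2 + (n (x (Suc i)))\<^sup>2) / e \<le> (2 * \<delta>) * ((n (x i))\<^sup>2 + (n (x (Suc i)))\<^sup>2) / e"
      using xi e by (intro divide_right_mono mult_right_mono) auto
    also have "integral_from_to (x i) (x (Suc i)) w = integral_from_to 0 (x (Suc i)) w - integral_from_to 0 (x i) w"
      using xi st by (intro integral_from_to_diff[OF w]) auto
    finally show "\<bar>\<Phi> (x (Suc i)) - \<Phi> (x i)\<bar> \<le> (2 * \<delta> / e) * ((n (x i))\<^sup>2 + (n (x (Suc i)))\<^sup>2)
      + (integral_from_to 0 (x (Suc i)) w - integral_from_to 0 (x i) w)" by simp
  qed
  also have "\<dots> = (2 * \<delta> / e) * (\<Sum>i<Suc K. (n (x i))\<^sup>2 + (n (x (Suc i)))\<^sup>2) + (integral_from_to 0 t w - integral_from_to 0 s w)"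
    unfolding sum.distrib sum_distrib_left[symmetric]
    using sum_lessThan_telescope[of "\<lambda>i. integral_from_to 0 (x i) w" "Suc K"] x0 by simp
  also have "integral_from_to 0 t w - integral_from_to 0 s w = integral_from_to s t w"
    using st by (intro integral_from_to_diff[OF w, symmetric]) auto
  also have "(2 * \<delta> / e) * (\<Sum>i<Suc K. (n (x i))\<^sup>2 + (n (x (Suc i)))\<^sup>2)
      \<le> (2 / e) * (2 * (integral_from_to s t ?n2 + e\<^sup>2))"
  proof -
    have 1: "(\<Sum>i<Suc K. (n (x i))\<^sup>2) = (n s)\<^sup>2 + (\<Sum>i<K. (n (\<tau> i))\<^sup>2)"
      unfolding sum.lessThan_Suc_shift by (simp add: x_def)
    have 2: "(\<Sum>i<Suc K. (n (x (Suc i)))\<^sup>2) = (\<Sum>i<K. (n (\<tau> i))\<^sup>2) + (n t)\<^sup>2"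
      by (simp add: x_def)
    have "(\<Sum>i<K. (n (\<tau> i))\<^sup>2) * \<delta> \<le> (\<Sum>i<K. (integral_from_to 0 (a (Suc i)) ?n2 - integral_from_to 0 (a i) ?n2) + \<kappa>)"
      unfolding sum_distrib_right
    proof (rule sum_mono)
      fix i assume "i \<in> {..<K}"
      then have i: "i < K" by simp
      have "integral_from_to (a i) (a (Suc i)) ?n2 = integral_from_to 0 (a (Suc i)) ?n2 - integral_from_to 0 (a i) ?n2"
        using a[of i] aT[OF i] st by (intro integral_from_to_diff[OF n]) auto
      then show "(n (\<tau> i))\<^sup>2 * \<delta> \<le> integral_from_to 0 (a (Suc i)) ?n2 - integral_from_to 0 (a i) ?n2 + \<kappa>"
        using \<tau>(4)[OF i] by simp
    qed
    also have "\<dots> = integral_from_to 0 (a K) ?n2 - integral_from_to 0 (a 0) ?n2 + real K * \<kappa>"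
      unfolding sum.distrib using sum_lessThan_telescope[of "\<lambda>i. integral_from_to 0 (a i) ?n2" K] by simp
    also have "integral_from_to 0 (a K) ?n2 - integral_from_to 0 (a 0) ?n2 = integral_from_to s t ?n2"
      using st tK integral_from_to_diff[OF n st(3), of t] by (simp add: a_def)
    also have "real K * \<kappa> = e\<^sup>2 / 2" using K by (simp add: \<kappa>_def)
    finally have 3: "(\<Sum>i<K. (n (\<tau> i))\<^sup>2) * \<delta> \<le> integral_from_to s t ?n2 + e\<^sup>2 / 2" .
    \<comment> \<open>Each interior point belongs to two intervals, each end point to one.\<close>
    have "\<delta> * (\<Sum>i<Suc K. (n (x i))\<^sup>2 + (n (x (Suc i)))\<^sup>2) = \<delta> * c + 2 * ((\<Sum>i<K. (n (\<tau> i))\<^sup>2) * \<delta>)"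
      unfolding sum.distrib 1 2 c_def by (simp add: algebra_simps)
    also have "\<dots> \<le> 2 * (integral_from_to s t ?n2 + e\<^sup>2)"
      using 3 \<delta>(3) zero_le_power2[of e] by argo
    finally have "(2 / e) * (\<delta> * (\<Sum>i<Suc K. (n (x i))\<^sup>2 + (n (x (Suc i)))\<^sup>2)) \<le> (2 / e) * (2 * (integral_from_to s t ?n2 + e\<^sup>2))"
      using e by (intro mult_left_mono) auto
    then show ?thesis by simp
  qed
  finally show ?thesis by simp
qed

context seminormed_functions
begin

text \<open>If \<open>F\<close> were continuous in time, replacing \<open>F t\<close> and
  \<open>F s\<close> by \<open>F r\<close> under the integrals would cost little on short intervals.
  In general \<open>F\<close> differs from a path with continuous coefficients by an error
  \<open>n\<close> that is small in quadratic mean only; \<open>increments_bound\<close> supplies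
  the partition points at which this is enough. Of \<open>F\<close> no time derivative occurs, only
  the bound of \<open>e r\<close> by \<open>m r\<close>.\<close>

lemma energy_chain_rule:
  fixes e :: "real \<Rightarrow> ('a \<Rightarrow> 'b) \<Rightarrow> real" and E m :: "real \<Rightarrow> real"
  assumes F: "F \<in> Bochner_L2 T X N"
    and G: "AE t in lebesgue_on {0..T}. t \<in> G" "G \<subseteq> {0..T}" and FG: "\<And>t. t \<in> G \<Longrightarrow> F t \<in> X"
    and e_diff: "\<And>r v w. r \<in> G \<Longrightarrow> v \<in> X \<Longrightarrow> w \<in> X \<Longrightarrow> e r (\<lambda>x. v x - w x) = e r v - e r w"
    and e_bound: "\<And>r v. r \<in> G \<Longrightarrow> v \<in> X \<Longrightarrow> \<bar>e r v\<bar> \<le> m r * N v"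
    and m: "integrable (lebesgue_on {0..T}) (\<lambda>t. (m t)\<^sup>2)" "\<And>t. t \<in> G \<Longrightarrow> m t \<ge> 0"
    and e_int: "\<And>v. v \<in> X \<Longrightarrow> integrable (lebesgue_on {0..T}) (\<lambda>r. e r v)"
    and E: "\<And>s t. s \<in> G \<Longrightarrow> t \<in> G \<Longrightarrow> s < t \<Longrightarrow>
       2 * (E t - E s) = integral_from_to s t (\<lambda>r. e r (F t)) + integral_from_to s t (\<lambda>r. e r (F s))"
  shows "integrable (lebesgue_on {0..T}) (\<lambda>r. e r (F r))"
    and "\<And>s t. s \<in> G \<Longrightarrow> t \<in> G \<Longrightarrow> s < t \<Longrightarrow> E t - E s = integral_from_to s t (\<lambda>r. e r (F r))"
proof -
  let ?L = "lebesgue_on {0..T}"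
  interpret L: finite_measure ?L by (intro finite_measure_lebesgue_on) auto
  have sm: "strongly_measurable T X N F" and F2: "integrable ?L (\<lambda>t. (N (F t))\<^sup>2)"
    using F by (auto simp: Bochner_L2_def)
  let ?R = "\<lambda>r. e r (F r)"
  have Rm: "?R \<in> borel_measurable ?L"
  proof (rule strongly_measurable_apply[OF sm])
    show "(\<lambda>t. e t q) \<in> borel_measurable ?L" if "q \<in> X" for q using e_int[OF that] by simp
    show "AE t in ?L. \<forall>v\<in>X. \<forall>s. (\<forall>n. s n \<in> X) \<longrightarrow> (\<lambda>n. N (\<lambda>x. s n x - v x)) \<longlonglongrightarrow> 0 \<longrightarrow> (\<lambda>n. e t (s n)) \<longlonglongrightarrow> e t v"
      using G(1)
    proof (eventually_elim, intro ballI allI impI)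
      fix t v s assume t: "t \<in> G" "v \<in> X" "\<forall>n. s n \<in> X" "(\<lambda>n. N (\<lambda>x. s n x - v x)) \<longlonglongrightarrow> 0"
      have "(\<lambda>n. m t * N (\<lambda>x. s n x - v x)) \<longlonglongrightarrow> 0" using tendsto_mult[OF tendsto_const t(4)] by simp
      then have "(\<lambda>n. e t (s n) - e t v) \<longlonglongrightarrow> 0"
      proof (rule Lim_null_comparison[OF always_eventually, rotated], intro allI)
        fix n
        have "norm (e t (s n) - e t v) = \<bar>e t (\<lambda>x. s n x - v x)\<bar>" using e_diff t by simp
        also have "\<dots> \<le> m t * N (\<lambda>x. s n x - v x)" using t by (intro e_bound diff_mem) auto
        finally show "norm (e t (s n) - e t v) \<le> m t * N (\<lambda>x. s n x - v x)" .
      qed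
      then show "(\<lambda>n. e t (s n)) \<longlonglongrightarrow> e t v" by (simp add: LIM_zero_iff)
    qed
  qed
  show Ri: "integrable ?L ?R"
  proof (rule Bochner_Integration.integrable_bound)
    show "integrable ?L (\<lambda>t. (m t)\<^sup>2 + (N (F t))\<^sup>2)" using m(1) F2 by simp
    show "AE t in ?L. norm (?R t) \<le> norm ((m t)\<^sup>2 + (N (F t))\<^sup>2)"
      using G(1)
    proof eventually_elim
      case (elim t)
      have "\<bar>?R t\<bar> \<le> m t * N (F t)" by (rule e_bound[OF elim FG[OF elim]])
      also have "\<dots> \<le> (m t)\<^sup>2 + (N (F t))\<^sup>2"
        using sum_squares_bound[of "m t" "N (F t)"] mult_nonneg_nonneg[OF m(2)[OF elim] nonneg[OF FG[OF elim]]] by argo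
      finally show ?case by simp
    qed
  qed (rule Rm)
  fix s t assume st: "s \<in> G" "t \<in> G" "s < t"
  have st': "0 \<le> s" "t \<le> T" using st G(2) by auto
  \<comment> \<open>Twice the energy with twice the claimed integral removed, the factor 2 being
    that of the trapezoidal identity. It is to be shown that \<Phi> takes equal values at
    \<open>s\<close> and \<open>t\<close>.\<close>
  define \<Phi> where "\<Phi> u = 2 * E u - 2 * integral_from_to 0 u ?R" for u
  define m2 where "m2 = integral_from_to s t (\<lambda>r. (m r)\<^sup>2)"
  \<comment> \<open>The constant collected at the end: 4 + 4 from \<open>increments_bound\<close>,
    and 1 + 3 \<open>m2\<close> + (t - s) from the integral of the majorant \<open>w\<close>. It
    does not depend on \<epsilon>.\<close>
  define C where "C = 9 + 3 * m2 + (t - s)"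
  have small: "\<bar>\<Phi> t - \<Phi> s\<bar> \<le> \<epsilon> * C" if \<epsilon>: "\<epsilon> > 0" for \<epsilon>
  proof -
    obtain Q g n where Q: "finite Q" "Q \<subseteq> X" and g: "\<And>q. q \<in> Q \<Longrightarrow> continuous_on UNIV (g q)"
      and n: "integrable ?L (\<lambda>t. (n t)\<^sup>2)" "n \<in> borel_measurable ?L" "(\<integral>t. (n t)\<^sup>2 \<partial>?L) < \<epsilon>\<^sup>2"
        "\<And>t. t \<in> {0..T} \<Longrightarrow> F t \<in> X \<Longrightarrow> N (\<lambda>x. F t x - (\<Sum>q\<in>Q. g q t *\<^sub>R q x)) \<le> n t"
      by (rule Bochner_L2_continuous_approx[OF F, of "\<epsilon>\<^sup>2"]) (use \<epsilon> in auto)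
    define P where "P t = (\<lambda>x. \<Sum>q\<in>Q. g q t *\<^sub>R q x)" for t
    have PX: "P t \<in> X" for t unfolding P_def using Q by (intro sum_mem[where v="\<lambda>q. q"]) auto
    have nP: "N (\<lambda>x. F t x - P t x) \<le> n t" if "t \<in> G" for t using n(4)[of t] FG[OF that] that G(2) by (auto simp: P_def)
    have n0: "0 \<le> n t" if "t \<in> G" for t using nP[OF that] nonneg[OF diff_mem[OF FG[OF that] PX]] order_trans by blast
    have PP: "N (\<lambda>x. P a x - P b x) \<le> (\<Sum>q\<in>Q. \<bar>g q a - g q b\<bar> * N q)" for a b
    proof -
      have "(\<lambda>x. P a x - P b x) = (\<lambda>x. \<Sum>q\<in>Q. (g q a - g q b) *\<^sub>R q x)"
        by (simp add: P_def fun_eq_iff scaleR_diff_left sum_subtractf)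
      then show ?thesis using norm_sum[of Q "\<lambda>q. q" "\<lambda>q. g q a - g q b"] Q by auto
    qed
    have "continuous_on UNIV (\<lambda>(a, b). \<Sum>q\<in>Q. \<bar>g q a - g q b\<bar> * N q)"
      unfolding case_prod_beta
      by (intro continuous_on_sum continuous_intros continuous_on_compose2[OF g]) auto
    then have "uniformly_continuous_on ({0..T} \<times> {0..T}) (\<lambda>(a, b). \<Sum>q\<in>Q. \<bar>g q a - g q b\<bar> * N q)"
      by (rule compact_uniformly_continuous[OF continuous_on_subset[OF _ subset_UNIV] compact_Times[OF compact_Icc compact_Icc]])
    from this[unfolded uniformly_continuous_on_def, rule_format, OF \<epsilon>]
    obtain \<eta> where \<eta>: "\<eta> > 0" "\<forall>x\<in>{0..T} \<times> {0..T}. \<forall>y\<in>{0..T} \<times> {0..T}. dist y x < \<eta> \<longrightarrow>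
        dist (case y of (a, b) \<Rightarrow> \<Sum>q\<in>Q. \<bar>g q a - g q b\<bar> * N q) (case x of (a, b) \<Rightarrow> \<Sum>q\<in>Q. \<bar>g q a - g q b\<bar> * N q) < \<epsilon>"
      by (elim exE conjE)
    have PPe: "N (\<lambda>x. P a x - P r x) \<le> \<epsilon>" if "a \<in> {0..T}" "r \<in> {0..T}" "\<bar>a - r\<bar> < \<eta>" for a r
    proof -
      \<comment> \<open>The function of two times is compared with its value 0 at the point
        \<open>(a, a)\<close> of the diagonal.\<close>
      have "dist (a, r) (a, a) < \<eta>" using that by (simp add: dist_Pair_Pair dist_real_def abs_minus_commute)
      from \<eta>(2)[rule_format, OF _ _ this] that have "\<bar>\<Sum>q\<in>Q. \<bar>g q a - g q r\<bar> * N q\<bar> < \<epsilon>" by (simp add: dist_real_def)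
      then show ?thesis using PP[of a r] by linarith
    qed
    \<comment> \<open>From \<open>F a\<close> to \<open>F r\<close> by way of the path
      \<open>P\<close>: its distance to \<open>F\<close> at the two times is at most
      \<open>n a\<close> and \<open>n r\<close>, and between them it moves by at most
      \<epsilon>.\<close>
    have key: "\<bar>e r (F a) - e r (F r)\<bar> \<le> m r * (n a + \<epsilon> + n r)" if "a \<in> G" "r \<in> G" "\<bar>a - r\<bar> < \<eta>" for a r
    proof -
      have "\<bar>e r (F a) - e r (F r)\<bar> = \<bar>e r (\<lambda>x. F a x - F r x)\<bar>" using that FG e_diff by simp
      also have "\<dots> \<le> m r * N (\<lambda>x. F a x - F r x)" using that FG by (intro e_bound diff_mem) auto
      also have "N (\<lambda>x. F a x - F r x) \<le> N (\<lambda>x. F a x - P a x) + (N (\<lambda>x. P a x - P r x) + N (\<lambda>x. P r x - F r x))"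
        using triangle_diff[OF FG[OF that(1)] PX FG[OF that(2)], of a] triangle_diff[OF PX PX FG[OF that(2)], of a r] by simp
      also have "\<dots> \<le> n a + (\<epsilon> + n r)"
      proof -
        have "a \<in> {0..T}" "r \<in> {0..T}" using that G(2) by auto
        then have "N (\<lambda>x. P a x - P r x) \<le> \<epsilon>" using that(3) by (rule PPe)
        then show ?thesis
          using nP[OF that(1)] nP[OF that(2)] minus_commute[OF PX FG[OF that(2)], of r] by (intro add_mono) auto
      qed
      finally show ?thesis using m(2)[OF that(2)] by (simp add: mult_left_mono add.assoc)
    qed
    \<comment> \<open>What Young's inequality with weight \<epsilon> leaves of the two bounds
      \<open>key\<close>, at \<open>a\<close> and at \<open>b\<close>, once the values of
      \<open>n\<close> at the end points are split off; this is \<open>pw\<close>.\<close>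
    define w where "w r = \<epsilon> * (3 * (m r)\<^sup>2) + (n r)\<^sup>2 / \<epsilon> + \<epsilon>" for r
    have wi: "integrable ?L w" unfolding w_def using m(1) n(1) by simp
    have pw: "m r * (n a + \<epsilon> + n r) + m r * (n b + \<epsilon> + n r) \<le> ((n a)\<^sup>2 + (n b)\<^sup>2) / \<epsilon> + w r" for a b r
    proof -
      have y: "p * q \<le> q\<^sup>2 / (2 * \<epsilon>) + \<epsilon> * p\<^sup>2 / 2" for p q :: real
      proof -
        have "0 \<le> (q - \<epsilon> * p)\<^sup>2" by simp
        then have "2 * \<epsilon> * (p * q) \<le> q\<^sup>2 + \<epsilon>\<^sup>2 * p\<^sup>2" by (simp add: power2_diff power_mult_distrib mult_ac)
        then show ?thesis using \<epsilon> by (simp add: field_simps power2_eq_square)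
      qed
      have y1: "2 * \<epsilon> * m r \<le> \<epsilon> + \<epsilon> * (m r)\<^sup>2"
        using mult_left_mono[OF sum_squares_bound[of 1 "m r"], of \<epsilon>] \<epsilon> by (simp add: algebra_simps)
      have y2: "x\<^sup>2 / (2 * \<epsilon>) \<le> x\<^sup>2 / \<epsilon>" for x using \<epsilon> by (intro divide_left_mono) auto
      have "m r * (n a + \<epsilon> + n r) + m r * (n b + \<epsilon> + n r) = m r * n a + m r * n b + 2 * (m r * n r) + 2 * \<epsilon> * m r"
        by (simp add: algebra_simps)
      also have "\<dots> \<le> ((n a)\<^sup>2 / \<epsilon> + \<epsilon> * (m r)\<^sup>2 / 2) + ((n b)\<^sup>2 / \<epsilon> + \<epsilon> * (m r)\<^sup>2 / 2)
          + 2 * ((n r)\<^sup>2 / (2 * \<epsilon>) + \<epsilon> * (m r)\<^sup>2 / 2) + (\<epsilon> + \<epsilon> * (m r)\<^sup>2)"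
        by (intro add_mono mult_left_mono y y1 order_trans[OF y add_right_mono[OF y2]]) simp
      also have "\<dots> = ((n a)\<^sup>2 + (n b)\<^sup>2) / \<epsilon> + w r" using \<epsilon> by (simp add: w_def add_divide_distrib)
      finally show ?thesis .
    qed
    have "\<bar>\<Phi> t - \<Phi> s\<bar> \<le> 4 * (integral_from_to s t (\<lambda>t. (n t)\<^sup>2) + \<epsilon>\<^sup>2) / \<epsilon> + integral_from_to s t w"
    proof (rule increments_bound[OF n(1) wi G(1) \<epsilon> _ st(1,2) st'(1) st(3) st'(2)])
      \<comment> \<open>Half of \<eta>, because \<open>b - a\<close> may equal the bound while the
        points of [a, b] must be strictly closer than \<eta> to both ends.\<close>
      show "\<eta> / 2 > 0" using \<eta> by simp
      fix a b assume ab: "a \<in> G" "b \<in> G" "0 \<le> a" "a < b" "b \<le> T" "b - a \<le> \<eta> / 2"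
      let ?h = "\<lambda>r. (e r (F b) - ?R r) + (e r (F a) - ?R r)"
      have hi: "integrable ?L ?h" using e_int[OF FG[OF ab(1)]] e_int[OF FG[OF ab(2)]] Ri by simp
      have i3: "integrable (lebesgue_on {a..b}) (\<lambda>r. e r (F b))" "integrable (lebesgue_on {a..b}) (\<lambda>r. e r (F a))"
        "integrable (lebesgue_on {a..b}) ?R"
        using integrable_subinterval[OF _ ab(3,5)] e_int[OF FG[OF ab(1)]] e_int[OF FG[OF ab(2)]] Ri by blast+
      have "\<Phi> b - \<Phi> a = 2 * (E b - E a) - 2 * integral_from_to a b ?R"
        using integral_from_to_diff[OF Ri ab(3) _ ab(5)] ab by (simp add: \<Phi>_def)
      also have "\<dots> = integral_from_to a b ?h"
        unfolding E[OF ab(1,2,4)] using i3 by (simp add: integral_from_to_def)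
      finally have 1: "\<Phi> b - \<Phi> a = integral_from_to a b ?h" .
      let ?c = "((n a)\<^sup>2 + (n b)\<^sup>2) / \<epsilon>"
      have "AE r in lebesgue_on {a..b}. \<bar>?h r\<bar> \<le> ?c + w r"
      proof -
        have "AE r in lebesgue. r \<in> {0..T} \<longrightarrow> r \<in> G" using G(1) by (simp add: AE_lebesgue_on_iff)
        then have "AE r in lebesgue. r \<in> {a..b} \<longrightarrow> \<bar>?h r\<bar> \<le> ?c + w r"
        proof (eventually_elim, intro impI)
          fix r assume r: "r \<in> {0..T} \<longrightarrow> r \<in> G" "r \<in> {a..b}"
          then have rG: "r \<in> G" using ab by auto
          have "\<bar>b - r\<bar> < \<eta>" "\<bar>a - r\<bar> < \<eta>" using r ab \<eta>(1) by auto
          then have "\<bar>?h r\<bar> \<le> m r * (n b + \<epsilon> + n r) + m r * (n a + \<epsilon> + n r)"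
            using key[OF ab(1) rG] key[OF ab(2) rG] by linarith
          then show "\<bar>?h r\<bar> \<le> ?c + w r" using pw[of r a b] by linarith
        qed
        then show ?thesis by (simp add: AE_lebesgue_on_iff)
      qed
      moreover have ci: "integrable (lebesgue_on {a..b}) (\<lambda>r. ?c)" by (intro continuous_on_integrable continuous_on_const)
      moreover have wi': "integrable (lebesgue_on {a..b}) w" by (rule integrable_subinterval[OF wi ab(3,5)])
      ultimately have "(\<integral>r. \<bar>?h r\<bar> \<partial>lebesgue_on {a..b}) \<le> (\<integral>r. ?c + w r \<partial>lebesgue_on {a..b})"
        using integrable_subinterval[OF hi ab(3,5)] by (intro integral_mono_AE) auto
      moreover have "(\<integral>r. ?c + w r \<partial>lebesgue_on {a..b}) = (b - a) * ?c + integral_from_to a b w"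
        using ci wi' ab by (simp add: integral_from_to_def measure_restrict_space)
      moreover have "\<bar>integral_from_to a b ?h\<bar> \<le> (\<integral>r. \<bar>?h r\<bar> \<partial>lebesgue_on {a..b})"
        unfolding integral_from_to_def by (rule integral_abs_bound)
      ultimately show "\<bar>\<Phi> b - \<Phi> a\<bar> \<le> (b - a) * ((n a)\<^sup>2 + (n b)\<^sup>2) / \<epsilon> + integral_from_to a b w"
        unfolding 1 by simp
    qed
    also have "integral_from_to s t w = \<epsilon> * (3 * m2) + integral_from_to s t (\<lambda>t. (n t)\<^sup>2) / \<epsilon> + \<epsilon> * (t - s)"
    proof -
      have "integrable (lebesgue_on {s..t}) (\<lambda>t. (n t)\<^sup>2)" "integrable (lebesgue_on {s..t}) (\<lambda>t. (m t)\<^sup>2)"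
        "integrable (lebesgue_on {s..t}) (\<lambda>t. \<epsilon>)"
        using integrable_subinterval[OF n(1) st'] integrable_subinterval[OF m(1) st'] continuous_on_integrable by auto
      then show ?thesis unfolding w_def m2_def integral_from_to_def using st by (simp add: measure_restrict_space)
    qed
    finally have *: "\<bar>\<Phi> t - \<Phi> s\<bar> \<le> 4 * (integral_from_to s t (\<lambda>t. (n t)\<^sup>2) + \<epsilon>\<^sup>2) / \<epsilon>
        + (\<epsilon> * (3 * m2) + integral_from_to s t (\<lambda>t. (n t)\<^sup>2) / \<epsilon> + \<epsilon> * (t - s))" .
    have "integral_from_to s t (\<lambda>t. (n t)\<^sup>2) \<le> \<epsilon>\<^sup>2"
    proof -
      have "integral_from_to s t (\<lambda>t. (n t)\<^sup>2) = (\<integral>x. indicator {s..t} x * (n x)\<^sup>2 \<partial>?L)"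
        by (rule integral_from_to_indicator[OF st'])
      also have "\<dots> \<le> (\<integral>x. (n x)\<^sup>2 \<partial>?L)"
        by (rule integral_mono'[OF n(1)]) (auto simp: indicator_def)
      finally show ?thesis using n(3) by simp
    qed
    then have "integral_from_to s t (\<lambda>t. (n t)\<^sup>2) / \<epsilon> \<le> \<epsilon>" using \<epsilon> by (simp add: field_simps power2_eq_square)
    moreover have "4 * (integral_from_to s t (\<lambda>t. (n t)\<^sup>2) + \<epsilon>\<^sup>2) / \<epsilon> = 4 * (integral_from_to s t (\<lambda>t. (n t)\<^sup>2) / \<epsilon>) + 4 * \<epsilon>"
      using \<epsilon> by (simp add: field_simps power2_eq_square)
    ultimately have "\<bar>\<Phi> t - \<Phi> s\<bar> \<le> 4 * \<epsilon> + 4 * \<epsilon> + (\<epsilon> * (3 * m2) + \<epsilon> + \<epsilon> * (t - s))" using * by argo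
    then show ?thesis by (simp add: C_def algebra_simps)
  qed
  have "\<bar>\<Phi> t - \<Phi> s\<bar> \<le> 0"
  proof (rule field_le_epsilon)
    fix k :: real assume k: "k > 0"
    have C: "C > 0"
    proof -
      have "m2 \<ge> 0" unfolding m2_def integral_from_to_def by (simp add: integral_nonneg_AE)
      then show ?thesis using st by (simp add: C_def)
    qed
    show "\<bar>\<Phi> t - \<Phi> s\<bar> \<le> 0 + k" using small[of "k / C"] k C by simp
  qed
  then show "E t - E s = integral_from_to s t ?R"
    using integral_from_to_diff[OF Ri st'(1) _ st'(2)] st by (simp add: \<Phi>_def)
qed

end

text \<open>The function \<open>D\<close> will be the squared energy norm of the difference of the solution at two
  times; \<open>r\<close> is a time at which \<open>m\<close> does not exceed, up to a factor, its quadratic mean over the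
  interval.\<close>

lemma energy_difference_bound:
  fixes E m :: "real \<Rightarrow> real" and D e :: "real \<Rightarrow> real \<Rightarrow> real"
  assumes G: "AE t in lebesgue_on {0..T}. t \<in> G" "G \<subseteq> {0..T}"
    and m: "integrable (lebesgue_on {0..T}) (\<lambda>t. (m t)\<^sup>2)" "\<And>t. t \<in> G \<Longrightarrow> m t \<ge> 1"
    and e: "\<And>t. t \<in> G \<Longrightarrow> integrable (lebesgue_on {0..T}) (\<lambda>r. e r t)" "integrable (lebesgue_on {0..T}) (\<lambda>r. e r r)"
      "\<And>r t. r \<in> G \<Longrightarrow> t \<in> G \<Longrightarrow> \<bar>e r t\<bar> \<le> m r * m t"
    and E: "\<And>s t. s \<in> G \<Longrightarrow> t \<in> G \<Longrightarrow> s < t \<Longrightarrow> E t - E s = integral_from_to s t (\<lambda>r. e r r)"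
    and D1: "\<And>s t. s \<in> G \<Longrightarrow> t \<in> G \<Longrightarrow> s < t \<Longrightarrow> D t s = 2 * (E t - E s) - 2 * integral_from_to s t (\<lambda>r. e r s)"
    and D2: "\<And>s t. s \<in> G \<Longrightarrow> t \<in> G \<Longrightarrow> s < t \<Longrightarrow> D s t = - 2 * (E t - E s) + 2 * integral_from_to s t (\<lambda>r. e r t)"
    and st: "s \<in> G" "t \<in> G" "s < t"
  shows "\<exists>r\<in>G. D s r \<le> 5 * integral_from_to s t (\<lambda>t. (m t)\<^sup>2) \<and> D t r \<le> 5 * integral_from_to s t (\<lambda>t. (m t)\<^sup>2)"
proof -
  let ?L = "lebesgue_on {0..T}" and ?m2 = "\<lambda>t. (m t)\<^sup>2"
  let ?\<mu> = "integral_from_to s t ?m2"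
  have st': "0 \<le> s" "t \<le> T" using st G(2) by auto
  \<comment> \<open>The slack \<open>t - s\<close> is harmless: as \<open>m \<ge> 1\<close> on
    \<open>G\<close>, it is at most \<open>?\<mu>\<close>, so that \<open>?m2 r * (t - s)\<close> is
    at most \<open>2 * ?\<mu>\<close>.\<close>
  obtain r where r: "r \<in> G" "s < r" "r < t" "?m2 r * (t - s) \<le> ?\<mu> + (t - s)"
    using AE_interval_point[OF m(1) st'(1) st(3) st'(2) G(1), of "t - s"] st by auto
  have const: "integrable ?L (\<lambda>x. c)" for c :: real by (intro continuous_on_integrable continuous_on_const)
  have c_int: "integral_from_to a b (\<lambda>x. c) = c * (b - a)" if "a \<le> b" for a b c
    unfolding integral_from_to_def using that by (simp add: measure_restrict_space)
  have "AE x in ?L. 1 \<le> ?m2 x" using G(1) by eventually_elim (simp add: m(2) one_le_power)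
  then have "integral_from_to s t (\<lambda>x. 1) \<le> ?\<mu>" by (rule integral_from_to_mono[OF const m(1) st'])
  then have len: "t - s \<le> ?\<mu>" using c_int[of s t 1] st by simp
  have sub: "integral_from_to a b ?m2 \<le> ?\<mu>" if "s \<le> a" "a \<le> b" "b \<le> t" for a b
  proof -
    have pos: "0 \<le> integral_from_to x y ?m2" for x y unfolding integral_from_to_def by (simp add: integral_nonneg_AE)
    have "?\<mu> = integral_from_to s a ?m2 + integral_from_to a t ?m2"
      using that st' by (intro integral_from_to_combine[OF m(1)]) auto
    also have "integral_from_to a t ?m2 = integral_from_to a b ?m2 + integral_from_to b t ?m2"
      using that st' by (intro integral_from_to_combine[OF m(1)]) auto
    finally show ?thesis using pos[of s a] pos[of b t] by simp
  qed
  have Ebound: "\<bar>E b - E a\<bar> \<le> ?\<mu>" if ab: "a \<in> G" "b \<in> G" "a < b" "s \<le> a" "b \<le> t" for a b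
  proof -
    have "\<bar>integral_from_to a b (\<lambda>r. e r r)\<bar> \<le> integral_from_to a b ?m2"
    proof (rule integral_from_to_abs_le[OF e(2) m(1)])
      show "AE x in ?L. \<bar>e x x\<bar> \<le> (m x)\<^sup>2" using G(1) by eventually_elim (use e(3) in \<open>auto simp: power2_eq_square\<close>)
    qed (use ab st' in auto)
    then show ?thesis using E[OF ab(1-3)] sub[of a b] ab by simp
  qed
  have ebound: "2 * \<bar>integral_from_to a b (\<lambda>x. e x r)\<bar> \<le> 3 * ?\<mu>" if ab: "a < b" "s \<le> a" "b \<le> t" for a b
  proof -
    have "\<bar>integral_from_to a b (\<lambda>x. e x r)\<bar> \<le> integral_from_to a b (\<lambda>x. (?m2 x + ?m2 r) / 2)"
    proof (rule integral_from_to_abs_le[OF e(1)[OF r(1)]])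
      show "integrable ?L (\<lambda>x. (?m2 x + ?m2 r) / 2)" using m(1) const by simp
      show "AE x in ?L. \<bar>e x r\<bar> \<le> (?m2 x + ?m2 r) / 2"
        using G(1)
      proof eventually_elim
        case (elim x)
        then show ?case using e(3)[OF elim r(1)] sum_squares_bound[of "m x" "m r"] by simp
      qed
    qed (use ab st' in auto)
    also have "\<dots> = (integral_from_to a b ?m2 + ?m2 r * (b - a)) / 2"
    proof -
      have "integrable (lebesgue_on {a..b}) ?m2" using ab st' by (intro integrable_subinterval[OF m(1)]) auto
      moreover have "integrable (lebesgue_on {a..b}) (\<lambda>x. ?m2 r)" by (intro continuous_on_integrable continuous_on_const)
      ultimately show ?thesis using c_int[of a b "?m2 r"] ab by (simp add: integral_from_to_def)
    qed
    finally have "2 * \<bar>integral_from_to a b (\<lambda>x. e x r)\<bar> \<le> integral_from_to a b ?m2 + ?m2 r * (b - a)" by simp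
    also have "\<dots> \<le> ?\<mu> + ?m2 r * (t - s)" using sub[of a b] ab by (intro add_mono mult_left_mono) auto
    finally show ?thesis using r(4) len by simp
  qed
  \<comment> \<open>The good point is the right end of [s, r] and the left end of [r, t];
    \<open>D2\<close> and \<open>D1\<close> are the forms of \<open>D\<close> in which the second
    argument of \<open>e\<close> is \<open>r\<close>. The constant is 2 for the energy difference
    plus 3 from \<open>ebound\<close>.\<close>
  have "D s r \<le> 5 * ?\<mu>"
    using D2[OF st(1) r(1,2)] Ebound[OF st(1) r(1,2)] ebound[of s r] r by simp
  moreover have "D t r \<le> 5 * ?\<mu>"
    using D1[OF r(1) st(2) r(3)] Ebound[OF r(1) st(2) r(3)] ebound[of r t] r by simp
  ultimately show ?thesis using r(1) by blast
qed

section \<open>Weak solutions of the poroelasticity problem\<close>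

lemma AE_mem_lebesgue_on: "S \<in> sets lebesgue \<Longrightarrow> AE t in lebesgue_on S. t \<in> S"
  by (simp add: AE_lebesgue_on_iff)

lemma dual_spaceD:
  assumes "G \<in> dual_space X N"
  shows "\<forall>v\<in>X. \<forall>w\<in>X. G (\<lambda>x. v x + w x) = G v + G w"
    "\<forall>a. \<forall>v\<in>X. G (\<lambda>x. a * v x) = a * G v"
    "\<exists>C. \<forall>v\<in>X. \<bar>G v\<bar> \<le> C * N v"
  using assms unfolding dual_space_def by simp_all

lemma dual_space_diff:
  assumes "G \<in> dual_space X N" "v \<in> X" "w \<in> X" "\<And>a v. v \<in> X \<Longrightarrow> (\<lambda>x. a * v x) \<in> X"
  shows "G (\<lambda>x. v x - w x) = G v - G w"
proof -
  have "G (\<lambda>x. v x + (- 1) * w x) = G v + G (\<lambda>x. (- 1) * w x)"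
    by (rule dual_spaceD(1)[OF assms(1), rule_format, OF assms(2) assms(4)[OF assms(3)]])
  also have "G (\<lambda>x. (- 1) * w x) = (- 1) * G w"
    by (rule dual_spaceD(2)[OF assms(1), rule_format, OF assms(3)])
  finally show ?thesis by simp
qed

locale poroelastic_solution = bounded_open_set \<Omega>
  for \<Omega> :: "(real^'d) set" +
  fixes T lam \<mu> \<alpha> c0 \<mu>f :: real
    and K :: "real^'d^'d"
    and \<rho>f :: "real^'d \<Rightarrow> real" and g :: "real^'d"
    and f f1 :: "real^'d \<Rightarrow> real^'d" and \<phi> \<phi>1 :: "real^'d \<Rightarrow> real"
    and u0 :: "real^'d \<Rightarrow> real^'d" and p0 :: "real^'d \<Rightarrow> real"
    and u :: "real \<Rightarrow> real^'d \<Rightarrow> real^'d" and p :: "real \<Rightarrow> real^'d \<Rightarrow> real"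
    and etat :: "real \<Rightarrow> (real^'d \<Rightarrow> real) \<Rightarrow> real"
  assumes T: "T > 0" and lam: "lam > 0" and \<mu>: "\<mu> > 0" and c0: "c0 \<ge> 0" and \<mu>f: "\<mu>f > 0"
    and \<rho>f: "\<rho>f \<in> L2 M" and f: "f \<in> L2 M" and \<phi>: "\<phi> \<in> L2 M" and \<phi>1: "\<phi>1 \<in> L2 (surface_measure \<Omega>)"
    and u0: "u0 \<in> H1v \<Omega>" and p0: "p0 \<in> L2 M"
    and weak: "weak_solution \<Omega> T lam \<mu> \<alpha> c0 \<mu>f K \<rho>f g f f1 \<phi> \<phi>1 u0 p0 u p etat"
begin

abbreviation "L \<equiv> lebesgue_on {0..T}"

definition load :: "(real^'d \<Rightarrow> real^'d) \<Rightarrow> real" where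
  "load v = L2_inner M f v + boundary_inner \<Omega> f1 v"

definition source :: "(real^'d \<Rightarrow> real) \<Rightarrow> real" where
  "source q = L2_inner M \<phi> q + boundary_inner \<Omega> \<phi>1 q"

definition flux :: "(real^'d \<Rightarrow> real) \<Rightarrow> real^'d \<Rightarrow> real^'d" where
  "flux q x = K *v (grad \<Omega> q x - \<rho>f x *\<^sub>R g)"

definition elastic :: "real \<Rightarrow> bool" where
  "elastic t \<longleftrightarrow> (\<forall>v\<in>H1v \<Omega>. \<mu> * L2_inner M (strain \<Omega> (u t)) (strain \<Omega> v)
        + lam * L2_inner M (dvg \<Omega> (u t)) (dvg \<Omega> v) - \<alpha> * L2_inner M (p t) (dvg \<Omega> v) = load v)"

text \<open>Membership in the dual is part of the predicate because linearity and boundedness of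
  \<open>source\<close> are deduced from those of \<open>etat t\<close>.\<close>

definition mass_balance :: "real \<Rightarrow> bool" where
  "mass_balance t \<longleftrightarrow> etat t \<in> dual_space (H1 \<Omega>) (H1_norm \<Omega>) \<and>
     (\<forall>q\<in>H1 \<Omega>. etat t q + 1 / \<mu>f * L2_inner M (flux (p t)) (grad \<Omega> q) = source q)"

text \<open>The fluid content, which is the \<eta> of the overview.\<close>

definition content :: "real \<Rightarrow> real^'d \<Rightarrow> real" where
  "content t x = c0 * p t x + \<alpha> * dvg \<Omega> (u t) x"

lemma weak_u: "strongly_measurable T (H1_perp \<Omega>) (H1v_norm \<Omega>) u" "\<exists>C. AE t in L. H1v_norm \<Omega> (u t) \<le> C"
  using weak by (auto simp: weak_solution_def Bochner_Linf_def)

lemma weak_p: "p \<in> Bochner_L2 T (H1 \<Omega>) (H1_norm \<Omega>)"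
  using weak by (simp only: weak_solution_def)

lemma weak_p_measurable: "strongly_measurable T (H1 \<Omega>) (H1_norm \<Omega>) p"
  and weak_p_square: "integrable L (\<lambda>t. (H1_norm \<Omega> (p t))\<^sup>2)"
  using weak_p by (auto simp: Bochner_L2_def)

lemma weak_elastic: "AE t in L. elastic t"
  using weak unfolding weak_solution_def elastic_def load_def by (elim conjE)

lemma weak_time_derivative: "is_time_derivative \<Omega> T content etat"
  using weak unfolding weak_solution_def content_def[abs_def] by (elim conjE)

lemma weak_mass_balance: "AE t in L. mass_balance t"
proof -
  have "AE t in L. \<forall>q\<in>H1 \<Omega>. etat t q + 1 / \<mu>f * L2_inner M (flux (p t)) (grad \<Omega> q) = source q"
    using weak unfolding weak_solution_def source_def flux_def[abs_def] by (elim conjE)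
  moreover have "AE t in L. etat t \<in> dual_space (H1 \<Omega>) (H1_norm \<Omega>)"
    using weak_time_derivative unfolding is_time_derivative_def by (elim conjE)
  ultimately show ?thesis by eventually_elim (simp add: mass_balance_def)
qed

lemma weak_initial_u: "has_initial_value \<Omega> T u u0"
  using weak unfolding weak_solution_def by (elim conjE)

lemma weak_initial_p: "has_initial_value \<Omega> T (\<lambda>t x. sqrt c0 * p t x) (\<lambda>x. sqrt c0 * p0 x)"
  using weak unfolding weak_solution_def by (elim conjE)

lemma etat_integrable: "q \<in> H1 \<Omega> \<Longrightarrow> integrable L (\<lambda>t. etat t q)"
  using weak_time_derivative unfolding is_time_derivative_def by blast

lemma AE_L_ex: "AE t in L. P t \<Longrightarrow> \<exists>t\<in>{0..T}. P t"
proof (rule ccontr)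
  assume P: "AE t in L. P t" and n: "\<not> (\<exists>t\<in>{0..T}. P t)"
  have "AE t in L. t \<in> {0..T}" by (rule AE_mem_lebesgue_on) simp
  with P have "AE t in L. False" by eventually_elim (use n in auto)
  then have "AE t in lebesgue. t \<notin> {0..T}" by (simp add: AE_lebesgue_on_iff)
  then have "{t. \<not> t \<notin> {0..T}} \<in> null_sets lebesgue" unfolding completion.AE_iff_null_sets by simp
  then have "negligible {0..T}" by (simp add: negligible_iff_null_sets atLeastAtMost_def atLeast_def atMost_def Int_def)
  then show False using negligible_interval(1)[of 0 T] T by (simp add: box_real)
qed

lemma flux_L2: "q \<in> H1 \<Omega> \<Longrightarrow> flux q \<in> L2 M" "q \<in> H1 \<Omega> \<Longrightarrow> (\<lambda>x. grad \<Omega> q x - \<rho>f x *\<^sub>R g) \<in> L2 M"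
proof -
  assume q: "q \<in> H1 \<Omega>"
  have "linear (\<lambda>r::real. r *\<^sub>R g)" by (rule linearI) (auto simp: scaleR_add_left)
  from L2_linear_image[OF this \<rho>f] show 1: "(\<lambda>x. grad \<Omega> q x - \<rho>f x *\<^sub>R g) \<in> L2 M"
    by (intro L2_diff grad(1) q)
  show "flux q \<in> L2 M" unfolding flux_def[abs_def]
    by (rule L2_linear_image[OF matrix_vector_mul_linear 1])
qed

lemma gravity_L2: "(\<lambda>x. \<rho>f x *\<^sub>R g) \<in> L2 M"
proof -
  have "linear (\<lambda>r::real. r *\<^sub>R g)" by (rule linearI) (auto simp: scaleR_add_left)
  from L2_linear_image[OF this \<rho>f] show ?thesis .
qed

lemma flux_norm: "q \<in> H1 \<Omega> \<Longrightarrow> L2_norm M (flux q) \<le> onorm (\<lambda>x. K *v x) * L2_norm M (\<lambda>x. grad \<Omega> q x - \<rho>f x *\<^sub>R g)"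
  unfolding flux_def[abs_def] by (rule L2_norm_linear_image[OF matrix_vector_mul_linear flux_L2(2)])

lemma onorm_K: "0 \<le> onorm (\<lambda>x. K *v x)"
  by (rule onorm_pos_le) (rule matrix_vector_mul_bounded_linear)

text \<open>The functionals \<open>load\<close> and \<open>source\<close> contain boundary integrals of traces. That they are linear
  and bounded is read off the equations at one time at which these hold.\<close>

lemma source_linear_bounded:
  obtains C where "C \<ge> 0" "\<And>q. q \<in> H1 \<Omega> \<Longrightarrow> \<bar>source q\<bar> \<le> C * H1_norm \<Omega> q"
    "\<And>v w. v \<in> H1 \<Omega> \<Longrightarrow> w \<in> H1 \<Omega> \<Longrightarrow> source (\<lambda>x. v x - w x) = source v - source w"
proof -
  have "AE t in L. mass_balance t \<and> p t \<in> H1 \<Omega>"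
    using weak_mass_balance H1.strongly_measurable_AE_mem[OF weak_p_measurable] by eventually_elim simp
  then obtain t where t: "mass_balance t" "p t \<in> H1 \<Omega>" using AE_L_ex by blast
  have dual: "etat t \<in> dual_space (H1 \<Omega>) (H1_norm \<Omega>)" using t(1) by (simp add: mass_balance_def)
  obtain B where B: "\<forall>q\<in>H1 \<Omega>. \<bar>etat t q\<bar> \<le> B * H1_norm \<Omega> q" using dual_spaceD(3)[OF dual] by (rule exE)
  have s: "source q = etat t q + 1 / \<mu>f * L2_inner M (flux (p t)) (grad \<Omega> q)" if "q \<in> H1 \<Omega>" for q
    using t(1) that by (simp add: mass_balance_def)
  let ?C = "\<bar>B\<bar> + 1 / \<mu>f * L2_norm M (flux (p t))"
  show ?thesis
  proof (rule that[of ?C])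
    show "?C \<ge> 0" using \<mu>f L2_norm_nonneg[of M "flux (p t)"] by simp
    fix q assume q: "q \<in> H1 \<Omega>"
    have N0: "0 \<le> H1_norm \<Omega> q" by (rule H1.nonneg[OF q])
    have "\<bar>L2_inner M (flux (p t)) (grad \<Omega> q)\<bar> \<le> L2_norm M (flux (p t)) * L2_norm M (grad \<Omega> q)"
      by (rule L2_Cauchy_Schwarz[OF flux_L2(1)[OF t(2)] grad(1)[OF q]])
    also have "\<dots> \<le> L2_norm M (flux (p t)) * H1_norm \<Omega> q"
      by (intro mult_left_mono L2_norm_grad_le_H1_norm L2_norm_nonneg)
    finally have "\<bar>1 / \<mu>f * L2_inner M (flux (p t)) (grad \<Omega> q)\<bar> \<le> 1 / \<mu>f * (L2_norm M (flux (p t)) * H1_norm \<Omega> q)"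
      using \<mu>f by (simp add: abs_mult divide_right_mono)
    moreover have "\<bar>etat t q\<bar> \<le> \<bar>B\<bar> * H1_norm \<Omega> q"
      using B[rule_format, OF q] mult_right_mono[OF abs_ge_self N0, of B] by linarith
    ultimately have "\<bar>source q\<bar> \<le> \<bar>B\<bar> * H1_norm \<Omega> q + 1 / \<mu>f * (L2_norm M (flux (p t)) * H1_norm \<Omega> q)"
      unfolding s[OF q] by linarith
    then show "\<bar>source q\<bar> \<le> ?C * H1_norm \<Omega> q" by (simp add: algebra_simps)
  next
    fix v w assume v: "v \<in> H1 \<Omega>" and w: "w \<in> H1 \<Omega>"
    have e: "etat t (\<lambda>x. v x - w x) = etat t v - etat t w"
      by (rule dual_space_diff[OF dual v w H1_scale(1)])
    have "AE x in M. grad \<Omega> (\<lambda>x. v x + (-1) * w x) x = grad \<Omega> v x - grad \<Omega> w x"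
      using H1_add(2)[OF v H1_scale(1)[OF w, of "-1"]] H1_scale(2)[OF w, of "-1"] by eventually_elim simp
    then have "AE x in M. grad \<Omega> (\<lambda>x. v x - w x) x = grad \<Omega> v x - grad \<Omega> w x" by simp
    then have "L2_inner M (flux (p t)) (grad \<Omega> (\<lambda>x. v x - w x)) = L2_inner M (flux (p t)) (\<lambda>x. grad \<Omega> v x - grad \<Omega> w x)"
      using L2D(1)[OF flux_L2(1)[OF t(2)]] grad_measurable[OF v] grad_measurable[OF w] grad_measurable[OF H1.diff_mem[OF v w]]
      by (intro L2_inner_cong_AE) auto
    also have "\<dots> = L2_inner M (flux (p t)) (grad \<Omega> v) - L2_inner M (flux (p t)) (grad \<Omega> w)"
      by (intro L2_inner_diff_right grad flux_L2 v w t)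
    finally have "L2_inner M (flux (p t)) (grad \<Omega> (\<lambda>x. v x - w x))
        = L2_inner M (flux (p t)) (grad \<Omega> v) - L2_inner M (flux (p t)) (grad \<Omega> w)" .
    then show "source (\<lambda>x. v x - w x) = source v - source w"
      unfolding s[OF H1.diff_mem[OF v w]] s[OF v] s[OF w] e by (simp add: diff_divide_distrib)
  qed
qed

text \<open>Membership in the dual gives at each time a constant whose dependence on time is not
  controlled. The mass balance gives one that grows at most linearly with the H1 norm of
  \<open>p t\<close> and hence is square integrable in time.\<close>

lemma etat_bound:
  obtains C1 C2 where "C1 \<ge> 0" "C2 \<ge> 0"
    "\<And>t q. mass_balance t \<Longrightarrow> p t \<in> H1 \<Omega> \<Longrightarrow> q \<in> H1 \<Omega> \<Longrightarrow> \<bar>etat t q\<bar> \<le> (C1 + C2 * H1_norm \<Omega> (p t)) * H1_norm \<Omega> q"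
proof -
  obtain C where C: "C \<ge> 0" "\<And>q. q \<in> H1 \<Omega> \<Longrightarrow> \<bar>source q\<bar> \<le> C * H1_norm \<Omega> q"
    using source_linear_bounded by metis
  let ?k = "onorm (\<lambda>x. K *v x) / \<mu>f" and ?\<gamma> = "L2_norm M (\<lambda>x. \<rho>f x *\<^sub>R g)"
  have k: "?k \<ge> 0" using onorm_K \<mu>f by simp
  show ?thesis
  proof (rule that[of "C + ?k * ?\<gamma>" ?k])
    show "C + ?k * ?\<gamma> \<ge> 0" by (intro add_nonneg_nonneg mult_nonneg_nonneg C(1) k L2_norm_nonneg)
    show "?k \<ge> 0" by (rule k)
    fix t q assume t: "mass_balance t" "p t \<in> H1 \<Omega>" and q: "q \<in> H1 \<Omega>"
    have N0: "0 \<le> H1_norm \<Omega> q" by (rule H1.nonneg[OF q])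
    have "L2_norm M (\<lambda>x. grad \<Omega> (p t) x - \<rho>f x *\<^sub>R g) \<le> L2_norm M (grad \<Omega> (p t)) + ?\<gamma>"
      using seminormed_functions.triangle_le_diff[OF seminormed_functions_L2 grad(1)[OF t(2)] gravity_L2] .
    also have "\<dots> \<le> H1_norm \<Omega> (p t) + ?\<gamma>" using L2_norm_grad_le_H1_norm by simp
    finally have 1: "L2_norm M (flux (p t)) \<le> onorm (\<lambda>x. K *v x) * (H1_norm \<Omega> (p t) + ?\<gamma>)"
      using flux_norm[OF t(2)] mult_left_mono[OF _ onorm_K] order_trans by blast
    have "\<bar>L2_inner M (flux (p t)) (grad \<Omega> q)\<bar> \<le> L2_norm M (flux (p t)) * L2_norm M (grad \<Omega> q)"
      by (rule L2_Cauchy_Schwarz[OF flux_L2(1)[OF t(2)] grad(1)[OF q]])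
    also have "\<dots> \<le> onorm (\<lambda>x. K *v x) * (H1_norm \<Omega> (p t) + ?\<gamma>) * H1_norm \<Omega> q"
      using order_trans[OF L2_norm_nonneg 1] by (intro mult_mono 1 L2_norm_grad_le_H1_norm L2_norm_nonneg)
    finally have 2: "\<bar>1 / \<mu>f * L2_inner M (flux (p t)) (grad \<Omega> q)\<bar> \<le> ?k * (H1_norm \<Omega> (p t) + ?\<gamma>) * H1_norm \<Omega> q"
      using \<mu>f by (simp add: abs_mult divide_right_mono)
    have "etat t q = source q - 1 / \<mu>f * L2_inner M (flux (p t)) (grad \<Omega> q)"
      using t(1) q unfolding mass_balance_def by (metis add_diff_cancel_right')
    then have "\<bar>etat t q\<bar> \<le> C * H1_norm \<Omega> q + ?k * (H1_norm \<Omega> (p t) + ?\<gamma>) * H1_norm \<Omega> q"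
      using C(2)[OF q] 2 by linarith
    then show "\<bar>etat t q\<bar> \<le> (C + ?k * ?\<gamma> + ?k * H1_norm \<Omega> (p t)) * H1_norm \<Omega> q"
      by (simp only: algebra_simps)
  qed
qed

section \<open>Integrability in time of functionals of the solution\<close>

lemma H1_norm_p_integrable: "integrable L (\<lambda>t. H1_norm \<Omega> (p t))"
proof -
  interpret finite_measure L by (intro finite_measure_lebesgue_on) auto
  have "(\<lambda>t. H1_norm \<Omega> (p t)) \<in> L2 L"
    using H1.norm_measurable[OF weak_p_measurable] weak_p_square by (simp add: L2_def)
  then show ?thesis by (rule L2_imp_integrable[OF finite_measure_axioms])
qed

text \<open>For \<open>source\<close>, whose boundary part is accessible only by its linearity and
  its bound, this is how measurability in time is obtained.\<close>

lemma integrable_functional_p: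
  assumes b: "\<And>q. q \<in> H1 \<Omega> \<Longrightarrow> \<bar>\<Lambda> q\<bar> \<le> C * H1_norm \<Omega> q"
    and d: "\<And>v w. v \<in> H1 \<Omega> \<Longrightarrow> w \<in> H1 \<Omega> \<Longrightarrow> \<Lambda> (\<lambda>x. v x - w x) = \<Lambda> v - \<Lambda> w"
  shows "integrable L (\<lambda>t. \<Lambda> (p t))"
proof (rule Bochner_Integration.integrable_bound)
  show "integrable L (\<lambda>t. C * H1_norm \<Omega> (p t))" using H1_norm_p_integrable by simp
  show "AE t in L. norm (\<Lambda> (p t)) \<le> norm (C * H1_norm \<Omega> (p t))"
    using H1.strongly_measurable_AE_mem[OF weak_p_measurable] by eventually_elim (use b in force)
  show "(\<lambda>t. \<Lambda> (p t)) \<in> borel_measurable L"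
  proof (rule strongly_measurable_apply[OF weak_p_measurable, where \<Lambda>="\<lambda>t. \<Lambda>"])
    show "AE t in L. \<forall>v\<in>H1 \<Omega>. \<forall>s. (\<forall>n. s n \<in> H1 \<Omega>) \<longrightarrow> (\<lambda>n. H1_norm \<Omega> (\<lambda>x. s n x - v x)) \<longlonglongrightarrow> 0 \<longrightarrow> (\<lambda>n. \<Lambda> (s n)) \<longlonglongrightarrow> \<Lambda> v"
    proof (intro AE_I2 ballI allI impI)
      fix v s assume v: "v \<in> H1 \<Omega>" "\<forall>n. s n \<in> H1 \<Omega>" "(\<lambda>n. H1_norm \<Omega> (\<lambda>x. s n x - v x)) \<longlonglongrightarrow> 0"
      have "(\<lambda>n. C * H1_norm \<Omega> (\<lambda>x. s n x - v x)) \<longlonglongrightarrow> 0" using tendsto_mult[OF tendsto_const v(3)] by simp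
      then have "(\<lambda>n. \<Lambda> (s n) - \<Lambda> v) \<longlonglongrightarrow> 0"
      proof (rule Lim_null_comparison[OF always_eventually, rotated], intro allI)
        fix n show "norm (\<Lambda> (s n) - \<Lambda> v) \<le> C * H1_norm \<Omega> (\<lambda>x. s n x - v x)"
          using b[OF H1.diff_mem, of "s n" v] d[of "s n" v] v by simp
      qed
      then show "(\<lambda>n. \<Lambda> (s n)) \<longlonglongrightarrow> \<Lambda> v" by (simp add: LIM_zero_iff)
    qed
  qed simp
qed

lemma L2_inner_p_integrable:
  assumes "w \<in> L2 M"
  shows "integrable L (\<lambda>t. L2_inner M (p t) w)"
proof (rule integrable_functional_p)
  fix q assume q: "q \<in> H1 \<Omega>"
  have "\<bar>L2_inner M q w\<bar> \<le> L2_norm M q * L2_norm M w" by (rule L2_Cauchy_Schwarz[OF H1_L2[OF q] assms])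
  also have "\<dots> \<le> H1_norm \<Omega> q * L2_norm M w" by (intro mult_right_mono L2_norm_le_H1_norm L2_norm_nonneg)
  finally show "\<bar>L2_inner M q w\<bar> \<le> L2_norm M w * H1_norm \<Omega> q" by (simp add: mult.commute)
qed (intro L2_inner_diff_left H1_L2 assms)

lemma L2_inner_dvg_integrable:
  assumes w: "w \<in> L2 M"
  shows "integrable L (\<lambda>t. L2_inner M (dvg \<Omega> (u t)) w)"
proof -
  interpret finite_measure L by (intro finite_measure_lebesgue_on) auto
  obtain C where C: "AE t in L. H1v_norm \<Omega> (u t) \<le> C" using weak_u(2) by blast
  have b: "\<bar>L2_inner M (dvg \<Omega> v) w - L2_inner M (dvg \<Omega> v') w\<bar> \<le> onorm (trace :: real^'d^'d \<Rightarrow> real) * L2_norm M w * H1v_norm \<Omega> (\<lambda>x. v x - v' x)"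
    if v: "v \<in> H1v \<Omega>" "v' \<in> H1v \<Omega>" for v v'
  proof -
    have "\<bar>L2_inner M (dvg \<Omega> v) w - L2_inner M (dvg \<Omega> v') w\<bar> = \<bar>L2_inner M (\<lambda>x. dvg \<Omega> v x - dvg \<Omega> v' x) w\<bar>"
      using L2_inner_diff_left[OF dvg_L2[OF v(1)] dvg_L2[OF v(2)] w] by simp
    also have "\<dots> \<le> L2_norm M (\<lambda>x. dvg \<Omega> v x - dvg \<Omega> v' x) * L2_norm M w"
      by (intro L2_Cauchy_Schwarz L2_diff dvg_L2 v w)
    also have "\<dots> \<le> (onorm (trace :: real^'d^'d \<Rightarrow> real) * H1v_norm \<Omega> (\<lambda>x. v x - v' x)) * L2_norm M w"
      unfolding dvg_eq by (intro mult_right_mono L2_norm_linear_jac_diff linear_trace v L2_norm_nonneg)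
    finally show ?thesis by (simp add: mult_ac)
  qed
  have k: "0 \<le> onorm (trace :: real^'d^'d \<Rightarrow> real) * L2_norm M w"
    using linear_trace by (intro mult_nonneg_nonneg onorm_pos_le L2_norm_nonneg) (simp add: linear_conv_bounded_linear)
  show ?thesis
  proof (rule integrable_const_bound[where B="onorm (trace :: real^'d^'d \<Rightarrow> real) * L2_norm M w * C"])
    show "AE t in L. norm (L2_inner M (dvg \<Omega> (u t)) w) \<le> onorm (trace :: real^'d^'d \<Rightarrow> real) * L2_norm M w * C"
      using H1_perp.strongly_measurable_AE_mem[OF weak_u(1)] C
    proof eventually_elim
      case (elim t)
      have ut: "u t \<in> H1v \<Omega>" using H1_perp_H1v elim by blast
      have "\<bar>L2_inner M (dvg \<Omega> (u t)) w\<bar> \<le> L2_norm M (dvg \<Omega> (u t)) * L2_norm M w"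
        by (intro L2_Cauchy_Schwarz dvg_L2 ut w)
      also have "\<dots> \<le> (onorm (trace :: real^'d^'d \<Rightarrow> real) * L2_norm M (jac \<Omega> (u t))) * L2_norm M w"
        unfolding dvg_eq by (intro mult_right_mono L2_norm_linear_image linear_trace jac_L2 ut L2_norm_nonneg)
      also have "\<dots> = onorm (trace :: real^'d^'d \<Rightarrow> real) * L2_norm M w * L2_norm M (jac \<Omega> (u t))" by (simp add: mult_ac)
      also have "\<dots> \<le> onorm (trace :: real^'d^'d \<Rightarrow> real) * L2_norm M w * C"
        using k elim L2_norm_jac_le_H1v_norm[of "u t"] by (intro mult_left_mono) auto
      finally show ?case by simp
    qed
    show "(\<lambda>t. L2_inner M (dvg \<Omega> (u t)) w) \<in> borel_measurable L"
    proof (rule strongly_measurable_apply[OF weak_u(1), where \<Lambda>="\<lambda>t v. L2_inner M (dvg \<Omega> v) w"])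
      show "AE t in L. \<forall>v\<in>H1_perp \<Omega>. \<forall>s. (\<forall>n. s n \<in> H1_perp \<Omega>) \<longrightarrow> (\<lambda>n. H1v_norm \<Omega> (\<lambda>x. s n x - v x)) \<longlonglongrightarrow> 0 \<longrightarrow>
          (\<lambda>n. L2_inner M (dvg \<Omega> (s n)) w) \<longlonglongrightarrow> L2_inner M (dvg \<Omega> v) w"
      proof (intro AE_I2 ballI allI impI)
        fix v s assume v: "v \<in> H1_perp \<Omega>" "\<forall>n. s n \<in> H1_perp \<Omega>" "(\<lambda>n. H1v_norm \<Omega> (\<lambda>x. s n x - v x)) \<longlonglongrightarrow> 0"
        have "(\<lambda>n. onorm (trace :: real^'d^'d \<Rightarrow> real) * L2_norm M w * H1v_norm \<Omega> (\<lambda>x. s n x - v x)) \<longlonglongrightarrow> 0"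
          using tendsto_mult[OF tendsto_const v(3)] by simp
        then have "(\<lambda>n. L2_inner M (dvg \<Omega> (s n)) w - L2_inner M (dvg \<Omega> v) w) \<longlonglongrightarrow> 0"
          by (rule Lim_null_comparison[OF always_eventually, rotated]) (use b v H1_perp_H1v in simp)
        then show "(\<lambda>n. L2_inner M (dvg \<Omega> (s n)) w) \<longlonglongrightarrow> L2_inner M (dvg \<Omega> v) w" by (simp add: LIM_zero_iff)
      qed
    qed simp
  qed
qed

section \<open>Increments of the fluid content between good times\<close>

lemma content_inner:
  assumes "p t \<in> L2 M" "u t \<in> H1v \<Omega>" "w \<in> L2 M"
  shows "L2_inner M (content t) w = c0 * L2_inner M (p t) w + \<alpha> * L2_inner M (dvg \<Omega> (u t)) w"
  unfolding content_def[abs_def]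
  using L2_inner_add_left[OF L2_mult[OF assms(1)] L2_mult[OF dvg_L2[OF assms(2)]] assms(3), of c0 \<alpha>]
  by (simp add: L2_inner_mult_left)

text \<open>Turns the distributional derivative into a primitive, for one test function at a time:
  the constant and the exceptional null set depend on \<open>q\<close>.\<close>

lemma content_primitive:
  assumes q: "q \<in> H1 \<Omega>"
  shows "\<exists>c. AE t in L. L2_inner M (content t) q = c + integral_from_to 0 t (\<lambda>r. etat r q)"
proof -
  have i: "integrable L (\<lambda>t. c0 * L2_inner M (p t) q + \<alpha> * L2_inner M (dvg \<Omega> (u t)) q)"
    using L2_inner_p_integrable[OF H1_L2[OF q]] L2_inner_dvg_integrable[OF H1_L2[OF q]] by simp
  have e: "AE t in L. c0 * L2_inner M (p t) q + \<alpha> * L2_inner M (dvg \<Omega> (u t)) q = L2_inner M (content t) q"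
    using H1_perp.strongly_measurable_AE_mem[OF weak_u(1)] H1.strongly_measurable_AE_mem[OF weak_p_measurable]
    by eventually_elim (simp add: content_inner H1_L2 H1_perp_H1v q)
  have i': "integrable L (\<lambda>t. L2_inner M (content t) q)"
    using AE_measurable_lebesgue_on[OF _ borel_measurable_integrable[OF i] e] e
    by (intro integrable_cong_AE_imp[OF i]) auto
  have w: "(\<integral>t. L2_inner M (content t) q * deriv \<psi> t \<partial>L) = - (\<integral>t. etat t q * \<psi> t \<partial>L)" if "\<psi> \<in> test_fun {0<..<T}" for \<psi>
    using weak_time_derivative q that unfolding is_time_derivative_def by blast
  show ?thesis by (rule du_Bois_Reymond[OF T i' etat_integrable[OF q] w]) (assumption, rule exI)
qed

text \<open>One null set of times serves for all test functions \<open>p r\<close>, because \<open>p\<close> is essentially separably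
  valued. The initial time is excluded: the continuous version has the prescribed value there, which
  need not be that of \<open>u\<close>.\<close>

lemma good_times:
  obtains G C where "AE t in L. t \<in> G" "G \<subseteq> {0<..T}"
    "\<And>w. w \<in> L2 M \<Longrightarrow> ((\<lambda>t. L2_inner M (u t) w) \<longlongrightarrow> L2_inner M u0 w) (at 0 within G)"
    "\<And>w. w \<in> L2 M \<Longrightarrow> ((\<lambda>t. L2_inner M (\<lambda>x. sqrt c0 * p t x) w) \<longlongrightarrow> L2_inner M (\<lambda>x. sqrt c0 * p0 x) w) (at 0 within G)"
    "\<And>t. t \<in> G \<Longrightarrow> u t \<in> H1_perp \<Omega> \<and> H1v_norm \<Omega> (u t) \<le> C \<and> p t \<in> H1 \<Omega> \<and> elastic t \<and> mass_balance t"
    "\<And>s t r. s \<in> G \<Longrightarrow> t \<in> G \<Longrightarrow> r \<in> G \<Longrightarrow> s < t \<Longrightarrow>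
       L2_inner M (content t) (p r) - L2_inner M (content s) (p r) = integral_from_to s t (\<lambda>x. etat x (p r))"
proof -
  obtain C where C: "AE t in L. H1v_norm \<Omega> (u t) \<le> C" using weak_u(2) by blast
  obtain s where s0: "(\<forall>n. simple_function L (s n) \<and> s n ` {0..T} \<subseteq> H1 \<Omega>) \<and>
      (AE t in L. p t \<in> H1 \<Omega> \<and> (\<lambda>n. H1_norm \<Omega> (s n t - p t)) \<longlonglongrightarrow> 0)"
    using weak_p_measurable[unfolded strongly_measurable_def] by (rule exE)
  note s = conjunct1[OF spec[OF conjunct1[OF s0]]] conjunct2[OF spec[OF conjunct1[OF s0]]] conjunct2[OF s0]
  \<comment> \<open>The values of the approximating simple functions: a countable set of test
    functions that contains, for every good time \<open>r\<close>, a sequence converging to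
    \<open>p r\<close>.\<close>
  define Q where "Q = (\<Union>n. s n ` {0..T})"
  have "finite (s n ` {0..T})" for n using s(1)[of n] by (simp add: simple_function_def space_restrict_space)
  then have cQ: "countable Q" unfolding Q_def by (intro countable_UN) (auto intro: countable_finite)
  have QH: "Q \<subseteq> H1 \<Omega>" unfolding Q_def using s(2) by blast
  have "\<forall>q\<in>Q. \<exists>c. AE t in L. L2_inner M (content t) q = c + integral_from_to 0 t (\<lambda>r. etat r q)"
    using content_primitive QH by blast
  then obtain c where "\<forall>q\<in>Q. AE t in L. L2_inner M (content t) q = c q + integral_from_to 0 t (\<lambda>r. etat r q)"
    by (rule bchoice[THEN exE])
  then have prim: "AE t in L. \<forall>q\<in>Q. L2_inner M (content t) q = c q + integral_from_to 0 t (\<lambda>r. etat r q)"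
    by (simp add: AE_ball_countable[OF cQ])
  obtain Z1 where Z1: "Z1 \<in> null_sets lebesgue" "\<forall>w\<in>L2 M. ((\<lambda>t. L2_inner M (u t) w) \<longlongrightarrow> L2_inner M u0 w) (at 0 within ({0..T} - Z1))"
    using weak_initial_u unfolding has_initial_value_def by (rule bexE)
  obtain Z2 where Z2: "Z2 \<in> null_sets lebesgue"
    "\<forall>w\<in>L2 M. ((\<lambda>t. L2_inner M (\<lambda>x. sqrt c0 * p t x) w) \<longlongrightarrow> L2_inner M (\<lambda>x. sqrt c0 * p0 x) w) (at 0 within ({0..T} - Z2))"
    using weak_initial_p unfolding has_initial_value_def by (rule bexE)
  define Z where "Z = insert 0 (Z1 \<union> Z2)"
  have Z: "Z \<in> null_sets lebesgue"
  proof -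
    have "{0::real} \<in> null_sets lebesgue" by (simp add: negligible_iff_null_sets[symmetric])
    then have "{0} \<union> (Z1 \<union> Z2) \<in> null_sets lebesgue" using Z1(1) Z2(1) by (intro null_sets.Un)
    then show ?thesis by (simp add: Z_def)
  qed
  have AEZ: "AE t in L. t \<notin> Z"
    using AE_not_in[OF Z] by (subst AE_lebesgue_on_iff) auto
  define good where "good t \<longleftrightarrow> t \<in> {0..T} \<and> t \<notin> Z \<and> u t \<in> H1_perp \<Omega> \<and> H1v_norm \<Omega> (u t) \<le> C \<and> p t \<in> H1 \<Omega> \<and>
      elastic t \<and> mass_balance t \<and> (\<lambda>n. H1_norm \<Omega> (s n t - p t)) \<longlonglongrightarrow> 0 \<and>
      (\<forall>q\<in>Q. L2_inner M (content t) q = c q + integral_from_to 0 t (\<lambda>r. etat r q))" for t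
  have "AE t in L. t \<in> {0..T}" by (rule AE_mem_lebesgue_on) simp
  then have AEg: "AE t in L. good t"
    using AEZ H1_perp.strongly_measurable_AE_mem[OF weak_u(1)] C s(3) weak_elastic weak_mass_balance prim
    by eventually_elim (unfold good_def, blast)
  obtain C1 C2 where C12: "C1 \<ge> 0" "C2 \<ge> 0"
    "\<And>t q. mass_balance t \<Longrightarrow> p t \<in> H1 \<Omega> \<Longrightarrow> q \<in> H1 \<Omega> \<Longrightarrow> \<bar>etat t q\<bar> \<le> (C1 + C2 * H1_norm \<Omega> (p t)) * H1_norm \<Omega> q"
    using etat_bound by metis
  define G where "G = {t. good t}"
  have G0: "G \<subseteq> {0<..T}" by (auto simp: G_def good_def Z_def less_le)
  show ?thesis
  proof (rule that[of G C])
    show "AE t in L. t \<in> G" using AEg by (simp add: G_def)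
    show "G \<subseteq> {0<..T}" by (rule G0)
    show "((\<lambda>t. L2_inner M (u t) w) \<longlongrightarrow> L2_inner M u0 w) (at 0 within G)" if "w \<in> L2 M" for w
      by (rule tendsto_within_subset[OF Z1(2)[rule_format, OF that]]) (auto simp: G_def good_def Z_def)
    show "((\<lambda>t. L2_inner M (\<lambda>x. sqrt c0 * p t x) w) \<longlongrightarrow> L2_inner M (\<lambda>x. sqrt c0 * p0 x) w) (at 0 within G)" if "w \<in> L2 M" for w
      by (rule tendsto_within_subset[OF Z2(2)[rule_format, OF that]]) (auto simp: G_def good_def Z_def)
    show "u t \<in> H1_perp \<Omega> \<and> H1v_norm \<Omega> (u t) \<le> C \<and> p t \<in> H1 \<Omega> \<and> elastic t \<and> mass_balance t" if "t \<in> G" for t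
      using that by (simp add: G_def good_def)
    fix a b r assume abr: "a \<in> G" "b \<in> G" "r \<in> G" "a < b"
    have ab: "0 \<le> a" "b \<le> T" using abr G0 by auto
    let ?q = "\<lambda>n. s n r"
    have rT: "r \<in> {0..T}" using abr(3) by (simp add: G_def good_def)
    have qQ: "?q n \<in> Q" for n using rT unfolding Q_def by blast
    then have qH: "?q n \<in> H1 \<Omega>" for n using QH by blast
    have pr: "p r \<in> H1 \<Omega>" using abr(3) by (simp add: G_def good_def)
    have lim: "(\<lambda>n. H1_norm \<Omega> (\<lambda>x. ?q n x - p r x)) \<longlonglongrightarrow> 0" using abr(3) by (simp add: G_def good_def fun_diff_def)
    have cL: "content t \<in> L2 M" if "t \<in> G" for t
      unfolding content_def[abs_def] using that
      by (intro L2_add L2_mult dvg_L2 H1_L2 H1_perp_H1v) (simp_all add: G_def good_def)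
    have lhs: "(\<lambda>n. L2_inner M (content t) (?q n)) \<longlonglongrightarrow> L2_inner M (content t) (p r)" if "t \<in> G" for t
    proof -
      have "(\<lambda>n. L2_norm M (\<lambda>x. ?q n x - p r x)) \<longlonglongrightarrow> 0"
        by (rule Lim_null_comparison[OF always_eventually lim]) (simp add: L2_norm_nonneg L2_norm_le_H1_norm)
      then show ?thesis unfolding L2_inner_commute[of M "content t"]
        by (intro L2_inner_tendsto H1_L2 qH pr cL that)
    qed
    define m where "m t = C1 + C2 * H1_norm \<Omega> (p t)" for t
    have mi: "integrable L m" unfolding m_def
      using H1_norm_p_integrable continuous_on_integrable[OF continuous_on_const, of 0 T C1] by simp
    \<comment> \<open>Passage to the limit under the time integral: the norm of
      \<open>etat x\<close> is at most \<open>m x\<close>, an integrable function that does not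
      depend on \<open>n\<close>.\<close>
    have rhs: "(\<lambda>n. integral_from_to a b (\<lambda>x. etat x (?q n))) \<longlonglongrightarrow> integral_from_to a b (\<lambda>x. etat x (p r))"
    proof -
      have "(\<lambda>n. integral_from_to a b m * H1_norm \<Omega> (\<lambda>x. ?q n x - p r x)) \<longlonglongrightarrow> 0"
        using tendsto_mult[OF tendsto_const lim] by simp
      then have "(\<lambda>n. integral_from_to a b (\<lambda>x. etat x (?q n)) - integral_from_to a b (\<lambda>x. etat x (p r))) \<longlonglongrightarrow> 0"
      proof (rule Lim_null_comparison[OF always_eventually, rotated], intro allI)
        fix n
        let ?N = "H1_norm \<Omega> (\<lambda>x. ?q n x - p r x)"
        have "integral_from_to a b (\<lambda>x. etat x (?q n)) - integral_from_to a b (\<lambda>x. etat x (p r))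
            = integral_from_to a b (\<lambda>x. etat x (?q n) - etat x (p r))"
          unfolding integral_from_to_def
          by (intro Bochner_Integration.integral_diff[symmetric] integrable_subinterval[OF etat_integrable ab] qH pr)
        moreover have "\<bar>integral_from_to a b (\<lambda>x. etat x (?q n) - etat x (p r))\<bar> \<le> integral_from_to a b (\<lambda>x. m x * ?N)"
        proof (rule integral_from_to_abs_le[OF _ _ ab])
          show "integrable L (\<lambda>x. etat x (?q n) - etat x (p r))" using etat_integrable[OF qH] etat_integrable[OF pr] by simp
          show "integrable L (\<lambda>x. m x * ?N)" using mi by simp
          show "AE x in L. \<bar>etat x (?q n) - etat x (p r)\<bar> \<le> m x * ?N"
            using AEg
          proof eventually_elim
            case (elim x)
            then have x: "mass_balance x" "p x \<in> H1 \<Omega>" by (auto simp: good_def)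
            then have "etat x (\<lambda>y. ?q n y - p r y) = etat x (?q n) - etat x (p r)"
              by (intro dual_space_diff[OF _ qH pr H1_scale(1)]) (auto simp: mass_balance_def)
            then show ?case using C12(3)[OF x H1.diff_mem[OF qH pr], of n] by (simp add: m_def)
          qed
        qed
        ultimately show "norm (integral_from_to a b (\<lambda>x. etat x (?q n)) - integral_from_to a b (\<lambda>x. etat x (p r)))
            \<le> integral_from_to a b m * ?N"
          by (simp add: integral_from_to_def)
      qed
      then show ?thesis by (simp add: LIM_zero_iff)
    qed
    have "L2_inner M (content b) (?q n) - L2_inner M (content a) (?q n) = integral_from_to a b (\<lambda>x. etat x (?q n))" for n
      using abr(1,2) qQ[of n] integral_from_to_diff[OF etat_integrable[OF qH] ab(1) less_imp_le[OF abr(4)] ab(2), of n]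
      by (simp add: G_def good_def)
    with tendsto_diff[OF lhs[OF abr(2)] lhs[OF abr(1)]]
    have "(\<lambda>n. integral_from_to a b (\<lambda>x. etat x (?q n))) \<longlonglongrightarrow> L2_inner M (content b) (p r) - L2_inner M (content a) (p r)" by simp
    with rhs show "L2_inner M (content b) (p r) - L2_inner M (content a) (p r) = integral_from_to a b (\<lambda>x. etat x (p r))"
      using LIMSEQ_unique by blast
  qed
qed

end

section \<open>The continuous version\<close>

context bounded_open_set
begin

text \<open>The functions whose Jacobian is mapped by \<open>A\<close> to within \<open>C\<close> of
  \<open>J\<close> form a convex set, so it contains the midpoints of its members.\<close>

lemma midpoints_linear_jac:
  assumes A: "linear A" and y: "y \<in> midpoints s n" and s: "\<And>m. s m \<in> H1v \<Omega>"
    and J: "J \<in> L2 M" and b: "\<And>m. m \<ge> n \<Longrightarrow> L2_norm M (\<lambda>x. A (jac \<Omega> (s m) x) - J x) \<le> C"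
  shows "L2_norm M (\<lambda>x. A (jac \<Omega> y x) - J x) \<le> C"
  using y
proof (induction rule: midpoints.induct)
  case (base m)
  then show ?case by (rule b)
next
  case (mid v w)
  have v: "v \<in> H1v \<Omega>" and w: "w \<in> H1v \<Omega>" using H1v.midpoints_mem[of _ s n, OF _ s] mid.hyps by blast+
  have L: "(\<lambda>x. A (jac \<Omega> v x) - J x) \<in> L2 M" "(\<lambda>x. A (jac \<Omega> w x) - J x) \<in> L2 M"
    by (rule L2_diff[OF L2_linear_image[OF A jac_L2[OF v]] J], rule L2_diff[OF L2_linear_image[OF A jac_L2[OF w]] J])
  have m: "(\<lambda>x. (1/2) *\<^sub>R (v x + w x)) \<in> H1v \<Omega>" by (rule H1v.midpoint_mem[OF v w])
  have "AE x in M. A (jac \<Omega> (\<lambda>x. (1/2) *\<^sub>R (v x + w x)) x) - J x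
      = (1/2) *\<^sub>R ((A (jac \<Omega> v x) - J x) + (A (jac \<Omega> w x) - J x))"
    using H1v_scale(2)[OF H1v_add(1)[OF v w], of "1/2"] H1v_add(2)[OF v w]
  proof eventually_elim
    case (elim x)
    have "(a - j) + (b - j) = (a + b) - 2 *\<^sub>R j" for a b j :: 'a by (simp add: scaleR_2)
    then have "(1/2) *\<^sub>R ((a - j) + (b - j)) = (1/2) *\<^sub>R (a + b) - j" for a b j :: 'a
      by (simp only: scaleR_diff_right) simp
    then show ?case unfolding elim by (simp only: linear_cmul[OF A] linear_add[OF A])
  qed
  then have "L2_norm M (\<lambda>x. A (jac \<Omega> (\<lambda>x. (1/2) *\<^sub>R (v x + w x)) x) - J x)
      = L2_norm M (\<lambda>x. (1/2) *\<^sub>R ((A (jac \<Omega> v x) - J x) + (A (jac \<Omega> w x) - J x)))"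
    by (intro L2_norm_cong_AE L2D(1)[OF L2_diff[OF L2_linear_image[OF A jac_L2[OF m]] J]] L2D(1)[OF L2_scaleR[OF L2_add[OF L]]])
  also have "\<dots> = 1/2 * L2_norm M (\<lambda>x. (A (jac \<Omega> v x) - J x) + (A (jac \<Omega> w x) - J x))"
    by (simp add: L2_norm_scaleR)
  also have "\<dots> \<le> 1/2 * (C + C)"
    using L2_norm_triangle[OF L] mid.IH by (intro mult_left_mono) auto
  finally show ?case by simp
qed

text \<open>Closeness of the inner product with a fixed function to a number is a convex condition
  as well; this transfers weak limits from a sequence to its midpoints.\<close>

lemma midpoints_inner:
  assumes y: "y \<in> midpoints s n" and s: "\<And>m. s m \<in> L2 M" and w: "w \<in> L2 M"
    and b: "\<And>m. m \<ge> n \<Longrightarrow> \<bar>L2_inner M (s m) w - c\<bar> \<le> e"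
  shows "y \<in> L2 M \<and> \<bar>L2_inner M y w - c\<bar> \<le> e"
  using y
proof (induction rule: midpoints.induct)
  case (base m)
  then show ?case using b s by simp
next
  case (mid v v')
  have "L2_inner M (\<lambda>x. (1/2) *\<^sub>R (v x + v' x)) w = 1/2 * (L2_inner M v w + L2_inner M v' w)"
    using mid.IH w by (simp only: L2_inner_scaleR_left L2_inner_add_left)
  then show ?case using mid.IH L2_scaleR[OF L2_add, of v M v' "1/2"] by (simp add: abs_le_iff)
qed

text \<open>The difference of the two functions is itself an admissible \<open>h\<close>, so its
  norm is zero.\<close>

lemma L2_weak_eq_imp_AE_eq:
  assumes "v \<in> L2 M" "w \<in> L2 M" "\<And>h. h \<in> L2 M \<Longrightarrow> L2_inner M v h = L2_inner M w h"
  shows "AE x in M. v x = w x"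
proof -
  have d: "(\<lambda>x. v x - w x) \<in> L2 M" by (rule L2_diff[OF assms(1,2)])
  have "(L2_norm M (\<lambda>x. v x - w x))\<^sup>2 = 0"
    using L2_inner_diff_left[OF assms(1,2) d] assms(3)[OF d] by (simp add: L2_norm_sq)
  then have "AE x in M. v x - w x = 0" using L2_norm_eq_0_AE[OF d] by simp
  then show ?thesis by eventually_elim simp
qed

text \<open>The modulus of continuity known on \<open>G\<close> is inherited by the limits
  \<open>V\<close>, because \<open>W\<close> is continuous at the exceptional times too.\<close>

lemma L2_continuous_extension:
  fixes Y V :: "real \<Rightarrow> real^'d \<Rightarrow> 'b::euclidean_space"
  assumes Y: "\<And>t. t \<in> G \<Longrightarrow> Y t \<in> L2 M" and V: "\<And>t. t \<in> {0..T} \<Longrightarrow> V t \<in> L2 M"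
    and G: "G \<subseteq> {0..T}"
    and lim: "\<And>t. t \<in> {0..T} \<Longrightarrow> \<exists>\<sigma>. (\<forall>n. \<sigma> n \<in> G) \<and> \<sigma> \<longlonglongrightarrow> t \<and> (\<lambda>n. L2_norm M (\<lambda>x. Y (\<sigma> n) x - V t x)) \<longlonglongrightarrow> 0"
    and W: "continuous_on {0..T} W"
    and est: "\<And>s t. s \<in> G \<Longrightarrow> t \<in> G \<Longrightarrow> (L2_norm M (\<lambda>x. Y s x - Y t x))\<^sup>2 \<le> C * \<bar>W s - W t\<bar>"
  shows "L2_continuous \<Omega> T V"
proof -
  have b: "L2_norm M (\<lambda>x. V s x - V t x) \<le> sqrt (C * \<bar>W s - W t\<bar>)" if s: "s \<in> {0..T}" and t: "t \<in> {0..T}" for s t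
  proof -
    obtain \<sigma> where \<sigma>: "\<forall>n. \<sigma> n \<in> G" "\<sigma> \<longlonglongrightarrow> s" "(\<lambda>n. L2_norm M (\<lambda>x. Y (\<sigma> n) x - V s x)) \<longlonglongrightarrow> 0"
      using lim[OF s] by (elim exE conjE)
    obtain \<tau> where \<tau>: "\<forall>n. \<tau> n \<in> G" "\<tau> \<longlonglongrightarrow> t" "(\<lambda>n. L2_norm M (\<lambda>x. Y (\<tau> n) x - V t x)) \<longlonglongrightarrow> 0"
      using lim[OF t] by (elim exE conjE)
    have Wl: "(\<lambda>n. W (\<rho> n)) \<longlonglongrightarrow> W r" if "\<forall>n. \<rho> n \<in> G" "\<rho> \<longlonglongrightarrow> r" "r \<in> {0..T}" for \<rho> r
      using W that G unfolding continuous_on_sequentially by (auto simp: comp_def subset_iff)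
    have "(\<lambda>n. L2_norm M (\<lambda>x. Y (\<sigma> n) x - V s x) + sqrt (C * \<bar>W (\<sigma> n) - W (\<tau> n)\<bar>) + L2_norm M (\<lambda>x. Y (\<tau> n) x - V t x))
        \<longlonglongrightarrow> 0 + sqrt (C * \<bar>W s - W t\<bar>) + 0"
      by (intro tendsto_add \<sigma>(3) \<tau>(3) tendsto_real_sqrt tendsto_mult tendsto_const tendsto_rabs tendsto_diff Wl \<sigma> \<tau> s t)
    moreover have "L2_norm M (\<lambda>x. V s x - V t x)
        \<le> L2_norm M (\<lambda>x. Y (\<sigma> n) x - V s x) + sqrt (C * \<bar>W (\<sigma> n) - W (\<tau> n)\<bar>) + L2_norm M (\<lambda>x. Y (\<tau> n) x - V t x)" for n
    proof -
      have Y': "Y (\<sigma> n) \<in> L2 M" "Y (\<tau> n) \<in> L2 M" using Y \<sigma> \<tau> by auto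
      have "L2_norm M (\<lambda>x. V s x - V t x) \<le> L2_norm M (\<lambda>x. V s x - Y (\<sigma> n) x) + L2_norm M (\<lambda>x. Y (\<sigma> n) x - V t x)"
        by (rule L2_norm_triangle_diff[OF V[OF s] Y'(1) V[OF t]])
      also have "L2_norm M (\<lambda>x. Y (\<sigma> n) x - V t x) \<le> L2_norm M (\<lambda>x. Y (\<sigma> n) x - Y (\<tau> n) x) + L2_norm M (\<lambda>x. Y (\<tau> n) x - V t x)"
        by (rule L2_norm_triangle_diff[OF Y' V[OF t]])
      also have "L2_norm M (\<lambda>x. Y (\<sigma> n) x - Y (\<tau> n) x) \<le> sqrt (C * \<bar>W (\<sigma> n) - W (\<tau> n)\<bar>)"
        using est \<sigma>(1) \<tau>(1) by (intro real_le_rsqrt) auto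
      finally show ?thesis by (simp add: L2_norm_minus_commute[of M "V s"])
    qed
    ultimately show ?thesis using LIMSEQ_le_const[of _ "0 + sqrt (C * \<bar>W s - W t\<bar>) + 0"] by simp
  qed
  show ?thesis
    unfolding L2_continuous_def
  proof (intro ballI conjI V)
    fix t assume t: "t \<in> {0..T}"
    have "((\<lambda>s. W s) \<longlongrightarrow> W t) (at t within {0..T})" using W t by (simp add: continuous_on_def)
    then have "((\<lambda>s. sqrt (C * \<bar>W s - W t\<bar>)) \<longlongrightarrow> sqrt (C * \<bar>W t - W t\<bar>)) (at t within {0..T})"
      by (intro tendsto_intros)
    then have l: "((\<lambda>s. sqrt (C * \<bar>W s - W t\<bar>)) \<longlongrightarrow> 0) (at t within {0..T})" by simp
    have "\<forall>\<^sub>F s in at t within {0..T}. s \<in> {0..T}" by (simp add: eventually_at_filter)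
    then have "\<forall>\<^sub>F s in at t within {0..T}. norm (L2_norm M (\<lambda>x. V s x - V t x)) \<le> sqrt (C * \<bar>W s - W t\<bar>)"
      by eventually_elim (use b t in \<open>simp add: abs_of_nonneg[OF L2_norm_nonneg]\<close>)
    then show "((\<lambda>s. L2_norm M (\<lambda>x. V s x - V t x)) \<longlongrightarrow> 0) (at t within {0..T})"
      using l by (rule Lim_null_comparison)
  qed
qed

end

section \<open>Energy identities and the modulus of continuity at good times\<close>

context poroelastic_solution
begin

abbreviation "en t \<equiv> energy \<Omega> lam \<mu> c0 f f1 (u t) (p t)"

lemma energy_load:
  "energy \<Omega> lam \<mu> c0 f f1 v q = 1 / 2 * (\<mu> * (L2_norm M (strain \<Omega> v))\<^sup>2 + lam * (L2_norm M (dvg \<Omega> v))\<^sup>2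
              + c0 * (L2_norm M q)\<^sup>2 - 2 * load v)"
  by (simp add: energy_def load_def)

text \<open>All assertions about the energy follow from the symmetric form \<open>(c\<^sub>0 p + \<alpha> div u)(t)\<close> tested
  with \<open>p s\<close>, by the elasticity equations at the times \<open>s\<close> and \<open>t\<close>.\<close>

lemma energy_algebra:
  assumes s: "u s \<in> H1v \<Omega>" "p s \<in> L2 M" "elastic s" and t: "u t \<in> H1v \<Omega>" "p t \<in> L2 M" "elastic t"
  defines "H \<equiv> \<lambda>t s. L2_inner M (content t) (p s)"
  shows "2 * (en t - en s) = H t t + H t s - H s t - H s s"
    and "\<mu> * (L2_norm M (\<lambda>x. strain \<Omega> (u t) x - strain \<Omega> (u s) x))\<^sup>2
       + lam * (L2_norm M (\<lambda>x. dvg \<Omega> (u t) x - dvg \<Omega> (u s) x))\<^sup>2 + c0 * (L2_norm M (\<lambda>x. p t x - p s x))\<^sup>2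
       = H t t - H t s - H s t + H s s"
proof -
  let ?A = "\<lambda>r r'. \<mu> * L2_inner M (strain \<Omega> (u r)) (strain \<Omega> (u r')) + lam * L2_inner M (dvg \<Omega> (u r)) (dvg \<Omega> (u r'))"
  have el: "\<alpha> * L2_inner M (p r) (dvg \<Omega> (u r')) = ?A r r' - load (u r')" if "elastic r" "u r' \<in> H1v \<Omega>" for r r'
    using that unfolding elastic_def by force
  \<comment> \<open>Symmetric in the two times but for \<open>load (u r)\<close>. The loads
    therefore cancel in the second claim, and in the first they give the linear terms of the
    energy.\<close>
  have H: "H r r' = c0 * L2_inner M (p r) (p r') + ?A r' r - load (u r)"
    if "u r \<in> H1v \<Omega>" "p r \<in> L2 M" "p r' \<in> L2 M" "elastic r'" for r r'
    unfolding H_def using content_inner[OF that(2,1,3)] el[OF that(4,1)] L2_inner_commute[of M "dvg \<Omega> (u r)" "p r'"] by simp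
  note Hs = H[OF t(1,2) t(2,3)] H[OF t(1,2) s(2,3)] H[OF s(1,2) t(2,3)] H[OF s(1,2) s(2,3)]
  note c = L2_inner_commute[of M "p s" "p t"] L2_inner_commute[of M "strain \<Omega> (u s)" "strain \<Omega> (u t)"]
    L2_inner_commute[of M "dvg \<Omega> (u s)" "dvg \<Omega> (u t)"]
  show "2 * (en t - en s) = H t t + H t s - H s t - H s s"
    unfolding Hs energy_load L2_norm_sq c by (simp add: algebra_simps)
  show "\<mu> * (L2_norm M (\<lambda>x. strain \<Omega> (u t) x - strain \<Omega> (u s) x))\<^sup>2
       + lam * (L2_norm M (\<lambda>x. dvg \<Omega> (u t) x - dvg \<Omega> (u s) x))\<^sup>2 + c0 * (L2_norm M (\<lambda>x. p t x - p s x))\<^sup>2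
       = H t t - H t s - H s t + H s s"
    unfolding Hs L2_norm_diff_sq[OF strain_L2[OF t(1)] strain_L2[OF s(1)]] L2_norm_diff_sq[OF dvg_L2[OF t(1)] dvg_L2[OF s(1)]]
      L2_norm_diff_sq[OF t(2) s(2)] c
    by (simp add: algebra_simps)
qed

text \<open>\<open>W\<close> is the primitive of the square of a majorant of the H1 norm of
  \<open>p\<close>; it is a common modulus of continuity for the three norms in the energy. The
  divisors \<open>\<mu>\<close> and \<open>lam\<close> are the weights of the strain and the
  divergence in \<open>D\<close>.\<close>

lemma good_times_energy:
  obtains G C W where "AE t in L. t \<in> G" "G \<subseteq> {0<..T}"
    "\<And>w. w \<in> L2 M \<Longrightarrow> ((\<lambda>t. L2_inner M (u t) w) \<longlongrightarrow> L2_inner M u0 w) (at 0 within G)"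
    "\<And>w. w \<in> L2 M \<Longrightarrow> ((\<lambda>t. L2_inner M (\<lambda>x. sqrt c0 * p t x) w) \<longlongrightarrow> L2_inner M (\<lambda>x. sqrt c0 * p0 x) w) (at 0 within G)"
    "\<And>t. t \<in> G \<Longrightarrow> u t \<in> H1_perp \<Omega> \<and> H1v_norm \<Omega> (u t) \<le> C \<and> p t \<in> H1 \<Omega> \<and> elastic t \<and> mass_balance t"
    "integrable L (\<lambda>t. etat t (p t))"
    "\<And>s t. s \<in> G \<Longrightarrow> t \<in> G \<Longrightarrow> s < t \<Longrightarrow> en t - en s = integral_from_to s t (\<lambda>r. etat r (p r))"
    "continuous_on {0..T} W"
    "\<And>s t. s \<in> G \<Longrightarrow> t \<in> G \<Longrightarrow> (L2_norm M (\<lambda>x. strain \<Omega> (u s) x - strain \<Omega> (u t) x))\<^sup>2 \<le> (20 / \<mu>) * \<bar>W s - W t\<bar>"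
    "\<And>s t. s \<in> G \<Longrightarrow> t \<in> G \<Longrightarrow> (L2_norm M (\<lambda>x. dvg \<Omega> (u s) x - dvg \<Omega> (u t) x))\<^sup>2 \<le> (20 / lam) * \<bar>W s - W t\<bar>"
    "\<And>s t. s \<in> G \<Longrightarrow> t \<in> G \<Longrightarrow> (L2_norm M (\<lambda>x. sqrt c0 * p s x - sqrt c0 * p t x))\<^sup>2 \<le> 20 * \<bar>W s - W t\<bar>"
proof (rule good_times)
  fix G C
  assume G: "AE t in L. t \<in> G" "G \<subseteq> {0<..T}"
    and init: "\<And>w. w \<in> L2 M \<Longrightarrow> ((\<lambda>t. L2_inner M (u t) w) \<longlongrightarrow> L2_inner M u0 w) (at 0 within G)"
    "\<And>w. w \<in> L2 M \<Longrightarrow> ((\<lambda>t. L2_inner M (\<lambda>x. sqrt c0 * p t x) w) \<longlongrightarrow> L2_inner M (\<lambda>x. sqrt c0 * p0 x) w) (at 0 within G)"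
    and good: "\<And>t. t \<in> G \<Longrightarrow> u t \<in> H1_perp \<Omega> \<and> H1v_norm \<Omega> (u t) \<le> C \<and> p t \<in> H1 \<Omega> \<and> elastic t \<and> mass_balance t"
    and inc: "\<And>s t r. s \<in> G \<Longrightarrow> t \<in> G \<Longrightarrow> r \<in> G \<Longrightarrow> s < t \<Longrightarrow>
       L2_inner M (content t) (p r) - L2_inner M (content s) (p r) = integral_from_to s t (\<lambda>x. etat x (p r))"
  have G': "G \<subseteq> {0..T}" using G(2) by auto
  have gu: "u t \<in> H1v \<Omega>" and gp: "p t \<in> H1 \<Omega>" "p t \<in> L2 M" and ge: "elastic t" and gm: "mass_balance t" if "t \<in> G" for t
    using good[OF that] H1_perp_H1v H1_L2 by auto
  obtain C1 C2 where C12: "C1 \<ge> 0" "C2 \<ge> 0"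
    "\<And>t q. mass_balance t \<Longrightarrow> p t \<in> H1 \<Omega> \<Longrightarrow> q \<in> H1 \<Omega> \<Longrightarrow> \<bar>etat t q\<bar> \<le> (C1 + C2 * H1_norm \<Omega> (p t)) * H1_norm \<Omega> q"
    using etat_bound by metis
  \<comment> \<open>Chosen to dominate 1, the H1 norm of \<open>p t\<close> and the bound for
    \<open>etat t\<close> at the same time, as the chain rule and
    \<open>energy_difference_bound\<close> require.\<close>
  define m where "m t = (1 + C1) + (1 + C2) * H1_norm \<Omega> (p t)" for t
  have mi: "integrable L (\<lambda>t. (m t)\<^sup>2)"
  proof -
    have "integrable L (\<lambda>t. (1 + C1)\<^sup>2 + 2 * (1 + C1) * (1 + C2) * H1_norm \<Omega> (p t) + (1 + C2)\<^sup>2 * (H1_norm \<Omega> (p t))\<^sup>2)"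
      using H1_norm_p_integrable weak_p_square continuous_on_integrable[OF continuous_on_const, of 0 T "(1 + C1)\<^sup>2"] by simp
    also have "(\<lambda>t. (1 + C1)\<^sup>2 + 2 * (1 + C1) * (1 + C2) * H1_norm \<Omega> (p t) + (1 + C2)\<^sup>2 * (H1_norm \<Omega> (p t))\<^sup>2) = (\<lambda>t. (m t)\<^sup>2)"
      by (rule ext) (simp add: m_def power2_eq_square algebra_simps)
    finally show ?thesis .
  qed
  have N0: "0 \<le> H1_norm \<Omega> (p t)" if "t \<in> G" for t by (rule H1.nonneg[OF gp(1)[OF that]])
  have m1: "m t \<ge> 1" "m t \<ge> H1_norm \<Omega> (p t)" "m t \<ge> C1 + C2 * H1_norm \<Omega> (p t)" if "t \<in> G" for t
    using N0[OF that] C12(1,2) mult_nonneg_nonneg[OF C12(2) N0[OF that]] by (auto simp: m_def algebra_simps)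
  have eb: "\<bar>etat r v\<bar> \<le> m r * H1_norm \<Omega> v" if "r \<in> G" "v \<in> H1 \<Omega>" for r v
    using C12(3)[OF gm[OF that(1)] gp(1)[OF that(1)] that(2)] mult_right_mono[OF m1(3)[OF that(1)] H1.nonneg[OF that(2)]] by linarith
  \<comment> \<open>The pairing (\<eta>(t) - \<eta>(s), p(t) + p(s)) splits into two increments of
    \<eta>, each tested with a function that is fixed in time.\<close>
  have Een: "2 * (en t - en s) = integral_from_to s t (\<lambda>r. etat r (p t)) + integral_from_to s t (\<lambda>r. etat r (p s))"
    if "s \<in> G" "t \<in> G" "s < t" for s t
    using energy_algebra(1)[OF gu[OF that(1)] gp(2)[OF that(1)] ge[OF that(1)] gu[OF that(2)] gp(2)[OF that(2)] ge[OF that(2)]] inc[OF that(1,2,2,3)] inc[OF that(1,2,1,3)] that by simp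
  have m0: "m t \<ge> 0" if "t \<in> G" for t using m1(1)[OF that] by linarith
  have edif: "etat r (\<lambda>x. v x - w x) = etat r v - etat r w" if "r \<in> G" "v \<in> H1 \<Omega>" "w \<in> H1 \<Omega>" for r v w
    using gm[OF that(1)] by (intro dual_space_diff[OF _ that(2,3) H1_scale(1)]) (auto simp: mass_balance_def)
  note chain = H1.energy_chain_rule[where e=etat and E="\<lambda>t. en t" and m=m, OF weak_p G(1) G' gp(1) edif eb mi m0 etat_integrable Een]
  define D where "D t s = \<mu> * (L2_norm M (\<lambda>x. strain \<Omega> (u t) x - strain \<Omega> (u s) x))\<^sup>2
       + lam * (L2_norm M (\<lambda>x. dvg \<Omega> (u t) x - dvg \<Omega> (u s) x))\<^sup>2 + c0 * (L2_norm M (\<lambda>x. p t x - p s x))\<^sup>2" for t s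
  define H where "H t s = L2_inner M (content t) (p s)" for t s
  have DH: "D t s = H t t - H t s - H s t + H s s" and EH: "2 * (en t - en s) = H t t + H t s - H s t - H s s"
    if "s \<in> G" "t \<in> G" for s t
    using energy_algebra[OF gu[OF that(1)] gp(2)[OF that(1)] ge[OF that(1)] gu[OF that(2)] gp(2)[OF that(2)] ge[OF that(2)]]
    by (simp_all add: D_def H_def)
  have IH: "integral_from_to s t (\<lambda>x. etat x (p r)) = H t r - H s r" if "s \<in> G" "t \<in> G" "r \<in> G" "s < t" for s t r
    using inc[OF that] by (simp add: H_def)
  define W where "W t = integral_from_to 0 t (\<lambda>t. (m t)\<^sup>2)" for t
  have Wc: "continuous_on {0..T} W" unfolding W_def by (rule integral_from_to_continuous[OF mi])
  have key: "\<exists>r\<in>G. D s r \<le> 5 * \<bar>W s - W t\<bar> \<and> D t r \<le> 5 * \<bar>W s - W t\<bar>" if st: "s \<in> G" "t \<in> G" "s < t" for s t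
  proof -
    have "\<exists>r\<in>G. D s r \<le> 5 * integral_from_to s t (\<lambda>t. (m t)\<^sup>2) \<and> D t r \<le> 5 * integral_from_to s t (\<lambda>t. (m t)\<^sup>2)"
    proof (rule energy_difference_bound[where e="\<lambda>r t. etat r (p t)" and E="\<lambda>t. en t", OF G(1) G' mi m1(1) _ chain(1) _ chain(2) _ _ st])
      show "integrable L (\<lambda>r. etat r (p t))" if "t \<in> G" for t by (rule etat_integrable[OF gp(1)[OF that]])
      show "\<bar>etat r (p t)\<bar> \<le> m r * m t" if "r \<in> G" "t \<in> G" for r t
        using eb[OF that(1) gp(1)[OF that(2)]] mult_left_mono[OF m1(2)[OF that(2)] m0[OF that(1)]] by linarith
      \<comment> \<open>Difference and sum of the identities \<open>EH\<close> and \<open>DH\<close>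
        each retain a single value of \<open>p\<close>.\<close>
      show "D t s = 2 * (en t - en s) - 2 * integral_from_to s t (\<lambda>r. etat r (p s))" if "s \<in> G" "t \<in> G" "s < t" for s t
        unfolding IH[OF that(1,2,1,3)] EH[OF that(1,2)] DH[OF that(1,2)] by simp
      show "D s t = - 2 * (en t - en s) + 2 * integral_from_to s t (\<lambda>r. etat r (p t))" if "s \<in> G" "t \<in> G" "s < t" for s t
      proof -
        have "- 2 * (en t - en s) = - (2 * (en t - en s))" by simp
        then show ?thesis unfolding IH[OF that(1,2,2,3)] DH[OF that(2,1)] EH[OF that(1,2)] by simp
      qed
    qed
    moreover have "integral_from_to s t (\<lambda>t. (m t)\<^sup>2) = W t - W s"
      unfolding W_def using st G' by (intro integral_from_to_diff[OF mi]) auto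
    moreover have "integral_from_to s t (\<lambda>t. (m t)\<^sup>2) \<ge> 0" unfolding integral_from_to_def by (simp add: integral_nonneg_AE)
    ultimately show ?thesis by simp
  qed
  \<comment> \<open>One statement for the three parts of \<open>D\<close>, whose codomains differ.
    The number \<kappa> is the weight of the part: \<open>\<mu>\<close>, \<open>lam\<close>, or 1
    for the pressure, where the weight \<open>c0\<close> is absorbed by the factor
    \<open>sqrt c0\<close>.\<close>
  have est: "(L2_norm M (\<lambda>x. Y s x - Y t x))\<^sup>2 \<le> 20 / \<kappa> * \<bar>W s - W t\<bar>"
    if st: "s \<in> G" "t \<in> G" and \<kappa>: "\<kappa> > 0" and YL: "\<And>t. t \<in> G \<Longrightarrow> Y t \<in> L2 M"
      and Y: "\<And>s t. s \<in> G \<Longrightarrow> t \<in> G \<Longrightarrow> \<kappa> * (L2_norm M (\<lambda>x. Y s x - Y t x))\<^sup>2 \<le> D s t"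
    for Y :: "real \<Rightarrow> real^'d \<Rightarrow> 'b::euclidean_space" and \<kappa> s t
  proof -
    have main: "(L2_norm M (\<lambda>x. Y s x - Y t x))\<^sup>2 \<le> 20 / \<kappa> * \<bar>W s - W t\<bar>" if st: "s \<in> G" "t \<in> G" "s < t" for s t
    proof -
      obtain r where r: "r \<in> G" "D s r \<le> 5 * \<bar>W s - W t\<bar>" "D t r \<le> 5 * \<bar>W s - W t\<bar>" using key[OF st] by blast
      let ?a = "L2_norm M (\<lambda>x. Y s x - Y r x)" and ?b = "L2_norm M (\<lambda>x. Y t x - Y r x)"
      have "L2_norm M (\<lambda>x. Y s x - Y t x) \<le> ?a + ?b"
        using L2_norm_triangle_diff[OF YL[OF st(1)] YL[OF r(1)] YL[OF st(2)]] L2_norm_minus_commute[of M "Y r" "Y t"] by simp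
      then have "(L2_norm M (\<lambda>x. Y s x - Y t x))\<^sup>2 \<le> (?a + ?b)\<^sup>2" by (intro power_mono L2_norm_nonneg)
      also have "\<dots> \<le> 2 * ?a\<^sup>2 + 2 * ?b\<^sup>2" using sum_squares_bound[of ?a ?b] by (simp add: power2_sum)
      finally have "\<kappa> * (L2_norm M (\<lambda>x. Y s x - Y t x))\<^sup>2 \<le> \<kappa> * (2 * ?a\<^sup>2 + 2 * ?b\<^sup>2)" using \<kappa> by (intro mult_left_mono) auto
      also have "\<dots> = 2 * (\<kappa> * ?a\<^sup>2) + 2 * (\<kappa> * ?b\<^sup>2)" by (simp add: algebra_simps)
      \<comment> \<open>20 = 2 * 5 + 2 * 5: both \<open>s\<close> and \<open>t\<close> are compared
        with \<open>r\<close>, each at the cost of 5 times the increment of \<open>W\<close>, and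
        the square of a sum costs the factor 2.\<close>
      also have "\<dots> \<le> 20 * \<bar>W s - W t\<bar>"
        using order_trans[OF Y[OF st(1) r(1)] r(2)] order_trans[OF Y[OF st(2) r(1)] r(3)] by simp
      finally show ?thesis using \<kappa> by (simp add: field_simps)
    qed
    show ?thesis
    proof (cases s t rule: linorder_cases)
      case equal then show ?thesis by simp
    next
      case greater
      then show ?thesis using main[OF st(2,1)] by (simp add: L2_norm_minus_commute[of M "Y s"] abs_minus_commute)
    qed (rule main[OF st])
  qed
  have nn: "0 \<le> \<mu> * (L2_norm M a)\<^sup>2" "0 \<le> lam * (L2_norm M b)\<^sup>2" "0 \<le> c0 * (L2_norm M d)\<^sup>2"
    for a :: "real^'d \<Rightarrow> real^'d^'d" and b d :: "real^'d \<Rightarrow> real" using \<mu> lam c0 by auto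
  have sc: "(L2_norm M (\<lambda>x. sqrt c0 * p s x - sqrt c0 * p t x))\<^sup>2 = c0 * (L2_norm M (\<lambda>x. p s x - p t x))\<^sup>2" for s t
    using L2_norm_scaleR[of M "sqrt c0" "\<lambda>x. p s x - p t x"] c0 by (simp add: right_diff_distrib power_mult_distrib)
  show thesis
  proof (rule that[OF G init good chain(1) chain(2) Wc])
    show "(L2_norm M (\<lambda>x. strain \<Omega> (u s) x - strain \<Omega> (u t) x))\<^sup>2 \<le> (20 / \<mu>) * \<bar>W s - W t\<bar>" if "s \<in> G" "t \<in> G" for s t
      by (rule est[OF that \<mu>]) (use strain_L2[OF gu] nn in \<open>auto simp: D_def\<close>)
    show "(L2_norm M (\<lambda>x. dvg \<Omega> (u s) x - dvg \<Omega> (u t) x))\<^sup>2 \<le> (20 / lam) * \<bar>W s - W t\<bar>" if "s \<in> G" "t \<in> G" for s t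
      by (rule est[OF that lam]) (use dvg_L2[OF gu] nn in \<open>auto simp: D_def\<close>)
    show "(L2_norm M (\<lambda>x. sqrt c0 * p s x - sqrt c0 * p t x))\<^sup>2 \<le> 20 * \<bar>W s - W t\<bar>" if "s \<in> G" "t \<in> G" for s t
      using est[OF that zero_less_one, of "\<lambda>t x. sqrt c0 * p t x"] L2_mult[OF gp(2)] nn by (simp add: D_def sc)
  qed
qed

end

section \<open>Limits along good times\<close>

lemma AE_dense:
  fixes T t e :: real
  assumes G: "AE t in lebesgue_on {0..T}. t \<in> G" and T: "T > 0" and t: "t \<in> {0..T}" and e: "e > 0"
  shows "\<exists>s\<in>G. \<bar>s - t\<bar> < e"
proof -
  \<comment> \<open>For the function 0 the inequality in \<open>AE_interval_point\<close> is void,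
    and what remains is a point of \<open>G\<close> in the interval.\<close>
  have "\<exists>s\<in>G. max 0 (t - e) < s \<and> s < min T (t + e) \<and>
      0 * (min T (t + e) - max 0 (t - e)) \<le> integral_from_to (max 0 (t - e)) (min T (t + e)) (\<lambda>t. 0) + 1"
    by (rule AE_interval_point[where f="\<lambda>t. 0" and T=T, OF _ _ _ _ G]) (use T t e in auto)
  then obtain s where "s \<in> G" "t - e < s" "s < t + e" by auto
  then show ?thesis by (intro bexI[of _ s]) auto
qed

context bounded_open_set
begin

text \<open>Late midpoints lie within \<open>e / 2\<close> of every late member of the sequence, and
  so does their limit \<open>v\<close>. In the seminorm given by \<open>A\<close> the sequence
  itself thus converges, not only its midpoints.\<close>

lemma midpoints_limit:
  fixes A :: "real^'d^'d \<Rightarrow> 'b::euclidean_space"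
  assumes A: "linear A" and s: "\<And>m. s m \<in> H1v \<Omega>" and v: "v \<in> H1v \<Omega>"
    and y: "\<And>n. y n \<in> midpoints s n" "(\<lambda>n. H1v_norm \<Omega> (\<lambda>x. y n x - v x)) \<longlonglongrightarrow> 0"
    and cau: "\<And>e. e > 0 \<Longrightarrow> \<exists>k. \<forall>m\<ge>k. \<forall>n\<ge>k. L2_norm M (\<lambda>x. A (jac \<Omega> (s m) x) - A (jac \<Omega> (s n) x)) < e"
  shows "(\<lambda>n. L2_norm M (\<lambda>x. A (jac \<Omega> (s n) x) - A (jac \<Omega> v x))) \<longlonglongrightarrow> 0"
proof (rule LIMSEQ_I)
  fix e :: real assume "e > 0"
  then obtain k where k: "\<And>m n. m \<ge> k \<Longrightarrow> n \<ge> k \<Longrightarrow> L2_norm M (\<lambda>x. A (jac \<Omega> (s m) x) - A (jac \<Omega> (s n) x)) < e / 2"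
    using cau[of "e / 2"] by auto
  have AL: "(\<lambda>x. A (jac \<Omega> w x)) \<in> L2 M" if "w \<in> H1v \<Omega>" for w by (rule L2_linear_image[OF A jac_L2[OF that]])
  have "L2_norm M (\<lambda>x. A (jac \<Omega> (s n) x) - A (jac \<Omega> v x)) \<le> e / 2" if n: "n \<ge> k" for n
  proof -
    have yH: "y j \<in> H1v \<Omega>" for j using H1v.midpoints_mem[of _ s j, OF y(1) s] .
    have lim: "(\<lambda>j. onorm A * H1v_norm \<Omega> (\<lambda>x. y j x - v x) + e / 2) \<longlonglongrightarrow> onorm A * 0 + e / 2"
      by (intro tendsto_intros y)
    have "L2_norm M (\<lambda>x. A (jac \<Omega> (s n) x) - A (jac \<Omega> v x)) \<le> onorm A * H1v_norm \<Omega> (\<lambda>x. y j x - v x) + e / 2" if "j \<ge> k" for j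
    proof -
      have "L2_norm M (\<lambda>x. A (jac \<Omega> (y j) x) - A (jac \<Omega> (s n) x)) \<le> e / 2"
        by (rule midpoints_linear_jac[OF A y(1) s AL[OF s]]) (use k n that in \<open>auto intro: less_imp_le\<close>)
      moreover have "L2_norm M (\<lambda>x. A (jac \<Omega> (y j) x) - A (jac \<Omega> v x)) \<le> onorm A * H1v_norm \<Omega> (\<lambda>x. y j x - v x)"
        by (rule L2_norm_linear_jac_diff[OF A yH v])
      ultimately show ?thesis
        using L2_norm_triangle_diff[OF AL[OF s] AL[OF yH] AL[OF v], of n j]
          L2_norm_minus_commute[of M "\<lambda>x. A (jac \<Omega> (s n) x)" "\<lambda>x. A (jac \<Omega> (y j) x)"] by simp
    qed
    then show ?thesis using LIMSEQ_le_const[OF lim] by auto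
  qed
  then show "\<exists>no. \<forall>n\<ge>no. norm (L2_norm M (\<lambda>x. A (jac \<Omega> (s n) x) - A (jac \<Omega> v x)) - 0) < e"
    using \<open>e > 0\<close> by (intro exI[of _ k]) (force simp: abs_of_nonneg[OF L2_norm_nonneg])
qed

lemma L2_continuous_inner:
  assumes "L2_continuous \<Omega> T Y" "w \<in> L2 M"
  shows "continuous_on {0..T} (\<lambda>t. L2_inner M w (Y t))"
  unfolding continuous_on_def
proof
  fix t assume t: "t \<in> {0..T}"
  have YL: "Y t \<in> L2 M" if "t \<in> {0..T}" for t using assms(1) that by (simp add: L2_continuous_def)
  have "((\<lambda>s. L2_norm M w * L2_norm M (\<lambda>x. Y s x - Y t x)) \<longlongrightarrow> L2_norm M w * 0) (at t within {0..T})"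
    using assms(1) t unfolding L2_continuous_def by (intro tendsto_mult tendsto_const) blast
  then have l: "((\<lambda>s. L2_norm M w * L2_norm M (\<lambda>x. Y s x - Y t x)) \<longlongrightarrow> 0) (at t within {0..T})" by simp
  have "\<forall>\<^sub>F s in at t within {0..T}. s \<in> {0..T}" by (simp add: eventually_at_filter)
  then have "\<forall>\<^sub>F s in at t within {0..T}. norm (L2_inner M w (Y s) - L2_inner M w (Y t)) \<le> L2_norm M w * L2_norm M (\<lambda>x. Y s x - Y t x)"
  proof eventually_elim
    case (elim s)
    then show ?case
      using L2_Cauchy_Schwarz[OF assms(2) L2_diff[OF YL YL[OF t]], of s] L2_inner_diff_right[OF YL YL[OF t] assms(2), of s] by simp
  qed
  then have "((\<lambda>s. L2_inner M w (Y s) - L2_inner M w (Y t)) \<longlongrightarrow> 0) (at t within {0..T})"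
    using l by (rule Lim_null_comparison)
  then show "((\<lambda>s. L2_inner M w (Y s)) \<longlongrightarrow> L2_inner M w (Y t)) (at t within {0..T})" by (rule Lim_null[THEN iffD2])
qed

lemma L2_continuous_norm:
  assumes "L2_continuous \<Omega> T Y"
  shows "continuous_on {0..T} (\<lambda>t. L2_norm M (Y t))"
  unfolding continuous_on_def
proof
  fix t assume t: "t \<in> {0..T}"
  have YL: "Y t \<in> L2 M" if "t \<in> {0..T}" for t using assms(1) that by (simp add: L2_continuous_def)
  have l: "((\<lambda>s. L2_norm M (\<lambda>x. Y s x - Y t x)) \<longlongrightarrow> 0) (at t within {0..T})"
    using assms t unfolding L2_continuous_def by blast
  have "\<forall>\<^sub>F s in at t within {0..T}. s \<in> {0..T}" by (simp add: eventually_at_filter)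
  then have "\<forall>\<^sub>F s in at t within {0..T}. norm (L2_norm M (Y s) - L2_norm M (Y t)) \<le> L2_norm M (\<lambda>x. Y s x - Y t x)"
    by eventually_elim (use L2_norm_reverse_triangle[OF YL YL[OF t]] in simp)
  then have "((\<lambda>s. L2_norm M (Y s) - L2_norm M (Y t)) \<longlongrightarrow> 0) (at t within {0..T})"
    using l by (rule Lim_null_comparison)
  then show "((\<lambda>s. L2_norm M (Y s)) \<longlongrightarrow> L2_norm M (Y t)) (at t within {0..T})" by (rule Lim_null[THEN iffD2])
qed

end

context poroelastic_solution
begin

text \<open>At good times nothing is changed. At any other time the displacement is a strong limit
  in H1 of midpoints of \<open>u\<close> at nearby good times, which keeps it in
  \<open>H1_perp\<close>. The existence of this limit rests on the bound of \<open>u\<close> in H1,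
  the continuity in the energy norms on the modulus \<open>W\<close>.\<close>

theorem continuous_version_exists: "\<exists>U P. continuous_version \<Omega> T c0 u0 p0 u p U P"
proof (rule good_times_energy)
  fix G C W
  assume G: "AE t in L. t \<in> G" "G \<subseteq> {0<..T}"
    and init: "\<And>w. w \<in> L2 M \<Longrightarrow> ((\<lambda>t. L2_inner M (u t) w) \<longlongrightarrow> L2_inner M u0 w) (at 0 within G)"
    "\<And>w. w \<in> L2 M \<Longrightarrow> ((\<lambda>t. L2_inner M (\<lambda>x. sqrt c0 * p t x) w) \<longlongrightarrow> L2_inner M (\<lambda>x. sqrt c0 * p0 x) w) (at 0 within G)"
    and good: "\<And>t. t \<in> G \<Longrightarrow> u t \<in> H1_perp \<Omega> \<and> H1v_norm \<Omega> (u t) \<le> C \<and> p t \<in> H1 \<Omega> \<and> elastic t \<and> mass_balance t"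
    and Wc: "continuous_on {0..T} W"
    and est: "\<And>s t. s \<in> G \<Longrightarrow> t \<in> G \<Longrightarrow> (L2_norm M (\<lambda>x. strain \<Omega> (u s) x - strain \<Omega> (u t) x))\<^sup>2 \<le> (20 / \<mu>) * \<bar>W s - W t\<bar>"
    "\<And>s t. s \<in> G \<Longrightarrow> t \<in> G \<Longrightarrow> (L2_norm M (\<lambda>x. dvg \<Omega> (u s) x - dvg \<Omega> (u t) x))\<^sup>2 \<le> (20 / lam) * \<bar>W s - W t\<bar>"
    "\<And>s t. s \<in> G \<Longrightarrow> t \<in> G \<Longrightarrow> (L2_norm M (\<lambda>x. sqrt c0 * p s x - sqrt c0 * p t x))\<^sup>2 \<le> 20 * \<bar>W s - W t\<bar>"
  have G': "G \<subseteq> {0..T}" using G(2) by auto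
  have up: "u t \<in> H1_perp \<Omega>" and uC: "H1v_norm \<Omega> (u t) \<le> C" and uv: "u t \<in> H1v \<Omega>" and pL: "p t \<in> L2 M" if "t \<in> G" for t
    using good[OF that] H1_perp_H1v H1_L2 by auto
  \<comment> \<open>The modulus \<open>W\<close> makes each of the three energy quantities a Cauchy
    sequence along good times that converge, also to an exceptional time.\<close>
  have cau: "\<exists>k. \<forall>m\<ge>k. \<forall>n\<ge>k. L2_norm M (\<lambda>x. Y (\<sigma> m) x - Y (\<sigma> n) x) < e"
    if Y: "\<And>s t. s \<in> G \<Longrightarrow> t \<in> G \<Longrightarrow> (L2_norm M (\<lambda>x. Y s x - Y t x))\<^sup>2 \<le> c * \<bar>W s - W t\<bar>" and c: "c > 0"
      and \<sigma>: "\<And>n. \<sigma> n \<in> G" "\<sigma> \<longlonglongrightarrow> \<tau>" "\<tau> \<in> {0..T}" and e: "e > 0"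
    for Y :: "real \<Rightarrow> real^'d \<Rightarrow> 'b::euclidean_space" and c \<sigma> \<tau> e
  proof -
    have "(\<lambda>n. W (\<sigma> n)) \<longlonglongrightarrow> W \<tau>"
      using Wc \<sigma> G' unfolding continuous_on_sequentially by (auto simp: comp_def subset_iff)
    then have "Cauchy (\<lambda>n. W (\<sigma> n))" by (rule LIMSEQ_imp_Cauchy)
    then obtain k where k: "\<And>m n. m \<ge> k \<Longrightarrow> n \<ge> k \<Longrightarrow> \<bar>W (\<sigma> m) - W (\<sigma> n)\<bar> < e\<^sup>2 / c"
      using CauchyD[of _ "e\<^sup>2 / c"] e c by (metis real_norm_def divide_pos_pos zero_less_power)
    have "L2_norm M (\<lambda>x. Y (\<sigma> m) x - Y (\<sigma> n) x) < e" if "m \<ge> k" "n \<ge> k" for m n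
    proof -
      have "(L2_norm M (\<lambda>x. Y (\<sigma> m) x - Y (\<sigma> n) x))\<^sup>2 < e\<^sup>2"
        using Y[OF \<sigma>(1) \<sigma>(1), of m n] k[OF that] c by (simp add: field_simps)
      then show ?thesis using e by (simp add: power2_less_imp_less)
    qed
    then show ?thesis by blast
  qed
  \<comment> \<open>Only the norms of the energy occur; in \<open>H1v_norm\<close> it is the
    midpoints that are shown to converge, not \<open>u (\<sigma> n)\<close> itself.\<close>
  define lim where "lim \<tau> v q \<longleftrightarrow> (\<exists>\<sigma>. (\<forall>n. \<sigma> n \<in> G) \<and> \<sigma> \<longlonglongrightarrow> \<tau> \<and>
      (\<lambda>n. L2_norm M (\<lambda>x. strain \<Omega> (u (\<sigma> n)) x - strain \<Omega> v x)) \<longlonglongrightarrow> 0 \<and>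
      (\<lambda>n. L2_norm M (\<lambda>x. dvg \<Omega> (u (\<sigma> n)) x - dvg \<Omega> v x)) \<longlonglongrightarrow> 0 \<and>
      (\<lambda>n. L2_norm M (\<lambda>x. sqrt c0 * p (\<sigma> n) x - sqrt c0 * q x)) \<longlonglongrightarrow> 0)" for \<tau> v q
  have ex: "\<exists>v q. v \<in> H1_perp \<Omega> \<and> q \<in> L2 M \<and> lim \<tau> v q \<and> (\<tau> \<in> G \<longrightarrow> v = u \<tau> \<and> q = p \<tau>) \<and>
      (\<tau> = 0 \<longrightarrow> (AE x in M. v x = u0 x) \<and> q = p0)" if \<tau>: "\<tau> \<in> {0..T}" for \<tau>
  proof (cases "\<tau> \<in> G")
    case True
    then have "\<tau> \<noteq> 0" using G(2) by auto
    moreover have "lim \<tau> (u \<tau>) (p \<tau>)" unfolding lim_def by (rule exI[of _ "\<lambda>n. \<tau>"]) (use True in simp)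
    ultimately show ?thesis using True up pL by blast
  next
    case False
    have "\<forall>n. \<exists>s\<in>G. \<bar>s - \<tau>\<bar> < 1 / real (Suc n)" using AE_dense[OF G(1) T \<tau>] by simp
    then obtain \<sigma> where \<sigma>: "\<And>n. \<sigma> n \<in> G" "\<And>n. \<bar>\<sigma> n - \<tau>\<bar> < 1 / real (Suc n)" by metis
    have "(\<lambda>n. \<sigma> n - \<tau>) \<longlonglongrightarrow> 0"
      by (rule Lim_null_comparison[OF always_eventually LIMSEQ_Suc[OF lim_1_over_n]]) (use \<sigma>(2) in \<open>auto intro: less_imp_le\<close>)
    then have \<sigma>\<tau>: "\<sigma> \<longlonglongrightarrow> \<tau>" by (rule LIM_zero_cancel)
    let ?s = "\<lambda>n. u (\<sigma> n)"
    obtain y v where v: "v \<in> H1_perp \<Omega>" and y: "\<And>n. y n \<in> midpoints ?s n" "\<And>n. y n \<in> H1_perp \<Omega>"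
      "(\<lambda>n. H1v_norm \<Omega> (\<lambda>x. y n x - v x)) \<longlonglongrightarrow> 0"
    proof (rule H1_perp_bounded_midpoints[of ?s C])
      show "?s n \<in> H1_perp \<Omega>" "H1v_norm \<Omega> (?s n) \<le> C" for n using up uC \<sigma>(1) by auto
      fix y v
      assume "v \<in> H1_perp \<Omega>" "\<And>n. y n \<in> midpoints ?s n" "\<And>n. y n \<in> H1_perp \<Omega>"
        "(\<lambda>n. H1v_norm \<Omega> (\<lambda>x. y n x - v x)) \<longlonglongrightarrow> 0"
      then show thesis by (rule that)
    qed
    have vv: "v \<in> H1v \<Omega>" using H1_perp_H1v[OF v] .
    have sv: "?s n \<in> H1v \<Omega>" for n by (rule uv[OF \<sigma>(1)])
    have l1: "(\<lambda>n. L2_norm M (\<lambda>x. strain \<Omega> (?s n) x - strain \<Omega> v x)) \<longlonglongrightarrow> 0"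
      unfolding strain_eq
      by (rule midpoints_limit[OF linear_strain_map sv vv y(1,3)])
         (rule cau[of "\<lambda>t. strain \<Omega> (u t)", unfolded strain_eq, OF est(1)[unfolded strain_eq] _ \<sigma>(1) \<sigma>\<tau> \<tau>], use \<mu> in simp_all)
    have l2: "(\<lambda>n. L2_norm M (\<lambda>x. dvg \<Omega> (?s n) x - dvg \<Omega> v x)) \<longlonglongrightarrow> 0"
      unfolding dvg_eq
      by (rule midpoints_limit[OF linear_trace sv vv y(1,3)])
         (rule cau[of "\<lambda>t. dvg \<Omega> (u t)", unfolded dvg_eq, OF est(2)[unfolded dvg_eq] _ \<sigma>(1) \<sigma>\<tau> \<tau>], use lam in simp_all)
    have qL: "(\<lambda>x. sqrt c0 * p (\<sigma> n) x) \<in> L2 M" for n by (rule L2_mult[OF pL[OF \<sigma>(1)]])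
    \<comment> \<open>For the pressure part the completeness of L2 suffices, as no derivative has to
      be retained.\<close>
    obtain h where h: "h \<in> L2 M" "(\<lambda>n. L2_norm M (\<lambda>x. sqrt c0 * p (\<sigma> n) x - h x)) \<longlonglongrightarrow> 0"
    proof (rule L2_complete[OF finite_M qL])
      show "\<exists>k. \<forall>m\<ge>k. \<forall>n\<ge>k. L2_norm M (\<lambda>x. sqrt c0 * p (\<sigma> m) x - sqrt c0 * p (\<sigma> n) x) < e" if "e > 0" for e
        by (rule cau[of "\<lambda>t x. sqrt c0 * p t x", OF est(3) _ \<sigma>(1) \<sigma>\<tau> \<tau> that]) simp_all
    qed
    show ?thesis
    proof (cases "\<tau> = 0")
      case True
      \<comment> \<open>\<open>G\<close> excludes the time 0, so the sequence approaches 0 without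
        taking the value 0, as a limit within \<open>G\<close> demands.\<close>
      have f\<sigma>: "filterlim \<sigma> (at 0 within G) sequentially"
        using \<sigma>\<tau> \<sigma>(1) G(2) True by (auto simp: filterlim_at intro!: always_eventually) (metis greaterThanAtMost_iff less_irrefl subsetD)
      have "L2_inner M v w = L2_inner M u0 w" if w: "w \<in> L2 M" for w
      proof -
        have lw: "(\<lambda>n. L2_inner M (?s n) w) \<longlonglongrightarrow> L2_inner M u0 w" by (rule filterlim_compose[OF init(1)[OF w] f\<sigma>])
        have yw: "(\<lambda>n. L2_inner M (y n) w) \<longlonglongrightarrow> L2_inner M v w"
        proof (rule L2_inner_tendsto[OF H1v_L2[OF H1_perp_H1v[OF y(2)]] H1v_L2[OF vv] w])
          show "(\<lambda>n. L2_norm M (\<lambda>x. y n x - v x)) \<longlonglongrightarrow> 0"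
            by (rule Lim_null_comparison[OF always_eventually y(3)]) (simp add: L2_norm_nonneg L2_norm_le_H1v_norm)
        qed
        \<comment> \<open>The strong limit of the midpoints is thus identified by the weak initial
          value of the solution.\<close>
        have "(\<lambda>n. L2_inner M (y n) w) \<longlonglongrightarrow> L2_inner M u0 w"
        proof (rule LIMSEQ_I)
          fix e :: real assume "e > 0"
          then obtain k where k: "\<And>n. n \<ge> k \<Longrightarrow> \<bar>L2_inner M (?s n) w - L2_inner M u0 w\<bar> < e / 2"
            using LIMSEQ_D[OF lw, of "e / 2"] by auto
          have "\<bar>L2_inner M (y n) w - L2_inner M u0 w\<bar> \<le> e / 2" if "n \<ge> k" for n
          proof -
            have "\<bar>L2_inner M (?s m) w - L2_inner M u0 w\<bar> \<le> e / 2" if "m \<ge> n" for m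
              using k[of m] that \<open>n \<ge> k\<close> by simp
            from midpoints_inner[where s="?s", OF y(1) H1v_L2[OF sv] w this] show ?thesis by blast
          qed
          then show "\<exists>no. \<forall>n\<ge>no. norm (L2_inner M (y n) w - L2_inner M u0 w) < e"
            using \<open>e > 0\<close> by (intro exI[of _ k]) force
        qed
        with yw show ?thesis by (rule LIMSEQ_unique)
      qed
      then have vu: "AE x in M. v x = u0 x" by (rule L2_weak_eq_imp_AE_eq[OF H1v_L2[OF vv] H1v_L2[OF u0]])
      have p0L: "(\<lambda>x. sqrt c0 * p0 x) \<in> L2 M" by (rule L2_mult[OF p0])
      have hp: "AE x in M. h x = sqrt c0 * p0 x"
      proof (rule L2_weak_eq_imp_AE_eq[OF h(1) p0L])
        fix w :: "real^'d \<Rightarrow> real" assume w: "w \<in> L2 M"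
        have "(\<lambda>n. L2_inner M (\<lambda>x. sqrt c0 * p (\<sigma> n) x) w) \<longlonglongrightarrow> L2_inner M (\<lambda>x. sqrt c0 * p0 x) w"
          by (rule filterlim_compose[OF init(2)[OF w] f\<sigma>])
        moreover have "(\<lambda>n. L2_inner M (\<lambda>x. sqrt c0 * p (\<sigma> n) x) w) \<longlonglongrightarrow> L2_inner M h w"
          by (rule L2_inner_tendsto[OF qL h(1) w h(2)])
        ultimately show "L2_inner M h w = L2_inner M (\<lambda>x. sqrt c0 * p0 x) w" using LIMSEQ_unique by blast
      qed
      have "L2_norm M (\<lambda>x. sqrt c0 * p (\<sigma> n) x - sqrt c0 * p0 x) = L2_norm M (\<lambda>x. sqrt c0 * p (\<sigma> n) x - h x)" for n
        by (rule L2_norm_cong_AE[OF L2D(1)[OF L2_diff[OF qL p0L]] L2D(1)[OF L2_diff[OF qL h(1)]]])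
           (use hp in \<open>eventually_elim; simp\<close>)
      then have "(\<lambda>n. L2_norm M (\<lambda>x. sqrt c0 * p (\<sigma> n) x - sqrt c0 * p0 x)) \<longlonglongrightarrow> 0" using h(2) by simp
      \<comment> \<open>For \<open>c0 = 0\<close> the pressure condition in \<open>lim\<close> is
        trivial, and \<open>p0\<close> is simply assigned as the value at time 0.\<close>
      then have "lim \<tau> v p0" unfolding lim_def using \<sigma>(1) \<sigma>\<tau> l1 l2 by blast
      then show ?thesis using v p0 vu False by blast
    next
      case \<tau>0: False
      \<comment> \<open>For \<open>c0 = 0\<close> division by zero makes this the zero function, and
        the difference in \<open>lim\<close> is 0 by its factor \<open>sqrt c0\<close>.\<close>
      define q where "q = (\<lambda>x. 1 / sqrt c0 * h x)"
      have qL2: "q \<in> L2 M" unfolding q_def by (rule L2_mult[OF h(1)])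
      have "(\<lambda>n. L2_norm M (\<lambda>x. sqrt c0 * p (\<sigma> n) x - sqrt c0 * q x)) \<longlonglongrightarrow> 0"
        using h(2) by (cases "c0 = 0") (simp_all add: q_def)
      then have "lim \<tau> v q" unfolding lim_def using \<sigma>(1) \<sigma>\<tau> l1 l2 by blast
      then show ?thesis using v qL2 \<tau>0 False by blast
    qed
  qed
  then have "\<forall>\<tau>\<in>{0..T}. \<exists>v. \<exists>q. v \<in> H1_perp \<Omega> \<and> q \<in> L2 M \<and> lim \<tau> v q \<and> (\<tau> \<in> G \<longrightarrow> v = u \<tau> \<and> q = p \<tau>) \<and>
      (\<tau> = 0 \<longrightarrow> (AE x in M. v x = u0 x) \<and> q = p0)" by blast
  from bchoice[OF this] obtain U where "\<forall>\<tau>\<in>{0..T}. \<exists>q. U \<tau> \<in> H1_perp \<Omega> \<and> q \<in> L2 M \<and> lim \<tau> (U \<tau>) q \<and>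
      (\<tau> \<in> G \<longrightarrow> U \<tau> = u \<tau> \<and> q = p \<tau>) \<and> (\<tau> = 0 \<longrightarrow> (AE x in M. U \<tau> x = u0 x) \<and> q = p0)" by (rule exE)
  from bchoice[OF this] obtain P where UP: "\<forall>\<tau>\<in>{0..T}. U \<tau> \<in> H1_perp \<Omega> \<and> P \<tau> \<in> L2 M \<and> lim \<tau> (U \<tau>) (P \<tau>) \<and>
      (\<tau> \<in> G \<longrightarrow> U \<tau> = u \<tau> \<and> P \<tau> = p \<tau>) \<and> (\<tau> = 0 \<longrightarrow> (AE x in M. U \<tau> x = u0 x) \<and> P \<tau> = p0)" by (rule exE)
  have UPD: "U \<tau> \<in> H1_perp \<Omega>" "P \<tau> \<in> L2 M" "lim \<tau> (U \<tau>) (P \<tau>)" "\<tau> \<in> G \<Longrightarrow> U \<tau> = u \<tau> \<and> P \<tau> = p \<tau>"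
    "\<tau> = 0 \<Longrightarrow> (AE x in M. U \<tau> x = u0 x) \<and> P \<tau> = p0" if "\<tau> \<in> {0..T}" for \<tau>
    using bspec[OF UP that] by simp_all
  have "continuous_version \<Omega> T c0 u0 p0 u p U P"
    unfolding continuous_version_def
  proof (intro conjI ballI)
    show "AE t in L. AE x in M. U t x = u t x \<and> P t x = p t x"
      using G(1) by eventually_elim (use UPD(4) G' in auto)
    show "U t \<in> H1_perp \<Omega>" "P t \<in> L2 M" if "t \<in> {0..T}" for t using UPD(1,2)[OF that] by auto
    show "L2_continuous \<Omega> T (\<lambda>t. strain \<Omega> (U t))"
    proof (rule L2_continuous_extension[OF _ _ G' _ Wc est(1)])
      show "\<exists>\<sigma>. (\<forall>n. \<sigma> n \<in> G) \<and> \<sigma> \<longlonglongrightarrow> t \<and> (\<lambda>n. L2_norm M (\<lambda>x. strain \<Omega> (u (\<sigma> n)) x - strain \<Omega> (U t) x)) \<longlonglongrightarrow> 0"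
        if "t \<in> {0..T}" for t using UPD(3)[OF that] unfolding lim_def by blast
    qed (use strain_L2[OF uv] strain_L2[OF H1_perp_H1v[OF UPD(1)]] in auto)
    show "L2_continuous \<Omega> T (\<lambda>t. dvg \<Omega> (U t))"
    proof (rule L2_continuous_extension[OF _ _ G' _ Wc est(2)])
      show "\<exists>\<sigma>. (\<forall>n. \<sigma> n \<in> G) \<and> \<sigma> \<longlonglongrightarrow> t \<and> (\<lambda>n. L2_norm M (\<lambda>x. dvg \<Omega> (u (\<sigma> n)) x - dvg \<Omega> (U t) x)) \<longlonglongrightarrow> 0"
        if "t \<in> {0..T}" for t using UPD(3)[OF that] unfolding lim_def by blast
    qed (use dvg_L2[OF uv] dvg_L2[OF H1_perp_H1v[OF UPD(1)]] in auto)
    show "L2_continuous \<Omega> T (\<lambda>t x. sqrt c0 * P t x)"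
    proof (rule L2_continuous_extension[OF _ _ G' _ Wc est(3)])
      show "\<exists>\<sigma>. (\<forall>n. \<sigma> n \<in> G) \<and> \<sigma> \<longlonglongrightarrow> t \<and> (\<lambda>n. L2_norm M (\<lambda>x. sqrt c0 * p (\<sigma> n) x - sqrt c0 * P t x)) \<longlonglongrightarrow> 0"
        if "t \<in> {0..T}" for t using UPD(3)[OF that] unfolding lim_def by blast
    qed (use L2_mult[OF pL] L2_mult[OF UPD(2)] in auto)
    show "AE x in M. U 0 x = u0 x \<and> P 0 x = p0 x" using UPD(5)[of 0] T by simp
  qed
  then show ?thesis by blast
qed

end

section \<open>The energy law and the bound for the time derivative\<close>

lemma esqrt_le:
  assumes "x \<le> ennreal (z\<^sup>2)" "z \<ge> 0"
  shows "esqrt x \<le> ennreal z"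
proof -
  obtain r where r: "x = ennreal r" "r \<ge> 0" using assms(1) by (cases x) (auto simp: top_unique)
  then have "r \<le> z\<^sup>2" using assms(1) by (simp add: ennreal_le_iff)
  with assms(2) have "sqrt r \<le> z" by (simp add: real_le_lsqrt)
  then show ?thesis using r by (simp add: esqrt_def ennreal_leI)
qed

lemma esqrt_power2: "z \<ge> 0 \<Longrightarrow> esqrt (ennreal (z\<^sup>2)) = ennreal z"
  by (simp add: esqrt_def)

lemma continuous_on_eq_on_dense:
  fixes f :: "real \<Rightarrow> real"
  assumes f: "continuous_on {0..T} f" and G: "AE t in lebesgue_on {0..T}. t \<in> G" "G \<subseteq> {0..T}" and T: "T > 0"
    and c: "\<And>s t. s \<in> G \<Longrightarrow> t \<in> G \<Longrightarrow> s < t \<Longrightarrow> f t = f s" and t: "t \<in> {0..T}"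
  shows "f t = f 0"
proof -
  have cl: "closure G = {0..T}"
  proof
    show "closure G \<subseteq> {0..T}" using G(2) by (intro closure_minimal) auto
    show "{0..T} \<subseteq> closure G"
    proof
      fix x assume "x \<in> {0..T}"
      from AE_dense[OF G(1) T this] show "x \<in> closure G" by (simp add: closure_approachable dist_real_def)
    qed
  qed
  obtain s where s: "s \<in> G" using AE_dense[OF G(1) T t zero_less_one] by (rule bexE)
  have fs: "f r = f s" if "r \<in> G" for r
  proof (cases r s rule: linorder_cases)
    case less then show ?thesis using c[OF that s] by simp
  next
    case greater then show ?thesis using c[OF s that] by simp
  qed simp
  have "f r = f s" if "r \<in> {0..T}" for r
    by (rule continuous_constant_on_closure[of G f "f s" r]) (use f fs that cl in simp_all)
  from this[of t] this[of 0] show ?thesis using t T by simp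
qed

context poroelastic_solution
begin

text \<open>The energy minus the time integral of \<eta>_t tested with \<open>p\<close> is
  continuous in time and constant on the good times, hence constant. At almost every time the mass
  balance tested with the pressure splits the pairing into the flux, volume and boundary
  terms.\<close>

theorem energy_law:
  assumes cv: "continuous_version \<Omega> T c0 u0 p0 u p U P" and t: "t \<in> {0..T}"
  shows "energy \<Omega> lam \<mu> c0 f f1 (U t) (P t)
         + 1 / \<mu>f * (\<integral>s. L2_inner M (flux (P s)) (grad \<Omega> (P s)) \<partial>lebesgue_on {0..t})
         - (\<integral>s. L2_inner M \<phi> (P s) \<partial>lebesgue_on {0..t})
         - (\<integral>s. boundary_inner \<Omega> \<phi>1 (P s) \<partial>lebesgue_on {0..t})
         = energy \<Omega> lam \<mu> c0 f f1 (U 0) (P 0)"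
proof (rule good_times_energy)
  fix G C W
  assume G: "AE t in L. t \<in> G" "G \<subseteq> {0<..T}"
    and good: "\<And>t. t \<in> G \<Longrightarrow> u t \<in> H1_perp \<Omega> \<and> H1v_norm \<Omega> (u t) \<le> C \<and> p t \<in> H1 \<Omega> \<and> elastic t \<and> mass_balance t"
    and Ri: "integrable L (\<lambda>t. etat t (p t))"
    and en: "\<And>s t. s \<in> G \<Longrightarrow> t \<in> G \<Longrightarrow> s < t \<Longrightarrow> en t - en s = integral_from_to s t (\<lambda>r. etat r (p r))"
  have G': "G \<subseteq> {0..T}" using G(2) by auto
  have cAE: "AE t in L. AE x in M. U t x = u t x \<and> P t x = p t x"
    and cm: "\<And>t. t \<in> {0..T} \<Longrightarrow> U t \<in> H1_perp \<Omega>" "\<And>t. t \<in> {0..T} \<Longrightarrow> P t \<in> L2 M"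
    and cc: "L2_continuous \<Omega> T (\<lambda>t. strain \<Omega> (U t))" "L2_continuous \<Omega> T (\<lambda>t. dvg \<Omega> (U t))"
      "L2_continuous \<Omega> T (\<lambda>t x. sqrt c0 * P t x)"
    using cv unfolding continuous_version_def by blast+
  \<comment> \<open>Good times at which the given version agrees with the solution; the version is
    arbitrary and not the one constructed above.\<close>
  define G1 where "G1 = {t \<in> G. AE x in M. U t x = u t x \<and> P t x = p t x}"
  have G1: "AE t in L. t \<in> G1" "G1 \<subseteq> G" "G1 \<subseteq> {0..T}"
    using G(1) cAE G' by (auto simp: G1_def elim: AE_mp)
  have uU: "strain \<Omega> (U t) = strain \<Omega> (u t)" "dvg \<Omega> (U t) = dvg \<Omega> (u t)" "grad \<Omega> (P t) = grad \<Omega> (p t)"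
    "U t \<in> H1v \<Omega>" "u t \<in> H1v \<Omega>" "p t \<in> H1 \<Omega>" "P t \<in> H1 \<Omega>" "AE x in M. P t x = p t x" "elastic t" "mass_balance t"
    if "t \<in> G1" for t
  proof -
    have tG: "t \<in> G" "t \<in> {0..T}" "AE x in M. U t x = u t x \<and> P t x = p t x" using that G1(3) by (auto simp: G1_def)
    have a: "AE x in M. U t x = u t x" using tG(3) by eventually_elim simp
    show b: "AE x in M. P t x = p t x" using tG(3) by eventually_elim simp
    show "U t \<in> H1v \<Omega>" "u t \<in> H1v \<Omega>" "p t \<in> H1 \<Omega>" "elastic t" "mass_balance t"
      using cm(1)[OF tG(2)] good[OF tG(1)] H1_perp_H1v by auto
    then have "jac \<Omega> (U t) = jac \<Omega> (u t)" using a by (intro jac_cong_AE H1v_L2)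
    then show "strain \<Omega> (U t) = strain \<Omega> (u t)" "dvg \<Omega> (U t) = dvg \<Omega> (u t)" by (simp_all add: strain_eq dvg_eq)
    have p: "p t \<in> H1 \<Omega>" using good[OF tG(1)] by simp
    show "grad \<Omega> (P t) = grad \<Omega> (p t)"
      by (rule grad_cong_AE[OF L2D(1)[OF cm(2)[OF tG(2)]] L2D(1)[OF H1_L2[OF p]] b])
    have "AE x in M. p t x = P t x" using b by eventually_elim simp
    then show "P t \<in> H1 \<Omega>" by (rule H1_cong_AE[OF p cm(2)[OF tG(2)]])
  qed
  let ?e = "\<lambda>t. energy \<Omega> lam \<mu> c0 f f1 (U t) (P t)"
  obtain t0 where t0: "t0 \<in> G1" using AE_dense[OF G1(1) T t zero_less_one] by (rule bexE)
  \<comment> \<open>The elasticity equation at the single time \<open>t0\<close> represents the load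
    by strain and divergence, so that its continuity along \<open>U\<close> follows from
    theirs.\<close>
  have load: "load v = \<mu> * L2_inner M (strain \<Omega> (u t0)) (strain \<Omega> v)
        + lam * L2_inner M (dvg \<Omega> (u t0)) (dvg \<Omega> v) - \<alpha> * L2_inner M (p t0) (dvg \<Omega> v)" if "v \<in> H1v \<Omega>" for v
    using uU(9)[OF t0] that by (simp add: elastic_def)
  have ee: "?e t = en t" if "t \<in> G1" for t
  proof -
    have "load (U t) = load (u t)" unfolding load[OF uU(4)[OF that]] load[OF uU(5)[OF that]] uU[OF that] ..
    moreover have "L2_norm M (P t) = L2_norm M (p t)"
      by (rule L2_norm_cong_AE[OF L2D(1)[OF H1_L2[OF uU(7)[OF that]]] L2D(1)[OF H1_L2[OF uU(6)[OF that]]] uU(8)[OF that]])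
    ultimately show ?thesis by (simp add: energy_load uU[OF that])
  qed
  have ec: "continuous_on {0..T} ?e"
  proof -
    have sc: "c0 * (L2_norm M q)\<^sup>2 = (L2_norm M (\<lambda>x. sqrt c0 * q x))\<^sup>2" for q :: "real^'d \<Rightarrow> real"
      using L2_norm_scaleR[of M "sqrt c0" q] c0 by (simp add: power_mult_distrib)
    have "continuous_on {0..T} (\<lambda>t. load (U t))"
    proof (rule continuous_on_cong[THEN iffD1, rotated 2])
      show "continuous_on {0..T} (\<lambda>t. \<mu> * L2_inner M (strain \<Omega> (u t0)) (strain \<Omega> (U t))
        + lam * L2_inner M (dvg \<Omega> (u t0)) (dvg \<Omega> (U t)) - \<alpha> * L2_inner M (p t0) (dvg \<Omega> (U t)))"
        by (intro continuous_intros L2_continuous_inner cc strain_L2 dvg_L2 H1_L2 uU[OF t0])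
    qed (use load[OF H1_perp_H1v[OF cm(1)]] in auto)
    then show ?thesis unfolding energy_load sc
      by (intro continuous_intros L2_continuous_norm cc)
  qed
  let ?R = "\<lambda>t. etat t (p t)"
  have const: "?e t - integral_from_to 0 t ?R = ?e 0 - integral_from_to 0 0 ?R"
  proof (rule continuous_on_eq_on_dense[OF _ G1(1,3) T _ t])
    show "continuous_on {0..T} (\<lambda>t. ?e t - integral_from_to 0 t ?R)"
      by (intro continuous_on_diff ec integral_from_to_continuous[OF Ri])
    show "?e t - integral_from_to 0 t ?R = ?e s - integral_from_to 0 s ?R" if "s \<in> G1" "t \<in> G1" "s < t" for s t
      using en[of s t] integral_from_to_diff[OF Ri, of s t] that G1 ee by (auto simp: subset_iff)
  qed
  define A where "A = (\<lambda>s. L2_inner M (flux (P s)) (grad \<Omega> (P s)))"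
  define B where "B = (\<lambda>s. L2_inner M \<phi> (P s))"
  define D where "D = (\<lambda>s. boundary_inner \<Omega> \<phi>1 (P s))"
  obtain C' where C': "C' \<ge> 0" "\<And>q. q \<in> H1 \<Omega> \<Longrightarrow> \<bar>source q\<bar> \<le> C' * H1_norm \<Omega> q"
    "\<And>v w. v \<in> H1 \<Omega> \<Longrightarrow> w \<in> H1 \<Omega> \<Longrightarrow> source (\<lambda>x. v x - w x) = source v - source w"
    by (rule source_linear_bounded) blast
  have si: "integrable L (\<lambda>t. source (p t))" by (rule integrable_functional_p[OF C'(2,3)])
  have bi: "integrable L (\<lambda>t. L2_inner M \<phi> (p t))"
    using L2_inner_p_integrable[OF \<phi>] by (simp add: L2_inner_commute)
  have eqs: "A s = \<mu>f * (source (p s) - ?R s)" "B s = L2_inner M \<phi> (p s)" "D s = source (p s) - L2_inner M \<phi> (p s)"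
    if s: "s \<in> G1" for s
  proof -
    have fl: "flux (P s) = flux (p s)" by (simp add: flux_def[abs_def] uU(3)[OF s])
    have "?R s + 1 / \<mu>f * A s = source (p s)"
      using uU(6,10)[OF s] unfolding mass_balance_def A_def fl uU(3)[OF s] by blast
    then show "A s = \<mu>f * (source (p s) - ?R s)" using \<mu>f by (simp add: field_simps)
    show b: "B s = L2_inner M \<phi> (p s)" unfolding B_def
      by (rule L2_inner_cong_AE) (use L2D(1)[OF \<phi>] L2D(1)[OF H1_L2[OF uU(6)[OF s]]] L2D(1)[OF H1_L2[OF uU(7)[OF s]]] uU(8)[OF s] in auto)
    \<comment> \<open>The functions \<open>P s\<close> and \<open>p s\<close> agree almost
      everywhere in \<Omega>, while \<open>source\<close> contains a boundary integral; its bound by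
      the H1 norm shows that it does not distinguish them.\<close>
    have "H1_norm \<Omega> (\<lambda>x. P s x - p s x) = 0"
    proof -
      have z: "AE x in M. P s x - p s x = 0" using uU(8)[OF s] by eventually_elim simp
      have m: "(\<lambda>x. P s x - p s x) \<in> L2 M" by (intro L2_diff H1_L2 uU(6,7)[OF s])
      have 1: "L2_norm M (\<lambda>x. P s x - p s x) = L2_norm M (\<lambda>x. 0 :: real)"
        by (rule L2_norm_cong_AE[OF L2D(1)[OF m] L2D(1)[OF L2_zero] z])
      have 2: "grad \<Omega> (\<lambda>x. P s x - p s x) = grad \<Omega> (\<lambda>x. 0)"
        by (rule grad_cong_AE[OF L2D(1)[OF m] L2D(1)[OF L2_zero] z])
      show ?thesis using H1.zero unfolding H1_norm_def 1 2 .
    qed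
    then have "source (P s) - source (p s) = 0"
      using C'(2)[OF H1.diff_mem[OF uU(7,6)[OF s]]] C'(3)[OF uU(7,6)[OF s]] by simp
    then show "D s = source (p s) - L2_inner M \<phi> (p s)" using b by (simp add: D_def B_def source_def)
  qed
  have tr: "integrable L h" if "integrable L k" "\<And>s. s \<in> G1 \<Longrightarrow> h s = k s" for h k :: "real \<Rightarrow> real"
  proof -
    have ae: "AE s in L. k s = h s" using G1(1) by eventually_elim (simp add: that(2))
    show ?thesis
      by (rule integrable_cong_AE_imp[OF that(1) AE_measurable_lebesgue_on[OF _ borel_measurable_integrable[OF that(1)] ae] ae]) simp
  qed
  have Ai: "integrable L A" by (rule tr[OF _ eqs(1)]) (use si Ri in auto)
  have Bi: "integrable L B" by (rule tr[OF bi eqs(2)])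
  \<comment> \<open>The boundary term is integrable in time because it equals \<open>source\<close>
    minus the volume term at almost every time.\<close>
  have Di: "integrable L D" by (rule tr[OF _ eqs(3)]) (use si bi in auto)
  have t': "0 \<le> (0::real)" "t \<le> T" using t by auto
  note sub = integrable_subinterval[OF _ t']
  have "1 / \<mu>f * integral_from_to 0 t A - integral_from_to 0 t B - integral_from_to 0 t D
      = integral_from_to 0 t (\<lambda>s. 1 / \<mu>f * A s - B s - D s)"
    unfolding integral_from_to_def using sub[OF Ai] sub[OF Bi] sub[OF Di] by simp
  also have "\<dots> = integral_from_to 0 t (\<lambda>s. - ?R s)"
    unfolding integral_from_to_def
  proof (rule integral_cong_AE)
    have "AE s in lebesgue. s \<in> {0..T} \<longrightarrow> s \<in> G1" using G1(1) by (simp add: AE_lebesgue_on_iff)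
    then have "AE s in lebesgue. s \<in> {0..t} \<longrightarrow> 1 / \<mu>f * A s - B s - D s = - ?R s"
      by eventually_elim (use t eqs \<mu>f in auto)
    then show "AE s in lebesgue_on {0..t}. 1 / \<mu>f * A s - B s - D s = - ?R s" by (simp add: AE_lebesgue_on_iff)
  qed (use sub[OF Ai] sub[OF Bi] sub[OF Di] sub[OF Ri] in auto)
  also have "\<dots> = - integral_from_to 0 t ?R" by (simp add: integral_from_to_def)
  finally have "?e t + 1 / \<mu>f * integral_from_to 0 t A - integral_from_to 0 t B - integral_from_to 0 t D = ?e 0"
    using const by (simp add: integral_from_to_same)
  then show ?thesis unfolding integral_from_to_def A_def B_def D_def .
qed

text \<open>By density: the boundary functional is bounded on \<open>H1\<close> and vanishes on test functions.\<close>

lemma boundary_inner_H10: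
  assumes q: "q \<in> H10 \<Omega>"
  shows "boundary_inner \<Omega> \<phi>1 q = 0"
proof -
  obtain C where C: "C \<ge> 0" "\<And>q. q \<in> H1 \<Omega> \<Longrightarrow> \<bar>source q\<bar> \<le> C * H1_norm \<Omega> q"
    "\<And>v w. v \<in> H1 \<Omega> \<Longrightarrow> w \<in> H1 \<Omega> \<Longrightarrow> source (\<lambda>x. v x - w x) = source v - source w"
    by (rule source_linear_bounded) blast
  have qH: "q \<in> H1 \<Omega>" using q by (simp add: H10_def)
  have test: "boundary_inner \<Omega> \<phi>1 \<psi> = 0" if "\<psi> \<in> test_fun \<Omega>" for \<psi>
  proof -
    have tr: "boundary_trace \<Omega> \<psi> x = 0" if "x \<in> space (surface_measure \<Omega>)" for x
    proof -
      have x: "x \<in> frontier \<Omega>" using that by (simp add: surface_measure_def space_restrict_space)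
      then have "boundary_trace \<Omega> \<psi> x = \<psi> x"
        by (rule boundary_trace_eq_restriction[OF open_\<Omega> bounded_\<Omega> test_fun_continuous[OF \<open>\<psi> \<in> test_fun \<Omega>\<close>]])
      also have "\<psi> x = 0"
        using x open_\<Omega> by (intro test_fun_outside[OF \<open>\<psi> \<in> test_fun \<Omega>\<close>]) (auto simp: frontier_def interior_open)
      finally show ?thesis .
    qed
    have "(\<integral>x. \<phi>1 x \<bullet> boundary_trace \<Omega> \<psi> x \<partial>surface_measure \<Omega>) = (\<integral>x. 0 \<partial>surface_measure \<Omega>)"
      by (rule Bochner_Integration.integral_cong) (use tr in auto)
    then show ?thesis by (simp add: boundary_inner_def L2_inner_def)
  qed
  let ?C = "C + L2_norm M \<phi>"
  have bound: "\<bar>boundary_inner \<Omega> \<phi>1 q\<bar> \<le> ?C * e" if e: "e > 0" for e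
  proof -
    obtain \<psi> where \<psi>: "\<psi> \<in> test_fun \<Omega>" "H1_norm \<Omega> (\<lambda>x. q x - \<psi> x) < e" using q e unfolding H10_def by blast
    have \<psi>H: "\<psi> \<in> H1 \<Omega>" by (rule test_fun_H1[OF \<psi>(1)])
    let ?d = "\<lambda>x. q x - \<psi> x"
    have d: "?d \<in> H1 \<Omega>" by (rule H1.diff_mem[OF qH \<psi>H])
    have "boundary_inner \<Omega> \<phi>1 q = source ?d - L2_inner M \<phi> ?d"
      using C(3)[OF qH \<psi>H] L2_inner_diff_right[OF H1_L2[OF qH] H1_L2[OF \<psi>H] \<phi>] test[OF \<psi>(1)] by (simp add: source_def)
    moreover have "\<bar>source ?d\<bar> \<le> C * H1_norm \<Omega> ?d" by (rule C(2)[OF d])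
    moreover have "\<bar>L2_inner M \<phi> ?d\<bar> \<le> L2_norm M \<phi> * H1_norm \<Omega> ?d"
      by (rule order_trans[OF L2_Cauchy_Schwarz[OF \<phi> H1_L2[OF d]]]) (intro mult_left_mono L2_norm_le_H1_norm L2_norm_nonneg)
    ultimately have "\<bar>boundary_inner \<Omega> \<phi>1 q\<bar> \<le> ?C * H1_norm \<Omega> ?d" by (simp add: distrib_right abs_le_iff)
    also have "\<dots> \<le> ?C * e" using \<psi>(2) C(1) L2_norm_nonneg[of M \<phi>] by (intro mult_left_mono) auto
    finally show ?thesis .
  qed
  have "\<bar>boundary_inner \<Omega> \<phi>1 q\<bar> \<le> 0"
  proof (rule field_le_epsilon)
    fix e :: real assume e: "e > 0"
    have C0: "?C + 1 > 0" using C(1) L2_norm_nonneg[of M \<phi>] by simp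
    \<comment> \<open>The summand 1 keeps the denominator positive when \<open>?C\<close> is
      0.\<close>
    have "\<bar>boundary_inner \<Omega> \<phi>1 q\<bar> \<le> ?C * (e / (?C + 1))" using bound[of "e / (?C + 1)"] e C0 by simp
    also have "\<dots> \<le> (?C + 1) * (e / (?C + 1))" using e C0 by (intro mult_right_mono) auto
    finally show "\<bar>boundary_inner \<Omega> \<phi>1 q\<bar> \<le> 0 + e" using C0 by simp
  qed
  then show ?thesis by simp
qed

section \<open>The norm of the time derivative in the dual of \<open>H10\<close>\<close>

abbreviation "pressure_force t \<equiv> L2_norm M (\<lambda>x. grad \<Omega> (p t) x - \<rho>f x *\<^sub>R g)"

text \<open>The boundary part of the source vanishes on \<open>H10\<close>, so that testing with
  functions of norm at most 1 leaves the flux and \<phi>. The operator norm of \<open>K\<close>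
  plays the role of the scalar permeability.\<close>

lemma Hm1_norm_etat:
  assumes t: "mass_balance t" "p t \<in> H1 \<Omega>"
  shows "0 \<le> Hm1_norm \<Omega> (etat t)"
    "Hm1_norm \<Omega> (etat t) \<le> onorm (\<lambda>x. K *v x) / \<mu>f * pressure_force t + L2_norm M \<phi>"
proof -
  let ?B = "onorm (\<lambda>x. K *v x) / \<mu>f * pressure_force t + L2_norm M \<phi>"
  let ?S = "{q \<in> H10 \<Omega>. H1_norm \<Omega> q \<le> 1}"
  \<comment> \<open>The supremum in \<open>dual_norm\<close> is taken in the reals, so the set must
    be shown nonempty and bounded above; the zero function settles the former.\<close>
  have z: "(\<lambda>x. 0) \<in> ?S"
  proof -
    have "(\<lambda>x. 0) \<in> test_fun \<Omega>" by (simp add: test_fun_def C_k_const)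
    then have "(\<lambda>x. 0) \<in> H10 \<Omega>" using H1.zero_mem H1.zero by (auto simp: H10_def intro!: bexI[of _ "\<lambda>x. 0"])
    then show ?thesis by (simp add: H1.zero)
  qed
  have b: "\<bar>etat t q\<bar> \<le> ?B" if "q \<in> ?S" for q
  proof -
    have q: "q \<in> H1 \<Omega>" "q \<in> H10 \<Omega>" "H1_norm \<Omega> q \<le> 1" using that by (auto simp: H10_def)
    have g1: "L2_norm M (grad \<Omega> q) \<le> 1" "L2_norm M q \<le> 1"
      using L2_norm_grad_le_H1_norm L2_norm_le_H1_norm q(3) order_trans by blast+
    have "etat t q = L2_inner M \<phi> q - 1 / \<mu>f * L2_inner M (flux (p t)) (grad \<Omega> q)"
      using t(1) q(1) boundary_inner_H10[OF q(2)] unfolding mass_balance_def source_def by (simp add: eq_diff_eq)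
    moreover have "\<bar>L2_inner M \<phi> q\<bar> \<le> L2_norm M \<phi>"
      using L2_Cauchy_Schwarz[OF \<phi> H1_L2[OF q(1)]] mult_left_mono[OF g1(2) L2_norm_nonneg, of M \<phi>] by simp
    moreover have "\<bar>1 / \<mu>f * L2_inner M (flux (p t)) (grad \<Omega> q)\<bar> \<le> onorm (\<lambda>x. K *v x) / \<mu>f * pressure_force t"
    proof -
      have "\<bar>L2_inner M (flux (p t)) (grad \<Omega> q)\<bar> \<le> L2_norm M (flux (p t))"
        using L2_Cauchy_Schwarz[OF flux_L2(1)[OF t(2)] grad(1)[OF q(1)]] mult_left_mono[OF g1(1) L2_norm_nonneg, of M "flux (p t)"] by simp
      also have "\<dots> \<le> onorm (\<lambda>x. K *v x) * pressure_force t" by (rule flux_norm[OF t(2)])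
      finally have "\<bar>L2_inner M (flux (p t)) (grad \<Omega> q)\<bar> / \<mu>f \<le> onorm (\<lambda>x. K *v x) * pressure_force t / \<mu>f"
        using \<mu>f by (simp add: divide_right_mono)
      then show ?thesis using \<mu>f by (simp add: abs_mult)
    qed
    ultimately show ?thesis by linarith
  qed
  show "Hm1_norm \<Omega> (etat t) \<le> ?B" unfolding dual_norm_def using z b by (intro cSUP_least) auto
  have "bdd_above ((\<lambda>q. \<bar>etat t q\<bar>) ` ?S)" using b by (intro bdd_aboveI2) auto
  from cSUP_upper[OF z this] show "0 \<le> Hm1_norm \<Omega> (etat t)" unfolding dual_norm_def
    by (meson abs_ge_zero order_trans)
qed

lemma pressure_force_L2: "(\<lambda>t. pressure_force t) \<in> L2 L"
proof -
  let ?\<gamma> = "L2_norm M (\<lambda>x. \<rho>f x *\<^sub>R g)"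
  have m: "(\<lambda>t. pressure_force t) \<in> borel_measurable L"
  proof (rule strongly_measurable_apply[OF weak_p_measurable, where \<Lambda>="\<lambda>t q. L2_norm M (\<lambda>x. grad \<Omega> q x - \<rho>f x *\<^sub>R g)"])
    show "AE t in L. \<forall>v\<in>H1 \<Omega>. \<forall>s. (\<forall>n. s n \<in> H1 \<Omega>) \<longrightarrow> (\<lambda>n. H1_norm \<Omega> (\<lambda>x. s n x - v x)) \<longlonglongrightarrow> 0 \<longrightarrow>
        (\<lambda>n. L2_norm M (\<lambda>x. grad \<Omega> (s n) x - \<rho>f x *\<^sub>R g)) \<longlonglongrightarrow> L2_norm M (\<lambda>x. grad \<Omega> v x - \<rho>f x *\<^sub>R g)"
    proof (intro AE_I2 ballI allI impI)
      fix v s assume v: "v \<in> H1 \<Omega>" "\<forall>n. s n \<in> H1 \<Omega>" "(\<lambda>n. H1_norm \<Omega> (\<lambda>x. s n x - v x)) \<longlonglongrightarrow> 0"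
      show "(\<lambda>n. L2_norm M (\<lambda>x. grad \<Omega> (s n) x - \<rho>f x *\<^sub>R g)) \<longlonglongrightarrow> L2_norm M (\<lambda>x. grad \<Omega> v x - \<rho>f x *\<^sub>R g)"
      proof (rule seminormed_functions.norm_tendsto[OF seminormed_functions_L2])
        show "(\<lambda>n. L2_norm M (\<lambda>x. (grad \<Omega> (s n) x - \<rho>f x *\<^sub>R g) - (grad \<Omega> v x - \<rho>f x *\<^sub>R g))) \<longlonglongrightarrow> 0"
          by (rule Lim_null_comparison[OF always_eventually v(3)])
             (use v L2_norm_grad_diff L2_norm_grad_le_H1_norm in \<open>simp add: L2_norm_nonneg\<close>)
      qed (use v flux_L2(2) in auto)
    qed
  qed simp
  have i: "integrable L (\<lambda>t. 2 * (H1_norm \<Omega> (p t))\<^sup>2 + 2 * ?\<gamma>\<^sup>2)"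
    using weak_p_square continuous_on_integrable[OF continuous_on_const, of 0 T "2 * ?\<gamma>\<^sup>2"] by simp
  have "integrable L (\<lambda>t. (pressure_force t)\<^sup>2)"
  proof (rule Bochner_Integration.integrable_bound[OF i])
    show "AE t in L. norm ((pressure_force t)\<^sup>2) \<le> norm (2 * (H1_norm \<Omega> (p t))\<^sup>2 + 2 * ?\<gamma>\<^sup>2)"
      using H1.strongly_measurable_AE_mem[OF weak_p_measurable]
    proof eventually_elim
      case (elim t)
      have "pressure_force t \<le> L2_norm M (grad \<Omega> (p t)) + ?\<gamma>"
        by (rule seminormed_functions.triangle_le_diff[OF seminormed_functions_L2 grad(1)[OF elim] gravity_L2])
      also have "\<dots> \<le> H1_norm \<Omega> (p t) + ?\<gamma>" using L2_norm_grad_le_H1_norm by simp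
      finally have "(pressure_force t)\<^sup>2 \<le> (H1_norm \<Omega> (p t) + ?\<gamma>)\<^sup>2" by (intro power_mono L2_norm_nonneg)
      also have "\<dots> \<le> 2 * (H1_norm \<Omega> (p t))\<^sup>2 + 2 * ?\<gamma>\<^sup>2"
        using sum_squares_bound[of "H1_norm \<Omega> (p t)" ?\<gamma>] by (simp add: power2_sum)
      finally show ?case by simp
    qed
  qed (use m in simp)
  then show ?thesis using m by (simp add: L2_def)
qed

text \<open>The bound on the dual norm holds at almost every time; the triangle inequality in
  L2(0,T) then separates the pressure term from \<phi>. Finiteness comes from writing each cylinder
  norm as a real norm over [0, T] of a norm over the space variable.\<close>

theorem Hm1_bound:
  defines "B \<equiv> ennreal (onorm (\<lambda>x. K *v x) / \<mu>f) * cylinder_L2_enorm T M (\<lambda>t x. grad \<Omega> (p t) x - \<rho>f x *\<^sub>R g)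
             + cylinder_L2_enorm T M (\<lambda>t. \<phi>) + cylinder_L2_enorm T (surface_measure \<Omega>) (\<lambda>t. \<phi>1)"
  shows "Bochner_L2_enorm T (Hm1_norm \<Omega>) etat \<le> B \<and> B < \<infinity>"
proof -
  let ?k = "onorm (\<lambda>x. K *v x) / \<mu>f"
  have k0: "?k \<ge> 0" using onorm_K \<mu>f by simp
  have cL: "(\<lambda>t. c) \<in> L2 L" for c :: real
    by (simp add: L2_def continuous_on_integrable)
  \<comment> \<open>The data do not depend on time, so the outer norm is that of a constant on a
    bounded interval.\<close>
  have const: "cylinder_L2_enorm T M' (\<lambda>t. h) = ennreal (L2_norm L (\<lambda>t. L2_norm M' h))"
    if "h \<in> L2 M'" for M' :: "(real^'d) measure" and h :: "real^'d \<Rightarrow> real"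
  proof -
    have "(\<integral>\<^sup>+t. (\<integral>\<^sup>+x. ennreal ((norm (h x))\<^sup>2) \<partial>M') \<partial>L) = (\<integral>\<^sup>+t. ennreal ((norm (L2_norm M' h))\<^sup>2) \<partial>L)"
      by (simp only: nn_integral_L2_norm[OF that]) simp
    also have "\<dots> = ennreal ((L2_norm L (\<lambda>t. L2_norm M' h))\<^sup>2)" by (rule nn_integral_L2_norm[OF cL])
    finally show ?thesis unfolding cylinder_L2_enorm_def by (simp only: esqrt_power2[OF L2_norm_nonneg])
  qed
  have gr: "cylinder_L2_enorm T M (\<lambda>t x. grad \<Omega> (p t) x - \<rho>f x *\<^sub>R g) = ennreal (L2_norm L (\<lambda>t. pressure_force t))"
  proof -
    have "(\<integral>\<^sup>+t. (\<integral>\<^sup>+x. ennreal ((norm (grad \<Omega> (p t) x - \<rho>f x *\<^sub>R g))\<^sup>2) \<partial>M) \<partial>L)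
        = (\<integral>\<^sup>+t. ennreal ((norm (pressure_force t))\<^sup>2) \<partial>L)"
      using H1.strongly_measurable_AE_mem[OF weak_p_measurable]
      by (intro nn_integral_cong_AE, eventually_elim) (simp add: nn_integral_L2_norm[OF flux_L2(2)])
    also have "\<dots> = ennreal ((L2_norm L (\<lambda>t. pressure_force t))\<^sup>2)" by (rule nn_integral_L2_norm[OF pressure_force_L2])
    finally show ?thesis unfolding cylinder_L2_enorm_def by (simp only: esqrt_power2[OF L2_norm_nonneg])
  qed
  have B: "B = ennreal ?k * ennreal (L2_norm L (\<lambda>t. pressure_force t)) + ennreal (L2_norm L (\<lambda>t. L2_norm M \<phi>))
      + ennreal (L2_norm L (\<lambda>t. L2_norm (surface_measure \<Omega>) \<phi>1))"
    unfolding B_def gr const[OF \<phi>] const[OF \<phi>1] ..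
  let ?h = "\<lambda>t. ?k *\<^sub>R pressure_force t + L2_norm M \<phi>"
  have hL: "?h \<in> L2 L" by (intro L2_add L2_scaleR pressure_force_L2 cL)
  have "(\<integral>\<^sup>+t. ennreal ((Hm1_norm \<Omega> (etat t))\<^sup>2) \<partial>L) \<le> (\<integral>\<^sup>+t. ennreal ((norm (?h t))\<^sup>2) \<partial>L)"
  proof (rule nn_integral_mono_AE)
    show "AE t in L. ennreal ((Hm1_norm \<Omega> (etat t))\<^sup>2) \<le> ennreal ((norm (?h t))\<^sup>2)"
      using weak_mass_balance H1.strongly_measurable_AE_mem[OF weak_p_measurable]
    proof eventually_elim
      case (elim t)
      have "Hm1_norm \<Omega> (etat t) \<le> ?h t" using Hm1_norm_etat(2)[OF elim] by simp
      also have "\<dots> \<le> norm (?h t)" by simp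
      finally show ?case using Hm1_norm_etat(1)[OF elim] by (intro ennreal_leI power_mono)
    qed
  qed
  also have "\<dots> = ennreal ((L2_norm L ?h)\<^sup>2)" by (rule nn_integral_L2_norm[OF hL])
  finally have "Bochner_L2_enorm T (Hm1_norm \<Omega>) etat \<le> ennreal (L2_norm L ?h)"
    unfolding Bochner_L2_enorm_def by (rule esqrt_le) (rule L2_norm_nonneg)
  also have "ennreal (L2_norm L ?h) \<le> ennreal (?k * L2_norm L (\<lambda>t. pressure_force t) + L2_norm L (\<lambda>t. L2_norm M \<phi>))"
    using ennreal_leI[OF L2_norm_triangle[OF L2_scaleR[OF pressure_force_L2] cL, of ?k "L2_norm M \<phi>"]]
    unfolding L2_norm_scaleR abs_of_nonneg[OF k0] .
  also have "ennreal (?k * L2_norm L (\<lambda>t. pressure_force t) + L2_norm L (\<lambda>t. L2_norm M \<phi>))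
      = ennreal ?k * ennreal (L2_norm L (\<lambda>t. pressure_force t)) + ennreal (L2_norm L (\<lambda>t. L2_norm M \<phi>))"
    by (simp only: ennreal_plus[OF mult_nonneg_nonneg[OF k0 L2_norm_nonneg] L2_norm_nonneg] ennreal_mult[OF k0 L2_norm_nonneg])
  also have "\<dots> \<le> B" unfolding B by simp
  finally have "Bochner_L2_enorm T (Hm1_norm \<Omega>) etat \<le> B" .
  moreover have "B < \<infinity>" unfolding B by (simp add: ennreal_mult_less_top)
  ultimately show ?thesis by simp
qed

end

theorem lemma2p3:
  fixes \<Omega> :: "(real^'d) set"
    and T lam \<mu> \<alpha> c0 \<mu>f :: real
    and K :: "real^'d^'d"
    and \<rho>f :: "real^'d \<Rightarrow> real" and g :: "real^'d"
    and f f1 :: "real^'d \<Rightarrow> real^'d" and \<phi> \<phi>1 :: "real^'d \<Rightarrow> real"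
    and u0 :: "real^'d \<Rightarrow> real^'d" and p0 :: "real^'d \<Rightarrow> real"
    and u :: "real \<Rightarrow> real^'d \<Rightarrow> real^'d" and p :: "real \<Rightarrow> real^'d \<Rightarrow> real"
    and etat :: "real \<Rightarrow> (real^'d \<Rightarrow> real) \<Rightarrow> real"
  assumes "CARD('d) \<in> {1, 2, 3}"
    and "polygonal_domain \<Omega>" and "laplacian_isomorphism \<Omega>"
    and "T > 0" and "lam > 0" and "\<mu> > 0" and "\<alpha> > 0" and "c0 \<ge> 0" and "\<mu>f > 0"
    and "transpose K = K" and "\<And>x. x \<noteq> 0 \<Longrightarrow> x \<bullet> (K *v x) > 0"
    and "\<rho>f \<in> L2 (lebesgue_on \<Omega>)" and "\<not> (AE x in lebesgue_on \<Omega>. \<rho>f x = 0)"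
    and "f \<in> L2 (lebesgue_on \<Omega>)" and "f1 \<in> L2 (surface_measure \<Omega>)"
    and "\<phi> \<in> L2 (lebesgue_on \<Omega>)" and "\<phi>1 \<in> L2 (surface_measure \<Omega>)"
    and "u0 \<in> H1v \<Omega>" and "p0 \<in> L2 (lebesgue_on \<Omega>)"
    and "\<And>v. v \<in> RM \<Longrightarrow> L2_inner (lebesgue_on \<Omega>) f v + boundary_inner \<Omega> f1 v = 0"
    and "weak_solution \<Omega> T lam \<mu> \<alpha> c0 \<mu>f K \<rho>f g f f1 \<phi> \<phi>1 u0 p0 u p etat"
  shows "(\<exists>U P. continuous_version \<Omega> T c0 u0 p0 u p U P) \<and>
    (\<forall>U P. continuous_version \<Omega> T c0 u0 p0 u p U P \<longrightarrow>
      (\<forall>t\<in>{0..T}.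
         energy \<Omega> lam \<mu> c0 f f1 (U t) (P t)
         + 1 / \<mu>f * (\<integral>s. L2_inner (lebesgue_on \<Omega>)
               (\<lambda>x. K *v (grad \<Omega> (P s) x - \<rho>f x *\<^sub>R g)) (grad \<Omega> (P s)) \<partial>lebesgue_on {0..t})
         - (\<integral>s. L2_inner (lebesgue_on \<Omega>) \<phi> (P s) \<partial>lebesgue_on {0..t})
         - (\<integral>s. boundary_inner \<Omega> \<phi>1 (P s) \<partial>lebesgue_on {0..t})
         = energy \<Omega> lam \<mu> c0 f f1 (U 0) (P 0))) \<and>
    (let B = ennreal (onorm (\<lambda>x. K *v x) / \<mu>f)
               * cylinder_L2_enorm T (lebesgue_on \<Omega>) (\<lambda>t x. grad \<Omega> (p t) x - \<rho>f x *\<^sub>R g)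
             + cylinder_L2_enorm T (lebesgue_on \<Omega>) (\<lambda>t. \<phi>)
             + cylinder_L2_enorm T (surface_measure \<Omega>) (\<lambda>t. \<phi>1)
     in Bochner_L2_enorm T (Hm1_norm \<Omega>) etat \<le> B \<and> B < \<infinity>)"
proof -
  interpret poroelastic_solution \<Omega> T lam \<mu> \<alpha> c0 \<mu>f K \<rho>f g f f1 \<phi> \<phi>1 u0 p0 u p etat
    using assms by unfold_locales (auto simp: polygonal_domain_def)
  show ?thesis
    using continuous_version_exists energy_law[unfolded flux_def[abs_def]] Hm1_bound by (simp only: Let_def) blast
qed

end
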